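(* The category of connected holomorphic graded bundles and the category of connected holomorphic homogeneity structures are equivalent. At the level of objects the equivalence is provided by the following two constructions: (1) with every holomorphic graded bundle $\tau:F\to N$ one associates the holomorphic homogeneity structure $(F,h^F)$, where $h^F:\mathbb{C}\times F\to F$ is the action by homotheties of $F$; (2) given a holomorphic homogeneity structure $(N,h)$, the map $h_0:N\to N_0:=h_0(N)$, $h_0=h(0,\cdot)$, provides $N$ with a canonical structure of a holomorphic graded bundle (over $N_0$) such that $h$ is the related action by homotheties. At the level of morphisms: every morphism of holomorphic graded bundles is a morphism of the related holomorphic homogeneity structures and, conversely, every morphism of holomorphic homogeneity structures is a morphism of the related canonical holomorphic graded bundles.
   Context: Complex graded spaces. Let $\mathbf d=(d_1,\dots,d_k)$ be a sequence of non-negative integers, $|\mathbf d|=d_1+\dots+d_k$, $I$ a set with $|\mathbf d|$ elements, and $I\ni\alpha\mapsto w^\alpha\in\mathbb Z_{+}$ (positive integers) a map with $d_i=\#\{\alpha: w^\alpha=i\}$ for $1\le i\le k$. A complex graded space of rank $\mathbf d$ is a complex manifold $\mathrm V$ biholomorphic to $\mathbb C^{|\mathbf d|}$ equipped with an equivalence class of systems of complex graded coordinates, i.e. global holomorphic coordinate systems $(z^\alpha)_{\alpha\in I}:\mathrm V\to\mathbb C^{|\mathbf d|}$ with weight $w^\alpha$ assigned to $z^\alpha$. Two such systems $(z^\alpha)$ (weights $w^\alpha$) and $(\underline z^\alpha)$ (weights $\underline w^\alpha$) are equivalent if each $\underline z^\alpha$ is a polynomial with complex coefficients $\sum_{j\ge1}\sum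 c^\alpha_{\alpha_1\dots\alpha_j}z^{\alpha_1}\cdots z^{\alpha_j}$ summed over indices with $w^{\alpha_1}+\dots+w^{\alpha_j}=\underline w^\alpha$. The degree is the highest $i$ with $d_i\ne0$. A morphism of complex graded spaces is a holomorphic map which in complex graded coordinates is given by polynomials homogeneous with respect to the weights. The action by homotheties is $h^{\mathrm V}:\mathbb C\times \mathrm V\to \mathrm V$, $h^{\mathrm V}(\xi,(z^\alpha))=(\xi^{w^\alpha}z^\alpha)$. Complex and holomorphic graded bundles. A complex graded bundle of rank $\mathbf d$ is a smooth fiber bundle $\tau:E\to M$ over a real smooth manifold whose typical fiber is $\mathbb C^{\mathbf d}$ considered as a complex graded space of rank $\mathbf d$, with local trivializations $\phi_U:\tau^{-1}(U)\to U\times\mathbb C^{\mathbf d}$ whose transition functions $g_{UU'}(q)=\phi_{U'}\circ\phi_U^{-1}|_{\{q\}\times\mathbb C^{\mathbf d}}$ are isomorphisms of complex graded spaces depending smoothly on $q\in U\cap U'$. If $M$ and $E$ are complex manifolds (with complex structure compatible with the trivializations) and the $g_{UU'}$ are holomorphic functions of $q$, then $\tau$ is a holomorphic graded bundle. A morphism of complex graded bundles is a fiber-bundle morphism which is a complex graded space morphism on fibers; a morphism of holomorphic graded bundles is a holomorphic map between the total spaces which is also a morphism of complex graded bundles. The action by homotheties $h^E:\mathbb C\times E\to E$ is defined fiberwise by the homotheties of the fibers. Holomorphic homogeneity structures. A holomorphic homogeneity structure on a complex manifold $N$ is a holomorphic action $h:\mathbb C\times N\to N$ of the multiplicative monoid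 $(\mathbb C,\cdot)$: $h_\xi\circ h_\eta=h_{\xi\eta}$ for all $\xi,\eta\in\mathbb{C}$, and $h_1=\mathrm{id}_N$, where $h_\xi=h(\xi,\cdot)$. A morphism $(N_1,h^1)\to(N_2,h^2)$ is a holomorphic map $\Phi:N_1\to N_2$ with $\Phi\circ h^1_\xi=h^2_\xi\circ\Phi$ for all $\xi\in\mathbb C$. "Connected" refers to connectedness of the manifold on which the action is defined (the total space). *)

theory Defs
  imports "HOL-Analysis.Analysis"
begin

section \<open>Holomorphic maps between open subsets of complex coordinate spaces\<close>

text \<open>
  The dimension has to vary inside the statement, so the \<open>n\<close>-dimensional complex coordinate space
  is the set of sequences supported in \<open>{..<n}\<close> (compare \<open>Euclidean_space\<close> of HOL-Homology), with
  the product topology of \<^typ>\<open>nat \<Rightarrow> complex\<close>.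
\<close>

definition complex_space :: "nat \<Rightarrow> (nat \<Rightarrow> complex) set" where
  "complex_space n = {z. \<forall>i\<ge>n. z i = 0}"

text \<open>
  Complex (Frechet) differentiability at every point. The type \<^typ>\<open>nat \<Rightarrow> complex\<close> carries no norm;
  the sum of the moduli of the first \<open>n\<close> coordinates is a norm on \<open>complex_space n\<close>.
\<close>

definition holomorphic_fun :: "nat \<Rightarrow> (nat \<Rightarrow> complex) set \<Rightarrow> ((nat \<Rightarrow> complex) \<Rightarrow> complex) \<Rightarrow> bool" where
  "holomorphic_fun n S f \<longleftrightarrow>
     (\<forall>z\<in>S. \<exists>c :: nat \<Rightarrow> complex.
        ((\<lambda>w. cmod (f w - f z - (\<Sum>i<n. c i * (w i - z i))) / (\<Sum>i<n. cmod (w i - z i))) \<longlongrightarrow> 0)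
          (at z within S))"

definition holomorphic_vec ::
  "nat \<Rightarrow> nat \<Rightarrow> (nat \<Rightarrow> complex) set \<Rightarrow> ((nat \<Rightarrow> complex) \<Rightarrow> nat \<Rightarrow> complex) \<Rightarrow> bool" where
  "holomorphic_vec n m S f \<longleftrightarrow>
     f ` S \<subseteq> complex_space m \<and> (\<forall>j<m. holomorphic_fun n S (\<lambda>z. f z j))"


section \<open>Complex manifolds\<close>

text \<open>
  A chart is a pair of a domain and a coordinate map. Partially defined maps are extensional
  throughout (\<^const>\<open>undefined\<close> off their domain), so that equality of maps, atlases and structures
  means what it should.
\<close>

type_synonym 'a chart = "'a set \<times> ('a \<Rightarrow> nat \<Rightarrow> complex)"

definition is_chart :: "nat \<Rightarrow> 'a topology \<Rightarrow> 'a chart \<Rightarrow> bool" where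
  "is_chart n T = (\<lambda>(U, \<phi>).
     openin T U \<and> \<phi> \<in> extensional U \<and>
     openin (top_of_set (complex_space n)) (\<phi> ` U) \<and>
     homeomorphic_map (subtopology T U) (top_of_set (\<phi> ` U)) \<phi>)"

definition charts_compatible :: "nat \<Rightarrow> 'a chart \<Rightarrow> 'a chart \<Rightarrow> bool" where
  "charts_compatible n = (\<lambda>(U, \<phi>) (V, \<psi>).
     holomorphic_vec n n (\<phi> ` (U \<inter> V)) (\<psi> \<circ> inv_into U \<phi>) \<and>
     holomorphic_vec n n (\<psi> ` (U \<inter> V)) (\<phi> \<circ> inv_into V \<psi>))"

record 'a cmanifold =
  mdim :: nat
  mtop :: "'a topology"
  matlas :: "'a chart set"

abbreviation mcarrier :: "'a cmanifold \<Rightarrow> 'a set" where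
  "mcarrier M \<equiv> topspace (mtop M)"

text \<open>The complex structure is a maximal holomorphic atlas.\<close>

definition complex_manifold :: "'a cmanifold \<Rightarrow> bool" where
  "complex_manifold M \<longleftrightarrow>
     Hausdorff_space (mtop M) \<and> second_countable (mtop M) \<and>
     (\<forall>c\<in>matlas M. is_chart (mdim M) (mtop M) c) \<and>
     (\<Union>c\<in>matlas M. fst c) = mcarrier M \<and>
     (\<forall>c\<in>matlas M. \<forall>c'\<in>matlas M. charts_compatible (mdim M) c c') \<and>
     (\<forall>c. is_chart (mdim M) (mtop M) c \<and> (\<forall>c'\<in>matlas M. charts_compatible (mdim M) c c')
        \<longrightarrow> c \<in> matlas M)"

definition connected_manifold :: "'a cmanifold \<Rightarrow> bool" where
  "connected_manifold M \<longleftrightarrow> connected_space (mtop M) \<and> mcarrier M \<noteq> {}"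

definition holomorphic_map :: "'a cmanifold \<Rightarrow> 'b cmanifold \<Rightarrow> ('a \<Rightarrow> 'b) \<Rightarrow> bool" where
  "holomorphic_map M N f \<longleftrightarrow>
     continuous_map (mtop M) (mtop N) f \<and>
     (\<forall>(U, \<phi>)\<in>matlas M. \<forall>(V, \<psi>)\<in>matlas N.
        holomorphic_vec (mdim M) (mdim N) (\<phi> ` (U \<inter> f -` V)) (\<psi> \<circ> f \<circ> inv_into U \<phi>))"

definition biholomorphic_map :: "'a cmanifold \<Rightarrow> 'b cmanifold \<Rightarrow> ('a \<Rightarrow> 'b) \<Rightarrow> bool" where
  "biholomorphic_map M N f \<longleftrightarrow>
     bij_betw f (mcarrier M) (mcarrier N) \<and> holomorphic_map M N f \<and>
     holomorphic_map N M (inv_into (mcarrier M) f)"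

definition generated_atlas :: "nat \<Rightarrow> 'a topology \<Rightarrow> 'a chart set \<Rightarrow> 'a chart set" where
  "generated_atlas n T A = {c. is_chart n T c \<and> (\<forall>a\<in>A. charts_compatible n c a)}"

definition complex_space_manifold :: "nat \<Rightarrow> (nat \<Rightarrow> complex) cmanifold" where
  "complex_space_manifold n =
     \<lparr>mdim = n, mtop = top_of_set (complex_space n),
      matlas = generated_atlas n (top_of_set (complex_space n))
        {(complex_space n, \<lambda>z\<in>complex_space n. z)}\<rparr>"

definition complex_line_manifold :: "complex cmanifold" where
  "complex_line_manifold =
     \<lparr>mdim = 1, mtop = euclidean,
      matlas = generated_atlas 1 euclidean {(UNIV, \<lambda>\<xi> i. if i = 0 then \<xi> else 0)}\<rparr>"

definition open_submanifold :: "'a cmanifold \<Rightarrow> 'a set \<Rightarrow> 'a cmanifold" where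
  "open_submanifold M S =
     \<lparr>mdim = mdim M, mtop = subtopology (mtop M) S, matlas = {c \<in> matlas M. fst c \<subseteq> S}\<rparr>"

definition product_chart :: "nat \<Rightarrow> 'a chart \<Rightarrow> 'b chart \<Rightarrow> ('a \<times> 'b) chart" where
  "product_chart m = (\<lambda>(U, \<phi>) (V, \<psi>).
     (U \<times> V, \<lambda>p\<in>U \<times> V. \<lambda>i. if i < m then \<phi> (fst p) i else \<psi> (snd p) (i - m)))"

definition product_manifold :: "'a cmanifold \<Rightarrow> 'b cmanifold \<Rightarrow> ('a \<times> 'b) cmanifold" where
  "product_manifold M N =
     \<lparr>mdim = mdim M + mdim N, mtop = prod_topology (mtop M) (mtop N),
      matlas = generated_atlas (mdim M + mdim N) (prod_topology (mtop M) (mtop N))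
        {product_chart (mdim M) c c' | c c'. c \<in> matlas M \<and> c' \<in> matlas N}\<rparr>"


section \<open>Complex graded spaces\<close>

text \<open>
  A rank \<open>(d\<^sub>1, \<dots>, d\<^sub>k)\<close> is a list, with \<open>d\<^sub>i = d ! (i - 1)\<close>. The model graded space of rank \<open>d\<close> is
  \<open>complex_space (length (rank_weights d))\<close> with standard coordinate number \<open>\<alpha>\<close> of
  weight \<open>rank_weights d ! \<alpha>\<close>; the weights are \<open>1\<close> (\<open>d\<^sub>1\<close> times), \<open>2\<close> (\<open>d\<^sub>2\<close> times), and so on.
\<close>

definition rank_weights :: "nat list \<Rightarrow> nat list" where
  "rank_weights d = concat (map (\<lambda>i. replicate (d ! i) (Suc i)) [0..<length d])"

text \<open>
  Polynomials \<open>\<Sum> c\<^bsub>\<alpha>\<^sub>1\<dots>\<alpha>\<^sub>j\<^esub> z\<^bsup>\<alpha>\<^sub>1\<^esup> \<cdots> z\<^bsup>\<alpha>\<^sub>j\<^esup>\<close> summed over all \<open>j \<ge> 1\<close> and all index tuples whose weights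
  add up to \<open>k\<close>. The tuples are lists; there are finitely many of them because weights are positive.
\<close>

definition weighted_homogeneous_poly ::
  "nat list \<Rightarrow> nat \<Rightarrow> ((nat \<Rightarrow> complex) \<Rightarrow> complex) \<Rightarrow> bool" where
  "weighted_homogeneous_poly w k p \<longleftrightarrow>
     (\<exists>c :: nat list \<Rightarrow> complex. \<forall>z\<in>complex_space (length w).
        p z = (\<Sum>as | as \<noteq> [] \<and> set as \<subseteq> {..<length w} \<and> (\<Sum>\<alpha>\<leftarrow>as. w ! \<alpha>) = k.
                 c as * (\<Prod>\<alpha>\<leftarrow>as. z \<alpha>)))"

definition graded_space_morphism ::
  "nat list \<Rightarrow> nat list \<Rightarrow> ((nat \<Rightarrow> complex) \<Rightarrow> nat \<Rightarrow> complex) \<Rightarrow> bool" where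
  "graded_space_morphism w w' g \<longleftrightarrow>
     g ` complex_space (length w) \<subseteq> complex_space (length w') \<and>
     (\<forall>\<alpha><length w'. weighted_homogeneous_poly w (w' ! \<alpha>) (\<lambda>z. g z \<alpha>))"

definition graded_space_isomorphism ::
  "nat list \<Rightarrow> nat list \<Rightarrow> ((nat \<Rightarrow> complex) \<Rightarrow> nat \<Rightarrow> complex) \<Rightarrow> bool" where
  "graded_space_isomorphism w w' g \<longleftrightarrow>
     bij_betw g (complex_space (length w)) (complex_space (length w')) \<and>
     graded_space_morphism w w' g \<and>
     graded_space_morphism w' w (inv_into (complex_space (length w)) g)"

definition graded_homothety :: "nat list \<Rightarrow> complex \<Rightarrow> (nat \<Rightarrow> complex) \<Rightarrow> nat \<Rightarrow> complex" where
  "graded_homothety w \<xi> z = (\<lambda>\<alpha>. if \<alpha> < length w then \<xi> ^ (w ! \<alpha>) * z \<alpha> else 0)"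


section \<open>Holomorphic graded bundles\<close>

text \<open>
  A trivialization is a pair of an open subset \<open>U\<close> of the base and a map from the part of the total
  space over \<open>U\<close> to \<open>U\<close> times the model graded space. Total space and base live in the same type;
  this is no restriction, as the zero section embeds the base into the total space.
\<close>

type_synonym 'a trivialization = "'a set \<times> ('a \<Rightarrow> 'a \<times> (nat \<Rightarrow> complex))"

record 'a graded_bundle =
  gtotal :: "'a cmanifold"
  gbase :: "'a cmanifold"
  gproj :: "'a \<Rightarrow> 'a"
  grank :: "nat list"
  gtrivs :: "'a trivialization set"

abbreviation gweights :: "'a graded_bundle \<Rightarrow> nat list" where
  "gweights B \<equiv> rank_weights (grank B)"

definition gover :: "'a graded_bundle \<Rightarrow> 'a set \<Rightarrow> 'a set" where
  "gover B U = {e \<in> mcarrier (gtotal B). gproj B e \<in> U}"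

definition is_trivialization :: "'a graded_bundle \<Rightarrow> 'a trivialization \<Rightarrow> bool" where
  "is_trivialization B = (\<lambda>(U, \<phi>).
     openin (mtop (gbase B)) U \<and> \<phi> \<in> extensional (gover B U) \<and>
     biholomorphic_map (open_submanifold (gtotal B) (gover B U))
       (product_manifold (open_submanifold (gbase B) U)
          (complex_space_manifold (length (gweights B)))) \<phi> \<and>
     (\<forall>e\<in>gover B U. fst (\<phi> e) = gproj B e))"

text \<open>
  The transition functions are graded isomorphisms on each fiber. Their holomorphic dependence on
  the base point is part of the trivializations being biholomorphic.
\<close>

definition trivializations_compatible ::
  "'a graded_bundle \<Rightarrow> 'a trivialization \<Rightarrow> 'a trivialization \<Rightarrow> bool" where
  "trivializations_compatible B = (\<lambda>(U, \<phi>) (V, \<psi>).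
     \<forall>q\<in>U \<inter> V. graded_space_isomorphism (gweights B) (gweights B)
       (\<lambda>z. snd (\<psi> (inv_into (gover B U) \<phi> (q, z)))))"

text \<open>
  The graded structure is a maximal family of compatible trivializations. Trailing zeros in the rank
  do not change the model graded space and are excluded, so the length of the rank is the degree.
\<close>

definition holomorphic_graded_bundle :: "'a graded_bundle \<Rightarrow> bool" where
  "holomorphic_graded_bundle B \<longleftrightarrow>
     complex_manifold (gtotal B) \<and> complex_manifold (gbase B) \<and>
     gproj B \<in> extensional (mcarrier (gtotal B)) \<and>
     holomorphic_map (gtotal B) (gbase B) (gproj B) \<and>
     (grank B \<noteq> [] \<longrightarrow> last (grank B) \<noteq> 0) \<and>
     (\<forall>t\<in>gtrivs B. is_trivialization B t) \<and>
     (\<Union>t\<in>gtrivs B. fst t) = mcarrier (gbase B) \<and>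
     (\<forall>t\<in>gtrivs B. \<forall>t'\<in>gtrivs B. trivializations_compatible B t t') \<and>
     (\<forall>t. is_trivialization B t \<and> (\<forall>t'\<in>gtrivs B. trivializations_compatible B t t')
        \<longrightarrow> t \<in> gtrivs B)"

definition graded_bundle_morphism ::
  "'a graded_bundle \<Rightarrow> 'a graded_bundle \<Rightarrow> ('a \<Rightarrow> 'a) \<Rightarrow> bool" where
  "graded_bundle_morphism B B' \<Phi> \<longleftrightarrow>
     \<Phi> \<in> extensional (mcarrier (gtotal B)) \<and>
     holomorphic_map (gtotal B) (gtotal B') \<Phi> \<and>
     (\<exists>f. holomorphic_map (gbase B) (gbase B') f \<and>
        (\<forall>e\<in>mcarrier (gtotal B). gproj B' (\<Phi> e) = f (gproj B e)) \<and>
        (\<forall>(U, \<phi>)\<in>gtrivs B. \<forall>(V, \<psi>)\<in>gtrivs B'. \<forall>q\<in>U. f q \<in> V \<longrightarrow>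
           graded_space_morphism (gweights B) (gweights B')
             (\<lambda>z. snd (\<psi> (\<Phi> (inv_into (gover B U) \<phi> (q, z)))))))"

text \<open>The fiberwise homotheties; independent of the trivialization used to compute them.\<close>

definition gbundle_homothety :: "'a graded_bundle \<Rightarrow> complex \<Rightarrow> 'a \<Rightarrow> 'a" where
  "gbundle_homothety B \<xi> = (\<lambda>e\<in>mcarrier (gtotal B).
     THE e'. \<exists>(U, \<phi>)\<in>gtrivs B. e \<in> gover B U \<and> e' \<in> gover B U \<and>
       \<phi> e' = (gproj B e, graded_homothety (gweights B) \<xi> (snd (\<phi> e))))"


section \<open>Holomorphic homogeneity structures\<close>

record 'a homogeneity_structure =
  hspace :: "'a cmanifold"
  hact :: "complex \<Rightarrow> 'a \<Rightarrow> 'a"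

definition holomorphic_homogeneity_structure :: "'a homogeneity_structure \<Rightarrow> bool" where
  "holomorphic_homogeneity_structure S \<longleftrightarrow>
     complex_manifold (hspace S) \<and>
     (\<forall>\<xi>. hact S \<xi> \<in> extensional (mcarrier (hspace S))) \<and>
     holomorphic_map (product_manifold complex_line_manifold (hspace S)) (hspace S)
       (\<lambda>(\<xi>, x). hact S \<xi> x) \<and>
     (\<forall>\<xi> \<eta>. \<forall>x\<in>mcarrier (hspace S). hact S \<xi> (hact S \<eta> x) = hact S (\<xi> * \<eta>) x) \<and>
     (\<forall>x\<in>mcarrier (hspace S). hact S 1 x = x)"

definition homogeneity_morphism ::
  "'a homogeneity_structure \<Rightarrow> 'a homogeneity_structure \<Rightarrow> ('a \<Rightarrow> 'a) \<Rightarrow> bool" where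
  "homogeneity_morphism S S' \<Phi> \<longleftrightarrow>
     \<Phi> \<in> extensional (mcarrier (hspace S)) \<and>
     holomorphic_map (hspace S) (hspace S') \<Phi> \<and>
     (\<forall>\<xi>. \<forall>x\<in>mcarrier (hspace S). \<Phi> (hact S \<xi> x) = hact S' \<xi> (\<Phi> x))"


section \<open>The two constructions\<close>

definition homothety_structure :: "'a graded_bundle \<Rightarrow> 'a homogeneity_structure" where
  "homothety_structure B = \<lparr>hspace = gtotal B, hact = gbundle_homothety B\<rparr>"

definition is_graded_bundle_of :: "'a homogeneity_structure \<Rightarrow> 'a graded_bundle \<Rightarrow> bool" where
  "is_graded_bundle_of S B \<longleftrightarrow>
     holomorphic_graded_bundle B \<and>
     gtotal B = hspace S \<and>
     mcarrier (gbase B) = hact S 0 ` mcarrier (hspace S) \<and>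
     gproj B = hact S 0 \<and>
     gbundle_homothety B = hact S"

definition canonical_graded_bundle :: "'a homogeneity_structure \<Rightarrow> 'a graded_bundle" where
  "canonical_graded_bundle S = (THE B. is_graded_bundle_of S B)"


section \<open>Equivalence of categories\<close>

text \<open>\<open>Cmp C x y z g f\<close> is the composite of \<open>f : x \<rightarrow> y\<close> and \<open>g : y \<rightarrow> z\<close>.\<close>

record ('o, 'm) cat =
  Ob :: "'o set"
  Hom :: "'o \<Rightarrow> 'o \<Rightarrow> 'm set"
  Idt :: "'o \<Rightarrow> 'm"
  Cmp :: "'o \<Rightarrow> 'o \<Rightarrow> 'o \<Rightarrow> 'm \<Rightarrow> 'm \<Rightarrow> 'm"

definition is_category :: "('o, 'm) cat \<Rightarrow> bool" where
  "is_category C \<longleftrightarrow>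
     (\<forall>x\<in>Ob C. Idt C x \<in> Hom C x x) \<and>
     (\<forall>x\<in>Ob C. \<forall>y\<in>Ob C. \<forall>z\<in>Ob C. \<forall>f\<in>Hom C x y. \<forall>g\<in>Hom C y z. Cmp C x y z g f \<in> Hom C x z) \<and>
     (\<forall>x\<in>Ob C. \<forall>y\<in>Ob C. \<forall>f\<in>Hom C x y.
        Cmp C x x y f (Idt C x) = f \<and> Cmp C x y y (Idt C y) f = f) \<and>
     (\<forall>x\<in>Ob C. \<forall>y\<in>Ob C. \<forall>z\<in>Ob C. \<forall>u\<in>Ob C. \<forall>f\<in>Hom C x y. \<forall>g\<in>Hom C y z. \<forall>h\<in>Hom C z u.
        Cmp C x z u h (Cmp C x y z g f) = Cmp C x y u (Cmp C y z u h g) f)"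

text \<open>A functor is given by its object map and, for each pair of objects, its map on morphisms.\<close>

definition is_functor ::
  "('o, 'm) cat \<Rightarrow> ('p, 'n) cat \<Rightarrow> ('o \<Rightarrow> 'p) \<Rightarrow> ('o \<Rightarrow> 'o \<Rightarrow> 'm \<Rightarrow> 'n) \<Rightarrow> bool" where
  "is_functor C D Fo Fm \<longleftrightarrow>
     (\<forall>x\<in>Ob C. Fo x \<in> Ob D) \<and>
     (\<forall>x\<in>Ob C. \<forall>y\<in>Ob C. \<forall>f\<in>Hom C x y. Fm x y f \<in> Hom D (Fo x) (Fo y)) \<and>
     (\<forall>x\<in>Ob C. Fm x x (Idt C x) = Idt D (Fo x)) \<and>
     (\<forall>x\<in>Ob C. \<forall>y\<in>Ob C. \<forall>z\<in>Ob C. \<forall>f\<in>Hom C x y. \<forall>g\<in>Hom C y z.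
        Fm x z (Cmp C x y z g f) = Cmp D (Fo x) (Fo y) (Fo z) (Fm y z g) (Fm x y f))"

definition is_iso :: "('o, 'm) cat \<Rightarrow> 'o \<Rightarrow> 'o \<Rightarrow> 'm \<Rightarrow> bool" where
  "is_iso C x y f \<longleftrightarrow>
     f \<in> Hom C x y \<and> (\<exists>g\<in>Hom C y x. Cmp C x y x g f = Idt C x \<and> Cmp C y x y f g = Idt C y)"

definition naturally_isomorphic ::
  "('o, 'm) cat \<Rightarrow> ('p, 'n) cat \<Rightarrow> ('o \<Rightarrow> 'p) \<Rightarrow> ('o \<Rightarrow> 'o \<Rightarrow> 'm \<Rightarrow> 'n) \<Rightarrow>
    ('o \<Rightarrow> 'p) \<Rightarrow> ('o \<Rightarrow> 'o \<Rightarrow> 'm \<Rightarrow> 'n) \<Rightarrow> bool" where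
  "naturally_isomorphic C D Fo Fm Go Gm \<longleftrightarrow>
     (\<exists>\<eta>. (\<forall>x\<in>Ob C. is_iso D (Fo x) (Go x) (\<eta> x)) \<and>
       (\<forall>x\<in>Ob C. \<forall>y\<in>Ob C. \<forall>f\<in>Hom C x y.
          Cmp D (Fo x) (Fo y) (Go y) (\<eta> y) (Fm x y f) = Cmp D (Fo x) (Go x) (Go y) (Gm x y f) (\<eta> x)))"

definition equivalence_of_categories ::
  "('o, 'm) cat \<Rightarrow> ('p, 'n) cat \<Rightarrow> ('o \<Rightarrow> 'p) \<Rightarrow> ('o \<Rightarrow> 'o \<Rightarrow> 'm \<Rightarrow> 'n) \<Rightarrow>
    ('p \<Rightarrow> 'o) \<Rightarrow> ('p \<Rightarrow> 'p \<Rightarrow> 'n \<Rightarrow> 'm) \<Rightarrow> bool" where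
  "equivalence_of_categories C D Fo Fm Go Gm \<longleftrightarrow>
     is_category C \<and> is_category D \<and> is_functor C D Fo Fm \<and> is_functor D C Go Gm \<and>
     naturally_isomorphic C C (\<lambda>x. Go (Fo x)) (\<lambda>x y f. Gm (Fo x) (Fo y) (Fm x y f))
       (\<lambda>x. x) (\<lambda>x y f. f) \<and>
     naturally_isomorphic D D (\<lambda>x. Fo (Go x)) (\<lambda>x y f. Fm (Go x) (Go y) (Gm x y f))
       (\<lambda>x. x) (\<lambda>x y f. f)"

definition graded_bundle_cat :: "('a graded_bundle, 'a \<Rightarrow> 'a) cat" where
  "graded_bundle_cat =
     \<lparr>Ob = {B. holomorphic_graded_bundle B \<and> connected_manifold (gtotal B)},
      Hom = (\<lambda>B B'. {\<Phi>. graded_bundle_morphism B B' \<Phi>}),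
      Idt = (\<lambda>B. \<lambda>e\<in>mcarrier (gtotal B). e),
      Cmp = (\<lambda>B B' B'' \<Psi> \<Phi>. compose (mcarrier (gtotal B)) \<Psi> \<Phi>)\<rparr>"

definition homogeneity_cat :: "('a homogeneity_structure, 'a \<Rightarrow> 'a) cat" where
  "homogeneity_cat =
     \<lparr>Ob = {S. holomorphic_homogeneity_structure S \<and> connected_manifold (hspace S)},
      Hom = (\<lambda>S S'. {\<Phi>. homogeneity_morphism S S' \<Phi>}),
      Idt = (\<lambda>S. \<lambda>x\<in>mcarrier (hspace S). x),
      Cmp = (\<lambda>S S' S'' \<Psi> \<Phi>. compose (mcarrier (hspace S)) \<Psi> \<Phi>)\<rparr>"

end

theory Submission
  imports Defs "HOL-Complex_Analysis.Complex_Analysis"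
begin

text \<open>Everything rests on homogeneous coordinates near a fixed point \<open>p\<close> of \<open>h 0\<close>. Expanding the
  coordinates of \<open>h \<xi> x\<close> in powers of \<open>\<xi>\<close>, one obtains functions \<open>f\<close> with
  \<open>f (h \<eta> x) = \<eta> ^ k * f x\<close>, and by the inverse function theorem finitely many of them are coordinates
  at \<open>p\<close>. As \<open>h \<xi> x\<close> tends to \<open>h 0 x\<close>, these coordinates extend to the whole fibres of \<open>h 0\<close>, where they
  take values in a graded space. The weights are the same at all fixed points because \<open>h 0\<close> maps the
  connected total space onto the fixed points, so \<open>h 0\<close> is a bundle of some rank. A holomorphic map of graded spaces
  commuting with the homotheties is polynomial and homogeneous. Hence the morphisms of bundles are the
  equivariant holomorphic maps, and the trivializations are determined by the action.\<close>

section \<open>Complex differentiability in several variables\<close>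

text \<open>The scalars include 0, and this drives the argument: \<open>h 0\<close> retracts the
  space onto the fixed points, while the small nonzero scalars that push a point towards its limit
  are invertible. So a statement about germs at a fixed point becomes one about whole fibres. Since
  the dimension varies inside the statement, the analysis takes place on sequences supported in an
  initial segment. Osgood's lemma reduces it to one complex variable: with it, Cauchy integrals over
  circles yield continuity, differentiability and Taylor coefficients that depend holomorphically on
  parameters. On manifolds, holomorphy is handled point by point (\<open>hol_at\<close>), so that
  compositions and chart changes rest on one chain rule at a point. The weights are recovered from
  the single map \<open>h (1/2)\<close>, because distinct powers of 1/2 differ; this gives both the
  constancy and the uniqueness of the rank. The bundle of an action is unique as a structure and not
  merely up to isomorphism. Passing from an action to its bundle and back returns the same action,
  so the natural isomorphisms are given by identity maps.\<close>

definition pdisc :: "nat \<Rightarrow> (nat \<Rightarrow> complex) \<Rightarrow> real \<Rightarrow> (nat \<Rightarrow> complex) set" where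
  "pdisc n z r = {w \<in> complex_space n. \<forall>i<n. cmod (w i - z i) < r}"

abbreviation open_cs :: "nat \<Rightarrow> (nat \<Rightarrow> complex) set \<Rightarrow> bool" where
  "open_cs n S \<equiv> openin (top_of_set (complex_space n)) S"

lemma complex_space_upd [simp]: "z \<in> complex_space n \<Longrightarrow> i < n \<Longrightarrow> z(i := \<zeta>) \<in> complex_space n"
  by (auto simp: complex_space_def)

lemma complex_space_eqI:
  "z \<in> complex_space n \<Longrightarrow> w \<in> complex_space n \<Longrightarrow> (\<And>i. i < n \<Longrightarrow> z i = w i) \<Longrightarrow> z = w"
  by (auto simp: complex_space_def fun_eq_iff) (metis not_le)

lemma complex_space_mono: "m \<le> n \<Longrightarrow> complex_space m \<subseteq> complex_space n"
  by (auto simp: complex_space_def)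

lemma zero_in_complex_space [simp]: "(\<lambda>i. 0) \<in> complex_space n"
  by (auto simp: complex_space_def)

lemma pdisc_centre: "z \<in> complex_space n \<Longrightarrow> 0 < r \<Longrightarrow> z \<in> pdisc n z r"
  by (auto simp: pdisc_def)

lemma pdisc_mono: "r \<le> s \<Longrightarrow> pdisc n z r \<subseteq> pdisc n z s"
  by (fastforce simp: pdisc_def)

lemma pdisc_subset: "pdisc n z r \<subseteq> complex_space n"
  by (auto simp: pdisc_def)

lemma continuous_on_coord [continuous_intros]:
  "continuous_on S (\<lambda>x. (x :: nat \<Rightarrow> complex) i)"
  by (rule continuous_on_product_then_coordinatewise) (rule continuous_on_id)

lemma continuous_on_fun_upd [continuous_intros]:
  fixes f :: "'a::topological_space \<Rightarrow> nat \<Rightarrow> complex"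
  assumes "continuous_on S f" "continuous_on S g"
  shows "continuous_on S (\<lambda>x. (f x)(i := g x))"
proof (rule continuous_on_coordinatewise_then_product)
  fix j show "continuous_on S (\<lambda>x. ((f x)(i := g x)) j)"
    using assms continuous_on_product_then_coordinatewise[OF assms(1)] by (cases "j = i") auto
qed

lemma open_cs_pdisc: "open_cs n (pdisc n z r)"
proof -
  have *: "pdisc n z r = complex_space n \<inter> (\<Inter>i\<in>{..<n}. {w. w i \<in> ball (z i) r})"
    by (auto simp: pdisc_def dist_norm norm_minus_commute)
  have "open {w::nat \<Rightarrow> complex. w i \<in> ball (z i) r}" for i
    using open_vimage[OF open_ball[of "z i" r] continuous_on_product_coordinates[of i]]
    by (simp add: vimage_def)
  then show ?thesis unfolding * by (intro openin_open_Int open_INT) auto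
qed

text \<open>Polydiscs form a neighbourhood base of the subspace topology: the coordinates from
  \<open>n\<close> on vanish, so a basic open set of the product topology constrains only the first
  \<open>n\<close> of them.\<close>

lemma openin_complex_space:
  "open_cs n S \<longleftrightarrow> S \<subseteq> complex_space n \<and> (\<forall>z\<in>S. \<exists>r>0. pdisc n z r \<subseteq> S)"
proof
  assume S: "open_cs n S"
  then obtain T where T: "open T" "S = complex_space n \<inter> T" by (auto simp: openin_open)
  have "\<exists>r>0. pdisc n z r \<subseteq> S" if z: "z \<in> S" for z
  proof -
    have "openin (product_topology (\<lambda>i. euclidean) UNIV) T" "z \<in> T"
      using T z by (auto simp: open_fun_def)
    from product_topology_open_contains_basis[OF this]
    obtain X where X: "z \<in> Pi\<^sub>E UNIV X" "\<And>i. openin euclidean (X i)" "Pi\<^sub>E UNIV X \<subseteq> T" by metis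
    have "\<forall>i. \<exists>r>0. ball (z i) r \<subseteq> X i"
      using X by (metis PiE_mem UNIV_I open_contains_ball open_openin)
    then obtain r where r: "\<And>i. r i > 0" "\<And>i. ball (z i) (r i) \<subseteq> X i" by metis
    \<comment> \<open>The entry 1 keeps the minimum defined when \<open>n = 0\<close>.\<close>
    let ?r = "Min (insert 1 (r ` {..<n}))"
    have rr: "?r > 0" "\<And>i. i < n \<Longrightarrow> ?r \<le> r i" using r by (auto simp: Min_le_iff)
    have "pdisc n z ?r \<subseteq> S"
    proof
      fix w assume w: "w \<in> pdisc n z ?r"
      have "w i \<in> X i" for i
      proof (cases "i < n")
        case True
        with w rr(2)[OF True] have "cmod (w i - z i) < r i" by (fastforce simp: pdisc_def)
        then show ?thesis using r(2)[of i] by (auto simp: dist_norm norm_minus_commute)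
      next
        case False
        then have "w i = z i" using w z T by (auto simp: pdisc_def complex_space_def)
        then show ?thesis using X(1) by auto
      qed
      then have "w \<in> T" using X(3) by auto
      then show "w \<in> S" using w T by (auto simp: pdisc_def)
    qed
    then show ?thesis using rr by blast
  qed
  then show "S \<subseteq> complex_space n \<and> (\<forall>z\<in>S. \<exists>r>0. pdisc n z r \<subseteq> S)" using T by auto
next
  assume S: "S \<subseteq> complex_space n \<and> (\<forall>z\<in>S. \<exists>r>0. pdisc n z r \<subseteq> S)"
  show "open_cs n S"
  proof (subst openin_subopen, intro ballI)
    fix z assume z: "z \<in> S"
    with S obtain r where "r > 0" "pdisc n z r \<subseteq> S" by auto
    then show "\<exists>T. open_cs n T \<and> z \<in> T \<and> T \<subseteq> S"
      using open_cs_pdisc[of n z r] z S by (metis pdisc_centre subsetD)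
  qed
qed

lemma open_cs_pdiscE:
  assumes "open_cs n S" "z \<in> S"
  obtains r where "r > 0" "pdisc n z r \<subseteq> S"
  using assms openin_complex_space by blast

lemma open_cs_subset: "open_cs n S \<Longrightarrow> z \<in> S \<Longrightarrow> z \<in> complex_space n"
  using openin_complex_space by blast

lemma open_cs_eventually:
  assumes "open_cs n S" "z \<in> S"
  shows "eventually (\<lambda>w. w \<in> S) (at z within complex_space n)" "at z within S = at z within complex_space n"
proof -
  from assms(1) obtain T where "open T" "S = complex_space n \<inter> T" by (auto simp: openin_open)
  with assms show "eventually (\<lambda>w. w \<in> S) (at z within complex_space n)"
    by (auto simp: eventually_at_topological)
  show "at z within S = at z within complex_space n"
    using \<open>open T\<close> \<open>S = _\<close> assms by (intro at_within_nhd[of z T]) auto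
qed

lemma eventually_cs:
  assumes "z \<in> complex_space n"
  shows "eventually P (at z within complex_space n) \<longleftrightarrow> (\<exists>r>0. \<forall>w\<in>pdisc n z r. w \<noteq> z \<longrightarrow> P w)"
proof
  assume "eventually P (at z within complex_space n)"
  then obtain T where T: "open T" "z \<in> T" "\<And>w. w \<in> T \<Longrightarrow> w \<noteq> z \<Longrightarrow> w \<in> complex_space n \<Longrightarrow> P w"
    by (auto simp: eventually_at_topological)
  have "open_cs n (complex_space n \<inter> T)" using T by (simp add: openin_open_Int)
  from open_cs_pdiscE[OF this, of z] assms T
  obtain r where "r > 0" "pdisc n z r \<subseteq> complex_space n \<inter> T" by auto
  then show "\<exists>r>0. \<forall>w\<in>pdisc n z r. w \<noteq> z \<longrightarrow> P w" using T(3) by blast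
next
  assume "\<exists>r>0. \<forall>w\<in>pdisc n z r. w \<noteq> z \<longrightarrow> P w"
  then obtain r where r: "r > 0" "\<forall>w\<in>pdisc n z r. w \<noteq> z \<longrightarrow> P w" by blast
  have "eventually (\<lambda>w. w \<in> pdisc n z r) (at z within complex_space n)"
    using open_cs_eventually(1)[OF open_cs_pdisc] pdisc_centre assms r by blast
  moreover have "eventually (\<lambda>w. w \<noteq> z) (at z within complex_space n)"
    by (simp add: eventually_at_filter)
  ultimately show "eventually P (at z within complex_space n)"
    by eventually_elim (use r in auto)
qed

text \<open>The limit in \<open>holomorphic_fun\<close> with the quotient multiplied out: the case
  \<open>w = z\<close> becomes trivial, and errors can be added and composed directly.
  \<open>c\<close> is the gradient at \<open>z\<close>.\<close>

definition has_cderiv :: "nat \<Rightarrow> ((nat \<Rightarrow> complex) \<Rightarrow> complex) \<Rightarrow> (nat \<Rightarrow> complex) \<Rightarrow> (nat \<Rightarrow> complex) \<Rightarrow> bool"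
  where "has_cderiv n f c z \<longleftrightarrow> (\<forall>e>0. \<exists>r>0. \<forall>w\<in>pdisc n z r.
     cmod (f w - f z - (\<Sum>i<n. c i * (w i - z i))) \<le> e * (\<Sum>i<n. cmod (w i - z i)))"

lemma sum_cmod_pos:
  assumes "w \<in> complex_space n" "z \<in> complex_space n" "w \<noteq> z"
  shows "0 < (\<Sum>i<n. cmod (w i - z i))"
proof -
  obtain i where "i < n" "w i \<noteq> z i" using assms complex_space_eqI by metis
  then show ?thesis by (intro sum_pos2[of _ i]) auto
qed

lemma has_cderiv_iff_tendsto:
  assumes z: "z \<in> complex_space n"
  shows "has_cderiv n f c z \<longleftrightarrow>
    ((\<lambda>w. cmod (f w - f z - (\<Sum>i<n. c i * (w i - z i))) / (\<Sum>i<n. cmod (w i - z i))) \<longlongrightarrow> 0)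
          (at z within complex_space n)" (is "_ = (?q \<longlongrightarrow> 0) _")
proof
  assume L: "has_cderiv n f c z"
  show "(?q \<longlongrightarrow> 0) (at z within complex_space n)"
  proof (rule tendstoI)
    fix e :: real assume e: "e > 0"
    with L obtain r where r: "r > 0" "\<forall>w\<in>pdisc n z r.
       cmod (f w - f z - (\<Sum>i<n. c i * (w i - z i))) \<le> (e/2) * (\<Sum>i<n. cmod (w i - z i))"
      unfolding has_cderiv_def by (meson half_gt_zero)
    show "eventually (\<lambda>w. dist (?q w) 0 < e) (at z within complex_space n)"
      unfolding eventually_cs[OF z]
    proof (intro exI conjI ballI impI)
      fix w assume w: "w \<in> pdisc n z r" "w \<noteq> z"
      then have "0 < (\<Sum>i<n. cmod (w i - z i))" using sum_cmod_pos z pdisc_subset by blast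
      then have "?q w \<le> e / 2" using r w by (simp only: pos_divide_le_eq)
      moreover have "dist (?q w) 0 = ?q w" by (simp add: sum_nonneg)
      ultimately show "dist (?q w) 0 < e" using e by linarith
    qed (use r in auto)
  qed
next
  assume R: "(?q \<longlongrightarrow> 0) (at z within complex_space n)"
  show "has_cderiv n f c z" unfolding has_cderiv_def
  proof (intro allI impI)
    fix e :: real assume e: "e > 0"
    then have "eventually (\<lambda>w. dist (?q w) 0 < e) (at z within complex_space n)"
      using R tendstoD by blast
    then obtain r where r: "r > 0" "\<And>w. w\<in>pdisc n z r \<Longrightarrow> w \<noteq> z \<Longrightarrow> dist (?q w) 0 < e"
      unfolding eventually_cs[OF z] by blast
    show "\<exists>r>0. \<forall>w\<in>pdisc n z r.
     cmod (f w - f z - (\<Sum>i<n. c i * (w i - z i))) \<le> e * (\<Sum>i<n. cmod (w i - z i))"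
    proof (intro exI conjI ballI)
      fix w assume w: "w \<in> pdisc n z r"
      show "cmod (f w - f z - (\<Sum>i<n. c i * (w i - z i))) \<le> e * (\<Sum>i<n. cmod (w i - z i))"
      proof (cases "w = z")
        case False
        then have "0 < (\<Sum>i<n. cmod (w i - z i))" using sum_cmod_pos z pdisc_subset w by blast
        with r(2)[OF w False] show ?thesis by (simp add: pos_divide_less_eq)
      qed auto
    qed (use r in auto)
  qed
qed

lemma holomorphic_fun_iff:
  assumes "open_cs n S"
  shows "holomorphic_fun n S f \<longleftrightarrow> (\<forall>z\<in>S. \<exists>c. has_cderiv n f c z)"
  unfolding holomorphic_fun_def
  using has_cderiv_iff_tendsto[OF open_cs_subset[OF assms]] open_cs_eventually(2)[OF assms] by simp

lemma has_cderiv_cong: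
  assumes "has_cderiv n f c z" "open_cs n S" "z \<in> S" "\<And>w. w \<in> S \<Longrightarrow> f w = g w"
  shows "has_cderiv n g c z"
  unfolding has_cderiv_def
proof (intro allI impI)
  fix e :: real assume e: "e > 0"
  obtain s where s: "s > 0" "pdisc n z s \<subseteq> S" using assms open_cs_pdiscE by blast
  obtain r where r: "r > 0" "\<forall>w\<in>pdisc n z r.
     cmod (f w - f z - (\<Sum>i<n. c i * (w i - z i))) \<le> e * (\<Sum>i<n. cmod (w i - z i))"
    using assms(1) e unfolding has_cderiv_def by blast
  show "\<exists>r>0. \<forall>w\<in>pdisc n z r.
     cmod (g w - g z - (\<Sum>i<n. c i * (w i - z i))) \<le> e * (\<Sum>i<n. cmod (w i - z i))"
  proof (intro exI[of _ "min r s"] conjI ballI)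
    fix w assume "w \<in> pdisc n z (min r s)"
    then have "w \<in> pdisc n z r" "w \<in> S"
      using s pdisc_mono[of "min r s" r n z] pdisc_mono[of "min r s" s n z] by auto
    then show "cmod (g w - g z - (\<Sum>i<n. c i * (w i - z i))) \<le> e * (\<Sum>i<n. cmod (w i - z i))"
      using r assms(3,4) by metis
  qed (use r s in auto)
qed

lemma has_cderiv_continuous:
  assumes "has_cderiv n f c z" "z \<in> complex_space n" "e > 0"
  shows "\<exists>r>0. \<forall>w\<in>pdisc n z r. cmod (f w - f z) < e"
proof -
  obtain r where r: "r > 0" "\<And>w. w\<in>pdisc n z r \<Longrightarrow>
     cmod (f w - f z - (\<Sum>i<n. c i * (w i - z i))) \<le> 1 * (\<Sum>i<n. cmod (w i - z i))"
    using assms(1) unfolding has_cderiv_def by (meson zero_less_one)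
  \<comment> \<open>\<open>K - 1\<close> is a Lipschitz bound with respect to the largest coordinate
    difference; the extra 1 makes the final inequality strict.\<close>
  define K where "K = (\<Sum>i<n. cmod (c i) + 1) + 1"
  have K: "K > 0" unfolding K_def by (intro add_nonneg_pos sum_nonneg) auto
  show ?thesis
  proof (intro exI conjI ballI)
    show "min r (e / K) > 0" using r K assms by auto
    fix w assume w: "w \<in> pdisc n z (min r (e / K))"
    then have w1: "w \<in> pdisc n z r" using pdisc_mono by (meson min.cobounded1 subsetD)
    have wi: "\<And>i. i < n \<Longrightarrow> cmod (w i - z i) \<le> e / K" using w by (force simp: pdisc_def)
    have "cmod (f w - f z) \<le> (\<Sum>i<n. cmod (w i - z i)) + cmod (\<Sum>i<n. c i * (w i - z i))"
      using r(2)[OF w1] norm_triangle_sub[of "f w - f z" "\<Sum>i<n. c i * (w i - z i)"] by simp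
    also have "\<dots> \<le> (\<Sum>i<n. cmod (w i - z i)) + (\<Sum>i<n. cmod (c i) * cmod (w i - z i))"
      by (intro add_left_mono order.trans[OF norm_sum]) (simp add: norm_mult)
    also have "\<dots> = (\<Sum>i<n. (cmod (c i) + 1) * cmod (w i - z i))"
      by (simp add: algebra_simps sum.distrib)
    also have "\<dots> \<le> (\<Sum>i<n. (cmod (c i) + 1) * (e / K))"
      by (intro sum_mono mult_left_mono wi) auto
    also have "\<dots> = (\<Sum>i<n. cmod (c i) + 1) * (e / K)" by (rule sum_distrib_right[symmetric])
    also have "\<dots> = (K - 1) * (e / K)" by (simp add: K_def)
    also have "\<dots> < e" using K assms by (simp add: field_simps)
    finally show "cmod (f w - f z) < e" .
  qed
qed

lemma has_cderiv_compose:
  assumes f: "has_cderiv m f c (g z)" and g: "\<And>j. j < m \<Longrightarrow> has_cderiv n (\<lambda>w. g w j) (A j) z"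
    and z: "z \<in> complex_space n" and S: "open_cs n S" "z \<in> S" "g ` S \<subseteq> complex_space m"
  shows "has_cderiv n (\<lambda>w. f (g w)) (\<lambda>i. \<Sum>j<m. c j * A j i) z"
  unfolding has_cderiv_def
proof (intro allI impI)
  fix e :: real assume e: "e > 0"
  let ?N = "\<lambda>w. \<Sum>i<n. cmod (w i - z i)"
  define C where "C = (\<Sum>j<m. cmod (c j)) + 1"
  define K where "K = (\<Sum>j<m. (\<Sum>i<n. cmod (A j i)) + 1) + 1"
  have C: "C > 0" unfolding C_def by (intro add_nonneg_pos sum_nonneg) auto
  have K: "K > 0" unfolding K_def by (intro add_nonneg_pos sum_nonneg add_nonneg_nonneg) auto
  \<comment> \<open>\<open>K\<close> bounds the growth of \<open>g\<close> and \<open>C\<close> the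
    gradient of \<open>f\<close>, so each of the two error terms contributes at most half of
    \<open>e\<close>. The cap 1 on \<open>e2\<close> keeps \<open>K\<close> independent of
    \<open>e\<close>.\<close>
  define e1 where "e1 = e / (2 * K)"
  define e2 where "e2 = min 1 (e / (2 * C))"
  have e1: "e1 > 0" and e2: "e2 > 0" "e2 \<le> 1" "e2 \<le> e / (2*C)" using e C K by (auto simp: e1_def e2_def)
  obtain r where r: "r > 0" "\<And>w. w\<in>pdisc m (g z) r \<Longrightarrow>
     cmod (f w - f (g z) - (\<Sum>i<m. c i * (w i - g z i))) \<le> e1 * (\<Sum>i<m. cmod (w i - g z i))"
    using f e1 unfolding has_cderiv_def by meson
  have "\<forall>j. \<exists>s>0. j < m \<longrightarrow> (\<forall>w\<in>pdisc n z s. cmod (g w j - g z j) < r \<and>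
     cmod (g w j - g z j - (\<Sum>i<n. A j i * (w i - z i))) \<le> e2 * ?N w)"
  proof
    fix j show "\<exists>s>0. j < m \<longrightarrow> (\<forall>w\<in>pdisc n z s. cmod (g w j - g z j) < r \<and>
     cmod (g w j - g z j - (\<Sum>i<n. A j i * (w i - z i))) \<le> e2 * ?N w)"
    proof (cases "j < m")
      case True
      obtain s1 where s1: "s1 > 0" "\<forall>w\<in>pdisc n z s1. cmod (g w j - g z j) < r"
        using has_cderiv_continuous[OF g[OF True] z r(1)] by blast
      obtain s2 where s2: "s2 > 0" "\<forall>w\<in>pdisc n z s2. cmod (g w j - g z j - (\<Sum>i<n. A j i * (w i - z i))) \<le> e2 * ?N w"
        using g[OF True] e2 unfolding has_cderiv_def by meson
      have "pdisc n z (min s1 s2) \<subseteq> pdisc n z s1" "pdisc n z (min s1 s2) \<subseteq> pdisc n z s2"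
        by (auto intro!: pdisc_mono)
      with s1 s2 show ?thesis
        by (intro exI[of _ "min s1 s2"]) (simp add: subset_iff)
    qed (auto intro: exI[of _ 1])
  qed
  from choice[OF this] obtain s where s: "\<And>j. s j > 0" "\<And>j w. j < m \<Longrightarrow> w \<in> pdisc n z (s j) \<Longrightarrow> cmod (g w j - g z j) < r \<and>
     cmod (g w j - g z j - (\<Sum>i<n. A j i * (w i - z i))) \<le> e2 * ?N w" by blast
  obtain t where t: "t > 0" "pdisc n z t \<subseteq> S" using S open_cs_pdiscE by blast
  let ?s = "Min (insert t (s ` {..<m}))"
  have ss: "?s > 0" "\<And>j. j < m \<Longrightarrow> ?s \<le> s j" "?s \<le> t" using s t by (auto simp: Min_le_iff)
  show "\<exists>r>0. \<forall>w\<in>pdisc n z r. cmod (f (g w) - f (g z) - (\<Sum>i<n. (\<Sum>j<m. c j * A j i) * (w i - z i)))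
       \<le> e * (\<Sum>i<n. cmod (w i - z i))"
  proof (intro exI conjI ballI)
    fix w assume w: "w \<in> pdisc n z ?s"
    have w1: "\<And>j. j < m \<Longrightarrow> w \<in> pdisc n z (s j)" and w2: "w \<in> S"
      using pdisc_mono[OF ss(2)] pdisc_mono[OF ss(3)] w t by blast+
    have N0: "?N w \<ge> 0" by (intro sum_nonneg) auto
    have gj: "cmod (g w j - g z j) \<le> ((\<Sum>i<n. cmod (A j i)) + 1) * ?N w" if j: "j < m" for j
    proof -
      have "cmod (g w j - g z j) \<le> e2 * ?N w + cmod (\<Sum>i<n. A j i * (w i - z i))"
        using s(2)[OF j w1[OF j]] norm_triangle_sub[of "g w j - g z j" "\<Sum>i<n. A j i * (w i - z i)"] by simp
      also have "\<dots> \<le> 1 * ?N w + (\<Sum>i<n. cmod (A j i) * ?N w)"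
        by (intro add_mono mult_right_mono e2 N0 order.trans[OF norm_sum] sum_mono)
          (auto simp: norm_mult intro!: mult_left_mono member_le_sum)
      also have "\<dots> = ((\<Sum>i<n. cmod (A j i)) + 1) * ?N w"
        by (simp add: distrib_right sum_distrib_right[symmetric])
      finally show ?thesis .
    qed
    have gw: "g w \<in> pdisc m (g z) r" using s(2)[OF _ w1] S(3) w2 by (auto simp: pdisc_def)
    have eq: "f (g w) - f (g z) - (\<Sum>i<n. (\<Sum>j<m. c j * A j i) * (w i - z i)) =
      (f (g w) - f (g z) - (\<Sum>j<m. c j * (g w j - g z j))) +
      (\<Sum>j<m. c j * (g w j - g z j - (\<Sum>i<n. A j i * (w i - z i))))"
    proof -
      have "(\<Sum>i<n. (\<Sum>j<m. c j * A j i) * (w i - z i)) = (\<Sum>j<m. c j * (\<Sum>i<n. A j i * (w i - z i)))"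
        by (simp add: sum_distrib_left sum_distrib_right mult.assoc) (rule sum.swap)
      then show ?thesis by (simp add: right_diff_distrib sum_subtractf)
    qed
    have "cmod (f (g w) - f (g z) - (\<Sum>i<n. (\<Sum>j<m. c j * A j i) * (w i - z i)))
       \<le> e1 * (\<Sum>j<m. cmod (g w j - g z j)) + (\<Sum>j<m. cmod (c j) * (e2 * ?N w))"
      unfolding eq
      by (intro norm_triangle_le add_mono r(2) gw order.trans[OF norm_sum] sum_mono)
        (use s(2)[OF _ w1] in \<open>auto simp: norm_mult intro!: mult_left_mono\<close>)
    also have "\<dots> \<le> e1 * (\<Sum>j<m. ((\<Sum>i<n. cmod (A j i)) + 1) * ?N w) + (\<Sum>j<m. cmod (c j) * (e2 * ?N w))"
      by (intro add_right_mono mult_left_mono sum_mono gj) (use e1 in auto)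
    also have "\<dots> = e1 * ((K - 1) * ?N w) + (C - 1) * (e2 * ?N w)"
      by (simp add: K_def C_def sum_distrib_right)
    also have "\<dots> \<le> e1 * (K * ?N w) + C * (e2 * ?N w)"
      using e1 e2(1) N0 K by (intro add_mono mult_left_mono mult_right_mono) auto
    also have "\<dots> \<le> e1 * (K * ?N w) + C * (e / (2 * C) * ?N w)"
      using e2 C N0 by (intro add_left_mono mult_left_mono mult_right_mono) auto
    also have "\<dots> = e * ?N w" using C K by (simp add: e1_def field_simps)
    finally show "cmod (f (g w) - f (g z) - (\<Sum>i<n. (\<Sum>j<m. c j * A j i) * (w i - z i))) \<le> e * ?N w" .
  qed (use ss in auto)
qed

lemma has_cderiv_partial:
  assumes f: "has_cderiv n f c z" and z: "z \<in> complex_space n" and i: "i < n"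
  shows "((\<lambda>\<zeta>. f (z(i := \<zeta>))) has_field_derivative c i) (at (z i))"
  unfolding has_field_derivative_def has_derivative_within_alt
proof (intro conjI allI impI)
  show "bounded_linear ((*) (c i))" by (rule bounded_linear_mult_right)
  fix e :: real assume "e > 0"
  then obtain r where r: "r > 0" "\<And>w. w\<in>pdisc n z r \<Longrightarrow>
     cmod (f w - f z - (\<Sum>i<n. c i * (w i - z i))) \<le> e * (\<Sum>i<n. cmod (w i - z i))"
    using f unfolding has_cderiv_def by meson
  show "\<exists>d>0. \<forall>y\<in>UNIV. norm (y - z i) < d \<longrightarrow>
     norm (f (z(i := y)) - f (z(i := z i)) - c i * (y - z i)) \<le> e * norm (y - z i)"
  proof (intro exI conjI ballI impI)
    fix y assume y: "norm (y - z i) < r"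
    have w: "z(i := y) \<in> pdisc n z r" using y r z i by (auto simp: pdisc_def)
    have 1: "(\<Sum>k<n. c k * ((z(i := y)) k - z k)) = (\<Sum>k<n. if k = i then c i * (y - z i) else 0)"
      by (intro sum.cong) auto
    have 2: "(\<Sum>k<n. cmod ((z(i := y)) k - z k)) = (\<Sum>k<n. if k = i then cmod (y - z i) else 0)"
      by (intro sum.cong) auto
    show "norm (f (z(i := y)) - f (z(i := z i)) - c i * (y - z i)) \<le> e * norm (y - z i)"
      using r(2)[OF w] i unfolding 1 2 by simp
  qed (use r in auto)
qed


section \<open>Separate holomorphy, Cauchy integrals with parameters, Osgood's lemma\<close>

definition pd :: "nat \<Rightarrow> ((nat \<Rightarrow> complex) \<Rightarrow> complex) \<Rightarrow> (nat \<Rightarrow> complex) \<Rightarrow> complex" where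
  "pd i f z = deriv (\<lambda>\<zeta>. f (z(i := \<zeta>))) (z i)"

text \<open>The hypothesis of Osgood's lemma. On open sets it is equivalent to
  \<open>holomorphic_fun\<close> (\<open>holomorphic_fun_iff_sep_hol\<close>), and it makes the
  theory of one variable applicable slice by slice.\<close>

definition sep_hol :: "nat \<Rightarrow> (nat \<Rightarrow> complex) set \<Rightarrow> ((nat \<Rightarrow> complex) \<Rightarrow> complex) \<Rightarrow> bool" where
  "sep_hol n S f \<longleftrightarrow> continuous_on S f \<and>
     (\<forall>z\<in>S. \<forall>i<n. (\<lambda>\<zeta>. f (z(i := \<zeta>))) field_differentiable at (z i))"

definition ucirc :: "real \<Rightarrow> complex" where
  "ucirc t = exp (2 * of_real pi * \<i> * of_real t)"

lemma norm_ucirc [simp]: "cmod (ucirc t) = 1" "ucirc t \<noteq> 0"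
  by (auto simp: ucirc_def norm_exp_eq_Re)

lemma continuous_on_ucirc [continuous_intros]:
  "continuous_on S f \<Longrightarrow> continuous_on S (\<lambda>x. ucirc (f x))"
  unfolding ucirc_def by (intro continuous_intros)

text \<open>Cauchy's formula with the circle parametrized by [0,1]: dz divided by 2 pi i (z - c) is
  dt. The coefficient becomes a plain real integral, to which theorems on integrals with parameters
  apply.\<close>

lemma cauchy_coeff:
  assumes f: "f holomorphic_on T" and T: "cball c \<rho> \<subseteq> T" and \<rho>: "\<rho> > 0"
  shows "((\<lambda>t. f (c + of_real \<rho> * ucirc t) / (of_real \<rho> * ucirc t) ^ k) has_integral (deriv ^^ k) f c / fact k) {0..1}"
proof -
  have "continuous_on (cball c \<rho>) f" "f holomorphic_on ball c \<rho>"
    using holomorphic_on_imp_continuous_on holomorphic_on_subset f T ball_subset_cball by blast+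
  from Cauchy_has_contour_integral_higher_derivative_circlepath[OF this, of c k] \<rho>
  have "((\<lambda>u. f u / (u - c) ^ Suc k) has_contour_integral 2 * complex_of_real pi * \<i> / fact k * (deriv ^^ k) f c) (circlepath c \<rho>)"
    by simp
  then have "((\<lambda>t. f (c + of_real \<rho> * ucirc t) / (of_real \<rho> * ucirc t) ^ Suc k * (2 * pi * \<i> * \<rho> * ucirc t))
      has_integral 2 * complex_of_real pi * \<i> / fact k * (deriv ^^ k) f c) {0..1}"
    unfolding has_contour_integral_def
    by (rule has_integral_eq[rotated])
      (simp add: vector_derivative_circlepath01, simp add: circlepath ucirc_def)
  from has_integral_mult_right[OF this, of "1 / (2 * complex_of_real pi * \<i>)"]
  show ?thesis
    by (rule has_integral_eq_rhs[OF has_integral_eq[rotated]]) (use \<rho> in \<open>auto simp: field_simps\<close>)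
qed

lemma open_slice:
  assumes "open_cs n S" "i < n" "z \<in> complex_space n"
  shows "open {\<zeta>. z(i := \<zeta>) \<in> S}"
proof -
  from assms(1) obtain T where T: "open T" "S = complex_space n \<inter> T" by (auto simp: openin_open)
  have "open ((\<lambda>\<zeta>. z(i := \<zeta>)) -` T)"
    by (rule open_vimage[OF T(1)]) (intro continuous_intros)
  also have "(\<lambda>\<zeta>. z(i := \<zeta>)) -` T = {\<zeta>. z(i := \<zeta>) \<in> S}" using T assms by auto
  finally show ?thesis .
qed

lemma sep_hol_slice:
  assumes "sep_hol n S f" "i < n" "X \<subseteq> {\<zeta>. z(i := \<zeta>) \<in> S}"
  shows "(\<lambda>\<zeta>. f (z(i := \<zeta>))) holomorphic_on X"
  unfolding holomorphic_on_def
proof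
  fix x assume "x \<in> X"
  then have "z(i := x) \<in> S" using assms by auto
  with assms(1,2) have "(\<lambda>\<zeta>. f ((z(i := x))(i := \<zeta>))) field_differentiable at ((z(i := x)) i)"
    unfolding sep_hol_def by blast
  then show "(\<lambda>\<zeta>. f (z(i := \<zeta>))) field_differentiable at x within X"
    by (simp add: field_differentiable_at_within)
qed

lemma sep_hol_pd:
  assumes "sep_hol n S f" "i < n" "z \<in> S"
  shows "((\<lambda>\<zeta>. f (z(i := \<zeta>))) has_field_derivative pd i f z) (at (z i))"
  using assms unfolding sep_hol_def pd_def by (simp add: field_differentiable_derivI)

lemma sep_hol_pd_upd:
  assumes "sep_hol n S f" "i < n" "z(i := x) \<in> S"
  shows "((\<lambda>\<zeta>. f (z(i := \<zeta>))) has_field_derivative pd i f (z(i := x))) (at x)"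
  using sep_hol_pd[OF assms] by simp

lemma continuous_on_local:
  assumes "\<And>x. x \<in> S \<Longrightarrow> \<exists>T. openin (top_of_set S) T \<and> x \<in> T \<and> continuous_on T f"
  shows "continuous_on S f"
  unfolding continuous_on_def
proof
  fix x assume x: "x \<in> S"
  with assms obtain T where T: "openin (top_of_set S) T" "x \<in> T" "continuous_on T f" by blast
  from T(1) obtain U where U: "open U" "T = S \<inter> U" by (auto simp: openin_open)
  have "at x within S = at x within T" using U T by (intro at_within_nhd[of x U]) auto
  then show "(f \<longlongrightarrow> f x) (at x within S)" using T by (auto simp: continuous_on_def)
qed

text \<open>Near each point the partial derivative is a Cauchy integral over a circle of fixed
  radius in variable \<open>i\<close>, and such an integral depends continuously on its
  parameters.\<close>

lemma pd_continuous_param: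
  fixes H :: "(nat \<Rightarrow> complex) \<Rightarrow> real \<Rightarrow> complex"
  assumes S: "open_cs n S" and H: "continuous_on (S \<times> {0..1}) (\<lambda>(x,t). H x t)"
    and hol: "\<And>t. t \<in> {0..1} \<Longrightarrow> sep_hol n S (\<lambda>x. H x t)" and i: "i < n"
  shows "continuous_on (S \<times> {0..1}) (\<lambda>(x,t). pd i (\<lambda>x. H x t) x)"
proof (rule continuous_on_local)
  fix p assume p: "p \<in> S \<times> {0..1::real}"
  obtain x0 t0 where p0: "p = (x0, t0)" "x0 \<in> S" "t0 \<in> {0..1}" using p by auto
  obtain r where r: "r > 0" "pdisc n x0 r \<subseteq> S" using S p0 open_cs_pdiscE by blast
  define \<rho> where "\<rho> = r / 2"
  have \<rho>: "\<rho> > 0" using r by (simp add: \<rho>_def)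
  let ?T = "pdisc n x0 \<rho> \<times> {0..1::real}"
  have T: "openin (top_of_set (S \<times> {0..1})) ?T"
  proof -
    have "pdisc n x0 \<rho> \<subseteq> S" using r pdisc_mono[of \<rho> r n x0] by (auto simp: \<rho>_def)
    then have "openin (top_of_set S) (pdisc n x0 \<rho>)"
      using open_cs_pdisc S by (metis openin_imp_subset openin_subset_trans)
    then show ?thesis by (simp add: openin_Times)
  qed
  have sub: "x(i := x i + of_real \<rho> * u) \<in> S" if "x \<in> pdisc n x0 \<rho>" "cmod u \<le> 1" for x u
  proof -
    have "cmod (x i + of_real \<rho> * u - x0 i) \<le> cmod (x i - x0 i) + cmod (of_real \<rho> * u)"
      by (metis add_diff_eq diff_add_eq norm_triangle_ineq)
    also have "\<dots> < \<rho> + \<rho>" using that i \<rho> by (intro add_less_le_mono) (auto simp: pdisc_def norm_mult)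
    finally have "cmod (x i + of_real \<rho> * u - x0 i) < r" by (simp add: \<rho>_def)
    then have "x(i := x i + of_real \<rho> * u) \<in> pdisc n x0 r"
      using that i r by (fastforce simp: pdisc_def \<rho>_def)
    then show ?thesis using r by auto
  qed
  let ?G = "\<lambda>(x, t) s. H (x(i := x i + of_real \<rho> * ucirc s)) t / (of_real \<rho> * ucirc s)"
  have eq: "integral (cbox 0 1) (?G q) = (\<lambda>(x,t). pd i (\<lambda>x. H x t) x) q" if q: "q \<in> ?T" for q
  proof -
    obtain x t where xt: "q = (x, t)" "x \<in> pdisc n x0 \<rho>" "t \<in> {0..1}" using q by auto
    have cb: "cball (x i) \<rho> \<subseteq> {\<zeta>. x(i := \<zeta>) \<in> S}"
    proof
      fix \<zeta> assume "\<zeta> \<in> cball (x i) \<rho>"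
      then have "cmod ((\<zeta> - x i) / of_real \<rho>) \<le> 1" using \<rho> by (simp add: norm_divide dist_norm norm_minus_commute)
      from sub[OF xt(2) this] show "\<zeta> \<in> {\<zeta>. x(i := \<zeta>) \<in> S}" using \<rho> by simp
    qed
    have "(\<lambda>\<zeta>. H (x(i := \<zeta>)) t) holomorphic_on {\<zeta>. x(i := \<zeta>) \<in> S}"
      by (rule sep_hol_slice[OF hol[OF xt(3)] i]) auto
    from cauchy_coeff[OF this cb \<rho>, of 1] show ?thesis
      by (simp add: xt pd_def has_integral_iff)
  qed
  have "continuous_on (?T \<times> cbox 0 1) (\<lambda>(q, s). ?G q s)"
  proof -
    have "continuous_on (?T \<times> cbox 0 1) (\<lambda>w. (\<lambda>(x,t). H x t)
       (((fst (fst w))(i := fst (fst w) i + of_real \<rho> * ucirc (snd w))), snd (fst w)))"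
    proof (rule continuous_on_compose2[OF H])
      show "continuous_on (?T \<times> cbox 0 1) (\<lambda>w. (((fst (fst w))(i := fst (fst w) i + of_real \<rho> * ucirc (snd w))), snd (fst w)))"
        by (intro continuous_intros continuous_on_product_then_coordinatewise[of _ "\<lambda>w. fst (fst w)"])
      show "(\<lambda>w. (((fst (fst w))(i := fst (fst w) i + of_real \<rho> * ucirc (snd w))), snd (fst w))) ` (?T \<times> cbox 0 1) \<subseteq> S \<times> {0..1}"
        using sub[OF _ eq_refl[OF norm_ucirc(1)]] by auto
    qed
    then have "continuous_on (?T \<times> cbox 0 1) (\<lambda>w. (\<lambda>(x,t). H x t)
       (((fst (fst w))(i := fst (fst w) i + of_real \<rho> * ucirc (snd w))), snd (fst w)) / (of_real \<rho> * ucirc (snd w)))"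
      using \<rho> by (intro continuous_intros) auto
    then show ?thesis by (simp add: case_prod_beta)
  qed
  then have "continuous_on ?T (\<lambda>q. integral (cbox 0 1) (?G q))"
    by (rule integral_continuous_on_param[where U = ?T and f = ?G])
  then have "continuous_on ?T (\<lambda>(x,t). pd i (\<lambda>x. H x t) x)"
    by (rule continuous_on_eq) (use eq in blast)
  then show "\<exists>T. openin (top_of_set (S \<times> {0..1})) T \<and> p \<in> T \<and> continuous_on T (\<lambda>(x,t). pd i (\<lambda>x. H x t) x)"
    using T p0 \<rho> open_cs_subset[OF S] pdisc_centre by (intro exI[of _ ?T]) auto
qed

lemma sep_hol_pd_continuous:
  assumes "open_cs n S" "sep_hol n S f" "i < n"
  shows "continuous_on S (pd i f)"
proof -
  have "continuous_on (S \<times> {0..1::real}) (\<lambda>(x,t). f x)"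
    using assms(2) unfolding sep_hol_def case_prod_beta
    by (intro continuous_on_compose2[of S f _ fst]) (auto intro!: continuous_on_fst continuous_on_id)
  then have "continuous_on (S \<times> {0..1}) (\<lambda>(x,t::real). pd i f x)"
    using pd_continuous_param[of n S "\<lambda>x t. f x" i] assms by auto
  then have "continuous_on S (\<lambda>x. (\<lambda>(x,t::real). pd i f x) (x, 0))"
    by (rule continuous_on_compose2) (auto intro!: continuous_intros)
  then show ?thesis by simp
qed

text \<open>Leibniz's rule in each variable separately. The joint continuity of the differentiated
  integrand comes from \<open>pd_continuous_param\<close>.\<close>

lemma sep_hol_integral:
  fixes H :: "(nat \<Rightarrow> complex) \<Rightarrow> real \<Rightarrow> complex"
  assumes S: "open_cs n S" and H: "continuous_on (S \<times> {0..1}) (\<lambda>(x,t). H x t)"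
    and hol: "\<And>t. t \<in> {0..1} \<Longrightarrow> sep_hol n S (\<lambda>x. H x t)"
  shows "sep_hol n S (\<lambda>x. integral {0..1} (H x))"
    and "x \<in> S \<Longrightarrow> i < n \<Longrightarrow> pd i (\<lambda>x. integral {0..1} (H x)) x = integral {0..1} (\<lambda>t. pd i (\<lambda>x. H x t) x)"
proof -
  have der: "((\<lambda>\<zeta>. integral {0..1} (H (x(i := \<zeta>)))) has_field_derivative integral {0..1} (\<lambda>t. pd i (\<lambda>x. H x t) x)) (at (x i))"
    if x: "x \<in> S" and i: "i < n" for x i
  proof -
    have "open {\<zeta>. x(i := \<zeta>) \<in> S}" "x i \<in> {\<zeta>. x(i := \<zeta>) \<in> S}"
      using open_slice[OF S i] open_cs_subset[OF S] x by auto
    then obtain e where e: "e > 0" "ball (x i) e \<subseteq> {\<zeta>. x(i := \<zeta>) \<in> S}"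
      using open_contains_ball by blast
    let ?B = "ball (x i) e"
    define h where "h = (\<lambda>\<zeta> t. H (x(i := \<zeta>)) t)"
    define h' where "h' = (\<lambda>\<zeta> t. pd i (\<lambda>x. H x t) (x(i := \<zeta>)))"
    have d: "((\<lambda>\<zeta>. h \<zeta> t) has_field_derivative h' y t) (at y within ?B)"
      if "y \<in> ?B" "t \<in> cbox 0 1" for y and t :: real
    proof -
      have "x(i := y) \<in> S" "t \<in> {0..1}" using that e by auto
      from sep_hol_pd_upd[OF hol[OF this(2)] i this(1)] show ?thesis
        unfolding h_def h'_def by (rule has_field_derivative_at_within)
    qed
    have int: "h y integrable_on cbox 0 1" if "y \<in> ?B" for y
    proof -
      have "x(i := y) \<in> S" using that e by auto
      then have "continuous_on (cbox 0 1) (\<lambda>t. (\<lambda>(x,t). H x t) (x(i := y), t))"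
        by (intro continuous_on_compose2[OF H]) (auto intro!: continuous_intros)
      then show ?thesis unfolding h_def by (simp add: integrable_continuous_interval)
    qed
    have cont: "continuous_on (?B \<times> cbox 0 1) (\<lambda>(\<zeta>, t). h' \<zeta> t)"
    proof -
      have "continuous_on (?B \<times> cbox 0 (1::real)) (\<lambda>w. (\<lambda>(x,t). pd i (\<lambda>x. H x t) x) (x(i := fst w), snd w))"
        by (rule continuous_on_compose2[OF pd_continuous_param[where H = H, OF S H hol i]], assumption,
            intro continuous_on_Pair continuous_on_fun_upd continuous_on_fst continuous_on_snd
              continuous_on_id continuous_on_const, use e in auto)
      then show ?thesis by (simp add: case_prod_beta h'_def)
    qed
    have "((\<lambda>\<zeta>. integral (cbox 0 1) (h \<zeta>)) has_field_derivative integral (cbox 0 1) (h' (x i))) (at (x i) within ?B)"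
      by (rule leibniz_rule_field_derivative[OF d int cont]) (use e in auto)
    then have "((\<lambda>\<zeta>. integral {0..1} (H (x(i := \<zeta>)))) has_field_derivative integral {0..1} (\<lambda>t. pd i (\<lambda>x. H x t) x)) (at (x i) within ?B)"
      by (simp add: h_def h'_def)
    then show ?thesis using e by (simp add: at_within_open[of "x i" "ball (x i) e"])
  qed
  show "sep_hol n S (\<lambda>x. integral {0..1} (H x))"
    unfolding sep_hol_def
  proof (intro conjI ballI allI impI)
    show "continuous_on S (\<lambda>x. integral {0..1} (H x))"
      using integral_continuous_on_param[of S 0 1 H] H by simp
    show "(\<lambda>\<zeta>. integral {0..1} (H (z(i := \<zeta>)))) field_differentiable at (z i)" if "z \<in> S" "i < n" for z i
      using der[OF that] field_differentiable_def by blast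
  qed
  show "pd i (\<lambda>x. integral {0..1} (H x)) x = integral {0..1} (\<lambda>t. pd i (\<lambda>x. H x t) x)" if "x \<in> S" "i < n"
    unfolding pd_def[of i "\<lambda>x. integral {0..1} (H x)"] using der[OF that] by (rule DERIV_imp_deriv)
qed

lemma continuous_on_pdisc:
  assumes S: "open_cs n S" and f: "continuous_on S f" and z: "z \<in> S" and e: "e > 0"
  obtains r where "r > 0" "pdisc n z r \<subseteq> S" "\<And>w. w \<in> pdisc n z r \<Longrightarrow> cmod (f w - f z) < e"
proof -
  have zc: "z \<in> complex_space n" using S z open_cs_subset by blast
  have "(f \<longlongrightarrow> f z) (at z within complex_space n)"
    using f z open_cs_eventually(2)[OF S z] by (auto simp: continuous_on_def)
  then have "eventually (\<lambda>w. dist (f w) (f z) < e) (at z within complex_space n)"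
    using e tendstoD by blast
  then obtain r where r: "r > 0" "\<And>w. w \<in> pdisc n z r \<Longrightarrow> w \<noteq> z \<Longrightarrow> dist (f w) (f z) < e"
    unfolding eventually_cs[OF zc] by blast
  obtain s where s: "s > 0" "pdisc n z s \<subseteq> S" using S z open_cs_pdiscE by blast
  show ?thesis
  proof (rule that[of "min r s"])
    show "pdisc n z (min r s) \<subseteq> S" using s pdisc_mono[of "min r s" s n z] by auto
    show "cmod (f w - f z) < e" if "w \<in> pdisc n z (min r s)" for w
      using r that pdisc_mono[of "min r s" r n z] e by (cases "w = z") (auto simp: dist_norm subset_iff)
  qed (use r s in auto)
qed

text \<open>The point \<open>z\<close> is moved to \<open>w\<close> one coordinate at a time. A
  polydisc is a product, so all intermediate points lie in it, and the mean value bound of one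
  variable applies to every step.\<close>

lemma lipschitz_pdisc:
  assumes S: "sep_hol n S f" and sub: "pdisc n p r \<subseteq> S" and p: "p \<in> complex_space n"
    and K: "\<And>w j. w \<in> pdisc n p r \<Longrightarrow> j < n \<Longrightarrow> cmod (pd j f w) \<le> K"
    and w: "w \<in> pdisc n p r" and z: "z \<in> pdisc n p r"
  shows "cmod (f w - f z) \<le> K * (\<Sum>j<n. cmod (w j - z j))"
proof -
  define q where "q j = (\<lambda>i. if i < j then w i else z i)" for j
  have q: "q j \<in> pdisc n p r" for j using w z by (auto simp: q_def pdisc_def complex_space_def)
  have qS: "q (Suc j) = (q j)(j := w j)" for j by (auto simp: q_def fun_eq_iff less_Suc_eq)
  have qz: "(q j)(j := z j) = q j" for j by (auto simp: q_def)
  have qn: "q n = w" using w z by (intro ext) (auto simp: q_def pdisc_def complex_space_def)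
  have q0: "q 0 = z" by (auto simp: q_def)
  have step: "cmod (f (q (Suc j)) - f (q j)) \<le> K * cmod (w j - z j)" if j: "j < n" for j
  proof -
    have "cmod ((\<lambda>\<zeta>. f ((q j)(j := \<zeta>))) (w j) - (\<lambda>\<zeta>. f ((q j)(j := \<zeta>))) (z j)) \<le> K * cmod (w j - z j)"
    proof (rule field_differentiable_bound[where S = "ball (p j) r" and f' = "\<lambda>\<zeta>. pd j f ((q j)(j := \<zeta>))"])
      fix \<zeta> assume \<zeta>: "\<zeta> \<in> ball (p j) r"
      have m: "(q j)(j := \<zeta>) \<in> pdisc n p r"
        using q[of j] \<zeta> j by (auto simp: pdisc_def dist_norm norm_minus_commute)
      show "((\<lambda>\<zeta>. f ((q j)(j := \<zeta>))) has_field_derivative pd j f ((q j)(j := \<zeta>))) (at \<zeta> within ball (p j) r)"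
        using sep_hol_pd_upd[OF S j] m sub by (blast intro: has_field_derivative_at_within)
      show "cmod (pd j f ((q j)(j := \<zeta>))) \<le> K" by (rule K[OF m j])
    qed (use w z j in \<open>auto simp: pdisc_def dist_norm norm_minus_commute\<close>)
    then show ?thesis by (simp add: qS qz)
  qed
  have "f w - f z = (\<Sum>j<n. f (q (Suc j)) - f (q j))"
    using sum_lessThan_telescope[of "\<lambda>j. f (q j)" n] by (simp add: q0 qn)
  also have "cmod \<dots> \<le> (\<Sum>j<n. K * cmod (w j - z j))" by (intro order.trans[OF norm_sum] sum_mono step) auto
  finally show ?thesis by (simp add: sum_distrib_left)
qed

text \<open>With \<open>c\<close> the gradient at a point, this makes the differential vanish
  there.\<close>

lemma sep_hol_diff_linear:
  assumes "sep_hol n S f"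
  shows "sep_hol n S (\<lambda>w. f w - (\<Sum>i<n. c i * w i))"
    and "z \<in> S \<Longrightarrow> j < n \<Longrightarrow> pd j (\<lambda>w. f w - (\<Sum>i<n. c i * w i)) z = pd j f z - c j"
proof -
  have der: "((\<lambda>\<zeta>. f (z(j := \<zeta>)) - (\<Sum>i<n. c i * (z(j := \<zeta>)) i)) has_field_derivative pd j f z - c j) (at (z j))"
    if "z \<in> S" "j < n" for z j
  proof -
    have "((\<lambda>\<zeta>. \<Sum>i<n. c i * (z(j := \<zeta>)) i) has_field_derivative (\<Sum>i<n. if i = j then c j else 0)) (at (z j))"
    proof (rule DERIV_sum)
      show "((\<lambda>\<zeta>. c i * (z(j := \<zeta>)) i) has_field_derivative (if i = j then c j else 0)) (at (z j))" for i
        by (cases "i = j") (auto intro!: derivative_eq_intros)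
    qed
    then show ?thesis using that DERIV_diff[OF sep_hol_pd[OF assms that(2,1)]] by fastforce
  qed
  show "sep_hol n S (\<lambda>w. f w - (\<Sum>i<n. c i * w i))"
    unfolding sep_hol_def
  proof (intro conjI ballI allI impI)
    show "continuous_on S (\<lambda>w. f w - (\<Sum>i<n. c i * w i))"
      using assms by (intro continuous_intros) (auto simp: sep_hol_def)
    show "(\<lambda>\<zeta>. f (z(j := \<zeta>)) - (\<Sum>i<n. c i * (z(j := \<zeta>)) i)) field_differentiable at (z j)"
      if "z \<in> S" "j < n" for z j using der[OF that] field_differentiable_def by blast
  qed
  show "pd j (\<lambda>w. f w - (\<Sum>i<n. c i * w i)) z = pd j f z - c j" if "z \<in> S" "j < n"
    unfolding pd_def[of j "\<lambda>w. f w - (\<Sum>i<n. c i * w i)"] using der[OF that] by (rule DERIV_imp_deriv)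
qed

text \<open>After subtraction of the linear part the partial derivatives vanish at \<open>z\<close>
  and, being continuous, are at most \<open>e\<close> on a polydisc; \<open>lipschitz_pdisc\<close>
  then bounds the remainder.\<close>

theorem osgood:
  assumes S: "open_cs n S" and f: "sep_hol n S f" and z: "z \<in> S"
  shows "has_cderiv n f (\<lambda>i. pd i f z) z"
  unfolding has_cderiv_def
proof (intro allI impI)
  fix e :: real assume e: "e > 0"
  let ?g = "\<lambda>w. f w - (\<Sum>i<n. pd i f z * w i)"
  have zc: "z \<in> complex_space n" using S z open_cs_subset by blast
  have "\<forall>j. \<exists>r. r > 0 \<and> pdisc n z r \<subseteq> S \<and> (j < n \<longrightarrow> (\<forall>w\<in>pdisc n z r. cmod (pd j f w - pd j f z) < e))"
  proof
    fix j show "\<exists>r. r > 0 \<and> pdisc n z r \<subseteq> S \<and> (j < n \<longrightarrow> (\<forall>w\<in>pdisc n z r. cmod (pd j f w - pd j f z) < e))"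
    proof (cases "j < n")
      case True
      then show ?thesis using continuous_on_pdisc[OF S sep_hol_pd_continuous[OF S f True] z e] by metis
    qed (use S z open_cs_pdiscE in metis)
  qed
  from choice[OF this] obtain r where r: "\<And>j. r j > 0" "\<And>j. pdisc n z (r j) \<subseteq> S"
    "\<And>j w. j < n \<Longrightarrow> w \<in> pdisc n z (r j) \<Longrightarrow> cmod (pd j f w - pd j f z) < e" by blast
  \<comment> \<open>\<open>r n\<close> makes the set nonempty also for \<open>n = 0\<close> and
    ensures that the polydisc lies in \<open>S\<close>.\<close>
  let ?r = "Min (insert (r n) (r ` {..<n}))"
  have rr: "?r > 0" using r by (simp add: Min_gr_iff)
  have rr2: "\<And>j. j \<le> n \<Longrightarrow> ?r \<le> r j" by (rule Min_le) (auto simp: le_less)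
  have sub: "pdisc n z ?r \<subseteq> S" using rr2[of n] r(2)[of n] pdisc_mono[of ?r "r n" n z] by auto
  show "\<exists>r>0. \<forall>w\<in>pdisc n z r. cmod (f w - f z - (\<Sum>i<n. pd i f z * (w i - z i))) \<le> e * (\<Sum>i<n. cmod (w i - z i))"
  proof (intro exI conjI ballI)
    fix w assume w: "w \<in> pdisc n z ?r"
    have "cmod (?g w - ?g z) \<le> e * (\<Sum>j<n. cmod (w j - z j))"
    proof (rule lipschitz_pdisc[OF sep_hol_diff_linear(1)[OF f] sub zc])
      fix w j assume wj: "w \<in> pdisc n z ?r" "j < n"
      then have "w \<in> pdisc n z (r j)" using rr2[of j] pdisc_mono[of ?r "r j" n z] by auto
      then show "cmod (pd j ?g w) \<le> e"
        using r(3)[OF wj(2)] sep_hol_diff_linear(2)[OF f _ wj(2)] wj sub by (simp add: less_imp_le subset_iff)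
    qed (use w rr zc in \<open>auto intro: pdisc_centre\<close>)
    also have "?g w - ?g z = f w - f z - (\<Sum>i<n. pd i f z * (w i - z i))"
      by (simp add: right_diff_distrib sum_subtractf)
    finally show "cmod (f w - f z - (\<Sum>i<n. pd i f z * (w i - z i))) \<le> e * (\<Sum>i<n. cmod (w i - z i))" .
  qed (rule rr)
qed

lemma holomorphic_fun_iff_sep_hol:
  assumes S: "open_cs n S"
  shows "holomorphic_fun n S f \<longleftrightarrow> sep_hol n S f"
proof
  assume "sep_hol n S f"
  then show "holomorphic_fun n S f" using osgood[OF S] holomorphic_fun_iff[OF S] by blast
next
  assume "holomorphic_fun n S f"
  then have f: "\<exists>c. has_cderiv n f c z" if "z \<in> S" for z using holomorphic_fun_iff[OF S] that by blast
  show "sep_hol n S f" unfolding sep_hol_def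
  proof (intro conjI ballI allI impI)
    show "continuous_on S f" unfolding continuous_on_def
    proof
      fix z assume z: "z \<in> S"
      then have zc: "z \<in> complex_space n" using S open_cs_subset by blast
      obtain c where c: "has_cderiv n f c z" using f z by blast
      show "(f \<longlongrightarrow> f z) (at z within S)"
        unfolding open_cs_eventually(2)[OF S z]
      proof (rule tendstoI)
        fix e :: real assume "e > 0"
        then show "eventually (\<lambda>w. dist (f w) (f z) < e) (at z within complex_space n)"
          unfolding eventually_cs[OF zc] using has_cderiv_continuous[OF c zc] by (simp add: dist_norm) meson
      qed
    qed
    show "(\<lambda>\<zeta>. f (z(i := \<zeta>))) field_differentiable at (z i)" if "z \<in> S" "i < n" for z i
      using f[OF that(1)] has_cderiv_partial[OF _ open_cs_subset[OF S that(1)] that(2)]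
      unfolding field_differentiable_def by blast
  qed
qed

lemma has_cderiv_pd:
  "has_cderiv n f c z \<Longrightarrow> z \<in> complex_space n \<Longrightarrow> i < n \<Longrightarrow> pd i f z = c i"
  unfolding pd_def by (intro DERIV_imp_deriv has_cderiv_partial)

lemma sep_hol_iff_cderiv:
  "open_cs n S \<Longrightarrow> sep_hol n S f \<longleftrightarrow> (\<forall>z\<in>S. \<exists>c. has_cderiv n f c z)"
  using holomorphic_fun_iff holomorphic_fun_iff_sep_hol by blast

text \<open>Separate holomorphy is not visibly stable under composition. Osgood's lemma turns it
  into differentiability, for which the chain rule holds.\<close>

lemma sep_hol_compose:
  assumes S: "open_cs n S" and T: "open_cs m T" and f: "sep_hol m T f"
    and g: "\<And>j. j < m \<Longrightarrow> sep_hol n S (\<lambda>w. g w j)" and im: "g ` S \<subseteq> T"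
  shows "sep_hol n S (\<lambda>w. f (g w))"
    and "z \<in> S \<Longrightarrow> i < n \<Longrightarrow> pd i (\<lambda>w. f (g w)) z = (\<Sum>j<m. pd j f (g z) * pd i (\<lambda>w. g w j) z)"
proof -
  have imc: "g ` S \<subseteq> complex_space m" using im open_cs_subset[OF T] by auto
  have *: "has_cderiv n (\<lambda>w. f (g w)) (\<lambda>i. \<Sum>j<m. pd j f (g z) * pd i (\<lambda>w. g w j) z) z" if z: "z \<in> S" for z
    by (rule has_cderiv_compose[OF osgood[OF T f] osgood[OF S g] _ S z imc])
      (use im z open_cs_subset[OF S] in auto)
  then show "sep_hol n S (\<lambda>w. f (g w))" using sep_hol_iff_cderiv[OF S] by blast
  show "pd i (\<lambda>w. f (g w)) z = (\<Sum>j<m. pd j f (g z) * pd i (\<lambda>w. g w j) z)" if "z \<in> S" "i < n"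
    using has_cderiv_pd[OF * _ that(2)] that open_cs_subset[OF S] by blast
qed

lemma sep_hol_local:
  assumes S: "open_cs n S" and "\<And>z. z \<in> S \<Longrightarrow> \<exists>T. open_cs n T \<and> z \<in> T \<and> sep_hol n T f"
  shows "sep_hol n S f"
  unfolding sep_hol_iff_cderiv[OF S] using assms(2) sep_hol_iff_cderiv by blast

lemma sep_hol_cong:
  assumes S: "open_cs n S" and "sep_hol n S f" "\<And>w. w \<in> S \<Longrightarrow> f w = g w"
  shows "sep_hol n S g"
  using assms(2) has_cderiv_cong[where f = f and g = g, OF _ S _ assms(3)]
  unfolding sep_hol_iff_cderiv[OF S] by blast

lemma sep_hol_coord: "sep_hol n S (\<lambda>w. w j)" 
  unfolding sep_hol_def
proof (intro conjI ballI allI impI)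
  show "(\<lambda>\<zeta>. (z(i := \<zeta>)) j) field_differentiable at (z i)" for z :: "nat \<Rightarrow> complex" and i
    by (cases "i = j") (auto intro: field_differentiable_ident field_differentiable_const)
qed (intro continuous_intros)

lemma sep_hol_const: "sep_hol n S (\<lambda>w. a)"
  unfolding sep_hol_def by (auto intro!: continuous_intros field_differentiable_const)

lemma sep_hol_add: "sep_hol n S f \<Longrightarrow> sep_hol n S g \<Longrightarrow> sep_hol n S (\<lambda>w. f w + g w)"
  unfolding sep_hol_def by (auto intro!: continuous_intros field_differentiable_add)

lemma sep_hol_mult: "sep_hol n S f \<Longrightarrow> sep_hol n S g \<Longrightarrow> sep_hol n S (\<lambda>w. f w * g w)"
  unfolding sep_hol_def by (auto intro!: continuous_intros field_differentiable_mult)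

lemma sep_hol_power: "sep_hol n S f \<Longrightarrow> sep_hol n S (\<lambda>w. f w ^ k)"
  by (induction k) (auto intro: sep_hol_const sep_hol_mult)

lemma sep_hol_sum: "(\<And>i. i \<in> I \<Longrightarrow> sep_hol n S (f i)) \<Longrightarrow> sep_hol n S (\<lambda>w. \<Sum>i\<in>I. f i w)"
  by (induction I rule: infinite_finite_induct) (auto intro: sep_hol_const sep_hol_add)

lemma sep_hol_diff: "sep_hol n S f \<Longrightarrow> sep_hol n S g \<Longrightarrow> sep_hol n S (\<lambda>w. f w - g w)"
  unfolding sep_hol_def by (auto intro!: continuous_intros field_differentiable_diff)

text \<open>A partial derivative is locally a Cauchy integral of \<open>f\<close> over a circle,
  hence an integral of holomorphic functions of the centre.\<close>

lemma sep_hol_pd_hol: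
  assumes S: "open_cs n S" and f: "sep_hol n S f" and i: "i < n"
  shows "sep_hol n S (pd i f)"
proof (rule sep_hol_local[OF S])
  fix z assume z: "z \<in> S"
  obtain r where r: "r > 0" "pdisc n z r \<subseteq> S" using S z open_cs_pdiscE by blast
  define \<rho> where "\<rho> = r / 2"
  have \<rho>: "\<rho> > 0" using r by (simp add: \<rho>_def)
  let ?T = "pdisc n z \<rho>"
  have sub: "x(i := x i + of_real \<rho> * u) \<in> S" if "x \<in> ?T" "cmod u \<le> 1" for x u
  proof -
    have "cmod (x i + of_real \<rho> * u - z i) \<le> cmod (x i - z i) + cmod (of_real \<rho> * u)"
      by (metis add_diff_eq diff_add_eq norm_triangle_ineq)
    also have "\<dots> < \<rho> + \<rho>" using that i \<rho> by (intro add_less_le_mono) (auto simp: pdisc_def norm_mult)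
    finally have "cmod (x i + of_real \<rho> * u - z i) < r" by (simp add: \<rho>_def)
    then have "x(i := x i + of_real \<rho> * u) \<in> pdisc n z r"
      using that i r by (fastforce simp: pdisc_def \<rho>_def)
    then show ?thesis using r by auto
  qed
  define H where "H = (\<lambda>x s. f (x(i := x i + of_real \<rho> * ucirc s)) * (1 / (of_real \<rho> * ucirc s)))"
  have eq: "integral {0..1} (H x) = pd i f x" if x: "x \<in> ?T" for x
  proof -
    have cb: "cball (x i) \<rho> \<subseteq> {\<zeta>. x(i := \<zeta>) \<in> S}"
    proof
      fix \<zeta> assume "\<zeta> \<in> cball (x i) \<rho>"
      then have "cmod ((\<zeta> - x i) / of_real \<rho>) \<le> 1" using \<rho> by (simp add: norm_divide dist_norm norm_minus_commute)
      from sub[OF x this] show "\<zeta> \<in> {\<zeta>. x(i := \<zeta>) \<in> S}" using \<rho> by simp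
    qed
    have "(\<lambda>\<zeta>. f (x(i := \<zeta>))) holomorphic_on {\<zeta>. x(i := \<zeta>) \<in> S}"
      by (rule sep_hol_slice[OF f i]) auto
    from cauchy_coeff[OF this cb \<rho>, of 1] show ?thesis
      by (simp add: pd_def has_integral_iff H_def)
  qed
  have cf: "continuous_on S f" using f by (simp add: sep_hol_def)
  have "sep_hol n ?T (\<lambda>x. integral {0..1} (H x))"
  proof (rule sep_hol_integral(1)[OF open_cs_pdisc])
    have "continuous_on (?T \<times> {0..1}) (\<lambda>w. f ((fst w)(i := fst w i + of_real \<rho> * ucirc (snd w))))"
    proof (rule continuous_on_compose2[OF cf])
      show "continuous_on (?T \<times> {0..1}) (\<lambda>w. (fst w)(i := fst w i + of_real \<rho> * ucirc (snd w)))"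
        by (intro continuous_intros continuous_on_product_then_coordinatewise[of _ "\<lambda>w. fst w"])
      show "(\<lambda>w. (fst w)(i := fst w i + of_real \<rho> * ucirc (snd w))) ` (?T \<times> {0..1}) \<subseteq> S"
        using sub[OF _ eq_refl[OF norm_ucirc(1)]] by auto
    qed
    then show "continuous_on (?T \<times> {0..1}) (\<lambda>(x, t). H x t)"
      unfolding H_def case_prod_beta using \<rho> by (intro continuous_intros) auto
    fix t :: real
    have "sep_hol n ?T (\<lambda>x. f (x(i := x i + of_real \<rho> * ucirc t)))"
    proof (rule sep_hol_compose(1)[OF open_cs_pdisc S f])
      show "sep_hol n ?T (\<lambda>w. (w(i := w i + of_real \<rho> * ucirc t)) j)" for j
        using sep_hol_add[OF sep_hol_coord sep_hol_const] sep_hol_coord by (cases "j = i") simp_all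
      show "(\<lambda>x. x(i := x i + of_real \<rho> * ucirc t)) ` ?T \<subseteq> S"
        using sub[OF _ eq_refl[OF norm_ucirc(1)]] by blast
    qed
    then show "sep_hol n ?T (\<lambda>x. H x t)" unfolding H_def by (rule sep_hol_mult[OF _ sep_hol_const])
  qed
  then have "sep_hol n ?T (pd i f)" by (rule sep_hol_cong[OF open_cs_pdisc]) (rule eq)
  then show "\<exists>T. open_cs n T \<and> z \<in> T \<and> sep_hol n T (pd i f)"
    using pdisc_centre[OF open_cs_subset[OF S z] \<rho>] by (intro exI[of _ ?T] conjI open_cs_pdisc)
qed

text \<open>The \<open>k\<close>-th Taylor coefficient of \<open>F\<close> at 0 in variable number
  \<open>n\<close>, over a point \<open>x\<close> with \<open>n\<close> coordinates. The integral
  over the unit circle is taken as definition because holomorphic dependence on \<open>x\<close> can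
  be read off from it.\<close>

definition fcoef :: "nat \<Rightarrow> ((nat \<Rightarrow> complex) \<Rightarrow> complex) \<Rightarrow> nat \<Rightarrow> (nat \<Rightarrow> complex) \<Rightarrow> complex" where
  "fcoef n F k x = integral {0..1} (\<lambda>t. F (x(n := ucirc t)) * (1 / ucirc t ^ k))"

context
  fixes n S F U
  assumes S: "open_cs (Suc n) S" and F: "sep_hol (Suc n) S F" and U: "open_cs n U"
    and US: "\<And>x \<zeta>. x \<in> U \<Longrightarrow> cmod \<zeta> \<le> 1 \<Longrightarrow> x(n := \<zeta>) \<in> S"
begin

text \<open>The closed unit disc is compact and lies in the open slice, so a larger disc does too.
  Hence the Taylor series converges on the closed disc, in particular at 1, where it will be
  evaluated.\<close>

lemma fcoef_slice:
  assumes "x \<in> U"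
  obtains R where "R > 1" "(\<lambda>\<zeta>. F (x(n := \<zeta>))) holomorphic_on ball 0 R"
proof -
  have xc: "x \<in> complex_space (Suc n)" using open_cs_subset[OF U assms] complex_space_mono[of n "Suc n"] by auto
  let ?X = "{\<zeta>. x(n := \<zeta>) \<in> S}"
  have o: "open ?X" by (rule open_slice[OF S _ xc]) simp
  have "cball 0 1 \<subseteq> ?X" using US[OF assms] by auto
  from compact_in_open_separated[OF _ compact_cball o this]
  obtain e where e: "e > 0" "{x. infdist x (cball 0 1) \<le> e} \<subseteq> ?X" by auto
  have "ball 0 (1 + e) \<subseteq> ?X"
  proof
    fix \<zeta> :: complex assume "\<zeta> \<in> ball 0 (1 + e)"
    then have l: "cmod \<zeta> < 1 + e" by simp
    show "\<zeta> \<in> ?X"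
    proof (cases "cmod \<zeta> \<le> 1")
      case False
      \<comment> \<open>The radial projection shows that the distance of \<zeta> from the closed
        unit disc is at most \<open>cmod \<zeta> - 1\<close>.\<close>
      have "\<zeta> / cmod \<zeta> \<in> cball 0 1" by (simp add: norm_divide)
      from infdist_le[OF this, of \<zeta>] have "infdist \<zeta> (cball 0 1) \<le> dist \<zeta> (\<zeta> / cmod \<zeta>)" .
      also have "\<dots> = cmod (\<zeta> * complex_of_real (1 - 1 / cmod \<zeta>))" by (simp add: dist_norm algebra_simps)
      also have "\<dots> = cmod \<zeta> * (1 - 1 / cmod \<zeta>)"
      proof -
        have "1 / cmod \<zeta> \<le> 1" using False by (auto simp: divide_le_eq_1)
        then show ?thesis unfolding norm_mult norm_of_real by simp
      qed
      also have "\<dots> \<le> e" using l False by (simp add: right_diff_distrib)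
      finally show ?thesis using e by auto
    qed (use US[OF assms] in auto)
  qed
  then show ?thesis using e sep_hol_slice[OF F, of n "ball 0 (1 + e)" x] that[of "1 + e"] by auto
qed

lemma fcoef_eq_deriv: "x \<in> U \<Longrightarrow> fcoef n F k x = (deriv ^^ k) (\<lambda>\<zeta>. F (x(n := \<zeta>))) 0 / fact k"
proof -
  assume "x \<in> U"
  then obtain R where R: "R > 1" "(\<lambda>\<zeta>. F (x(n := \<zeta>))) holomorphic_on ball 0 R" by (rule fcoef_slice)
  have "cball (0::complex) 1 \<subseteq> ball 0 R" using R by auto
  from cauchy_coeff[OF R(2) this, of k] show ?thesis by (simp add: fcoef_def has_integral_iff)
qed

lemma fcoef_sums:
  assumes "x \<in> U" "cmod \<zeta> \<le> 1"
  shows "(\<lambda>k. fcoef n F k x * \<zeta> ^ k) sums F (x(n := \<zeta>))"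
proof -
  obtain R where R: "R > 1" "(\<lambda>\<zeta>. F (x(n := \<zeta>))) holomorphic_on ball 0 R" using assms fcoef_slice by metis
  have "\<zeta> \<in> ball 0 R" using assms R by auto
  from holomorphic_power_series[OF R(2) this] show ?thesis by (simp add: fcoef_eq_deriv[OF assms(1)])
qed

lemma
  shows sep_hol_fcoef: "sep_hol n U (fcoef n F k)"
    and pd_fcoef: "x \<in> U \<Longrightarrow> i < n \<Longrightarrow> pd i (fcoef n F k) x = fcoef n (pd i F) k x"
proof -
  have cF: "continuous_on S F" using F by (simp add: sep_hol_def)
  define H where "H = (\<lambda>x t. F (x(n := ucirc t)) * (1 / ucirc t ^ k))"
  have c: "continuous_on (U \<times> {0..1}) (\<lambda>(x, t). H x t)"
  proof -
    have "continuous_on (U \<times> {0..1}) (\<lambda>w. F ((fst w)(n := ucirc (snd w))))"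
    proof (rule continuous_on_compose2[OF cF])
      show "continuous_on (U \<times> {0..1}) (\<lambda>w. (fst w)(n := ucirc (snd w)))" by (intro continuous_intros)
      show "(\<lambda>w. (fst w)(n := ucirc (snd w))) ` (U \<times> {0..1}) \<subseteq> S" using US[OF _ eq_refl[OF norm_ucirc(1)]] by auto
    qed
    then show ?thesis unfolding H_def case_prod_beta by (intro continuous_intros) auto
  qed
  have s: "sep_hol n U (\<lambda>x. F (x(n := ucirc t)))" for t
  proof (rule sep_hol_compose(1)[OF U S F])
    show "sep_hol n U (\<lambda>w. (w(n := ucirc t)) j)" for j
      by (cases "j = n") (auto intro: sep_hol_coord sep_hol_const)
    show "(\<lambda>x. x(n := ucirc t)) ` U \<subseteq> S" using US[OF _ eq_refl[OF norm_ucirc(1)]] by auto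
  qed
  have h: "sep_hol n U (\<lambda>x. H x t)" for t unfolding H_def by (intro sep_hol_mult sep_hol_const s)
  have f: "fcoef n F k = (\<lambda>x. integral {0..1} (H x))" by (simp add: fcoef_def H_def fun_eq_iff)
  show "sep_hol n U (fcoef n F k)" unfolding f by (rule sep_hol_integral(1)[OF U c h])
  assume x: "x \<in> U" and i: "i < n"
  have "pd i (\<lambda>x. H x t) x = pd i F (x(n := ucirc t)) * (1 / ucirc t ^ k)" for t
  proof -
    have "(\<lambda>\<zeta>. H (x(i := \<zeta>)) t) = (\<lambda>\<zeta>. F ((x(n := ucirc t))(i := \<zeta>)) * (1 / ucirc t ^ k))"
      using i by (simp add: H_def fun_upd_twist)
    moreover have "(\<lambda>\<zeta>. F ((x(n := ucirc t))(i := \<zeta>))) field_differentiable at ((x(n := ucirc t)) i)"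
      using F[unfolded sep_hol_def, THEN conjunct2, rule_format, OF US[OF x eq_refl[OF norm_ucirc(1)]], of i] i
      by simp
    ultimately show ?thesis unfolding pd_def using i by (simp add: deriv_cmult_right deriv_cdivide_right power2_eq_square)
  qed
  then show "pd i (fcoef n F k) x = fcoef n (pd i F) k x"
    unfolding f sep_hol_integral(2)[OF U c h x i] fcoef_def by simp
qed

end

section \<open>The inverse function theorem\<close>

text \<open>The distance used in \<open>holomorphic_fun\<close>, in which
  \<open>lipschitz_pdisc\<close> is already stated.\<close>

definition l1_dist :: "nat \<Rightarrow> (nat \<Rightarrow> complex) \<Rightarrow> (nat \<Rightarrow> complex) \<Rightarrow> real" where
  "l1_dist n x y = (\<Sum>i<n. cmod (x i - y i))"

lemma l1_dist_ge: "i < n \<Longrightarrow> cmod (x i - y i) \<le> l1_dist n x y"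
  unfolding l1_dist_def by (rule member_le_sum) auto

lemma l1_dist_nonneg: "0 \<le> l1_dist n x y" unfolding l1_dist_def by (intro sum_nonneg) auto

lemma pdisc_finite:
  assumes "finite I" "\<And>i. i \<in> I \<Longrightarrow> \<exists>r>0. \<forall>w\<in>pdisc n z r. P i w"
  shows "\<exists>r>0. \<forall>w\<in>pdisc n z r. \<forall>i\<in>I. P i w"
  using assms
proof (induction I)
  case (insert i I)
  obtain r where r: "r > 0" "\<forall>w\<in>pdisc n z r. P i w" using insert.prems[of i] by auto
  obtain s where s: "s > 0" "\<forall>w\<in>pdisc n z s. \<forall>i\<in>I. P i w" using insert.IH insert.prems by auto
  have "pdisc n z (min r s) \<subseteq> pdisc n z r" "pdisc n z (min r s) \<subseteq> pdisc n z s" by (auto intro!: pdisc_mono)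
  then show ?case using r s by (intro exI[of _ "min r s"]) auto
qed (auto intro: exI[of _ 1])

text \<open>Weierstrass's convergence theorem, applied on a closed disc in each slice.\<close>

lemma sep_hol_uniform_limit:
  assumes W: "open_cs n W" and g: "\<And>k. sep_hol n W (g k)" and lim: "uniform_limit W g h sequentially"
  shows "sep_hol n W h"
  unfolding sep_hol_def
proof (intro conjI ballI allI impI)
  show "continuous_on W h"
    by (rule uniform_limit_theorem[OF _ lim]) (use g in \<open>auto simp: sep_hol_def\<close>)
  fix z i assume z: "z \<in> W" and i: "i < n"
  have "open {\<zeta>. z(i := \<zeta>) \<in> W}" "z i \<in> {\<zeta>. z(i := \<zeta>) \<in> W}"
    using open_slice[OF W i] open_cs_subset[OF W] z by auto
  then obtain r where r: "r > 0" "cball (z i) r \<subseteq> {\<zeta>. z(i := \<zeta>) \<in> W}" using open_contains_cball by blast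
  have hol: "(\<lambda>\<zeta>. g k (z(i := \<zeta>))) holomorphic_on cball (z i) r" for k
    by (rule sep_hol_slice[OF g i r(2)])
  have ul: "uniform_limit (cball (z i) r) (\<lambda>k \<zeta>. g k (z(i := \<zeta>))) (\<lambda>\<zeta>. h (z(i := \<zeta>))) sequentially"
    unfolding uniform_limit_iff
  proof (intro allI impI)
    fix e :: real assume "e > 0"
    with lim have "\<forall>\<^sub>F k in sequentially. \<forall>x\<in>W. dist (g k x) (h x) < e" by (auto simp: uniform_limit_iff)
    then show "\<forall>\<^sub>F k in sequentially. \<forall>x\<in>cball (z i) r. dist (g k (z(i := x))) (h (z(i := x))) < e"
      by eventually_elim (use r in auto)
  qed
  have ev: "\<forall>\<^sub>F k in sequentially. continuous_on (cball (z i) r) (\<lambda>\<zeta>. g k (z(i := \<zeta>))) \<and>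
      (\<lambda>\<zeta>. g k (z(i := \<zeta>))) holomorphic_on ball (z i) r"
    using hol holomorphic_on_imp_continuous_on holomorphic_on_subset[OF hol ball_subset_cball] by simp
  have "(\<lambda>\<zeta>. h (z(i := \<zeta>))) holomorphic_on ball (z i) r"
    using holomorphic_uniform_limit[OF ev ul] by auto
  then show "(\<lambda>\<zeta>. h (z(i := \<zeta>))) field_differentiable at (z i)"
    using r(1) by (metis centre_in_ball holomorphic_on_imp_differentiable_at open_ball)
qed

lemma openin_less:
  assumes "continuous_on S (g :: _ \<Rightarrow> real)" shows "openin (top_of_set S) {x\<in>S. g x < c}"
proof -
  have "{x\<in>S. g x < c} = S \<inter> g -` {..<c}" by auto
  then show ?thesis using continuous_openin_preimage_gen[OF assms, of "{..<c}"] by simp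
qed

text \<open>Near \<open>p\<close> the difference \<open>e\<close> of \<open>f\<close> and the
  identity is a contraction, so \<open>f x = y\<close> is solved by iterating
  \<open>x \<mapsto> y - e x\<close> from \<open>p\<close>. The iterates are holomorphic in
  \<open>y\<close> and converge uniformly, so holomorphy of the inverse comes from the limit theorem
  and not from differentiating the inverse.\<close>

lemma inverse_function_near_id:
  assumes S: "open_cs n S" and p: "p \<in> S" and f: "\<And>i. i < n \<Longrightarrow> sep_hol n S (\<lambda>x. f x i)"
    and fS: "f ` S \<subseteq> complex_space n"
    and D: "\<And>i j. i < n \<Longrightarrow> j < n \<Longrightarrow> pd j (\<lambda>x. f x i) p = (if i = j then 1 else 0)"
  obtains U G where "open_cs n U" "p \<in> U" "U \<subseteq> S" "open_cs n (f ` U)"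
    "\<And>j. sep_hol n (f ` U) (\<lambda>y. G y j)" "\<And>x. x \<in> U \<Longrightarrow> G (f x) = x"
proof -
  have pc: "p \<in> complex_space n" using open_cs_subset[OF S p] .
  define e where "e i x = f x i - x i" for i x
  \<comment> \<open>If each component of \<open>e\<close> has Lipschitz constant \<open>K\<close>,
    then \<open>e\<close> as a whole has constant \<open>n * K \<le> 1/2\<close> in the sum
    distance.\<close>
  define K where "K = 1 / (2 * (real n + 1))"
  have K: "K > 0" "n * K \<le> 1/2" by (auto simp: K_def field_simps)
  have eh: "sep_hol n S (e i)" if "i < n" for i
    unfolding e_def by (intro sep_hol_diff f that sep_hol_coord)
  have ed: "pd j (e i) p = 0" if ij: "i < n" "j < n" for i j
  proof -
    have "e i = (\<lambda>x. f x i - (\<Sum>k<n. (if k = i then 1 else 0) * x k))"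
      using ij by (simp add: e_def fun_eq_iff if_distrib[of "\<lambda>x. x * _"] cong: if_cong)
    then show ?thesis using sep_hol_diff_linear(2)[OF f[OF ij(1)] p ij(2)] D[OF ij] by auto
  qed
  have "\<exists>r>0. \<forall>w\<in>pdisc n p r. w \<in> S \<and> cmod (pd (snd q) (e (fst q)) w) \<le> K" if q: "q \<in> {..<n} \<times> {..<n}" for q
  proof -
    have ij: "fst q < n" "snd q < n" using q by auto
    show ?thesis
      using continuous_on_pdisc[OF S sep_hol_pd_continuous[OF S eh[OF ij(1)] ij(2)] p K(1)] ed[OF ij]
      by (metis diff_zero less_imp_le subsetD)
  qed
  then have "\<exists>r>0. \<forall>w\<in>pdisc n p r. \<forall>q\<in>{..<n} \<times> {..<n}. w \<in> S \<and> cmod (pd (snd q) (e (fst q)) w) \<le> K"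
    by (intro pdisc_finite) auto
  then obtain r1 where r1: "r1 > 0" "\<And>w q. w \<in> pdisc n p r1 \<Longrightarrow> q \<in> {..<n} \<times> {..<n} \<Longrightarrow>
      w \<in> S \<and> cmod (pd (snd q) (e (fst q)) w) \<le> K"
    by blast
  obtain r2 where r2: "r2 > 0" "pdisc n p r2 \<subseteq> S" using S p open_cs_pdiscE by blast
  define r where "r = min r1 r2"
  have r: "r > 0" "pdisc n p r \<subseteq> S" "\<And>w i j. w \<in> pdisc n p r \<Longrightarrow> i < n \<Longrightarrow> j < n \<Longrightarrow> cmod (pd j (e i) w) \<le> K"
  proof -
    show "r > 0" using r1 r2 by (simp add: r_def)
    show "pdisc n p r \<subseteq> S" using r2 pdisc_mono[of r r2 n p] by (auto simp: r_def)
    fix w i j assume "w \<in> pdisc n p r" "i < n" "j < n"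
    then show "cmod (pd j (e i) w) \<le> K" using r1(2)[of w "(i,j)"] pdisc_mono[of r r1 n p] by (auto simp: r_def)
  qed
  have lip1: "cmod (e i x - e i x') \<le> K * l1_dist n x x'" if "x \<in> pdisc n p r" "x' \<in> pdisc n p r" "i < n" for i x x'
    unfolding l1_dist_def by (rule lipschitz_pdisc[OF eh r(2) pc r(3)]) (use that in auto)
  have lip: "(\<Sum>i<n. cmod (e i x - e i x')) \<le> l1_dist n x x' / 2" if "x \<in> pdisc n p r" "x' \<in> pdisc n p r" for x x'
  proof -
    have "(\<Sum>i<n. cmod (e i x - e i x')) \<le> (\<Sum>i<n. K * l1_dist n x x')" by (intro sum_mono lip1 that) auto
    also have "\<dots> = (n * K) * l1_dist n x x'" by simp
    also have "\<dots> \<le> 1/2 * l1_dist n x x'" by (intro mult_right_mono K l1_dist_nonneg)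
    finally show ?thesis by simp
  qed
  define B where "B = {x \<in> complex_space n. l1_dist n x p < r}"
  define W where "W = {y \<in> complex_space n. l1_dist n y (f p) < r / 2}"
  have Bo: "open_cs n B" and Wo: "open_cs n W"
    unfolding B_def W_def l1_dist_def by (intro openin_less continuous_intros)+
  have Bp: "B \<subseteq> pdisc n p r" unfolding B_def pdisc_def using le_less_trans[OF l1_dist_ge] by blast
  have BS: "B \<subseteq> S" using Bp r by auto
  have pp: "p \<in> pdisc n p r" using pc r pdisc_centre by auto
  define X where "X k y = ((\<lambda>x i. if i < n then y i - e i x else 0) ^^ k) p" for k y
  have X0: "X 0 y = p" for y by (simp add: X_def)
  have XS: "X (Suc k) y = (\<lambda>i. if i < n then y i - e i (X k y) else 0)" for k y unfolding X_def by simp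
  have Xc: "X k y \<in> complex_space n" for k y
    using pc by (cases k) (auto simp: X0 XS complex_space_def)
  have Xp: "l1_dist n (X k y) p \<le> 2 * l1_dist n y (f p)" if y: "y \<in> W" for k y
  proof (induction k)
    case 0 show ?case by (simp add: X0 l1_dist_def sum_nonneg)
  next
    case (Suc k)
    have "X k y \<in> B" using Suc y Xc by (auto simp: B_def W_def)
    then have Xk: "X k y \<in> pdisc n p r" using Bp by auto
    have "l1_dist n (X (Suc k) y) p = (\<Sum>i<n. cmod ((y i - f p i) - (e i (X k y) - e i p)))"
      unfolding l1_dist_def XS by (intro sum.cong) (auto simp: e_def algebra_simps)
    also have "\<dots> \<le> l1_dist n y (f p) + (\<Sum>i<n. cmod (e i (X k y) - e i p))"
      unfolding l1_dist_def sum.distrib[symmetric] by (intro sum_mono norm_triangle_ineq4)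
    also have "\<dots> \<le> l1_dist n y (f p) + l1_dist n (X k y) p / 2" using lip[OF Xk pp] by simp
    finally show ?case using Suc by simp
  qed
  have XB: "X k y \<in> B" if "y \<in> W" for k y using Xp[OF that, of k] that Xc by (auto simp: B_def W_def)
  have Xd: "l1_dist n (X (Suc k) y) (X k y) \<le> r * (1/2) ^ k" if y: "y \<in> W" for k y
  proof (induction k)
    case 0 show ?case using Xp[OF y, of 1] y by (auto simp: X0 W_def)
  next
    case (Suc k)
    have "l1_dist n (X (Suc (Suc k)) y) (X (Suc k) y) = (\<Sum>i<n. cmod (e i (X (Suc k) y) - e i (X k y)))"
      unfolding l1_dist_def by (intro sum.cong) (simp_all add: XS[of "Suc k"] XS[of k] norm_minus_commute)
    also have "\<dots> \<le> l1_dist n (X (Suc k) y) (X k y) / 2" using XB[OF y] Bp by (intro lip) auto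
    finally show ?case using Suc by simp
  qed
  \<comment> \<open>The limit of the iterates, written as a telescoping series so that the
    Weierstrass M-test gives uniform convergence.\<close>
  define G where "G y = (\<lambda>i. if i < n then p i + (\<Sum>k. X (Suc k) y i - X k y i) else 0)" for y
  have UL: "uniform_limit W (\<lambda>k y. X k y i) (\<lambda>y. G y i) sequentially" if i: "i < n" for i
  proof -
    have "uniform_limit W (\<lambda>k y. \<Sum>l<k. X (Suc l) y i - X l y i) (\<lambda>y. \<Sum>k. X (Suc k) y i - X k y i) sequentially"
    proof (rule Weierstrass_m_test)
      show "norm (X (Suc k) y i - X k y i) \<le> r * (1/2) ^ k" if "y \<in> W" for k y
        using l1_dist_ge[OF i, of "X (Suc k) y" "X k y"] Xd[OF that, of k] by simp
      show "summable (\<lambda>k. r * (1/2) ^ k)" by (intro summable_mult summable_geometric) simp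
    qed
    from uniform_limit_add[OF uniform_limit_const[of "\<lambda>y. p i"] this]
    have "uniform_limit W (\<lambda>k y. p i + (\<Sum>l<k. X (Suc l) y i - X l y i)) (\<lambda>y. G y i) sequentially"
      using i by (simp add: G_def)
    moreover have "p i + (\<Sum>l<k. X (Suc l) y i - X l y i) = X k y i" for k y
      using sum_lessThan_telescope[of "\<lambda>l. X l y i" k] by (simp add: X0)
    ultimately show ?thesis by simp
  qed
  have Xh: "sep_hol n W (\<lambda>y. X k y i)" for k i
  proof (induction k arbitrary: i)
    case 0 show ?case by (simp add: X0 sep_hol_const)
  next
    case (Suc k)
    show ?case
    proof (cases "i < n")
      case True
      have "X k ` W \<subseteq> S" using XB BS by auto
      from sep_hol_compose(1)[OF Wo S eh[OF True] Suc this]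
      show ?thesis using True unfolding XS by (simp add: sep_hol_diff sep_hol_coord)
    qed (simp add: XS sep_hol_const)
  qed
  have Gh: "sep_hol n W (\<lambda>y. G y i)" for i
    using sep_hol_uniform_limit[OF Wo Xh UL] by (cases "i < n") (auto simp: G_def sep_hol_const)
  have lim: "(\<lambda>k. X k y i) \<longlonglongrightarrow> G y i" if "y \<in> W" "i < n" for y i
    using tendsto_uniform_limitI[OF UL[OF that(2)] that(1)] .
  have Gc: "G y \<in> complex_space n" for y by (simp add: G_def complex_space_def)
  have GB: "G y \<in> B" if y: "y \<in> W" for y
  proof -
    have "(\<lambda>k. l1_dist n (X k y) p) \<longlonglongrightarrow> l1_dist n (G y) p"
      unfolding l1_dist_def by (intro tendsto_intros lim y) auto
    then have "l1_dist n (G y) p \<le> 2 * l1_dist n y (f p)"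
      using Xp[OF y] by (intro LIMSEQ_le_const2) auto
    then show ?thesis using y Gc by (auto simp: B_def W_def)
  qed
  have fG: "f (G y) = y" if y: "y \<in> W" for y
  proof (rule complex_space_eqI[of _ n])
    show "f (G y) \<in> complex_space n" using GB[OF y] BS fS by auto
    show "y \<in> complex_space n" using y by (simp add: W_def)
    fix i assume i: "i < n"
    have "(\<lambda>k. l1_dist n (X k y) (G y)) \<longlonglongrightarrow> l1_dist n (G y) (G y)"
      unfolding l1_dist_def by (intro tendsto_intros lim y) auto
    then have "(\<lambda>k. K * l1_dist n (X k y) (G y)) \<longlonglongrightarrow> 0"
      by (intro tendsto_mult_right_zero) (simp add: l1_dist_def)
    then have "(\<lambda>k. e i (X k y) - e i (G y)) \<longlonglongrightarrow> 0"
      by (rule Lim_null_comparison[rotated]) (use lip1[OF _ _ i] XB[OF y] GB[OF y] Bp in \<open>auto intro!: always_eventually\<close>)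
    then have "(\<lambda>k. e i (X k y)) \<longlonglongrightarrow> e i (G y)" by (simp add: LIM_zero_iff)
    then have "(\<lambda>k. y i - e i (X k y)) \<longlonglongrightarrow> y i - e i (G y)" by (intro tendsto_intros)
    moreover have "(\<lambda>k. X (Suc k) y i) \<longlonglongrightarrow> G y i" using lim[OF y i] LIMSEQ_Suc by blast
    then have "(\<lambda>k. y i - e i (X k y)) \<longlonglongrightarrow> G y i" using i by (simp add: XS)
    ultimately have "y i - e i (G y) = G y i" using LIMSEQ_unique by blast
    then show "f (G y) i = y i" by (simp add: e_def algebra_simps)
  qed
  have inj: "x = x'" if x: "x \<in> B" "x' \<in> B" "f x = f x'" for x x'
  proof -
    have "l1_dist n x x' = (\<Sum>i<n. cmod (e i x - e i x'))"
      unfolding l1_dist_def e_def x(3) by (intro sum.cong) (auto simp: norm_minus_commute)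
    also have "\<dots> \<le> l1_dist n x x' / 2" using x Bp by (intro lip) auto
    finally have "l1_dist n x x' = 0" using l1_dist_nonneg[of n x x'] by simp
    then show ?thesis using x(1,2) l1_dist_ge[of _ n x x'] by (intro complex_space_eqI[of _ n]) (auto simp: B_def)
  qed
  \<comment> \<open>Cutting \<open>B\<close> down to the preimage of \<open>W\<close> makes the
    image of \<open>U\<close> exactly \<open>W\<close>.\<close>
  define U where "U = {x \<in> B. l1_dist n (f x) (f p) < r / 2}"
  have fB: "f ` B \<subseteq> complex_space n" using BS fS by auto
  have "continuous_on S (\<lambda>x. f x i)" if "i < n" for i using f[OF that] by (simp add: sep_hol_def)
  then have "continuous_on B (\<lambda>x. l1_dist n (f x) (f p))"
    unfolding l1_dist_def by (intro continuous_intros continuous_on_subset[OF _ BS]) auto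
  then have "openin (top_of_set B) U" unfolding U_def by (rule openin_less)
  then have Uo: "open_cs n U" using Bo openin_trans by blast
  have fU: "f ` U = W"
  proof
    show "f ` U \<subseteq> W" using fB by (auto simp: U_def W_def)
    show "W \<subseteq> f ` U"
    proof
      fix y assume y: "y \<in> W"
      then have "G y \<in> U" using GB fG by (auto simp: U_def W_def)
      then show "y \<in> f ` U" using fG[OF y] by (metis imageI)
    qed
  qed
  show ?thesis
  proof (rule that[of U G])
    show "p \<in> U" using pc r by (simp add: U_def B_def l1_dist_def)
    show "U \<subseteq> S" using BS by (auto simp: U_def)
    fix x assume x: "x \<in> U"
    then have "f x \<in> W" using fU by auto
    then show "G (f x) = x" using inj[OF GB] fG x by (auto simp: U_def)
  qed (use Uo fU Wo Gh in auto)
qed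

text \<open>Composition with the linear map \<open>v\<close> of matrix \<open>V\<close> turns the
  differential at \<open>p\<close> into the identity. The inverse matrix enters as a hypothesis
  because \<open>dual_rows\<close> delivers it together with the rows.\<close>

theorem inverse_function:
  assumes S: "open_cs n S" and p: "p \<in> S" and f: "\<And>i. i < n \<Longrightarrow> sep_hol n S (\<lambda>x. f x i)"
    and fS: "f ` S \<subseteq> complex_space n"
    and L: "\<And>i j. i < n \<Longrightarrow> j < n \<Longrightarrow> (\<Sum>k<n. V i k * pd j (\<lambda>x. f x k) p) = (if i = j then 1 else 0)"
    and R: "\<And>i j. i < n \<Longrightarrow> j < n \<Longrightarrow> (\<Sum>k<n. pd k (\<lambda>x. f x i) p * V k j) = (if i = j then 1 else 0)"
  obtains U G where "open_cs n U" "p \<in> U" "U \<subseteq> S" "open_cs n (f ` U)"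
    "\<And>j. sep_hol n (f ` U) (\<lambda>y. G y j)" "\<And>x. x \<in> U \<Longrightarrow> G (f x) = x"
proof -
  define v where "v y = (\<lambda>i. if i < n then \<Sum>k<n. V i k * y k else 0)" for y :: "nat \<Rightarrow> complex"
  define u where "u y = (\<lambda>i. if i < n then \<Sum>k<n. pd k (\<lambda>x. f x i) p * y k else 0)" for y :: "nat \<Rightarrow> complex"
  have uv: "u (v y) = y" if y: "y \<in> complex_space n" for y
  proof (rule complex_space_eqI[of _ n])
    fix i assume i: "i < n"
    have "u (v y) i = (\<Sum>k<n. \<Sum>l<n. pd k (\<lambda>x. f x i) p * V k l * y l)"
      using i by (simp add: u_def v_def sum_distrib_left mult.assoc)
    also have "\<dots> = (\<Sum>l<n. (\<Sum>k<n. pd k (\<lambda>x. f x i) p * V k l) * y l)"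
      by (subst sum.swap) (simp add: sum_distrib_right)
    also have "\<dots> = (\<Sum>l<n. (if i = l then 1 else 0) * y l)" by (intro sum.cong) (auto simp: R i)
    also have "\<dots> = y i" using i by (simp add: if_distrib[of "\<lambda>x. x * _"] cong: if_cong)
    finally show "u (v y) i = y i" .
  qed (use y in \<open>auto simp: u_def complex_space_def\<close>)
  have vc: "v y \<in> complex_space n" for y by (simp add: v_def complex_space_def)
  have vh: "sep_hol n T (\<lambda>y. v y i)" for T i
    unfolding v_def by (cases "i < n") (auto intro!: sep_hol_sum sep_hol_mult sep_hol_const sep_hol_coord)
  have vd: "pd k (\<lambda>y. v y i) z = V i k" if "i < n" "k < n" "z \<in> complex_space n" for i k z
  proof -
    have *: "open_cs n (complex_space n)" by simp
    have "(\<lambda>y. v y i) = (\<lambda>y. 0 - (\<Sum>k<n. (- V i k) * y k))" using that by (simp add: v_def sum_negf)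
    then show ?thesis using sep_hol_diff_linear(2)[OF sep_hol_const that(3,2), of 0 "\<lambda>k. - V i k"]
      by (simp add: pd_def)
  qed
  have fh: "sep_hol n S (\<lambda>x. v (f x) i)" for i
    by (rule sep_hol_compose(1)[where T = "complex_space n" and m = n, OF S _ vh f]) (use fS in auto)
  have fd: "pd j (\<lambda>x. v (f x) i) p = (if i = j then 1 else 0)" if ij: "i < n" "j < n" for i j
  proof -
    have "pd j (\<lambda>x. v (f x) i) p = (\<Sum>k<n. pd k (\<lambda>y. v y i) (f p) * pd j (\<lambda>x. f x k) p)"
      by (rule sep_hol_compose(2)[where T = "complex_space n" and m = n, OF S _ vh f]) (use fS p ij in auto)
    also have "\<dots> = (\<Sum>k<n. V i k * pd j (\<lambda>x. f x k) p)"
      using fS p by (intro sum.cong) (auto simp: vd ij image_subset_iff)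
    finally show ?thesis using L[OF ij] by simp
  qed
  obtain U G where U: "open_cs n U" "p \<in> U" "U \<subseteq> S" "open_cs n ((\<lambda>x. v (f x)) ` U)"
    "\<And>j. sep_hol n ((\<lambda>x. v (f x)) ` U) (\<lambda>y. G y j)" "\<And>x. x \<in> U \<Longrightarrow> G (v (f x)) = x"
    using inverse_function_near_id[where f = "\<lambda>x. v (f x)", OF S p fh image_subsetI[OF vc] fd] by blast
  let ?W = "(\<lambda>x. v (f x)) ` U"
  have fU: "f ` U = {y \<in> complex_space n. v y \<in> ?W}"
  proof
    show "f ` U \<subseteq> {y \<in> complex_space n. v y \<in> ?W}" using fS U(3) by auto
    show "{y \<in> complex_space n. v y \<in> ?W} \<subseteq> f ` U"
    proof clarify
      fix y x assume y: "y \<in> complex_space n" "v y = v (f x)" "x \<in> U"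
      have "f x \<in> complex_space n" using fS U(3) y(3) by auto
      then have "y = f x" using uv y(1,2) by metis
      then show "y \<in> f ` U" using y(3) by simp
    qed
  qed
  have "continuous_on (complex_space n) v"
    by (rule continuous_on_coordinatewise_then_product) (use vh in \<open>auto simp: sep_hol_def\<close>)
  then have "openin (top_of_set (complex_space n)) (complex_space n \<inter> v -` ?W)"
    using vc U(4) by (intro continuous_openin_preimage[of _ v "complex_space n"]) auto
  moreover have "complex_space n \<inter> v -` ?W = f ` U" unfolding fU by auto
  ultimately have fo: "open_cs n (f ` U)" by simp
  show ?thesis
  proof (rule that[of U "\<lambda>y. G (v y)"])
    show "sep_hol n (f ` U) (\<lambda>y. G (v y) j)" for j
      by (rule sep_hol_compose(1)[OF fo U(4) U(5) vh]) auto
  qed (use U fo in auto)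
qed

text \<open>The hypothesis says that the rows in \<open>R\<close> have no common kernel. Starting
  from the identity matrix, rows are exchanged one after another for rows from \<open>R\<close>,
  while the inverse matrix \<open>V\<close> is updated along with them.\<close>

lemma dual_rows:
  assumes R: "\<And>v. v \<in> complex_space n \<Longrightarrow> v \<noteq> (\<lambda>i. 0) \<Longrightarrow> \<exists>r\<in>R. (\<Sum>i<n. r i * v i) \<noteq> (0::complex)"
  obtains r V where "\<And>i. i < n \<Longrightarrow> r i \<in> R"
    "\<And>i j. i < n \<Longrightarrow> j < n \<Longrightarrow> (\<Sum>k<n. r i k * V k j) = (if i = j then 1 else 0)"
    "\<And>i j. i < n \<Longrightarrow> j < n \<Longrightarrow> (\<Sum>k<n. V i k * r k j) = (if i = j then 1 else 0)"
proof -
  let ?\<delta> = "\<lambda>i j :: nat. if i = j then 1 else 0 :: complex"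
  have "m \<le> n \<Longrightarrow> \<exists>W V. (\<forall>i<m. W i \<in> R) \<and> (\<forall>i<n. \<forall>j<n. (\<Sum>k<n. W i k * V k j) = ?\<delta> i j) \<and>
      (\<forall>i<n. \<forall>j<n. (\<Sum>k<n. V i k * W k j) = ?\<delta> i j)" for m
  proof (induction m)
    case 0
    show ?case by (intro exI[of _ ?\<delta>]) (auto simp: if_distrib[of "\<lambda>x. x * _"] cong: if_cong)
  next
    case (Suc m)
    then obtain W V where "(\<forall>i<m. W i \<in> R) \<and> (\<forall>i<n. \<forall>j<n. (\<Sum>k<n. W i k * V k j) = ?\<delta> i j) \<and>
      (\<forall>i<n. \<forall>j<n. (\<Sum>k<n. V i k * W k j) = ?\<delta> i j)" using Suc_leD by blast
    then have WR: "\<And>i. i < m \<Longrightarrow> W i \<in> R"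
      and WV: "\<And>i j. i < n \<Longrightarrow> j < n \<Longrightarrow> (\<Sum>k<n. W i k * V k j) = ?\<delta> i j"
      and VW: "\<And>i j. i < n \<Longrightarrow> j < n \<Longrightarrow> (\<Sum>k<n. V i k * W k j) = ?\<delta> i j" by auto
    have m: "m < n" using Suc.prems by simp
    \<comment> \<open>Column \<open>m\<close> of the inverse. A row that pairs nontrivially with it
      has a nonzero component along \<open>W m\<close> and can replace that row.\<close>
    let ?v = "\<lambda>k. if k < n then V k m else 0"
    have "?v \<noteq> (\<lambda>i. 0)"
    proof
      assume v: "?v = (\<lambda>i. 0)"
      have "(\<Sum>k<n. W m k * V k m) = 0"
      proof (intro sum.neutral ballI)
        fix k assume "k \<in> {..<n}"
        then show "W m k * V k m = 0" using fun_cong[OF v, of k] by simp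
      qed
      then show False using WV[OF m m] by simp
    qed
    then obtain r where r: "r \<in> R" "(\<Sum>i<n. r i * ?v i) \<noteq> 0" using R[of ?v] by (auto simp: complex_space_def)
    define c where "c j = (\<Sum>i<n. r i * V i j)" for j
    have cm: "c m \<noteq> 0" using r(2) by (simp add: c_def cong: sum.cong_simp)
    have rW: "r j = (\<Sum>k<n. c k * W k j)" if j: "j < n" for j
    proof -
      have "(\<Sum>k<n. c k * W k j) = (\<Sum>i<n. r i * (\<Sum>k<n. V i k * W k j))"
        unfolding c_def sum_distrib_left sum_distrib_right by (subst sum.swap) (simp add: mult.assoc)
      also have "\<dots> = (\<Sum>i<n. r i * ?\<delta> i j)" by (intro sum.cong) (auto simp: VW j)
      also have "\<dots> = r j" using j by (simp add: if_distrib[of "\<lambda>x. _ * x"] cong: if_cong)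
      finally show ?thesis by simp
    qed
    let ?W = "\<lambda>i. if i = m then r else W i"
    \<comment> \<open>The Gauss-Jordan update of the inverse; \<open>r\<close> is the combination of
      the rows \<open>W k\<close> with coefficients \<open>c k\<close>.\<close>
    let ?V = "\<lambda>k j. if j = m then V k m / c m else V k j - c j / c m * V k m"
    have sumV: "(\<Sum>k<n. a k * ?V k j) = (if j = m then (\<Sum>k<n. a k * V k m) / c m
       else (\<Sum>k<n. a k * V k j) - c j / c m * (\<Sum>k<n. a k * V k m))" for a :: "nat \<Rightarrow> complex" and j
      by (auto simp: sum_divide_distrib right_diff_distrib sum_subtractf sum_distrib_left mult_ac)
    have 1: "(\<Sum>k<n. ?W i k * ?V k j) = ?\<delta> i j" if "i < n" "j < n" for i j
      unfolding sumV using cm WV that m by (auto simp: c_def[symmetric])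
    have 2: "(\<Sum>k<n. ?V i k * ?W k j) = ?\<delta> i j" if ij: "i < n" "j < n" for i j
    proof -
      \<comment> \<open>The row changes only for \<open>k = m\<close>, so this summand is split
        off.\<close>
      have "(\<Sum>k<n. ?V i k * ?W k j) = ?V i m * ?W m j + (\<Sum>k\<in>{..<n}-{m}. ?V i k * ?W k j)"
        using m by (intro sum.remove) auto
      also have "(\<Sum>k\<in>{..<n}-{m}. ?V i k * ?W k j) = (\<Sum>k\<in>{..<n}-{m}. V i k * W k j - V i m / c m * (c k * W k j))"
        by (intro sum.cong) (auto simp: algebra_simps)
      also have "\<dots> = (\<Sum>k\<in>{..<n}-{m}. V i k * W k j) - V i m / c m * (\<Sum>k\<in>{..<n}-{m}. c k * W k j)"
        by (simp add: sum_subtractf sum_distrib_left)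
      also have "(\<Sum>k\<in>{..<n}-{m}. V i k * W k j) = ?\<delta> i j - V i m * W m j"
        using sum.remove[of "{..<n}" m "\<lambda>k. V i k * W k j"] VW[OF ij] m by simp
      also have "(\<Sum>k\<in>{..<n}-{m}. c k * W k j) = r j - c m * W m j"
        using sum.remove[of "{..<n}" m "\<lambda>k. c k * W k j"] rW[OF ij(2)] m by simp
      finally show ?thesis using cm by (simp add: field_simps)
    qed
    have 3: "\<forall>i<Suc m. ?W i \<in> R" using WR r by (auto simp: less_Suc_eq)
    show ?case by (intro exI[of _ ?W] exI[of _ ?V] conjI 3 allI impI 1 2)
  qed
  from this[of n] obtain W V where "(\<forall>i<n. W i \<in> R) \<and> (\<forall>i<n. \<forall>j<n. (\<Sum>k<n. W i k * V k j) = ?\<delta> i j) \<and>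
      (\<forall>i<n. \<forall>j<n. (\<Sum>k<n. V i k * W k j) = ?\<delta> i j)" by blast
  then show ?thesis using that[of W V] by simp
qed

section \<open>Weighted homogeneous functions\<close>

text \<open>Unlike \<^const>\<open>weighted_homogeneous_poly\<close>, this allows a constant term, as coefficients of
  weight zero occur in the expansion with respect to a single variable.\<close>

definition hpoly :: "nat list \<Rightarrow> nat \<Rightarrow> ((nat \<Rightarrow> complex) \<Rightarrow> complex) \<Rightarrow> bool" where
  "hpoly w k f \<longleftrightarrow> (\<exists>L :: (complex \<times> nat list) list.
     (\<forall>(c, as)\<in>set L. set as \<subseteq> {..<length w} \<and> (\<Sum>\<alpha>\<leftarrow>as. w ! \<alpha>) = k) \<and>
     (\<forall>z\<in>complex_space (length w). f z = (\<Sum>(c, as)\<leftarrow>L. c * (\<Prod>\<alpha>\<leftarrow>as. z \<alpha>))))"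

lemma hpoly_zero: "(\<And>z. z \<in> complex_space (length w) \<Longrightarrow> f z = 0) \<Longrightarrow> hpoly w k f"
  unfolding hpoly_def by (intro exI[of _ "[]"]) auto

lemma hpoly_add:
  assumes "hpoly w k f" "hpoly w k g" shows "hpoly w k (\<lambda>z. f z + g z)"
proof -
  from assms obtain L L' where
    "\<forall>(c, as)\<in>set L. set as \<subseteq> {..<length w} \<and> (\<Sum>\<alpha>\<leftarrow>as. w ! \<alpha>) = k"
    "\<forall>z\<in>complex_space (length w). f z = (\<Sum>(c, as)\<leftarrow>L. c * (\<Prod>\<alpha>\<leftarrow>as. z \<alpha>))"
    "\<forall>(c, as)\<in>set L'. set as \<subseteq> {..<length w} \<and> (\<Sum>\<alpha>\<leftarrow>as. w ! \<alpha>) = k"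
    "\<forall>z\<in>complex_space (length w). g z = (\<Sum>(c, as)\<leftarrow>L'. c * (\<Prod>\<alpha>\<leftarrow>as. z \<alpha>))"
    unfolding hpoly_def by blast
  then show ?thesis unfolding hpoly_def by (intro exI[of _ "L @ L'"]) auto
qed

lemma hpoly_sum: "finite J \<Longrightarrow> (\<And>j. j \<in> J \<Longrightarrow> hpoly w k (f j)) \<Longrightarrow> hpoly w k (\<lambda>z. \<Sum>j\<in>J. f j z)"
  by (induction J rule: finite_induct) (auto intro: hpoly_zero hpoly_add)

lemma hpoly_cong: "hpoly w k f \<Longrightarrow> (\<And>z. z \<in> complex_space (length w) \<Longrightarrow> f z = g z) \<Longrightarrow> hpoly w k g"
  unfolding hpoly_def by simp

text \<open>The new variable has index \<open>length w\<close> and weight \<open>a\<close>, so its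
  \<open>j\<close> factors add \<open>j * a\<close> to the weight. Setting the new coordinate to 0
  moves the argument into the smaller space.\<close>

lemma hpoly_snoc:
  assumes "hpoly w k f"
  shows "hpoly (w @ [a]) (k + j * a) (\<lambda>z. f (z(length w := 0)) * z (length w) ^ j)"
proof -
  let ?m = "length w"
  obtain L where L: "\<And>c as. (c, as)\<in>set L \<Longrightarrow> set as \<subseteq> {..<length w} \<and> (\<Sum>\<alpha>\<leftarrow>as. w ! \<alpha>) = k"
    "\<And>z. z\<in>complex_space (length w) \<Longrightarrow> f z = (\<Sum>(c, as)\<leftarrow>L. c * (\<Prod>\<alpha>\<leftarrow>as. z \<alpha>))"
    using assms unfolding hpoly_def by blast
  have w: "(\<Sum>\<alpha>\<leftarrow>as. (w @ [a]) ! \<alpha>) = (\<Sum>\<alpha>\<leftarrow>as. w ! \<alpha>)" if "set as \<subseteq> {..<?m}" for as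
    using that by (induction as) (auto simp: nth_append)
  have pz: "(\<Prod>\<alpha>\<leftarrow>as. (z(?m := 0)) \<alpha>) = (\<Prod>\<alpha>\<leftarrow>as. z \<alpha> :: complex)" if "set as \<subseteq> {..<?m}" for as and z :: "nat \<Rightarrow> complex"
    using that by (induction as) auto
  let ?L = "map (\<lambda>(c, as). (c, as @ replicate j ?m)) L"
  show ?thesis unfolding hpoly_def
  proof (intro exI[of _ ?L] conjI ballI)
    fix x assume "x \<in> set ?L"
    then show "case x of (c, as) \<Rightarrow> set as \<subseteq> {..<length (w @ [a])} \<and> (\<Sum>\<alpha>\<leftarrow>as. (w @ [a]) ! \<alpha>) = k + j * a"
      using L(1) w by (fastforce simp: sum_list_replicate)
  next
    fix z assume "z \<in> complex_space (length (w @ [a]))"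
    then have "z(?m := 0) \<in> complex_space ?m" by (auto simp: complex_space_def)
    then have "f (z(?m := 0)) * z ?m ^ j = (\<Sum>(c, as)\<leftarrow>L. c * (\<Prod>\<alpha>\<leftarrow>as. (z(?m := 0)) \<alpha>)) * z ?m ^ j" using L(2) by simp
    also have "\<dots> = (\<Sum>(c, as)\<leftarrow>L. c * (\<Prod>\<alpha>\<leftarrow>as @ replicate j ?m. z \<alpha>))"
      unfolding sum_list_mult_const[symmetric] by (intro arg_cong[of _ _ sum_list] map_cong) (auto simp: pz L(1))
    finally show "f (z(?m := 0)) * z ?m ^ j = (\<Sum>(c, as)\<leftarrow>?L. c * (\<Prod>\<alpha>\<leftarrow>as. z \<alpha>))"
      by (simp add: o_def case_prod_unfold)
  qed
qed

lemma graded_homothety_space [simp]: "graded_homothety w \<xi> z \<in> complex_space (length w)"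
  by (simp add: graded_homothety_def complex_space_def)

lemma graded_homothety_snoc:
  "graded_homothety (w @ [a]) \<xi> (z(length w := \<zeta>)) = (graded_homothety w \<xi> z)(length w := \<xi> ^ a * \<zeta>)"
  by (auto simp: graded_homothety_def fun_eq_iff nth_append)

text \<open>Induction on the number of variables: the Taylor coefficient of order \<open>j\<close> in the last variable,
  of weight \<open>a\<close>, is homogeneous of weight \<open>k - j * a\<close> and vanishes if \<open>j * a > k\<close>.\<close>

lemma homogeneous_hpoly:
  assumes "\<forall>a\<in>set w. 0 < a" "sep_hol (length w) (complex_space (length w)) f"
    "\<And>\<xi> z. \<xi> \<noteq> 0 \<Longrightarrow> z \<in> complex_space (length w) \<Longrightarrow> f (graded_homothety w \<xi> z) = \<xi> ^ k * f z"
  shows "hpoly w k f"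
  using assms
proof (induction w arbitrary: k f rule: rev_induct)
  case Nil
  have z: "complex_space 0 = {\<lambda>i. 0}" by (auto simp: complex_space_def)
  show ?case
  proof (cases "k = 0")
    case True
    then show ?thesis unfolding hpoly_def by (intro exI[of _ "[(f (\<lambda>i. 0), [])]"]) (auto simp: z)
  next
    case False
    \<comment> \<open>The only point is fixed by all homotheties; scaling by 2 forces the value 0
      when \<open>k\<close> is positive.\<close>
    have "f (\<lambda>i. 0) = 2 ^ k * f (\<lambda>i. 0)"
      using Nil(3)[of 2 "\<lambda>i. 0"] by (simp add: graded_homothety_def)
    moreover have "(2::complex) ^ k \<noteq> 1"
      using False by (metis norm_numeral norm_one norm_power one_less_numeral_iff one_less_power less_irrefl neq0_conv semiring_norm(76))
    ultimately have "f (\<lambda>i. 0) = 0" by simp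
    then show ?thesis by (intro hpoly_zero) (auto simp: z)
  qed
next
  case (snoc a w)
  let ?m = "length w"
  have F: "sep_hol (Suc ?m) (complex_space (Suc ?m)) f" using snoc.prems(2) by simp
  have a: "a > 0" and wpos: "\<forall>a\<in>set w. 0 < a" using snoc.prems(1) by auto
  have o: "open_cs n (complex_space n)" for n by simp
  have US: "x(?m := \<zeta>) \<in> complex_space (Suc ?m)" if "x \<in> complex_space ?m" for x \<zeta>
    using that by (auto simp: complex_space_def)
  then have US1: "x(?m := \<zeta>) \<in> complex_space (Suc ?m)" if "x \<in> complex_space ?m" "cmod \<zeta> \<le> 1" for x \<zeta>
    using that by blast
  have fc1: "sep_hol ?m (complex_space ?m) (fcoef ?m f j)" for j
    by (rule sep_hol_fcoef[OF o F o]) (rule US1)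
  have fc2: "fcoef ?m f j x = (deriv ^^ j) (\<lambda>\<zeta>. f (x(?m := \<zeta>))) 0 / fact j" if "x \<in> complex_space ?m" for x j
    by (rule fcoef_eq_deriv[OF o F o _ that]) (rule US1)
  have fc3: "(\<lambda>j. fcoef ?m f j x * \<zeta> ^ j) sums f (x(?m := \<zeta>))" if "x \<in> complex_space ?m" "cmod \<zeta> \<le> 1" for x \<zeta>
    by (rule fcoef_sums[OF o F o _ that]) (rule US1)
  \<comment> \<open>Scaling by \<xi> multiplies the last variable by \<open>\<xi> ^ a\<close>, so
    homogeneity of \<open>f\<close> passes to the coefficient of order \<open>j\<close> with the
    factor \<open>\<xi> ^ (j * a)\<close>.\<close>
  have hom: "\<xi> ^ (j * a) * fcoef ?m f j (graded_homothety w \<xi> x) = \<xi> ^ k * fcoef ?m f j x"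
    if x: "x \<in> complex_space ?m" and \<xi>: "\<xi> \<noteq> 0" for \<xi> x j
  proof -
    let ?g = "\<lambda>x \<zeta>. f (x(?m := \<zeta>))"
    have g: "?g y holomorphic_on UNIV" if "y \<in> complex_space ?m" for y
      using sep_hol_slice[OF F, of ?m UNIV y] US[OF that] by auto
    have "\<xi> ^ (j * a) * (deriv ^^ j) (?g (graded_homothety w \<xi> x)) 0 =
        (\<xi> ^ a) ^ j * (deriv ^^ j) (?g (graded_homothety w \<xi> x)) (\<xi> ^ a * 0)"
      by (simp add: power_mult[symmetric] mult.commute)
    also have "\<dots> = (deriv ^^ j) (\<lambda>\<zeta>. ?g (graded_homothety w \<xi> x) (\<xi> ^ a * \<zeta>)) 0"
      by (rule higher_deriv_compose_linear[symmetric, where T = UNIV and S = UNIV]) (use g in auto)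
    also have "(\<lambda>\<zeta>. ?g (graded_homothety w \<xi> x) (\<xi> ^ a * \<zeta>)) = (\<lambda>\<zeta>. \<xi> ^ k * ?g x \<zeta>)"
    proof
      fix \<zeta>
      show "?g (graded_homothety w \<xi> x) (\<xi> ^ a * \<zeta>) = \<xi> ^ k * ?g x \<zeta>"
      proof -
        have "f (graded_homothety (w @ [a]) \<xi> (x(?m := \<zeta>))) = \<xi> ^ k * f (x(?m := \<zeta>))"
          by (rule snoc.prems(3)[OF \<xi>], unfold length_append_singleton, rule US[OF x])
        then show ?thesis by (simp only: graded_homothety_snoc)
      qed
    qed
    also have "(deriv ^^ j) \<dots> 0 = \<xi> ^ k * (deriv ^^ j) (?g x) 0"
      by (rule higher_deriv_cmult[OF g[OF x]]) auto
    finally show ?thesis by (simp only: fc2[OF graded_homothety_space] fc2[OF x] times_divide_eq_right)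
  qed
  have zero: "fcoef ?m f j x = 0" if x: "x \<in> complex_space ?m" and j: "k < j * a" for j x
  proof -
    \<comment> \<open>A null sequence of nonzero scalars: by \<open>hom\<close> the coefficient at
      \<open>x\<close> is a positive power of \<xi> times a value that converges, so it
      vanishes.\<close>
    let ?\<xi> = "\<lambda>N. inverse (of_nat (Suc N)) :: complex"
    have nz: "?\<xi> N \<noteq> 0" for N by (simp del: of_nat_Suc)
    have e: "(1 :: complex) * fcoef ?m f j x = ?\<xi> N ^ (j * a - k) * fcoef ?m f j (graded_homothety w (?\<xi> N) x)" for N
    proof -
      have "?\<xi> N ^ k * (?\<xi> N ^ (j * a - k) * fcoef ?m f j (graded_homothety w (?\<xi> N) x)) = ?\<xi> N ^ k * fcoef ?m f j x"
        using hom[OF x nz[of N], of j] j by (simp add: mult.assoc[symmetric] power_add[symmetric])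
      moreover have "?\<xi> N ^ k \<noteq> 0" using nz by simp
      ultimately show ?thesis by (metis mult_1 mult_cancel_left)
    qed
    have xi: "?\<xi> \<longlonglongrightarrow> 0" by (rule lim_inverse_n[THEN LIMSEQ_Suc])
    have zp: "(\<lambda>N. ?\<xi> N ^ l) \<longlonglongrightarrow> 0" if "l > 0" for l
      using tendsto_power[OF xi, of l] that by (simp add: zero_power)
    have ch: "continuous_on UNIV (\<lambda>\<xi>. graded_homothety w \<xi> x)"
    proof (rule continuous_on_coordinatewise_then_product)
      fix i show "continuous_on UNIV (\<lambda>\<xi>. graded_homothety w \<xi> x i)"
        unfolding graded_homothety_def by (cases "i < ?m") (simp_all, intro continuous_intros)
    qed
    have "continuous_on (complex_space ?m) (fcoef ?m f j)" using fc1 by (simp add: sep_hol_def)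
    then have "continuous_on UNIV (\<lambda>\<xi>. fcoef ?m f j (graded_homothety w \<xi> x))"
      by (rule continuous_on_compose2[OF _ ch]) auto
    then have "(\<lambda>N. fcoef ?m f j (graded_homothety w (?\<xi> N) x)) \<longlonglongrightarrow> fcoef ?m f j (graded_homothety w 0 x)"
      by (rule continuous_on_tendsto_compose[OF _ xi]) auto
    from tendsto_mult[OF zp[of "j * a - k"] this] j
    have "(\<lambda>N. 1 * fcoef ?m f j x) \<longlonglongrightarrow> 0 * fcoef ?m f j (graded_homothety w 0 x)"
      by (simp only: e[symmetric] zero_less_diff)
    then show ?thesis by (simp add: LIMSEQ_const_iff)
  qed
  let ?J = "{j. j * a \<le> k}"
  have ja: "j \<le> j * a" for j using a by (cases a) auto
  have Jk: "?J \<subseteq> {..k}" using order.trans[OF ja] by blast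
  then have Jf: "finite ?J" using finite_subset by blast
  have hp: "hpoly w (k - j * a) (fcoef ?m f j)" if j: "j \<in> ?J" for j
  proof (rule snoc.IH[OF wpos fc1])
    fix \<xi> :: complex and z assume \<xi>: "\<xi> \<noteq> 0" and z: "z \<in> complex_space ?m"
    have "\<xi> ^ (j * a) * fcoef ?m f j (graded_homothety w \<xi> z) = \<xi> ^ (j * a) * (\<xi> ^ (k - j * a) * fcoef ?m f j z)"
      using hom[OF z \<xi>, of j] j by (simp add: mult.assoc[symmetric] power_add[symmetric])
    then show "fcoef ?m f j (graded_homothety w \<xi> z) = \<xi> ^ (k - j * a) * fcoef ?m f j z" using \<xi> by simp
  qed
  have small: "f (x(?m := \<zeta>)) = (\<Sum>j\<in>?J. fcoef ?m f j x * \<zeta> ^ j)" if x: "x \<in> complex_space ?m" and \<zeta>: "cmod \<zeta> \<le> 1" for x \<zeta>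
  proof (rule sums_unique2[OF fc3[OF x \<zeta>]])
    show "(\<lambda>j. fcoef ?m f j x * \<zeta> ^ j) sums (\<Sum>j\<in>?J. fcoef ?m f j x * \<zeta> ^ j)"
      by (rule sums_finite[OF Jf]) (use zero[OF x] in auto)
  qed
  have all: "f z = (\<Sum>j\<in>?J. fcoef ?m f j (z(?m := 0)) * z ?m ^ j)" if z: "z \<in> complex_space (length (w @ [a]))" for z
  proof -
    let ?x = "z(?m := 0)"
    have x: "?x \<in> complex_space ?m" using z by (auto simp: complex_space_def)
    \<comment> \<open>A real scaling that brings the last coordinate into the closed unit disc,
      where the Taylor expansion is available; homogeneity then removes the scaling.\<close>
    define t where "t = 1 / (1 + cmod (z ?m))"
    have t: "0 < t" "t \<le> 1" "t * cmod (z ?m) \<le> 1" by (auto simp: t_def add_pos_nonneg field_simps)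
    let ?\<xi> = "of_real t :: complex"
    have \<xi>: "?\<xi> \<noteq> 0" using t by auto
    have "t ^ a \<le> t" using t a power_decreasing[of 1 a t] by simp
    then have "t ^ a * cmod (z ?m) \<le> 1" using t(3) by (meson mult_right_mono norm_ge_zero order_trans)
    then have s: "cmod (?\<xi> ^ a * z ?m) \<le> 1" using t by (simp add: norm_mult norm_power)
    have "?\<xi> ^ k * f z = f (graded_homothety (w @ [a]) ?\<xi> (?x(?m := z ?m)))"
      using snoc.prems(3)[OF \<xi> z] by simp
    also have "\<dots> = f ((graded_homothety w ?\<xi> ?x)(?m := ?\<xi> ^ a * z ?m))"
      by (subst graded_homothety_snoc) simp
    also have "\<dots> = (\<Sum>j\<in>?J. fcoef ?m f j (graded_homothety w ?\<xi> ?x) * (?\<xi> ^ a * z ?m) ^ j)"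
      by (rule small[OF graded_homothety_space s])
    also have "\<dots> = (\<Sum>j\<in>?J. (?\<xi> ^ (j * a) * fcoef ?m f j (graded_homothety w ?\<xi> ?x)) * z ?m ^ j)"
      by (intro sum.cong) (auto simp: power_mult_distrib power_mult[symmetric] mult_ac)
    also have "\<dots> = ?\<xi> ^ k * (\<Sum>j\<in>?J. fcoef ?m f j ?x * z ?m ^ j)"
      unfolding hom[OF x \<xi>] by (simp add: sum_distrib_left mult.assoc)
    finally show ?thesis using \<xi> by simp
  qed
  have "hpoly (w @ [a]) k (\<lambda>z. \<Sum>j\<in>?J. fcoef ?m f j (z(?m := 0)) * z ?m ^ j)"
  proof (rule hpoly_sum[OF Jf])
    fix j assume j: "j \<in> ?J"
    from hpoly_snoc[OF hp[OF j], of a j] j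
    show "hpoly (w @ [a]) k (\<lambda>z. fcoef ?m f j (z(?m := 0)) * z ?m ^ j)" by simp
  qed
  then show ?case by (rule hpoly_cong) (simp add: all)
qed

text \<open>Positive weights bound the length of a tuple by its total weight.\<close>

lemma finite_weighted_tuples:
  assumes "\<forall>a\<in>set w. 0 < (a::nat)"
  shows "finite {as. as \<noteq> [] \<and> set as \<subseteq> {..<length w} \<and> (\<Sum>\<alpha>\<leftarrow>as. w ! \<alpha>) = k}"
proof (rule finite_subset)
  have "length as \<le> (\<Sum>\<alpha>\<leftarrow>as. w ! \<alpha>)" if "set as \<subseteq> {..<length w}" for as
    using that by (induction as) (use assms nth_mem in \<open>force simp: Suc_le_eq\<close>)+
  then show "{as. as \<noteq> [] \<and> set as \<subseteq> {..<length w} \<and> (\<Sum>\<alpha>\<leftarrow>as. w ! \<alpha>) = k} \<subseteq>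
      {as. set as \<subseteq> {..<length w} \<and> length as \<le> k}" by auto
  show "finite {as. set as \<subseteq> {..<length w} \<and> length as \<le> k}" by (rule finite_lists_length_le) simp
qed

text \<open>Terms with the same tuple are collected into one coefficient. The empty tuple has weight
  0, so \<open>k > 0\<close> rules out a constant term.\<close>

lemma hpoly_imp_weighted:
  assumes w: "\<forall>a\<in>set w. 0 < a" and k: "k > 0" and h: "hpoly w k f"
  shows "weighted_homogeneous_poly w k f"
proof -
  let ?I = "{as. as \<noteq> [] \<and> set as \<subseteq> {..<length w} \<and> (\<Sum>\<alpha>\<leftarrow>as. w ! \<alpha>) = k}"
  obtain L where L: "\<forall>(c, as)\<in>set L. set as \<subseteq> {..<length w} \<and> (\<Sum>\<alpha>\<leftarrow>as. w ! \<alpha>) = k"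
    "\<forall>z\<in>complex_space (length w). f z = (\<Sum>(c, as)\<leftarrow>L. c * (\<Prod>\<alpha>\<leftarrow>as. z \<alpha>))"
    using h unfolding hpoly_def by blast
  have "\<exists>c. \<forall>z. (\<Sum>(c, as)\<leftarrow>L. c * (\<Prod>\<alpha>\<leftarrow>as. z \<alpha> :: complex)) = (\<Sum>as\<in>?I. c as * (\<Prod>\<alpha>\<leftarrow>as. z \<alpha>))"
    using L(1)
  proof (induction L)
    case Nil show ?case by (intro exI[of _ "\<lambda>_. 0"]) simp
  next
    case (Cons x L)
    obtain b bs where x: "x = (b, bs)" by (cases x)
    obtain c where c: "\<And>z. (\<Sum>(c, as)\<leftarrow>L. c * (\<Prod>\<alpha>\<leftarrow>as. z \<alpha> :: complex)) = (\<Sum>as\<in>?I. c as * (\<Prod>\<alpha>\<leftarrow>as. z \<alpha>))"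
      using Cons by auto
    have bs: "bs \<in> ?I" using Cons.prems k x by auto
    show ?case
    proof (intro exI[of _ "\<lambda>as. (if as = bs then b else 0) + c as"] allI)
      fix z :: "nat \<Rightarrow> complex"
      have "(\<Sum>as\<in>?I. ((if as = bs then b else 0) + c as) * (\<Prod>\<alpha>\<leftarrow>as. z \<alpha>)) =
        (\<Sum>as\<in>?I. if as = bs then b * (\<Prod>\<alpha>\<leftarrow>as. z \<alpha>) else 0) + (\<Sum>as\<in>?I. c as * (\<Prod>\<alpha>\<leftarrow>as. z \<alpha>))"
        unfolding sum.distrib[symmetric] by (intro sum.cong) (auto simp: algebra_simps)
      also have "(\<Sum>as\<in>?I. if as = bs then b * (\<Prod>\<alpha>\<leftarrow>as. z \<alpha>) else 0) = b * (\<Prod>\<alpha>\<leftarrow>bs. z \<alpha>)"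
        using bs finite_weighted_tuples[OF w, of k] by (subst sum.delta) auto
      finally show "(\<Sum>(c, as)\<leftarrow>x # L. c * (\<Prod>\<alpha>\<leftarrow>as. z \<alpha>)) =
        (\<Sum>as\<in>?I. ((if as = bs then b else 0) + c as) * (\<Prod>\<alpha>\<leftarrow>as. z \<alpha>))"
        using c x by simp
    qed
  qed
  then obtain c where "\<And>z. (\<Sum>(c, as)\<leftarrow>L. c * (\<Prod>\<alpha>\<leftarrow>as. z \<alpha> :: complex)) = (\<Sum>as\<in>?I. c as * (\<Prod>\<alpha>\<leftarrow>as. z \<alpha>))"
    by blast
  with L(2) show ?thesis unfolding weighted_homogeneous_poly_def by (intro exI[of _ c]) simp
qed

lemma prod_list_homothety:
  "set as \<subseteq> {..<length w} \<Longrightarrow> (\<Prod>\<alpha>\<leftarrow>as. graded_homothety w \<xi> z \<alpha>) = \<xi> ^ (\<Sum>\<alpha>\<leftarrow>as. w ! \<alpha>) * (\<Prod>\<alpha>\<leftarrow>as. z \<alpha>)"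
  by (induction as) (auto simp: graded_homothety_def power_add)

lemma graded_morphism_homothety:
  assumes g: "graded_space_morphism w w' g" and z: "z \<in> complex_space (length w)"
  shows "g (graded_homothety w \<xi> z) = graded_homothety w' \<xi> (g z)"
proof (rule complex_space_eqI[of _ "length w'"])
  fix i assume i: "i < length w'"
  then obtain c where c: "\<And>z. z\<in>complex_space (length w) \<Longrightarrow>
        g z i = (\<Sum>as | as \<noteq> [] \<and> set as \<subseteq> {..<length w} \<and> (\<Sum>\<alpha>\<leftarrow>as. w ! \<alpha>) = w' ! i.
                 c as * (\<Prod>\<alpha>\<leftarrow>as. z \<alpha>))"
    using g unfolding graded_space_morphism_def weighted_homogeneous_poly_def by blast
  show "g (graded_homothety w \<xi> z) i = graded_homothety w' \<xi> (g z) i"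
    using i unfolding c[OF graded_homothety_space] graded_homothety_def[of w' \<xi> "g z"]
    by (simp add: c[OF z] sum_distrib_left) (intro sum.cong, auto simp: prod_list_homothety)
qed (use g z in \<open>auto simp: graded_space_morphism_def\<close>)

text \<open>The converse of \<open>graded_morphism_homothety\<close>: by
  \<open>homogeneous_hpoly\<close>, holomorphic equivariant maps of graded spaces are automatically
  polynomial. Transition functions and fibre maps are shown to be graded in this way.\<close>

lemma graded_morphismI:
  assumes w: "\<forall>a\<in>set w. 0 < a" and w': "\<forall>a\<in>set w'. 0 < a"
    and im: "g ` complex_space (length w) \<subseteq> complex_space (length w')"
    and hol: "\<And>i. i < length w' \<Longrightarrow> sep_hol (length w) (complex_space (length w)) (\<lambda>z. g z i)"
    and eqv: "\<And>\<xi> z. z \<in> complex_space (length w) \<Longrightarrow> g (graded_homothety w \<xi> z) = graded_homothety w' \<xi> (g z)"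
  shows "graded_space_morphism w w' g"
  unfolding graded_space_morphism_def
proof (intro conjI allI impI im)
  fix i assume i: "i < length w'"
  show "weighted_homogeneous_poly w (w' ! i) (\<lambda>z. g z i)"
    by (intro hpoly_imp_weighted homogeneous_hpoly w hol i)
      (use w' i eqv in \<open>auto simp: graded_homothety_def\<close>)
qed

section \<open>Ranks, sorted weight lists and multiplicities\<close>

lemma rank_weights_pos: "a \<in> set (rank_weights d) \<Longrightarrow> 0 < a"
  by (auto simp: rank_weights_def)

lemma count_rank_weights:
  "count (mset (rank_weights d)) k = (if 0 < k \<and> k \<le> length d then d ! (k - 1) else 0)"
proof -
  have "count (mset (concat (map (\<lambda>i. replicate (d ! i) (Suc i)) [0..<m]))) k =
      (if 0 < k \<and> k \<le> m then d ! (k - 1) else 0)" for m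
    by (induction m) (auto simp: le_Suc_eq)
  then show ?thesis by (simp add: rank_weights_def)
qed

lemma sorted_rank_weights: "sorted (rank_weights d)"
proof -
  have "sorted (concat (map (\<lambda>i. replicate (d ! i) (Suc i)) [0..<m])) \<and>
    (\<forall>x\<in>set (concat (map (\<lambda>i. replicate (d ! i) (Suc i)) [0..<m])). x \<le> m)" for m
    by (induction m) (auto simp: sorted_append)
  then show ?thesis by (simp add: rank_weights_def)
qed

lemma sorted_mset_unique: "sorted xs \<Longrightarrow> sorted ys \<Longrightarrow> mset xs = mset ys \<Longrightarrow> xs = ys"
  by (metis properties_for_sort)

text \<open>The multiplicities of the weights determine every entry of the rank, and the nonzero
  last entry fixes its length.\<close>

lemma rank_weights_inj:
  assumes "rank_weights d = rank_weights d'" "d \<noteq> [] \<longrightarrow> last d \<noteq> 0" "d' \<noteq> [] \<longrightarrow> last d' \<noteq> 0"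
  shows "d = d'"
proof -
  have c: "(if 0 < k \<and> k \<le> length d then d ! (k - 1) else 0) = (if 0 < k \<and> k \<le> length d' then d' ! (k - 1) else 0)" for k
    using assms(1) by (metis count_rank_weights)
  have "\<not> length d < length d'" using c[of "length d'"] assms(3) by (auto simp: last_conv_nth split: if_splits)
  moreover have "\<not> length d' < length d" using c[of "length d"] assms(2) by (auto simp: last_conv_nth split: if_splits)
  ultimately have l: "length d = length d'" by simp
  then show ?thesis
  proof (rule nth_equalityI)
    fix i assume "i < length d"
    then show "d ! i = d' ! i" using c[of "Suc i"] l by (simp add: Suc_le_eq)
  qed
qed

lemma rank_weights_exists:
  assumes "sorted v" "\<forall>a\<in>set v. 0 < a"
  obtains d where "d \<noteq> [] \<longrightarrow> last d \<noteq> 0" "rank_weights d = v"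
proof -
  define d where "d = map (\<lambda>i. count (mset v) (Suc i)) [0..<(if v = [] then 0 else last v)]"
  have le: "a \<le> last v" if "a \<in> set v" for a
    using assms(1) that by (metis last_ConsL last_snoc append_butlast_last_id empty_iff empty_set
        sorted_append set_ConsD rotate1.simps(2) set_rotate1 list.set_intros(1) order_refl)
  show ?thesis
  proof (rule that)
    show "d \<noteq> [] \<longrightarrow> last d \<noteq> 0"
      using assms(2) last_in_set[of v] by (auto simp: d_def last_conv_nth)
    have "mset (rank_weights d) = mset v"
    proof (rule multiset_eqI)
      fix k
      show "count (mset (rank_weights d)) k = count (mset v) k"
        using le[of k] assms(2) unfolding count_rank_weights
        by (cases "k \<in> set v"; cases k) (auto simp: d_def Suc_le_eq)
    qed
    then show "rank_weights d = v" by (rule sorted_mset_unique[OF sorted_rank_weights assms(1)])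
  qed
qed

text \<open>Weight 0 belongs to coordinates of the base and positive weights to the fibre, so
  \<open>n\<close> becomes the dimension of the base and \<open>d\<close> the rank.\<close>

lemma sorted_weights_split:
  assumes "sorted (v :: nat list)"
  obtains n d where "d \<noteq> [] \<longrightarrow> last d \<noteq> 0" "v = replicate n 0 @ rank_weights d"
proof -
  have "\<exists>n u. v = replicate n 0 @ u \<and> sorted u \<and> (\<forall>a\<in>set u. 0 < a)"
    using assms
  proof (induction v)
    case Nil show ?case by (intro exI[of _ 0] exI[of _ "[]"]) simp
  next
    case (Cons a v)
    show ?case
    proof (cases "a = 0")
      case True
      from Cons obtain n u where "v = replicate n 0 @ u \<and> sorted u \<and> (\<forall>a\<in>set u. 0 < a)" by auto
      then show ?thesis using True by (intro exI[of _ "Suc n"] exI[of _ u]) auto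
    next
      case False
      then show ?thesis using Cons.prems by (intro exI[of _ 0] exI[of _ "a # v"]) fastforce
    qed
  qed
  then obtain n u where u: "v = replicate n 0 @ u" "sorted u" "\<forall>a\<in>set u. 0 < a" by blast
  from rank_weights_exists[OF u(2,3)] obtain d where "d \<noteq> [] \<longrightarrow> last d \<noteq> 0" "rank_weights d = u" .
  then show ?thesis using that u by blast
qed

text \<open>\<open>L\<close> and \<open>M\<close> stand for inverse matrices, and \<open>L\<close>
  joins only equal weights. For each \<open>k\<close> the sum of \<open>L i j * M j i\<close> over
  the pairs of weight \<open>k\<close> is computed in both orders: it counts \<open>k\<close> in
  \<open>w'\<close> and in \<open>w\<close>.\<close>

lemma weights_mset_eq:
  fixes L M :: "nat \<Rightarrow> nat \<Rightarrow> complex"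
  assumes left: "\<And>i. i < length w' \<Longrightarrow> (\<Sum>j<length w. L i j * M j i) = 1"
    and right: "\<And>j. j < length w \<Longrightarrow> (\<Sum>i<length w'. M j i * L i j) = 1"
    and eqv: "\<And>i j. i < length w' \<Longrightarrow> j < length w \<Longrightarrow> L i j \<noteq> 0 \<Longrightarrow> w' ! i = w ! j"
  shows "mset w = (mset w' :: nat multiset)"
proof (rule multiset_eqI)
  fix k
  have c: "count (mset v) k = card {i\<in>{..<length v}. v ! i = k}" for v :: "nat list"
    by (simp add: count_mset count_list_eq_length_filter length_filter_conv_card eq_commute[of k])
  have "of_nat (card {i\<in>{..<length w'}. w' ! i = k}) = (\<Sum>i\<in>{i\<in>{..<length w'}. w' ! i = k}. (\<Sum>j<length w. L i j * M j i))"
    using left by simp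
  also have "\<dots> = (\<Sum>i<length w'. if w' ! i = k then \<Sum>j<length w. L i j * M j i else 0)"
    by (rule sum.inter_filter) simp
  also have "\<dots> = (\<Sum>i<length w'. \<Sum>j<length w. if w ! j = k then M j i * L i j else 0)"
  proof (intro sum.cong refl)
    fix i assume i: "i \<in> {..<length w'}"
    have "(if w' ! i = k then L i j * M j i else 0) = (if w ! j = k then M j i * L i j else 0)"
      if "j < length w" for j using eqv[of i j] i that by (cases "L i j = 0") auto
    then have "(\<Sum>j<length w. if w' ! i = k then L i j * M j i else 0) =
        (\<Sum>j<length w. if w ! j = k then M j i * L i j else 0)" by (intro sum.cong) auto
    then show "(if w' ! i = k then \<Sum>j<length w. L i j * M j i else 0) =
        (\<Sum>j<length w. if w ! j = k then M j i * L i j else 0)" by (cases "w' ! i = k") auto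
  qed
  also have "\<dots> = (\<Sum>j<length w. if w ! j = k then \<Sum>i<length w'. M j i * L i j else 0)"
  proof (subst sum.swap, intro sum.cong refl)
    fix j show "(\<Sum>i<length w'. if w ! j = k then M j i * L i j else 0) =
        (if w ! j = k then \<Sum>i<length w'. M j i * L i j else 0)" by (cases "w ! j = k") auto
  qed
  also have "\<dots> = (\<Sum>j\<in>{j\<in>{..<length w}. w ! j = k}. (\<Sum>i<length w'. M j i * L i j))"
    by (rule sum.inter_filter[symmetric]) simp
  also have "\<dots> = of_nat (card {j\<in>{..<length w}. w ! j = k})" using right by simp
  finally have "card {i\<in>{..<length w'}. w' ! i = k} = card {j\<in>{..<length w}. w ! j = k}"
    by (simp only: of_nat_eq_iff)
  then show "count (mset w) k = count (mset w') k" by (simp only: c)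
qed

section \<open>Holomorphic maps at a point\<close>

text \<open>Continuity at one point, the form in which it enters \<open>hol_at\<close>; it can be
  checked on any neighbourhood of the point.\<close>

definition cont_at :: "'a topology \<Rightarrow> 'b topology \<Rightarrow> ('a \<Rightarrow> 'b) \<Rightarrow> 'a \<Rightarrow> bool" where
  "cont_at X Y f x \<longleftrightarrow> x \<in> topspace X \<and> f x \<in> topspace Y \<and>
     (\<forall>V. openin Y V \<and> f x \<in> V \<longrightarrow> (\<exists>U. openin X U \<and> x \<in> U \<and> f ` U \<subseteq> V))"

lemma continuous_map_iff_cont_at: "continuous_map X Y f \<longleftrightarrow> (\<forall>x\<in>topspace X. cont_at X Y f x)"
proof
  assume L: "continuous_map X Y f"
  show "\<forall>x\<in>topspace X. cont_at X Y f x"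
    unfolding cont_at_def
  proof (intro ballI conjI allI impI)
    fix x assume x: "x \<in> topspace X"
    then show "x \<in> topspace X" "f x \<in> topspace Y" using L by (auto simp: continuous_map_def)
    fix V assume V: "openin Y V \<and> f x \<in> V"
    then have "openin X {y \<in> topspace X. f y \<in> V}" using L by (auto simp: continuous_map_def)
    then show "\<exists>U. openin X U \<and> x \<in> U \<and> f ` U \<subseteq> V" using x V by (intro exI[of _ "{y \<in> topspace X. f y \<in> V}"]) auto
  qed
next
  assume R: "\<forall>x\<in>topspace X. cont_at X Y f x"
  show "continuous_map X Y f" unfolding continuous_map_def
  proof (intro conjI allI impI)
    show "f \<in> topspace X \<rightarrow> topspace Y" using R by (auto simp: cont_at_def)
    fix V assume V: "openin Y V"
    show "openin X {x \<in> topspace X. f x \<in> V}"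
    proof (subst openin_subopen, intro ballI)
      fix x assume x: "x \<in> {x \<in> topspace X. f x \<in> V}"
      then obtain U where "openin X U" "x \<in> U" "f ` U \<subseteq> V" using R V unfolding cont_at_def by blast
      then show "\<exists>T. openin X T \<and> x \<in> T \<and> T \<subseteq> {x \<in> topspace X. f x \<in> V}"
        using openin_subset by (intro exI[of _ U]) fastforce
    qed
  qed
qed

lemma cont_at_compose: "cont_at X Y f x \<Longrightarrow> cont_at Y Z g (f x) \<Longrightarrow> cont_at X Z (\<lambda>x. g (f x)) x"
  unfolding cont_at_def by (simp add: image_subset_iff) meson

lemma cont_at_nbhd:
  assumes "cont_at X Y f x" "openin Y V" "f x \<in> V"
  obtains U where "openin X U" "x \<in> U" "f ` U \<subseteq> V"
  using assms unfolding cont_at_def by blast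

lemma cont_at_cong:
  assumes "cont_at X Y f x" "openin X W" "x \<in> W" "\<And>y. y \<in> W \<Longrightarrow> f y = g y"
  shows "cont_at X Y g x"
  unfolding cont_at_def
proof (intro conjI allI impI)
  show "x \<in> topspace X" "g x \<in> topspace Y" using assms by (auto simp: cont_at_def)
  fix V assume V: "openin Y V \<and> g x \<in> V"
  have "openin Y V" "f x \<in> V" using V assms(3,4) by auto
  from cont_at_nbhd[OF assms(1) this] obtain U where "openin X U" "x \<in> U" "f ` U \<subseteq> V" .
  then show "\<exists>U. openin X U \<and> x \<in> U \<and> g ` U \<subseteq> V"
    using assms(2-4) by (intro exI[of _ "U \<inter> W"]) (auto simp: image_subset_iff)
qed

lemma cont_at_subtopology_dom:
  assumes S: "openin X S" "x \<in> S"
  shows "cont_at (subtopology X S) Y f x \<longleftrightarrow> cont_at X Y f x"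
proof
  assume L: "cont_at (subtopology X S) Y f x"
  show "cont_at X Y f x" unfolding cont_at_def
  proof (intro conjI allI impI)
    show "x \<in> topspace X" "f x \<in> topspace Y" using L by (auto simp: cont_at_def)
    fix V assume "openin Y V \<and> f x \<in> V"
    then obtain U where "openin (subtopology X S) U" "x \<in> U" "f ` U \<subseteq> V" using L unfolding cont_at_def by blast
    then show "\<exists>U. openin X U \<and> x \<in> U \<and> f ` U \<subseteq> V" using S by (intro exI[of _ U]) (simp add: openin_open_subtopology)
  qed
next
  assume R: "cont_at X Y f x"
  show "cont_at (subtopology X S) Y f x" unfolding cont_at_def
  proof (intro conjI allI impI)
    show "x \<in> topspace (subtopology X S)" "f x \<in> topspace Y" using R S by (auto simp: cont_at_def)
    fix V assume "openin Y V \<and> f x \<in> V"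
    then obtain U where "openin X U" "x \<in> U" "f ` U \<subseteq> V" using R unfolding cont_at_def by blast
    then show "\<exists>U. openin (subtopology X S) U \<and> x \<in> U \<and> f ` U \<subseteq> V"
      using S by (intro exI[of _ "U \<inter> S"]) (auto simp: openin_subtopology_Int)
  qed
qed

lemma cont_at_from_subtopology:
  assumes "cont_at X Y f x" "x \<in> S"
  shows "cont_at (subtopology X S) Y f x"
  unfolding cont_at_def
proof (intro conjI allI impI)
  show "x \<in> topspace (subtopology X S)" "f x \<in> topspace Y" using assms by (auto simp: cont_at_def)
  fix V assume "openin Y V \<and> f x \<in> V"
  then obtain U where "openin X U" "x \<in> U" "f ` U \<subseteq> V" using assms unfolding cont_at_def by blast
  then show "\<exists>U. openin (subtopology X S) U \<and> x \<in> U \<and> f ` U \<subseteq> V"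
    using assms by (intro exI[of _ "U \<inter> S"]) (auto simp: openin_subtopology_Int)
qed

lemma cont_at_subtopology_codI:
  assumes "cont_at X Y f x" "openin X W" "x \<in> W" "f ` W \<subseteq> S"
  shows "cont_at X (subtopology Y S) f x"
  unfolding cont_at_def
proof (intro conjI allI impI)
  show "x \<in> topspace X" "f x \<in> topspace (subtopology Y S)" using assms by (auto simp: cont_at_def)
  fix V assume "openin (subtopology Y S) V \<and> f x \<in> V"
  then obtain V' where V': "openin Y V'" "V = V' \<inter> S" "f x \<in> V'" by (auto simp: openin_subtopology)
  then obtain U where "openin X U" "x \<in> U" "f ` U \<subseteq> V'" using assms(1) unfolding cont_at_def by blast
  then show "\<exists>U. openin X U \<and> x \<in> U \<and> f ` U \<subseteq> V"
    using assms(2-4) V' by (intro exI[of _ "U \<inter> W"]) auto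
qed

lemma cont_at_subtopology_codD:
  assumes "cont_at X (subtopology Y S) f x" shows "cont_at X Y f x"
  unfolding cont_at_def
proof (intro conjI allI impI)
  show "x \<in> topspace X" "f x \<in> topspace Y" using assms by (auto simp: cont_at_def)
  fix V assume "openin Y V \<and> f x \<in> V"
  moreover have "f x \<in> S" using assms by (auto simp: cont_at_def)
  ultimately have "openin (subtopology Y S) (V \<inter> S)" "f x \<in> V \<inter> S" by (auto simp: openin_subtopology_Int)
  then obtain U where "openin X U" "x \<in> U" "f ` U \<subseteq> V \<inter> S" using assms unfolding cont_at_def by metis
  then show "\<exists>U. openin X U \<and> x \<in> U \<and> f ` U \<subseteq> V" by blast
qed

lemma cont_at_pair:
  assumes "cont_at X Y (\<lambda>x. fst (f x)) x" "cont_at X Z (\<lambda>x. snd (f x)) x"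
  shows "cont_at X (prod_topology Y Z) f x"
  unfolding cont_at_def
proof (intro conjI allI impI)
  show "x \<in> topspace X" "f x \<in> topspace (prod_topology Y Z)" using assms by (auto simp: cont_at_def mem_Times_iff)
  fix V assume V: "openin (prod_topology Y Z) V \<and> f x \<in> V"
  then obtain A B where AB: "openin Y A" "openin Z B" "fst (f x) \<in> A" "snd (f x) \<in> B" "A \<times> B \<subseteq> V"
    unfolding openin_prod_topology_alt by (metis prod.collapse)
  obtain U1 where U1: "openin X U1" "x \<in> U1" "(\<lambda>x. fst (f x)) ` U1 \<subseteq> A" using cont_at_nbhd[OF assms(1) AB(1,3)] .
  obtain U2 where U2: "openin X U2" "x \<in> U2" "(\<lambda>x. snd (f x)) ` U2 \<subseteq> B" using cont_at_nbhd[OF assms(2) AB(2,4)] .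
  have "f y \<in> V" if "y \<in> U1 \<inter> U2" for y
  proof -
    have "f y \<in> A \<times> B" using that U1 U2 by (auto simp: mem_Times_iff)
    then show ?thesis using AB by auto
  qed
  then show "\<exists>U. openin X U \<and> x \<in> U \<and> f ` U \<subseteq> V" using U1 U2 by (intro exI[of _ "U1 \<inter> U2"]) auto
qed

lemma cont_at_fst: "p \<in> topspace (prod_topology X Y) \<Longrightarrow> cont_at (prod_topology X Y) X fst p"
  using continuous_map_fst[of X Y, unfolded continuous_map_iff_cont_at] by blast

lemma cont_at_snd: "p \<in> topspace (prod_topology X Y) \<Longrightarrow> cont_at (prod_topology X Y) Y snd p"
  using continuous_map_snd[of X Y, unfolded continuous_map_iff_cont_at] by blast

text \<open>Holomorphy on an open set means this at each of its points, and composition and local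
  modification work at a single point. The neighbourhood \<open>S\<close> records that values stay
  in \<open>complex_space m\<close>, which the components below \<open>m\<close> do not
  show.\<close>

definition cdiff_at :: "nat \<Rightarrow> nat \<Rightarrow> ((nat \<Rightarrow> complex) \<Rightarrow> nat \<Rightarrow> complex) \<Rightarrow> (nat \<Rightarrow> complex) \<Rightarrow> bool" where
  "cdiff_at n m g z \<longleftrightarrow> (\<exists>S. open_cs n S \<and> z \<in> S \<and> g ` S \<subseteq> complex_space m) \<and>
     (\<forall>j<m. \<exists>c. has_cderiv n (\<lambda>w. g w j) c z)"

lemma cdiff_at_space: "cdiff_at n m g z \<Longrightarrow> z \<in> complex_space n" "cdiff_at n m g z \<Longrightarrow> g z \<in> complex_space m"
  unfolding cdiff_at_def using open_cs_subset by blast+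

lemma holomorphic_vec_iff:
  assumes "open_cs n S"
  shows "holomorphic_vec n m S g \<longleftrightarrow> (\<forall>z\<in>S. cdiff_at n m g z)"
proof
  assume L: "holomorphic_vec n m S g"
  then show "\<forall>z\<in>S. cdiff_at n m g z"
    unfolding holomorphic_vec_def cdiff_at_def holomorphic_fun_iff[OF assms] using assms by blast
next
  assume R: "\<forall>z\<in>S. cdiff_at n m g z"
  then show "holomorphic_vec n m S g"
    unfolding holomorphic_vec_def holomorphic_fun_iff[OF assms]
    using cdiff_at_space(2) by (auto simp: cdiff_at_def)
qed

lemma cdiff_at_cong:
  assumes "cdiff_at n m f z" "open_cs n S" "z \<in> S" "\<And>w. w \<in> S \<Longrightarrow> f w = g w"
  shows "cdiff_at n m g z"
proof -
  obtain T where T: "open_cs n T" "z \<in> T" "f ` T \<subseteq> complex_space m" using assms(1) by (auto simp: cdiff_at_def)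
  have "open_cs n (S \<inter> T) \<and> z \<in> S \<inter> T \<and> g ` (S \<inter> T) \<subseteq> complex_space m"
    using T assms by (auto simp: image_subset_iff)
  moreover have "\<exists>c. has_cderiv n (\<lambda>w. g w j) c z" if "j < m" for j
    using assms that has_cderiv_cong[OF _ assms(2,3), of "\<lambda>w. f w j" _ "\<lambda>w. g w j"] unfolding cdiff_at_def by metis
  ultimately show ?thesis unfolding cdiff_at_def by blast
qed

lemma cdiff_at_continuous:
  assumes g: "cdiff_at n m g z" and V: "open_cs m V" "g z \<in> V"
  obtains S where "open_cs n S" "z \<in> S" "g ` S \<subseteq> V"
proof -
  have z: "z \<in> complex_space n" using cdiff_at_space g by blast
  obtain T where T: "open_cs n T" "z \<in> T" "g ` T \<subseteq> complex_space m" using g by (auto simp: cdiff_at_def)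
  obtain t where t: "t > 0" "pdisc n z t \<subseteq> T" using T open_cs_pdiscE by blast
  obtain r where r: "r > 0" "pdisc m (g z) r \<subseteq> V" using V open_cs_pdiscE by blast
  have "\<exists>s>0. \<forall>w\<in>pdisc n z s. cmod (g w j - g z j) < r" if "j \<in> {..<m}" for j
    using g that has_cderiv_continuous[OF _ z r(1), of "\<lambda>w. g w j"] unfolding cdiff_at_def by auto
  then have "\<exists>s>0. \<forall>w\<in>pdisc n z s. \<forall>j\<in>{..<m}. cmod (g w j - g z j) < r"
    by (intro pdisc_finite) auto
  then obtain s where s: "s > 0" "\<And>w j. w \<in> pdisc n z s \<Longrightarrow> j < m \<Longrightarrow> cmod (g w j - g z j) < r" by auto
  show ?thesis
  proof (rule that)
    show "open_cs n (pdisc n z (min s t))" by (rule open_cs_pdisc)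
    show "z \<in> pdisc n z (min s t)" using z s t by (intro pdisc_centre) auto
    have sub: "pdisc n z (min s t) \<subseteq> pdisc n z s" "pdisc n z (min s t) \<subseteq> T"
      using pdisc_mono[of "min s t" s n z] pdisc_mono[of "min s t" t n z] t by auto
    have "g w \<in> pdisc m (g z) r" if "w \<in> pdisc n z (min s t)" for w
      using s(2) sub that T(3) unfolding pdisc_def[of m] by blast
    then show "g ` pdisc n z (min s t) \<subseteq> V" using r by auto
  qed
qed

lemma cdiff_at_cont_at: "cdiff_at n m g z \<Longrightarrow> cont_at (top_of_set (complex_space n)) (top_of_set (complex_space m)) g z"
  unfolding cont_at_def topspace_euclidean_subtopology
proof (intro conjI allI impI)
  assume g: "cdiff_at n m g z"
  show "z \<in> complex_space n" "g z \<in> complex_space m" using cdiff_at_space[OF g] .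
  fix V assume "open_cs m V \<and> g z \<in> V"
  then show "\<exists>U. open_cs n U \<and> z \<in> U \<and> g ` U \<subseteq> V" using cdiff_at_continuous[OF g] by blast
qed

lemma cdiff_at_compose:
  assumes g: "cdiff_at n m g z" and f: "cdiff_at m l f (g z)"
  shows "cdiff_at n l (\<lambda>w. f (g w)) z"
proof -
  obtain T where T: "open_cs m T" "g z \<in> T" "f ` T \<subseteq> complex_space l" using f by (auto simp: cdiff_at_def)
  obtain S where S: "open_cs n S" "z \<in> S" "g ` S \<subseteq> T" using cdiff_at_continuous[OF g T(1,2)] .
  have im: "g ` S \<subseteq> complex_space m" using S T open_cs_subset by blast
  from g obtain A where A: "\<And>j. j < m \<Longrightarrow> has_cderiv n (\<lambda>w. g w j) (A j) z" unfolding cdiff_at_def by metis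
  have "\<exists>c. has_cderiv n (\<lambda>w. f (g w) j) c z" if j: "j < l" for j
  proof -
    have "\<forall>j<l. \<exists>c. has_cderiv m (\<lambda>w. f w j) c (g z)" using f by (simp add: cdiff_at_def)
    then obtain c where "has_cderiv m (\<lambda>w. f w j) c (g z)" using j by blast
    from has_cderiv_compose[where g = g, OF this A cdiff_at_space(1)[OF g] S(1,2) im] show ?thesis by blast
  qed
  moreover have "(\<lambda>w. f (g w)) ` S \<subseteq> complex_space l" using S T by auto
  ultimately show ?thesis unfolding cdiff_at_def using S by blast
qed

lemma cdiff_at_sep_hol:
  assumes "open_cs n S" "z \<in> S" "g ` S \<subseteq> complex_space m" "\<And>j. j < m \<Longrightarrow> sep_hol n S (\<lambda>w. g w j)"
  shows "cdiff_at n m g z"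
  unfolding cdiff_at_def using assms sep_hol_iff_cderiv by blast

lemma sep_hol_cdiff_at:
  assumes "open_cs n S" "\<And>z. z \<in> S \<Longrightarrow> cdiff_at n m g z" "j < m"
  shows "sep_hol n S (\<lambda>w. g w j)"
  using assms unfolding cdiff_at_def sep_hol_iff_cderiv[OF assms(1)] by blast

lemma cdiff_at_id: "z \<in> complex_space n \<Longrightarrow> cdiff_at n n (\<lambda>w. w) z"
  by (rule cdiff_at_sep_hol[of n "complex_space n"]) (auto intro: sep_hol_coord)

section \<open>Splitting and joining coordinate vectors\<close>

definition pj1 :: "nat \<Rightarrow> (nat \<Rightarrow> complex) \<Rightarrow> nat \<Rightarrow> complex" where
  "pj1 m z = (\<lambda>i. if i < m then z i else 0)"

definition pj2 :: "nat \<Rightarrow> nat \<Rightarrow> (nat \<Rightarrow> complex) \<Rightarrow> nat \<Rightarrow> complex" where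
  "pj2 m n z = (\<lambda>i. if i < n then z (m + i) else 0)"

definition join :: "nat \<Rightarrow> (nat \<Rightarrow> complex) \<Rightarrow> (nat \<Rightarrow> complex) \<Rightarrow> nat \<Rightarrow> complex" where
  "join m a b = (\<lambda>i. if i < m then a i else b (i - m))"

lemma pj_space [simp]: "pj1 m z \<in> complex_space m" "pj2 m n z \<in> complex_space n"
  by (auto simp: pj1_def pj2_def complex_space_def)

lemma join_space [simp]: "b \<in> complex_space n \<Longrightarrow> join m a b \<in> complex_space (m + n)"
  by (auto simp: join_def complex_space_def)

lemma join_pj: "z \<in> complex_space (m + n) \<Longrightarrow> join m (pj1 m z) (pj2 m n z) = z"
  by (auto simp: join_def pj1_def pj2_def complex_space_def fun_eq_iff)

lemma pj_join [simp]: "a \<in> complex_space m \<Longrightarrow> pj1 m (join m a b) = a"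
  "b \<in> complex_space n \<Longrightarrow> pj2 m n (join m a b) = b"
  by (auto simp: join_def pj1_def pj2_def complex_space_def fun_eq_iff)

lemma cdiff_at_pj1: "z \<in> complex_space n \<Longrightarrow> cdiff_at n m (pj1 m) z"
  by (rule cdiff_at_sep_hol[of n "complex_space n"]) (auto simp: pj1_def[abs_def] complex_space_def intro: sep_hol_coord)

lemma cdiff_at_pj2: "z \<in> complex_space k \<Longrightarrow> cdiff_at k n (pj2 m n) z"
  by (rule cdiff_at_sep_hol[of k "complex_space k"]) (auto simp: pj2_def[abs_def] complex_space_def intro: sep_hol_coord)

lemma cdiff_at_join:
  assumes "cdiff_at k m a z" "cdiff_at k n b z"
  shows "cdiff_at k (m + n) (\<lambda>w. join m (a w) (b w)) z"
proof -
  obtain T where T: "open_cs k T" "z \<in> T" "b ` T \<subseteq> complex_space n" using assms(2) by (auto simp: cdiff_at_def)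
  have "\<exists>c. has_cderiv k (\<lambda>w. join m (a w) (b w) j) c z" if "j < m + n" for j
    using assms that unfolding cdiff_at_def join_def by (cases "j < m") auto
  moreover have "(\<lambda>w. join m (a w) (b w)) ` T \<subseteq> complex_space (m + n)" using T by auto
  ultimately show ?thesis unfolding cdiff_at_def using T by blast
qed

section \<open>Charts and maximal atlases\<close>

lemma is_chartD:
  assumes "is_chart n T (U, \<phi>)"
  shows "openin T U" "\<phi> \<in> extensional U" "inj_on \<phi> U" "open_cs n (\<phi> ` U)"
    "x \<in> U \<Longrightarrow> cont_at T (top_of_set (complex_space n)) \<phi> x"
    "x \<in> U \<Longrightarrow> cont_at (top_of_set (complex_space n)) T (inv_into U \<phi>) (\<phi> x)"
    "x \<in> U \<Longrightarrow> \<phi> x \<in> complex_space n"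
proof -
  show U: "openin T U" and "\<phi> \<in> extensional U" and o: "open_cs n (\<phi> ` U)"
    using assms by (auto simp: is_chart_def)
  have h: "homeomorphic_map (subtopology T U) (top_of_set (\<phi> ` U)) \<phi>" using assms by (auto simp: is_chart_def)
  have tU: "topspace (subtopology T U) = U" using openin_subset[OF U] by auto
  show inj: "inj_on \<phi> U" using homeomorphic_imp_injective_map[OF h] tU by simp
  obtain g where g: "homeomorphic_maps (subtopology T U) (top_of_set (\<phi> ` U)) \<phi> g"
    using h homeomorphic_map_maps by blast
  show "\<phi> x \<in> complex_space n" if "x \<in> U" using that o open_cs_subset by blast
  show "cont_at T (top_of_set (complex_space n)) \<phi> x" if x: "x \<in> U"
  proof -
    have "cont_at (subtopology T U) (top_of_set (\<phi> ` U)) \<phi> x"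
      using g x tU by (auto simp: homeomorphic_maps_def continuous_map_iff_cont_at)
    then have "cont_at T (top_of_set (\<phi> ` U)) \<phi> x" using cont_at_subtopology_dom[OF U x] by blast
    moreover have "top_of_set (\<phi> ` U) = subtopology (top_of_set (complex_space n)) (\<phi> ` U)"
      using openin_imp_subset[OF o] by (simp add: subtopology_subtopology Int_absorb1)
    ultimately show ?thesis using cont_at_subtopology_codD by metis
  qed
  show "cont_at (top_of_set (complex_space n)) T (inv_into U \<phi>) (\<phi> x)" if x: "x \<in> U"
  proof -
    have "cont_at (top_of_set (\<phi> ` U)) (subtopology T U) g (\<phi> x)"
      using g x tU by (auto simp: homeomorphic_maps_def continuous_map_iff_cont_at)
    then have "cont_at (top_of_set (\<phi> ` U)) T g (\<phi> x)" by (rule cont_at_subtopology_codD)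
    moreover have "top_of_set (\<phi> ` U) = subtopology (top_of_set (complex_space n)) (\<phi> ` U)"
      using openin_imp_subset[OF o] by (simp add: subtopology_subtopology Int_absorb1)
    ultimately have "cont_at (top_of_set (complex_space n)) T g (\<phi> x)"
      using cont_at_subtopology_dom[OF o] x by auto
    then show ?thesis
    proof (rule cont_at_cong[OF _ o])
      fix y assume "y \<in> \<phi> ` U"
      then show "g y = inv_into U \<phi> y" using g tU inj by (auto simp: homeomorphic_maps_def)
    qed (use x in auto)
  qed
qed

lemma is_chartI:
  assumes U: "openin T U" and e: "\<phi> \<in> extensional U" and inj: "inj_on \<phi> U" and o: "open_cs n (\<phi> ` U)"
    and c1: "\<And>x. x \<in> U \<Longrightarrow> cont_at T (top_of_set (complex_space n)) \<phi> x"
    and c2: "\<And>x. x \<in> U \<Longrightarrow> cont_at (top_of_set (complex_space n)) T (inv_into U \<phi>) (\<phi> x)"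
  shows "is_chart n T (U, \<phi>)"
proof -
  have tU: "topspace (subtopology T U) = U" using openin_subset[OF U] by auto
  have eq: "top_of_set (\<phi> ` U) = subtopology (top_of_set (complex_space n)) (\<phi> ` U)"
    using openin_imp_subset[OF o] by (simp add: subtopology_subtopology Int_absorb1)
  have "continuous_map (subtopology T U) (top_of_set (\<phi> ` U)) \<phi>"
    unfolding continuous_map_iff_cont_at eq tU
    using cont_at_subtopology_dom[OF U] cont_at_subtopology_codI[OF c1 U _ order_refl] by blast
  moreover have "continuous_map (top_of_set (\<phi> ` U)) (subtopology T U) (inv_into U \<phi>)"
    unfolding continuous_map_iff_cont_at
  proof
    fix z assume "z \<in> topspace (top_of_set (\<phi> ` U))"
    then obtain x where x: "x \<in> U" "z = \<phi> x" by auto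
    have "cont_at (top_of_set (complex_space n)) (subtopology T U) (inv_into U \<phi>) z"
      unfolding x(2) by (rule cont_at_subtopology_codI[OF c2[OF x(1)] o]) (use x inj in auto)
    then show "cont_at (top_of_set (\<phi> ` U)) (subtopology T U) (inv_into U \<phi>) z"
      unfolding eq using cont_at_subtopology_dom[OF o] x by auto
  qed
  ultimately have "homeomorphic_maps (subtopology T U) (top_of_set (\<phi> ` U)) \<phi> (inv_into U \<phi>)"
    using inj tU by (auto simp: homeomorphic_maps_def f_inv_into_f)
  then have "homeomorphic_map (subtopology T U) (top_of_set (\<phi> ` U)) \<phi>"
    using homeomorphic_map_maps by blast
  then show ?thesis using U e o by (simp add: is_chart_def)
qed

lemma chart_image_open:
  assumes c: "is_chart n T (U, \<phi>)" and W: "openin T W" "W \<subseteq> U"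
  shows "open_cs n (\<phi> ` W)"
proof (subst openin_subopen, intro ballI)
  fix z assume "z \<in> \<phi> ` W"
  then obtain x where x: "x \<in> W" "z = \<phi> x" by auto
  then have xU: "x \<in> U" and "inv_into U \<phi> (\<phi> x) \<in> W" using W is_chartD(3)[OF c] by auto
  from cont_at_nbhd[where f = "inv_into U \<phi>" and x = "\<phi> x", OF is_chartD(6)[OF c xU] W(1) this(2)] x W
  obtain S where S: "open_cs n S" "\<phi> x \<in> S" "inv_into U \<phi> ` S \<subseteq> W" by auto
  show "\<exists>S. open_cs n S \<and> z \<in> S \<and> S \<subseteq> \<phi> ` W"
  proof (intro exI[of _ "S \<inter> \<phi> ` U"] conjI)
    show "S \<inter> \<phi> ` U \<subseteq> \<phi> ` W"
    proof
      fix y assume "y \<in> S \<inter> \<phi> ` U"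
      then show "y \<in> \<phi> ` W" using S(3) by (metis IntD1 IntD2 f_inv_into_f image_eqI image_subset_iff)
    qed
  qed (use S x W is_chartD(4)[OF c] in auto)
qed

lemma chart_compatible_iff:
  assumes c: "is_chart n T (U, \<phi>)" and d: "is_chart n T (V, \<psi>)"
  shows "charts_compatible n (U, \<phi>) (V, \<psi>) \<longleftrightarrow>
    (\<forall>x\<in>U \<inter> V. cdiff_at n n (\<lambda>w. \<psi> (inv_into U \<phi> w)) (\<phi> x) \<and> cdiff_at n n (\<lambda>w. \<phi> (inv_into V \<psi> w)) (\<psi> x))"
proof -
  have "openin T (U \<inter> V)" using is_chartD(1)[OF c] is_chartD(1)[OF d] by auto
  then have "open_cs n (\<phi> ` (U \<inter> V))" "open_cs n (\<psi> ` (U \<inter> V))"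
    using chart_image_open[OF c] chart_image_open[OF d] by auto
  then show ?thesis unfolding charts_compatible_def by (auto simp: holomorphic_vec_iff o_def)
qed

text \<open>Insertion of an intermediate chart. With a chart map for \<open>g\<close> this transfers
  compatibility; with a general \<open>g\<close> it changes the chart in which a map is
  tested.\<close>

lemma transition_trans:
  assumes c: "is_chart n T (U, \<phi>)" and a: "is_chart n T (W, \<kappa>)" and x: "x \<in> U" "x \<in> W"
    and 1: "cdiff_at n n (\<lambda>w. \<kappa> (inv_into U \<phi> w)) (\<phi> x)" and 2: "cdiff_at n m (\<lambda>w. g (inv_into W \<kappa> w)) (\<kappa> x)"
  shows "cdiff_at n m (\<lambda>w. g (inv_into U \<phi> w)) (\<phi> x)"
proof -
  have UW: "openin T (U \<inter> W)" using is_chartD(1)[OF c] is_chartD(1)[OF a] by auto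
  have "cdiff_at n m (\<lambda>w. g (inv_into W \<kappa> (\<kappa> (inv_into U \<phi> w)))) (\<phi> x)"
    by (rule cdiff_at_compose[OF 1]) (use 2 x is_chartD(3)[OF c] in simp)
  then show ?thesis
  proof (rule cdiff_at_cong[OF _ chart_image_open[OF c UW]])
    fix w assume "w \<in> \<phi> ` (U \<inter> W)"
    then obtain y where "y \<in> U" "y \<in> W" "w = \<phi> y" by auto
    then show "g (inv_into W \<kappa> (\<kappa> (inv_into U \<phi> w))) = g (inv_into U \<phi> w)"
      using is_chartD(3)[OF c] is_chartD(3)[OF a] by simp
  qed (use x in auto)
qed

text \<open>Two charts compatible with all of \<open>A\<close> are compatible with each other, since
  near each common point both can be compared with a member of \<open>A\<close>. Maximality follows
  because \<open>A\<close> lies in the generated atlas.\<close>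

lemma generated_manifold:
  assumes "Hausdorff_space T" "second_countable T" and A: "\<And>a. a \<in> A \<Longrightarrow> is_chart n T a"
    and cov: "(\<Union>a\<in>A. fst a) = topspace T"
    and comp: "\<And>a b. a \<in> A \<Longrightarrow> b \<in> A \<Longrightarrow> charts_compatible n a b"
  shows "complex_manifold \<lparr>mdim = n, mtop = T, matlas = generated_atlas n T A\<rparr>" "A \<subseteq> generated_atlas n T A"
proof -
  show sub: "A \<subseteq> generated_atlas n T A" using A comp by (auto simp: generated_atlas_def)
  have cc: "charts_compatible n c d" if c: "c \<in> generated_atlas n T A" and d: "d \<in> generated_atlas n T A" for c d
  proof -
    obtain U \<phi> V \<psi> where cd: "c = (U, \<phi>)" "d = (V, \<psi>)" by fastforce
    have ch: "is_chart n T (U, \<phi>)" "is_chart n T (V, \<psi>)" using c d cd by (auto simp: generated_atlas_def)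
    show ?thesis unfolding cd chart_compatible_iff[OF ch]
    proof
      fix x assume x: "x \<in> U \<inter> V"
      then have "x \<in> topspace T" using is_chartD(1)[OF ch(1)] openin_subset by auto
      then obtain W \<kappa> where a: "(W, \<kappa>) \<in> A" "x \<in> W" using cov by fastforce
      have aW: "is_chart n T (W, \<kappa>)" using A a by auto
      have "charts_compatible n (U, \<phi>) (W, \<kappa>)" "charts_compatible n (V, \<psi>) (W, \<kappa>)"
        using c d a cd by (auto simp: generated_atlas_def)
      then show "cdiff_at n n (\<lambda>w. \<psi> (inv_into U \<phi> w)) (\<phi> x) \<and> cdiff_at n n (\<lambda>w. \<phi> (inv_into V \<psi> w)) (\<psi> x)"
        unfolding chart_compatible_iff[OF ch(1) aW] chart_compatible_iff[OF ch(2) aW]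
        using transition_trans[OF ch(1) aW, of x n \<psi>] transition_trans[OF ch(2) aW, of x n \<phi>] x a by blast
    qed
  qed
  have "(\<Union>c\<in>generated_atlas n T A. fst c) = topspace T"
  proof
    show "(\<Union>c\<in>generated_atlas n T A. fst c) \<subseteq> topspace T"
    proof
      fix x assume "x \<in> (\<Union>c\<in>generated_atlas n T A. fst c)"
      then obtain U \<phi> where "is_chart n T (U, \<phi>)" "x \<in> U" by (auto simp: generated_atlas_def)
      then show "x \<in> topspace T" using is_chartD(1) openin_subset by blast
    qed
    show "topspace T \<subseteq> (\<Union>c\<in>generated_atlas n T A. fst c)" using sub cov by blast
  qed
  note cover = this
  define G where "G = generated_atlas n T A"
  define M where "M = \<lparr>mdim = n, mtop = T, matlas = G\<rparr>"
  have M: "mdim M = n" "mtop M = T" "matlas M = G" by (simp_all add: M_def)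
  have "complex_manifold M"
    unfolding complex_manifold_def M
  proof (intro conjI allI ballI impI)
    show "is_chart n T c" if "c \<in> G" for c using that by (simp add: G_def generated_atlas_def)
    show "charts_compatible n c d" if "c \<in> G" "d \<in> G" for c d using that unfolding G_def by (rule cc)
    show "(\<Union>c\<in>G. fst c) = topspace T" unfolding G_def by (rule cover)
    fix c assume c: "is_chart n T c \<and> (\<forall>c'\<in>G. charts_compatible n c c')"
    have "\<forall>a\<in>A. charts_compatible n c a" using c sub unfolding G_def by blast
    then show "c \<in> G" unfolding G_def generated_atlas_def using c by simp
  qed (rule assms)+
  then show "complex_manifold \<lparr>mdim = n, mtop = T, matlas = generated_atlas n T A\<rparr>"
    unfolding M_def G_def .
qed

lemma second_countable_euclidean: "second_countable (euclidean :: 'a::second_countable_topology topology)"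
proof -
  obtain B :: "'a set set" where B: "countable B" "\<And>C. C \<in> B \<Longrightarrow> open C" "\<And>S. open S \<Longrightarrow> \<exists>U. U \<subseteq> B \<and> S = \<Union>U"
    using univ_second_countable by metis
  show ?thesis unfolding second_countable_def
  proof (intro exI[of _ B] conjI allI impI ballI)
    fix U and x :: 'a assume "openin euclidean U \<and> x \<in> U"
    then obtain \<U> where "\<U> \<subseteq> B" "U = \<Union>\<U>" "x \<in> U" using B(3)[of U] by auto
    then show "\<exists>V\<in>B. x \<in> V \<and> V \<subseteq> U" by blast
  qed (use B in auto)
qed

lemma second_countable_prod:
  assumes "second_countable X" "second_countable Y" shows "second_countable (prod_topology X Y)"
proof -
  obtain B where B0: "countable B \<and> (\<forall>V\<in>B. openin X V) \<and> (\<forall>U x. openin X U \<and> x \<in> U \<longrightarrow> (\<exists>V\<in>B. x \<in> V \<and> V \<subseteq> U))"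
    using assms(1) unfolding second_countable_def ..
  then have B: "countable B" "\<And>V. V \<in> B \<Longrightarrow> openin X V" "\<And>U x. openin X U \<Longrightarrow> x \<in> U \<Longrightarrow> \<exists>V\<in>B. x \<in> V \<and> V \<subseteq> U" by simp_all
  obtain C where C0: "countable C \<and> (\<forall>V\<in>C. openin Y V) \<and> (\<forall>U x. openin Y U \<and> x \<in> U \<longrightarrow> (\<exists>V\<in>C. x \<in> V \<and> V \<subseteq> U))"
    using assms(2) unfolding second_countable_def ..
  then have C: "countable C" "\<And>V. V \<in> C \<Longrightarrow> openin Y V" "\<And>U x. openin Y U \<Longrightarrow> x \<in> U \<Longrightarrow> \<exists>V\<in>C. x \<in> V \<and> V \<subseteq> U" by simp_all
  show ?thesis unfolding second_countable_def
  proof (intro exI[of _ "(\<lambda>(b,c). b \<times> c) ` (B \<times> C)"] conjI allI impI ballI)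
    show "countable ((\<lambda>(b,c). b \<times> c) ` (B \<times> C))" using B C by (intro countable_image countable_SIGMA)
    show "openin (prod_topology X Y) V" if "V \<in> (\<lambda>(b,c). b \<times> c) ` (B \<times> C)" for V
      using that B C by (auto simp: openin_prod_Times_iff)
    fix U p assume U: "openin (prod_topology X Y) U \<and> p \<in> U"
    obtain x y where p: "p = (x, y)" by fastforce
    obtain A D where AD: "openin X A" "openin Y D" "x \<in> A" "y \<in> D" "A \<times> D \<subseteq> U"
      using U p unfolding openin_prod_topology_alt by blast
    obtain b where b: "b \<in> B" "x \<in> b" "b \<subseteq> A" using B(3)[OF AD(1,3)] by blast
    obtain c where c: "c \<in> C" "y \<in> c" "c \<subseteq> D" using C(3)[OF AD(2,4)] by blast
    show "\<exists>V\<in>(\<lambda>(b,c). b \<times> c) ` (B \<times> C). p \<in> V \<and> V \<subseteq> U"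
      by (rule bexI[of _ "b \<times> c"]) (use AD b c p in auto)
  qed
qed

section \<open>Holomorphic maps between manifolds, point by point\<close>

lemma mf_chart: "complex_manifold M \<Longrightarrow> c \<in> matlas M \<Longrightarrow> is_chart (mdim M) (mtop M) c"
  by (simp add: complex_manifold_def)

lemma mf_cover:
  assumes "complex_manifold M" "x \<in> mcarrier M"
  obtains U \<phi> where "(U, \<phi>) \<in> matlas M" "x \<in> U"
proof -
  have "x \<in> (\<Union>c\<in>matlas M. fst c)" using assms by (simp add: complex_manifold_def)
  then obtain c where "c \<in> matlas M" "x \<in> fst c" by blast
  then show ?thesis using that[of "fst c" "snd c"] by simp
qed

lemma mf_transition:
  assumes M: "complex_manifold M" and c: "(U, \<phi>) \<in> matlas M" "(V, \<psi>) \<in> matlas M" and x: "x \<in> U" "x \<in> V"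
  shows "cdiff_at (mdim M) (mdim M) (\<lambda>w. \<psi> (inv_into U \<phi> w)) (\<phi> x)"
proof -
  have "charts_compatible (mdim M) (U, \<phi>) (V, \<psi>)" using M c unfolding complex_manifold_def by blast
  then show ?thesis using chart_compatible_iff[OF mf_chart[OF M c(1)] mf_chart[OF M c(2)]] x by blast
qed

lemma mf_chart_mem: "complex_manifold M \<Longrightarrow> (U, \<phi>) \<in> matlas M \<Longrightarrow> x \<in> U \<Longrightarrow> x \<in> mcarrier M"
  using is_chartD(1)[OF mf_chart] openin_subset by blast

text \<open>One pair of charts is asked for, and by \<open>hol_at_charts\<close> all pairs then do.
  Continuity is stated separately because a chart expression is meaningful only if \<open>f\<close>
  maps a neighbourhood of \<open>x\<close> into the chart domain.\<close>

definition hol_at :: "'a cmanifold \<Rightarrow> 'b cmanifold \<Rightarrow> ('a \<Rightarrow> 'b) \<Rightarrow> 'a \<Rightarrow> bool" where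
  "hol_at M N f x \<longleftrightarrow> cont_at (mtop M) (mtop N) f x \<and>
    (\<exists>U \<phi> V \<psi>. (U, \<phi>) \<in> matlas M \<and> (V, \<psi>) \<in> matlas N \<and> x \<in> U \<and> f x \<in> V \<and>
       cdiff_at (mdim M) (mdim N) (\<lambda>w. \<psi> (f (inv_into U \<phi> w))) (\<phi> x))"

lemma hol_atI:
  assumes "cont_at (mtop M) (mtop N) f x" "(U, \<phi>) \<in> matlas M" "(V, \<psi>) \<in> matlas N" "x \<in> U" "f x \<in> V"
    "cdiff_at (mdim M) (mdim N) (\<lambda>w. \<psi> (f (inv_into U \<phi> w))) (\<phi> x)"
  shows "hol_at M N f x"
  using assms unfolding hol_at_def by blast

lemma hol_at_cont: "hol_at M N f x \<Longrightarrow> cont_at (mtop M) (mtop N) f x"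
  by (simp add: hol_at_def)

lemma hol_at_mem: "hol_at M N f x \<Longrightarrow> x \<in> mcarrier M" "hol_at M N f x \<Longrightarrow> f x \<in> mcarrier N"
  by (auto simp: hol_at_def cont_at_def)

lemma chart_cong:
  assumes c: "is_chart n T (U, \<phi>)" and W: "openin T W" and x: "x \<in> U" "x \<in> W"
    and f: "cdiff_at n m (\<lambda>w. f (inv_into U \<phi> w)) (\<phi> x)" and eq: "\<And>y. y \<in> U \<Longrightarrow> y \<in> W \<Longrightarrow> f y = g y"
  shows "cdiff_at n m (\<lambda>w. g (inv_into U \<phi> w)) (\<phi> x)"
proof (rule cdiff_at_cong[OF f])
  show "open_cs n (\<phi> ` (U \<inter> W))" using W is_chartD(1)[OF c] by (intro chart_image_open[OF c]) auto
  show "f (inv_into U \<phi> w) = g (inv_into U \<phi> w)" if "w \<in> \<phi> ` (U \<inter> W)" for w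
    using that eq is_chartD(3)[OF c] by auto
qed (use x in auto)

lemma hol_at_charts:
  assumes M: "complex_manifold M" and N: "complex_manifold N" and f: "hol_at M N f x"
    and c: "(U, \<phi>) \<in> matlas M" "x \<in> U" and d: "(V, \<psi>) \<in> matlas N" "f x \<in> V"
  shows "cdiff_at (mdim M) (mdim N) (\<lambda>w. \<psi> (f (inv_into U \<phi> w))) (\<phi> x)"
proof -
  obtain U0 \<phi>0 V0 \<psi>0 where 0: "(U0, \<phi>0) \<in> matlas M" "(V0, \<psi>0) \<in> matlas N" "x \<in> U0" "f x \<in> V0"
    "cdiff_at (mdim M) (mdim N) (\<lambda>w. \<psi>0 (f (inv_into U0 \<phi>0 w))) (\<phi>0 x)"
    using f unfolding hol_at_def by blast
  note cU = mf_chart[OF M c(1)] and cV0 = mf_chart[OF N 0(2)]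
  have 1: "cdiff_at (mdim M) (mdim N) (\<lambda>w. \<psi>0 (f (inv_into U \<phi> w))) (\<phi> x)"
    by (rule transition_trans[where g = "\<lambda>y. \<psi>0 (f y)", OF cU mf_chart[OF M 0(1)] c(2) 0(3) mf_transition[OF M c(1) 0(1) c(2) 0(3)] 0(5)])
  have "cdiff_at (mdim M) (mdim N) (\<lambda>w. (\<lambda>y. \<psi> (inv_into V0 \<psi>0 y)) ((\<lambda>w. \<psi>0 (f (inv_into U \<phi> w))) w)) (\<phi> x)"
  proof (rule cdiff_at_compose[OF 1])
    show "cdiff_at (mdim N) (mdim N) (\<lambda>y. \<psi> (inv_into V0 \<psi>0 y)) (\<psi>0 (f (inv_into U \<phi> (\<phi> x))))"
      using mf_transition[OF N 0(2) d(1) 0(4) d(2)] is_chartD(3)[OF cU] c(2) by simp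
  qed
  then have 2: "cdiff_at (mdim M) (mdim N) (\<lambda>w. (\<lambda>y. \<psi> (inv_into V0 \<psi>0 (\<psi>0 (f y)))) (inv_into U \<phi> w)) (\<phi> x)" by simp
  obtain W where W: "openin (mtop M) W" "x \<in> W" "f ` W \<subseteq> V0"
    using cont_at_nbhd[OF hol_at_cont[OF f] is_chartD(1)[OF cV0] 0(4)] .
  show ?thesis
    by (rule chart_cong[OF cU W(1) c(2) W(2) 2]) (use W(3) is_chartD(3)[OF cV0] in auto)
qed

lemma hol_at_cong:
  assumes M: "complex_manifold M" and f: "hol_at M N f x" and W: "openin (mtop M) W" "x \<in> W" "\<And>y. y \<in> W \<Longrightarrow> f y = g y"
  shows "hol_at M N g x"
proof -
  obtain U \<phi> V \<psi> where 0: "(U, \<phi>) \<in> matlas M" "(V, \<psi>) \<in> matlas N" "x \<in> U" "f x \<in> V"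
    "cdiff_at (mdim M) (mdim N) (\<lambda>w. \<psi> (f (inv_into U \<phi> w))) (\<phi> x)"
    using f unfolding hol_at_def by blast
  show ?thesis
  proof (rule hol_atI[OF cont_at_cong[OF hol_at_cont[OF f] W] 0(1,2,3)])
    show "g x \<in> V" using W 0 by metis
    show "cdiff_at (mdim M) (mdim N) (\<lambda>w. \<psi> (g (inv_into U \<phi> w))) (\<phi> x)"
      by (rule chart_cong[where f = "\<lambda>y. \<psi> (f y)", OF mf_chart[OF M 0(1)] W(1) 0(3) W(2) 0(5)]) (simp add: W(3))
  qed
qed

lemma hol_at_compose:
  assumes M: "complex_manifold M" and N: "complex_manifold N" and P: "complex_manifold P"
    and f: "hol_at M N f x" and g: "hol_at N P g (f x)"
  shows "hol_at M P (\<lambda>x. g (f x)) x"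
proof -
  obtain U \<phi> where c: "(U, \<phi>) \<in> matlas M" "x \<in> U" using mf_cover[OF M] hol_at_mem[OF f] by metis
  obtain V \<psi> where d: "(V, \<psi>) \<in> matlas N" "f x \<in> V" using mf_cover[OF N] hol_at_mem[OF f] by metis
  obtain W \<kappa> where e: "(W, \<kappa>) \<in> matlas P" "g (f x) \<in> W" using mf_cover[OF P] hol_at_mem[OF g] by metis
  note cU = mf_chart[OF M c(1)] and cV = mf_chart[OF N d(1)]
  note 1 = hol_at_charts[OF M N f c d] and 2 = hol_at_charts[OF N P g d e]
  have "cdiff_at (mdim M) (mdim P) (\<lambda>w. (\<lambda>y. \<kappa> (g (inv_into V \<psi> y))) ((\<lambda>w. \<psi> (f (inv_into U \<phi> w))) w)) (\<phi> x)"
    by (rule cdiff_at_compose[OF 1]) (use 2 is_chartD(3)[OF cU] c in simp)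
  then have 3: "cdiff_at (mdim M) (mdim P) (\<lambda>w. (\<lambda>y. \<kappa> (g (inv_into V \<psi> (\<psi> (f y))))) (inv_into U \<phi> w)) (\<phi> x)" by simp
  obtain Q where Q: "openin (mtop M) Q" "x \<in> Q" "f ` Q \<subseteq> V"
    using cont_at_nbhd[OF hol_at_cont[OF f] is_chartD(1)[OF cV] d(2)] .
  show ?thesis
  proof (rule hol_atI[OF cont_at_compose[OF hol_at_cont[OF f] hol_at_cont[OF g]] c(1) e(1) c(2) e(2)])
    show "cdiff_at (mdim M) (mdim P) (\<lambda>w. \<kappa> (g (f (inv_into U \<phi> w)))) (\<phi> x)"
      by (rule chart_cong[where g = "\<lambda>y. \<kappa> (g (f y))", OF cU Q(1) c(2) Q(2) 3])
        (use Q(3) is_chartD(3)[OF cV] in auto)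
  qed
qed

lemma hol_at_id: "complex_manifold M \<Longrightarrow> x \<in> mcarrier M \<Longrightarrow> hol_at M M (\<lambda>x. x) x"
proof -
  assume M: "complex_manifold M" and x: "x \<in> mcarrier M"
  obtain U \<phi> where c: "(U, \<phi>) \<in> matlas M" "x \<in> U" using mf_cover[OF M x] .
  show ?thesis
    by (rule hol_atI[OF _ c(1) c(1) c(2) c(2) mf_transition[OF M c(1) c(1) c(2) c(2)]])
      (use x in \<open>auto simp: cont_at_def\<close>)
qed

lemma hol_at_const:
  assumes M: "complex_manifold M" and N: "complex_manifold N" and x: "x \<in> mcarrier M" and a: "a \<in> mcarrier N"
  shows "hol_at M N (\<lambda>_. a) x"
proof -
  obtain U \<phi> where c: "(U, \<phi>) \<in> matlas M" "x \<in> U" using mf_cover[OF M x] .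
  obtain V \<psi> where d: "(V, \<psi>) \<in> matlas N" "a \<in> V" using mf_cover[OF N a] .
  show ?thesis
  proof (rule hol_atI[OF _ c(1) d(1) c(2) d(2)])
    show "cont_at (mtop M) (mtop N) (\<lambda>_. a) x" using x a openin_topspace by (fastforce simp: cont_at_def)
    have o: "open_cs (mdim M) (complex_space (mdim M))" by simp
    show "cdiff_at (mdim M) (mdim N) (\<lambda>w. \<psi> a) (\<phi> x)"
      by (rule cdiff_at_sep_hol[OF o]) (use is_chartD(7)[OF mf_chart[OF M c(1)] c(2)]
          is_chartD(7)[OF mf_chart[OF N d(1)] d(2)] in \<open>auto intro: sep_hol_const\<close>)
  qed
qed

text \<open>The bridge from the global definition to pointwise arguments; continuity makes the
  domain of each chart expression open.\<close>

lemma holomorphic_map_iff: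
  assumes M: "complex_manifold M" and N: "complex_manifold N"
  shows "holomorphic_map M N f \<longleftrightarrow> (\<forall>x\<in>mcarrier M. hol_at M N f x)"
proof
  assume f: "holomorphic_map M N f"
  then have cf: "continuous_map (mtop M) (mtop N) f" by (simp add: holomorphic_map_def)
  show "\<forall>x\<in>mcarrier M. hol_at M N f x"
  proof
    fix x assume x: "x \<in> mcarrier M"
    obtain U \<phi> where c: "(U, \<phi>) \<in> matlas M" "x \<in> U" using mf_cover[OF M x] .
    have fx: "f x \<in> mcarrier N" using cf x by (auto simp: continuous_map_def)
    obtain V \<psi> where d: "(V, \<psi>) \<in> matlas N" "f x \<in> V" using mf_cover[OF N fx] .
    note cU = mf_chart[OF M c(1)] and cV = mf_chart[OF N d(1)]
    have "openin (mtop M) {y \<in> mcarrier M. f y \<in> V}"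
      using cf is_chartD(1)[OF cV] by (auto simp: continuous_map_def)
    then have "openin (mtop M) (U \<inter> {y \<in> mcarrier M. f y \<in> V})" using is_chartD(1)[OF cU] by blast
    moreover have "U \<inter> {y \<in> mcarrier M. f y \<in> V} = U \<inter> f -` V" using mf_chart_mem[OF M c(1)] by auto
    ultimately have o: "open_cs (mdim M) (\<phi> ` (U \<inter> f -` V))" by (intro chart_image_open[OF cU]) auto
    have "holomorphic_vec (mdim M) (mdim N) (\<phi> ` (U \<inter> f -` V)) (\<psi> \<circ> f \<circ> inv_into U \<phi>)"
      using f c d unfolding holomorphic_map_def by fast
    then have "cdiff_at (mdim M) (mdim N) (\<psi> \<circ> f \<circ> inv_into U \<phi>) (\<phi> x)"
      unfolding holomorphic_vec_iff[OF o] using c d by blast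
    then show "hol_at M N f x"
      using cf x by (intro hol_atI[where f = f and x = x, OF _ c(1) d(1) c(2) d(2)]) (auto simp: o_def continuous_map_iff_cont_at)
  qed
next
  assume f: "\<forall>x\<in>mcarrier M. hol_at M N f x"
  then have "\<forall>x\<in>mcarrier M. cont_at (mtop M) (mtop N) f x" by (simp add: hol_at_def)
  then have cf: "continuous_map (mtop M) (mtop N) f" by (simp add: continuous_map_iff_cont_at)
  have "holomorphic_vec (mdim M) (mdim N) (\<phi> ` (U \<inter> f -` V)) (\<psi> \<circ> f \<circ> inv_into U \<phi>)"
    if c: "(U, \<phi>) \<in> matlas M" and d: "(V, \<psi>) \<in> matlas N" for U \<phi> V \<psi>
  proof -
    note cU = mf_chart[OF M c] and cV = mf_chart[OF N d]
    have "openin (mtop M) {y \<in> mcarrier M. f y \<in> V}"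
      using cf is_chartD(1)[OF cV] by (auto simp: continuous_map_def)
    then have "openin (mtop M) (U \<inter> {y \<in> mcarrier M. f y \<in> V})" using is_chartD(1)[OF cU] by blast
    moreover have "U \<inter> {y \<in> mcarrier M. f y \<in> V} = U \<inter> f -` V" using mf_chart_mem[OF M c] by auto
    ultimately have o: "open_cs (mdim M) (\<phi> ` (U \<inter> f -` V))" by (intro chart_image_open[OF cU]) auto
    show ?thesis unfolding holomorphic_vec_iff[OF o] o_def
      using hol_at_charts[OF M N _ c _ d] f mf_chart_mem[OF M c] by auto
  qed
  then show "holomorphic_map M N f" unfolding holomorphic_map_def using cf by blast
qed

section \<open>The coordinate space as a manifold\<close>

abbreviation csm :: "nat \<Rightarrow> (nat \<Rightarrow> complex) cmanifold" where "csm \<equiv> complex_space_manifold"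

lemma csm_sel [simp]: "mdim (csm n) = n" "mtop (csm n) = top_of_set (complex_space n)"
  by (auto simp: complex_space_manifold_def)

lemma csm_manifold: "complex_manifold (csm n)"
  and csm_chart: "(complex_space n, \<lambda>z\<in>complex_space n. z) \<in> matlas (csm n)"
proof -
  let ?T = "top_of_set (complex_space n)" and ?c = "(complex_space n, \<lambda>z\<in>complex_space n. z)"
  have im: "(\<lambda>z\<in>complex_space n. z) ` complex_space n = complex_space n" by (auto simp: image_def)
  have inv: "inv_into (complex_space n) (\<lambda>z\<in>complex_space n. z) z = z" if "z \<in> complex_space n" for z
    using that by (metis (no_types, lifting) im f_inv_into_f inv_into_into restrict_apply')
  have oc: "open_cs n (complex_space n)" by simp
  have idc: "cont_at ?T ?T (\<lambda>z. z) z" if "z \<in> complex_space n" for z using that by (auto simp: cont_at_def)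
  have ch: "is_chart n ?T ?c"
  proof (rule is_chartI)
    show "open_cs n ((\<lambda>z\<in>complex_space n. z) ` complex_space n)" unfolding im by simp
    fix z :: "nat \<Rightarrow> complex" assume z: "z \<in> complex_space n"
    show "cont_at ?T ?T (\<lambda>z\<in>complex_space n. z) z" by (rule cont_at_cong[OF idc[OF z] oc z]) simp
    have "cont_at ?T ?T (inv_into (complex_space n) (\<lambda>z\<in>complex_space n. z)) z"
      by (rule cont_at_cong[OF idc[OF z] oc z]) (simp add: inv)
    then show "cont_at ?T ?T (inv_into (complex_space n) (\<lambda>z\<in>complex_space n. z)) ((\<lambda>z\<in>complex_space n. z) z)"
      using z by simp
  qed (auto simp: inj_on_def)
  have cd: "cdiff_at n n (\<lambda>w. (\<lambda>z\<in>complex_space n. z) (inv_into (complex_space n) (\<lambda>z\<in>complex_space n. z) w)) z"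
    if z: "z \<in> complex_space n" for z
    by (rule cdiff_at_cong[OF cdiff_at_id[OF z] oc z]) (simp add: inv)
  have comp: "charts_compatible n ?c ?c" unfolding chart_compatible_iff[OF ch ch] using cd by simp
  have "Hausdorff_space ?T" "second_countable ?T"
    by (auto intro: Hausdorff_space_subtopology second_countable_subtopology second_countable_euclidean)
  from generated_manifold[OF this, of "{?c}" n] ch comp
  show "complex_manifold (csm n)" "?c \<in> matlas (csm n)" by (auto simp: complex_space_manifold_def)
qed

lemma inv_csm_chart: "z \<in> complex_space n \<Longrightarrow> inv_into (complex_space n) (\<lambda>z\<in>complex_space n. z) z = z"
  by (metis (no_types, lifting) image_eqI f_inv_into_f inv_into_into restrict_apply')

text \<open>For maps into a coordinate space, continuity is a consequence of differentiability in
  one chart.\<close>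

lemma hol_at_csmI:
  assumes M: "complex_manifold M" and c: "(U, \<phi>) \<in> matlas M" "x \<in> U"
    and d: "cdiff_at (mdim M) m (\<lambda>w. f (inv_into U \<phi> w)) (\<phi> x)"
  shows "hol_at M (csm m) f x"
proof (rule hol_atI[OF _ c(1) csm_chart c(2)])
  note cU = mf_chart[OF M c(1)]
  have eq: "f (inv_into U \<phi> (\<phi> x)) = f x" using is_chartD(3)[OF cU] c by simp
  show fx: "f x \<in> complex_space m" using cdiff_at_space(2)[OF d] eq by simp
  have "cont_at (mtop M) (top_of_set (complex_space m)) (\<lambda>y. (\<lambda>w. f (inv_into U \<phi> w)) (\<phi> y)) x"
    by (rule cont_at_compose[OF is_chartD(5)[OF cU c(2)] cdiff_at_cont_at[OF d]])
  then show "cont_at (mtop M) (mtop (csm m)) f x"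
    unfolding csm_sel by (rule cont_at_cong[OF _ is_chartD(1)[OF cU] c(2)]) (use is_chartD(3)[OF cU] in simp)
  obtain S where S: "open_cs (mdim M) S" "\<phi> x \<in> S" "(\<lambda>w. f (inv_into U \<phi> w)) ` S \<subseteq> complex_space m"
    using d by (auto simp: cdiff_at_def)
  show "cdiff_at (mdim M) (mdim (csm m)) (\<lambda>w. (\<lambda>z\<in>complex_space m. z) (f (inv_into U \<phi> w))) (\<phi> x)"
    unfolding csm_sel by (rule cdiff_at_cong[OF d S(1,2)]) (use S(3) in auto)
qed

lemma hol_at_csmD:
  assumes M: "complex_manifold M" and c: "(U, \<phi>) \<in> matlas M" "x \<in> U" and f: "hol_at M (csm m) f x"
  shows "cdiff_at (mdim M) m (\<lambda>w. f (inv_into U \<phi> w)) (\<phi> x)"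
proof -
  have fx: "f x \<in> complex_space m" using hol_at_mem(2)[OF f] by simp
  have 1: "cdiff_at (mdim M) m (\<lambda>w. (\<lambda>y. (\<lambda>z\<in>complex_space m. z) (f y)) (inv_into U \<phi> w)) (\<phi> x)"
    using hol_at_charts[OF M csm_manifold f c csm_chart fx] by simp
  have o: "openin (mtop (csm m)) (complex_space m)" by simp
  obtain W where W: "openin (mtop M) W" "x \<in> W" "f ` W \<subseteq> complex_space m"
    using cont_at_nbhd[OF hol_at_cont[OF f] o fx] .
  show ?thesis by (rule chart_cong[OF mf_chart[OF M c(1)] W(1) c(2) W(2) 1]) (use W(3) in auto)
qed

lemma chart_hol:
  assumes M: "complex_manifold M" and c: "(U, \<phi>) \<in> matlas M" "x \<in> U"
  shows "hol_at M (csm (mdim M)) \<phi> x"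
  by (rule hol_at_csmI[OF M c mf_transition[OF M c(1) c(1) c(2) c(2)]])

lemma csm_csm: "hol_at (csm n) (csm m) f z \<longleftrightarrow> cdiff_at n m f z"
proof
  assume f: "hol_at (csm n) (csm m) f z"
  then have z: "z \<in> complex_space n" using hol_at_mem(1) by fastforce
  from hol_at_csmD[OF csm_manifold csm_chart z f] z
  have "cdiff_at n m (\<lambda>w. f (inv_into (complex_space n) (\<lambda>z\<in>complex_space n. z) w)) z" by simp
  then show "cdiff_at n m f z"
    by (rule cdiff_at_cong[where S = "complex_space n"]) (use z in \<open>auto simp: inv_csm_chart\<close>)
next
  assume f: "cdiff_at n m f z"
  then have z: "z \<in> complex_space n" using cdiff_at_space by blast
  have "cdiff_at n m (\<lambda>w. f (inv_into (complex_space n) (\<lambda>z\<in>complex_space n. z) w)) z"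
    by (rule cdiff_at_cong[OF f, where S = "complex_space n"]) (use z in \<open>auto simp: inv_csm_chart\<close>)
  then show "hol_at (csm n) (csm m) f z"
    using z by (intro hol_at_csmI[OF csm_manifold csm_chart z]) simp
qed

lemma inv_chart_hol:
  assumes M: "complex_manifold M" and c: "(U, \<phi>) \<in> matlas M" "x \<in> U"
  shows "hol_at (csm (mdim M)) M (inv_into U \<phi>) (\<phi> x)"
proof -
  note cU = mf_chart[OF M c(1)]
  have z: "\<phi> x \<in> complex_space (mdim M)" by (rule is_chartD(7)[OF cU c(2)])
  have eq: "inv_into U \<phi> (\<phi> x) = x" using is_chartD(3)[OF cU] c by simp
  show ?thesis
  proof (rule hol_atI[OF _ csm_chart c(1) z])
    show "cont_at (mtop (csm (mdim M))) (mtop M) (inv_into U \<phi>) (\<phi> x)"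
      using is_chartD(6)[OF cU c(2)] by simp
    show "inv_into U \<phi> (\<phi> x) \<in> U" using eq c by simp
    have "cdiff_at (mdim M) (mdim M) (\<lambda>w. \<phi> (inv_into U \<phi> (inv_into (complex_space (mdim M)) (\<lambda>z\<in>complex_space (mdim M). z) w))) (\<phi> x)"
      by (rule cdiff_at_cong[OF mf_transition[OF M c(1) c(1) c(2) c(2)], where S = "complex_space (mdim M)"])
        (use z in \<open>auto simp: inv_csm_chart\<close>)
    then show "cdiff_at (mdim (csm (mdim M))) (mdim M) (\<lambda>w. \<phi> (inv_into U \<phi> (inv_into (complex_space (mdim M))
         (\<lambda>z\<in>complex_space (mdim M). z) w))) ((\<lambda>z\<in>complex_space (mdim M). z) (\<phi> x))" using z by simp
  qed
qed

text \<open>By maximality of the atlas, an open subset with a biholomorphic map onto an open subset of the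
  coordinate space is a chart.\<close>

lemma biholomorphic_chart:
  assumes M: "complex_manifold M" and U: "openin (mtop M) U" and inj: "inj_on Y U"
    and o: "open_cs (mdim M) (Y ` U)"
    and h: "\<And>x. x \<in> U \<Longrightarrow> hol_at M (csm (mdim M)) Y x"
    and h': "\<And>x. x \<in> U \<Longrightarrow> hol_at (csm (mdim M)) M (inv_into U Y) (Y x)"
  shows "(U, restrict Y U) \<in> matlas M"
proof -
  let ?n = "mdim M" and ?Y = "restrict Y U"
  have im: "?Y ` U = Y ` U" by auto
  have inv: "inv_into U ?Y = inv_into U Y" by (auto simp: inv_into_def fun_eq_iff intro!: arg_cong[of _ _ Eps])
  have hY: "hol_at M (csm ?n) ?Y x" if "x \<in> U" for x
    by (rule hol_at_cong[OF M h[OF that] U that]) simp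
  have ch: "is_chart ?n (mtop M) (U, ?Y)"
  proof (rule is_chartI[OF U])
    show "inj_on ?Y U" using inj by (simp add: inj_on_def)
    show "open_cs ?n (?Y ` U)" using o by simp
    show "cont_at (mtop M) (top_of_set (complex_space ?n)) ?Y x" if "x \<in> U" for x
      using hol_at_cont[OF hY[OF that]] by simp
    show "cont_at (top_of_set (complex_space ?n)) (mtop M) (inv_into U ?Y) (?Y x)" if "x \<in> U" for x
      using hol_at_cont[OF h'[OF that]] that unfolding inv by simp
  qed simp
  have "charts_compatible ?n (U, ?Y) c" if c: "c \<in> matlas M" for c
  proof -
    obtain V \<psi> where c2: "c = (V, \<psi>)" by fastforce
    note cV = c[unfolded c2]
    show ?thesis unfolding c2 chart_compatible_iff[OF ch mf_chart[OF M cV]]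
    proof
      fix x assume x: "x \<in> U \<inter> V"
      have e1: "inv_into U Y (Y x) = x" using inj x by simp
      have "hol_at (csm ?n) (csm ?n) (\<lambda>w. \<psi> (inv_into U Y w)) (Y x)"
        by (rule hol_at_compose[OF csm_manifold M csm_manifold h']) (use x e1 chart_hol[OF M cV] in auto)
      moreover have "cdiff_at ?n ?n (\<lambda>w. ?Y (inv_into V \<psi> w)) (\<psi> x)"
        by (rule hol_at_csmD[OF M cV _ hY]) (use x in auto)
      ultimately show "cdiff_at ?n ?n (\<lambda>w. \<psi> (inv_into U ?Y w)) (?Y x) \<and> cdiff_at ?n ?n (\<lambda>w. ?Y (inv_into V \<psi> w)) (\<psi> x)"
        using x unfolding csm_csm inv by simp
    qed
  qed
  then show ?thesis using M ch unfolding complex_manifold_def by blast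
qed

lemma chart_restrict:
  assumes M: "complex_manifold M" and c: "(V, \<psi>) \<in> matlas M" and W: "openin (mtop M) W" "W \<subseteq> V"
  shows "(W, restrict \<psi> W) \<in> matlas M"
proof (rule biholomorphic_chart[OF M W(1)])
  note cV = mf_chart[OF M c]
  show inj: "inj_on \<psi> W" using is_chartD(3)[OF cV] W inj_on_subset by blast
  show o: "open_cs (mdim M) (\<psi> ` W)" by (rule chart_image_open[OF cV W])
  fix x assume x: "x \<in> W"
  then show "hol_at M (csm (mdim M)) \<psi> x" using chart_hol[OF M c] W by blast
  have eq: "inv_into V \<psi> y = inv_into W \<psi> y" if "y \<in> \<psi> ` W" for y
    using that W inj is_chartD(3)[OF cV] by (auto simp: inj_on_def subset_iff)
  show "hol_at (csm (mdim M)) M (inv_into W \<psi>) (\<psi> x)"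
    by (rule hol_at_cong[OF csm_manifold inv_chart_hol[OF M c], where W = "\<psi> ` W"]) (use x W o eq in auto)
qed

text \<open>If the identity is holomorphic both ways, the topologies agree and, by
  \<open>biholomorphic_chart\<close>, each chart of one manifold lies in the maximal atlas of the
  other. Equality, not just isomorphism, is what uniqueness of the canonical bundle asks
  for.\<close>

lemma manifold_eqI:
  assumes M: "complex_manifold M" and N: "complex_manifold N" and d: "mdim M = mdim N"
    and car: "mcarrier M = mcarrier N"
    and 1: "\<And>x. x \<in> mcarrier M \<Longrightarrow> hol_at M N (\<lambda>x. x) x" and 2: "\<And>x. x \<in> mcarrier M \<Longrightarrow> hol_at N M (\<lambda>x. x) x"
  shows "M = N"
proof -
  have top: "openin A U" if A: "\<And>x. x \<in> topspace A \<Longrightarrow> cont_at A B (\<lambda>x. x) x" and U: "openin B U" "topspace A = topspace B"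
    for A B :: "'a topology" and U
  proof -
    have "continuous_map A B (\<lambda>x. x)" using A by (simp add: continuous_map_iff_cont_at)
    then have "openin A {x \<in> topspace A. x \<in> U}" using U by (auto simp: continuous_map_def)
    moreover have "{x \<in> topspace A. x \<in> U} = U" using openin_subset[OF U(1)] U(2) by auto
    ultimately show ?thesis by simp
  qed
  have T: "mtop M = mtop N"
    unfolding topology_eq using top[of "mtop M" "mtop N"] top[of "mtop N" "mtop M"] 1 2 hol_at_cont car by metis
  have sub: "matlas A \<subseteq> matlas B"
    if A: "complex_manifold A" and B: "complex_manifold B" and dd: "mdim A = mdim B" and tt: "mtop A = mtop B"
      and AB: "\<And>x. x \<in> mcarrier A \<Longrightarrow> hol_at A B (\<lambda>x. x) x" and BA: "\<And>x. x \<in> mcarrier A \<Longrightarrow> hol_at B A (\<lambda>x. x) x"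
    for A B :: "'a cmanifold"
  proof
    fix c assume c: "c \<in> matlas A"
    obtain U \<phi> where c2: "c = (U, \<phi>)" by fastforce
    note cA = c[unfolded c2] note ch = mf_chart[OF A cA]
    have "(U, restrict \<phi> U) \<in> matlas B"
    proof (rule biholomorphic_chart[OF B])
      show "openin (mtop B) U" using is_chartD(1)[OF ch] tt by simp
      show inj: "inj_on \<phi> U" by (rule is_chartD(3)[OF ch])
      show "open_cs (mdim B) (\<phi> ` U)" using is_chartD(4)[OF ch] dd by simp
      fix x assume x: "x \<in> U"
      have xA: "x \<in> mcarrier A" using mf_chart_mem[OF A cA x] .
      show "hol_at B (csm (mdim B)) \<phi> x"
        using hol_at_compose[where f = "\<lambda>x. x" and x = x, OF B A csm_manifold BA[OF xA] chart_hol[OF A cA x]] dd by simp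
      have "inv_into U \<phi> (\<phi> x) = x" using inj x by simp
      then have "hol_at A B (\<lambda>x. x) (inv_into U \<phi> (\<phi> x))" using AB[OF xA] by simp
      from hol_at_compose[where g = "\<lambda>x. x" and f = "inv_into U \<phi>" and x = "\<phi> x", OF csm_manifold A B inv_chart_hol[OF A cA x] this]
      show "hol_at (csm (mdim B)) B (inv_into U \<phi>) (\<phi> x)" using dd by simp
    qed
    moreover have "restrict \<phi> U = \<phi>" using is_chartD(2)[OF ch] by (rule extensional_restrict)
    ultimately show "c \<in> matlas B" using c2 by simp
  qed
  have "matlas M = matlas N" using sub[OF M N d T 1 2] sub[OF N M d[symmetric] T[symmetric] 2 1] car by auto
  then show ?thesis using d T by (intro cmanifold.equality) auto
qed

section \<open>Products and open submanifolds\<close>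

lemma product_chart_eq:
  "product_chart m (U, \<phi>) (V, \<psi>) = (U \<times> V, restrict (\<lambda>p. join m (\<phi> (fst p)) (\<psi> (snd p))) (U \<times> V))"
  by (simp add: product_chart_def join_def)

lemma cont_at_join:
  assumes a: "cont_at X (top_of_set (complex_space m)) a x" and b: "cont_at X (top_of_set (complex_space n)) b x"
  shows "cont_at X (top_of_set (complex_space (m + n))) (\<lambda>y. join m (a y) (b y)) x"
  unfolding cont_at_def
proof (intro conjI allI impI)
  have ab: "a x \<in> complex_space m" "b x \<in> complex_space n" using a b by (auto simp: cont_at_def)
  show "x \<in> topspace X" using a by (simp add: cont_at_def)
  show "join m (a x) (b x) \<in> topspace (top_of_set (complex_space (m + n)))" using ab by simp
  fix V assume V: "open_cs (m + n) V \<and> join m (a x) (b x) \<in> V"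
  then obtain r where r: "r > 0" "pdisc (m + n) (join m (a x) (b x)) r \<subseteq> V" using open_cs_pdiscE by metis
  obtain U1 where U1: "openin X U1" "x \<in> U1" "a ` U1 \<subseteq> pdisc m (a x) r"
    using cont_at_nbhd[OF a open_cs_pdisc pdisc_centre[OF ab(1) r(1)]] .
  obtain U2 where U2: "openin X U2" "x \<in> U2" "b ` U2 \<subseteq> pdisc n (b x) r"
    using cont_at_nbhd[OF b open_cs_pdisc pdisc_centre[OF ab(2) r(1)]] .
  have "join m (a y) (b y) \<in> V" if y: "y \<in> U1 \<inter> U2" for y
  proof -
    have "a y \<in> pdisc m (a x) r" "b y \<in> pdisc n (b x) r" using y U1 U2 by auto
    then have "join m (a y) (b y) \<in> pdisc (m + n) (join m (a x) (b x)) r"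
      by (auto simp: pdisc_def) (auto simp: join_def)
    then show ?thesis using r by auto
  qed
  then show "\<exists>U. openin X U \<and> x \<in> U \<and> (\<lambda>y. join m (a y) (b y)) ` U \<subseteq> V"
    using U1 U2 by (intro exI[of _ "U1 \<inter> U2"]) auto
qed

context
  fixes M :: "'a cmanifold" and N :: "'b cmanifold"
  assumes M: "complex_manifold M" and N: "complex_manifold N"
begin

abbreviation "pch U \<phi> V \<psi> \<equiv> restrict (\<lambda>p. join (mdim M) (\<phi> (fst p)) (\<psi> (snd p))) (U \<times> V)"

lemma pch_inj:
  assumes c: "(U, \<phi>) \<in> matlas M" and d: "(V, \<psi>) \<in> matlas N"
  shows "inj_on (pch U \<phi> V \<psi>) (U \<times> V)"
proof (rule inj_onI)
  fix p q assume pq: "p \<in> U \<times> V" "q \<in> U \<times> V" "pch U \<phi> V \<psi> p = pch U \<phi> V \<psi> q"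
  note cU = mf_chart[OF M c] and cV = mf_chart[OF N d]
  have j: "join (mdim M) (\<phi> (fst p)) (\<psi> (snd p)) = join (mdim M) (\<phi> (fst q)) (\<psi> (snd q))" using pq by simp
  have sp: "\<phi> (fst p) \<in> complex_space (mdim M)" "\<phi> (fst q) \<in> complex_space (mdim M)"
    "\<psi> (snd p) \<in> complex_space (mdim N)" "\<psi> (snd q) \<in> complex_space (mdim N)"
    using pq is_chartD(7)[OF cU] is_chartD(7)[OF cV] by auto
  have "\<phi> (fst p) = \<phi> (fst q)" using arg_cong[OF j, of "pj1 (mdim M)"] by (simp only: pj_join(1)[OF sp(1)] pj_join(1)[OF sp(2)])
  moreover have "\<psi> (snd p) = \<psi> (snd q)"
    using arg_cong[OF j, of "pj2 (mdim M) (mdim N)"] by (simp only: pj_join(2)[OF sp(3)] pj_join(2)[OF sp(4)])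
  ultimately show "p = q"
    using pq inj_onD[OF is_chartD(3)[OF cU], of "fst p" "fst q"] inj_onD[OF is_chartD(3)[OF cV], of "snd p" "snd q"]
    by (simp add: prod_eq_iff mem_Times_iff)
qed

lemma pch_image:
  assumes c: "(U, \<phi>) \<in> matlas M" and d: "(V, \<psi>) \<in> matlas N"
  shows "pch U \<phi> V \<psi> ` (U \<times> V) = {z \<in> complex_space (mdim M + mdim N). pj1 (mdim M) z \<in> \<phi> ` U \<and> pj2 (mdim M) (mdim N) z \<in> \<psi> ` V}"
    (is "?L = ?R")
proof
  note cU = mf_chart[OF M c] and cV = mf_chart[OF N d]
  show "?L \<subseteq> ?R" using is_chartD(7)[OF cU] is_chartD(7)[OF cV] by auto
  show "?R \<subseteq> ?L"
  proof
    fix z assume z: "z \<in> ?R"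
    then obtain x y where xy: "x \<in> U" "y \<in> V" "pj1 (mdim M) z = \<phi> x" "pj2 (mdim M) (mdim N) z = \<psi> y" by auto
    have "z = join (mdim M) (\<phi> x) (\<psi> y)" using join_pj[of z "mdim M" "mdim N"] z xy by simp
    then show "z \<in> ?L" using xy by (intro image_eqI[of _ _ "(x, y)"]) auto
  qed
qed

lemma pch_inv:
  assumes c: "(U, \<phi>) \<in> matlas M" and d: "(V, \<psi>) \<in> matlas N" and z: "z \<in> pch U \<phi> V \<psi> ` (U \<times> V)"
  shows "inv_into (U \<times> V) (pch U \<phi> V \<psi>) z = (inv_into U \<phi> (pj1 (mdim M) z), inv_into V \<psi> (pj2 (mdim M) (mdim N) z))"
proof -
  note cU = mf_chart[OF M c] and cV = mf_chart[OF N d]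
  obtain x y where xy: "x \<in> U" "y \<in> V" "z = join (mdim M) (\<phi> x) (\<psi> y)" using z by auto
  have "inv_into (U \<times> V) (pch U \<phi> V \<psi>) (pch U \<phi> V \<psi> (x, y)) = (x, y)"
    by (rule inv_into_f_f[OF pch_inj[OF c d]]) (use xy in simp)
  then show ?thesis using xy is_chartD(3,7)[OF cU] is_chartD(3,7)[OF cV] by simp
qed

lemma pch_is_chart:
  assumes c: "(U, \<phi>) \<in> matlas M" and d: "(V, \<psi>) \<in> matlas N"
  shows "is_chart (mdim M + mdim N) (prod_topology (mtop M) (mtop N)) (U \<times> V, pch U \<phi> V \<psi>)"
proof (rule is_chartI)
  let ?m = "mdim M" and ?n = "mdim N" and ?T = "prod_topology (mtop M) (mtop N)" and ?P = "pch U \<phi> V \<psi>"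
  note cU = mf_chart[OF M c] and cV = mf_chart[OF N d]
  show UV: "openin ?T (U \<times> V)" using is_chartD(1)[OF cU] is_chartD(1)[OF cV] by (simp add: openin_prod_Times_iff)
  show "inj_on ?P (U \<times> V)" by (rule pch_inj[OF c d])
  show o: "open_cs (?m + ?n) (?P ` (U \<times> V))"
    unfolding pch_image[OF c d]
  proof (subst openin_subopen, intro ballI)
    fix z assume z: "z \<in> {z \<in> complex_space (?m + ?n). pj1 ?m z \<in> \<phi> ` U \<and> pj2 ?m ?n z \<in> \<psi> ` V}"
    obtain S1 where S1: "open_cs (?m + ?n) S1" "z \<in> S1" "pj1 ?m ` S1 \<subseteq> \<phi> ` U"
      using cdiff_at_continuous[OF cdiff_at_pj1 is_chartD(4)[OF cU]] z by blast
    obtain S2 where S2: "open_cs (?m + ?n) S2" "z \<in> S2" "pj2 ?m ?n ` S2 \<subseteq> \<psi> ` V"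
      using cdiff_at_continuous[OF cdiff_at_pj2 is_chartD(4)[OF cV]] z by blast
    show "\<exists>T. open_cs (?m + ?n) T \<and> z \<in> T \<and> T \<subseteq> {z \<in> complex_space (?m + ?n). pj1 ?m z \<in> \<phi> ` U \<and> pj2 ?m ?n z \<in> \<psi> ` V}"
      using S1 S2 open_cs_subset[OF S1(1)] by (intro exI[of _ "S1 \<inter> S2"]) auto
  qed
  fix p assume p: "p \<in> U \<times> V"
  then have pT: "p \<in> topspace ?T" using UV openin_subset by blast
  have "cont_at ?T (top_of_set (complex_space ?m)) (\<lambda>p. \<phi> (fst p)) p"
    by (rule cont_at_compose[OF cont_at_fst[OF pT] is_chartD(5)[OF cU]]) (use p in auto)
  moreover have "cont_at ?T (top_of_set (complex_space ?n)) (\<lambda>p. \<psi> (snd p)) p"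
    by (rule cont_at_compose[OF cont_at_snd[OF pT] is_chartD(5)[OF cV]]) (use p in auto)
  ultimately have "cont_at ?T (top_of_set (complex_space (?m + ?n))) (\<lambda>p. join ?m (\<phi> (fst p)) (\<psi> (snd p))) p"
    by (rule cont_at_join)
  then show "cont_at ?T (top_of_set (complex_space (?m + ?n))) ?P p"
    by (rule cont_at_cong[OF _ UV p]) simp
  let ?z = "?P p"
  have zc: "?z \<in> complex_space (?m + ?n)" and zz: "pj1 ?m ?z = \<phi> (fst p)" "pj2 ?m ?n ?z = \<psi> (snd p)"
    using p is_chartD(7)[OF cU] is_chartD(7)[OF cV] by auto
  have fU: "fst p \<in> U" and sV: "snd p \<in> V" using p by auto
  have "cont_at (top_of_set (complex_space (?m + ?n))) ?T
      (\<lambda>z. (inv_into U \<phi> (pj1 ?m z), inv_into V \<psi> (pj2 ?m ?n z))) ?z"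
  proof (rule cont_at_pair)
    show "cont_at (top_of_set (complex_space (?m + ?n))) (mtop M) (\<lambda>z. fst (inv_into U \<phi> (pj1 ?m z), inv_into V \<psi> (pj2 ?m ?n z))) ?z"
      unfolding fst_conv
      by (rule cont_at_compose[OF cdiff_at_cont_at[OF cdiff_at_pj1[OF zc]]]) (use is_chartD(6)[OF cU fU] zz in simp)
    show "cont_at (top_of_set (complex_space (?m + ?n))) (mtop N) (\<lambda>z. snd (inv_into U \<phi> (pj1 ?m z), inv_into V \<psi> (pj2 ?m ?n z))) ?z"
      unfolding snd_conv
      by (rule cont_at_compose[OF cdiff_at_cont_at[OF cdiff_at_pj2[OF zc]]]) (use is_chartD(6)[OF cV sV] zz in simp)
  qed
  then show "cont_at (top_of_set (complex_space (?m + ?n))) ?T (inv_into (U \<times> V) ?P) ?z"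
    by (rule cont_at_cong[OF _ o]) (use p pch_inv[OF c d] in auto)
qed simp

text \<open>With chart maps for \<open>f\<close> and \<open>g\<close> this is the compatibility of
  product charts.\<close>

lemma pch_transition:
  assumes c: "(U, \<phi>) \<in> matlas M" and d: "(V, \<psi>) \<in> matlas N" and p: "p \<in> U \<times> V"
    and f: "cdiff_at (mdim M) k (\<lambda>w. f (inv_into U \<phi> w)) (\<phi> (fst p))"
    and g: "cdiff_at (mdim N) l (\<lambda>w. g (inv_into V \<psi> w)) (\<psi> (snd p))"
  shows "cdiff_at (mdim M + mdim N) (k + l)
    (\<lambda>w. join k (f (fst (inv_into (U \<times> V) (pch U \<phi> V \<psi>) w))) (g (snd (inv_into (U \<times> V) (pch U \<phi> V \<psi>) w)))) (pch U \<phi> V \<psi> p)"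
proof -
  let ?m = "mdim M" and ?n = "mdim N" and ?P = "pch U \<phi> V \<psi>"
  note cU = mf_chart[OF M c] and cV = mf_chart[OF N d]
  have zc: "?P p \<in> complex_space (?m + ?n)" and zz: "pj1 ?m (?P p) = \<phi> (fst p)" "pj2 ?m ?n (?P p) = \<psi> (snd p)"
    using p is_chartD(7)[OF cU] is_chartD(7)[OF cV] by auto
  have "cdiff_at (?m + ?n) (k + l)
    (\<lambda>w. join k ((\<lambda>w. f (inv_into U \<phi> w)) (pj1 ?m w)) ((\<lambda>w. g (inv_into V \<psi> w)) (pj2 ?m ?n w))) (?P p)"
    by (intro cdiff_at_join cdiff_at_compose[OF cdiff_at_pj1[OF zc]] cdiff_at_compose[OF cdiff_at_pj2[OF zc]])
      (use zz f g in simp_all)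
  then show ?thesis
    by (rule cdiff_at_cong[OF _ is_chartD(4)[OF pch_is_chart[OF c d]]])
      (use p pch_inv[OF c d] in auto)
qed

lemma product_manifold_complex: "complex_manifold (product_manifold M N)"
  and product_chart_mem: "(U, \<phi>) \<in> matlas M \<Longrightarrow> (V, \<psi>) \<in> matlas N \<Longrightarrow> (U \<times> V, pch U \<phi> V \<psi>) \<in> matlas (product_manifold M N)"
proof -
  let ?m = "mdim M" and ?n = "mdim N" and ?T = "prod_topology (mtop M) (mtop N)"
  let ?A = "{product_chart ?m c c' | c c'. c \<in> matlas M \<and> c' \<in> matlas N}"
  have A: "\<exists>U \<phi> V \<psi>. (U, \<phi>) \<in> matlas M \<and> (V, \<psi>) \<in> matlas N \<and> a = (U \<times> V, pch U \<phi> V \<psi>)" if a: "a \<in> ?A" for a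
  proof -
    obtain c d where cd: "c \<in> matlas M" "d \<in> matlas N" "a = product_chart ?m c d" using a by auto
    show ?thesis using cd by (cases c; cases d) (auto simp: product_chart_eq)
  qed
  have A': "(U \<times> V, pch U \<phi> V \<psi>) \<in> ?A" if "(U, \<phi>) \<in> matlas M" "(V, \<psi>) \<in> matlas N" for U \<phi> V \<psi>
    unfolding mem_Collect_eq
    by (intro exI[of _ "(U, \<phi>)"] exI[of _ "(V, \<psi>)"] conjI that product_chart_eq[symmetric])
  have ch: "is_chart (?m + ?n) ?T a" if "a \<in> ?A" for a
    using A[OF that] pch_is_chart by blast
  have comp: "charts_compatible (?m + ?n) a b" if ab: "a \<in> ?A" "b \<in> ?A" for a b
  proof -
    obtain U \<phi> V \<psi> where a: "(U, \<phi>) \<in> matlas M" "(V, \<psi>) \<in> matlas N" "a = (U \<times> V, pch U \<phi> V \<psi>)" using A[OF ab(1)] by blast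
    obtain U' \<phi>' V' \<psi>' where b: "(U', \<phi>') \<in> matlas M" "(V', \<psi>') \<in> matlas N" "b = (U' \<times> V', pch U' \<phi>' V' \<psi>')" using A[OF ab(2)] by blast
    have half: "cdiff_at (?m + ?n) (?m + ?n) (\<lambda>w. pch U' \<phi>' V' \<psi>' (inv_into (U \<times> V) (pch U \<phi> V \<psi>) w)) (pch U \<phi> V \<psi> p)"
      if a: "(U, \<phi>) \<in> matlas M" "(V, \<psi>) \<in> matlas N" and b: "(U', \<phi>') \<in> matlas M" "(V', \<psi>') \<in> matlas N"
        and p: "p \<in> (U \<times> V) \<inter> (U' \<times> V')" for U \<phi> V \<psi> U' \<phi>' V' \<psi>' p
    proof -
      have pp: "p \<in> U \<times> V" "p \<in> U' \<times> V'" "fst p \<in> U" "fst p \<in> U'" "snd p \<in> V" "snd p \<in> V'" using p by auto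
      have "cdiff_at (?m + ?n) (?m + ?n) (\<lambda>w. (\<lambda>q. join ?m (\<phi>' (fst q)) (\<psi>' (snd q))) (inv_into (U \<times> V) (pch U \<phi> V \<psi>) w)) (pch U \<phi> V \<psi> p)"
        using pch_transition[OF a pp(1) mf_transition[OF M a(1) b(1) pp(3,4)] mf_transition[OF N a(2) b(2) pp(5,6)]] .
      then show ?thesis
        by (rule chart_cong[OF pch_is_chart[OF a] is_chartD(1)[OF pch_is_chart[OF b]] pp(1,2)]) simp
    qed
    show ?thesis
      unfolding a(3) b(3) chart_compatible_iff[OF pch_is_chart[OF a(1,2)] pch_is_chart[OF b(1,2)]]
      using half[OF a(1,2) b(1,2)] half[OF b(1,2) a(1,2)] by blast
  qed
  have cov: "(\<Union>a\<in>?A. fst a) = topspace ?T"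
  proof
    show "(\<Union>a\<in>?A. fst a) \<subseteq> topspace ?T"
    proof
      fix p assume "p \<in> (\<Union>a\<in>?A. fst a)"
      then obtain a where "a \<in> ?A" "p \<in> fst a" by blast
      then obtain U \<phi> where "is_chart (?m + ?n) ?T (U, \<phi>)" "p \<in> U" using ch[of a] by (cases a) auto
      then show "p \<in> topspace ?T" using is_chartD(1) openin_subset by blast
    qed
    show "topspace ?T \<subseteq> (\<Union>a\<in>?A. fst a)"
    proof
      fix p assume "p \<in> topspace ?T"
      then have "fst p \<in> mcarrier M" "snd p \<in> mcarrier N" by auto
      then obtain U \<phi> where U: "(U, \<phi>) \<in> matlas M" "fst p \<in> U" using mf_cover[OF M] by blast
      obtain V \<psi> where "(V, \<psi>) \<in> matlas N" "snd p \<in> V" using mf_cover[OF N \<open>snd p \<in> mcarrier N\<close>] .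
      with U show "p \<in> (\<Union>a\<in>?A. fst a)" using A'[of U \<phi> V \<psi>] by (intro UN_I[of "(U \<times> V, pch U \<phi> V \<psi>)"]) (auto simp: mem_Times_iff)
    qed
  qed
  have "Hausdorff_space ?T" "second_countable ?T"
    using M N by (auto simp: complex_manifold_def Hausdorff_space_prod_topology second_countable_prod)
  note G = generated_manifold[OF this ch cov comp]
  show "complex_manifold (product_manifold M N)" unfolding product_manifold_def by (rule G(1))
  show "(U \<times> V, pch U \<phi> V \<psi>) \<in> matlas (product_manifold M N)" if "(U, \<phi>) \<in> matlas M" "(V, \<psi>) \<in> matlas N"
    unfolding product_manifold_def using subsetD[OF G(2) A'[OF that]] by simp
qed

lemma product_sel: "mdim (product_manifold M N) = mdim M + mdim N"
  "mtop (product_manifold M N) = prod_topology (mtop M) (mtop N)"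
  by (auto simp: product_manifold_def)

lemma hol_at_pr:
  assumes p: "p \<in> mcarrier (product_manifold M N)"
  shows "hol_at (product_manifold M N) M fst p" "hol_at (product_manifold M N) N snd p"
proof -
  have pm: "fst p \<in> mcarrier M" "snd p \<in> mcarrier N" using p by (auto simp: product_sel)
  obtain U \<phi> where c: "(U, \<phi>) \<in> matlas M" "fst p \<in> U" using mf_cover[OF M pm(1)] .
  obtain V \<psi> where d: "(V, \<psi>) \<in> matlas N" "snd p \<in> V" using mf_cover[OF N pm(2)] .
  have pUV: "p \<in> U \<times> V" using c d by (simp add: mem_Times_iff)
  note mem = product_chart_mem[OF c(1) d(1)] and ic = pch_is_chart[OF c(1) d(1)]
  have zc: "pch U \<phi> V \<psi> p \<in> complex_space (mdim M + mdim N)" by (rule is_chartD(7)[OF ic pUV])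
  have zi: "pch U \<phi> V \<psi> p \<in> pch U \<phi> V \<psi> ` (U \<times> V)" using pUV by blast
  note cU = mf_chart[OF M c(1)] and cV = mf_chart[OF N d(1)]
  have f: "\<phi> (fst (inv_into (U \<times> V) (pch U \<phi> V \<psi>) w)) = pj1 (mdim M) w"
    "\<psi> (snd (inv_into (U \<times> V) (pch U \<phi> V \<psi>) w)) = pj2 (mdim M) (mdim N) w"
    if "w \<in> pch U \<phi> V \<psi> ` (U \<times> V)" for w
    using that pch_inv[OF c(1) d(1) that] unfolding pch_image[OF c(1) d(1)] by (auto simp: f_inv_into_f)
  show "hol_at (product_manifold M N) M fst p"
  proof (rule hol_atI[where f = fst and x = p, OF _ mem c(1) pUV c(2)])
    show "cont_at (mtop (product_manifold M N)) (mtop M) fst p"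
      using p unfolding product_sel by (rule cont_at_fst)
    show "cdiff_at (mdim (product_manifold M N)) (mdim M) (\<lambda>w. \<phi> (fst (inv_into (U \<times> V) (pch U \<phi> V \<psi>) w))) (pch U \<phi> V \<psi> p)"
      unfolding product_sel by (rule cdiff_at_cong[OF cdiff_at_pj1[OF zc] is_chartD(4)[OF ic] zi]) (simp only: f)
  qed
  show "hol_at (product_manifold M N) N snd p"
  proof (rule hol_atI[where f = snd and x = p, OF _ mem d(1) pUV d(2)])
    show "cont_at (mtop (product_manifold M N)) (mtop N) snd p"
      using p unfolding product_sel by (rule cont_at_snd)
    show "cdiff_at (mdim (product_manifold M N)) (mdim N) (\<lambda>w. \<psi> (snd (inv_into (U \<times> V) (pch U \<phi> V \<psi>) w))) (pch U \<phi> V \<psi> p)"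
      unfolding product_sel by (rule cdiff_at_cong[OF cdiff_at_pj2[OF zc] is_chartD(4)[OF ic] zi]) (simp only: f)
  qed
qed

text \<open>With \<open>hol_at_pr\<close> this is the universal property of the product; from here
  on, maps into products are handled by components.\<close>

lemma hol_at_pair:
  assumes P: "complex_manifold P" and f: "hol_at P M (\<lambda>x. fst (f x)) x" "hol_at P N (\<lambda>x. snd (f x)) x"
  shows "hol_at P (product_manifold M N) f x"
proof -
  have xm: "x \<in> mcarrier P" "fst (f x) \<in> mcarrier M" "snd (f x) \<in> mcarrier N"
    using hol_at_mem[OF f(1)] hol_at_mem[OF f(2)] by auto
  obtain W \<kappa> where e: "(W, \<kappa>) \<in> matlas P" "x \<in> W" using mf_cover[OF P xm(1)] .
  obtain U \<phi> where c: "(U, \<phi>) \<in> matlas M" "fst (f x) \<in> U" using mf_cover[OF M xm(2)] .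
  obtain V \<psi> where d: "(V, \<psi>) \<in> matlas N" "snd (f x) \<in> V" using mf_cover[OF N xm(3)] .
  note mem = product_chart_mem[OF c(1) d(1)] and ic = pch_is_chart[OF c(1) d(1)]
  have fx: "f x \<in> U \<times> V" using c d by (simp add: mem_Times_iff)
  have cont: "cont_at (mtop P) (prod_topology (mtop M) (mtop N)) f x"
    by (rule cont_at_pair[OF hol_at_cont[OF f(1)] hol_at_cont[OF f(2)]])
  obtain Q where Q: "openin (mtop P) Q" "x \<in> Q" "f ` Q \<subseteq> U \<times> V"
    using cont_at_nbhd[OF cont is_chartD(1)[OF ic] fx] .
  have "cdiff_at (mdim P) (mdim M + mdim N) (\<lambda>w. (\<lambda>y. join (mdim M) (\<phi> (fst (f y))) (\<psi> (snd (f y)))) (inv_into W \<kappa> w)) (\<kappa> x)"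
    by (rule cdiff_at_join[OF hol_at_charts[OF P M f(1) e c] hol_at_charts[OF P N f(2) e d]])
  then have "cdiff_at (mdim P) (mdim M + mdim N) (\<lambda>w. (\<lambda>y. pch U \<phi> V \<psi> (f y)) (inv_into W \<kappa> w)) (\<kappa> x)"
    by (rule chart_cong[OF mf_chart[OF P e(1)] Q(1) e(2) Q(2)]) (use Q(3) in auto)
  then show ?thesis
    using cont by (intro hol_atI[where f = f and x = x, OF _ e(1) mem e(2) fx]) (simp_all add: product_sel)
qed

end

section \<open>Open submanifolds\<close>

lemma is_chart_subtopology:
  assumes S: "openin T S"
  shows "is_chart n (subtopology T S) (U, \<phi>) \<longleftrightarrow> is_chart n T (U, \<phi>) \<and> U \<subseteq> S"
proof -
  have "subtopology (subtopology T S) U = subtopology T U" if "U \<subseteq> S"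
    using that by (simp add: subtopology_subtopology Int_absorb1)
  then show ?thesis unfolding is_chart_def using S by (auto simp: openin_open_subtopology)
qed

lemma open_submanifold_sel:
  "mdim (open_submanifold M S) = mdim M" "mtop (open_submanifold M S) = subtopology (mtop M) S"
  "c \<in> matlas (open_submanifold M S) \<longleftrightarrow> c \<in> matlas M \<and> fst c \<subseteq> S"
  by (auto simp: open_submanifold_def)

lemma open_submanifold_carrier: "openin (mtop M) S \<Longrightarrow> mcarrier (open_submanifold M S) = S"
  using openin_subset by (auto simp: open_submanifold_sel)

lemma open_submanifold_cover:
  assumes M: "complex_manifold M" and S: "openin (mtop M) S" and c: "(U, \<phi>) \<in> matlas M" "x \<in> U" "x \<in> S"
  shows "(U \<inter> S, restrict \<phi> (U \<inter> S)) \<in> matlas (open_submanifold M S)"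
  unfolding open_submanifold_sel using chart_restrict[OF M c(1), of "U \<inter> S"] is_chartD(1)[OF mf_chart[OF M c(1)]] S by auto

text \<open>The point is maximality: a chart compatible with the restricted charts of
  \<open>M\<close> is biholomorphic onto its image, hence a chart of \<open>M\<close> by
  \<open>biholomorphic_chart\<close>.\<close>

lemma open_submanifold_manifold:
  assumes M: "complex_manifold M" and S: "openin (mtop M) S"
  shows "complex_manifold (open_submanifold M S)"
  unfolding complex_manifold_def
proof (intro conjI allI ballI impI)
  let ?S = "open_submanifold M S" and ?n = "mdim M"
  show "Hausdorff_space (mtop ?S)" "second_countable (mtop ?S)"
    using M by (auto simp: open_submanifold_sel complex_manifold_def Hausdorff_space_subtopology second_countable_subtopology)
  show ch: "is_chart (mdim ?S) (mtop ?S) c" if "c \<in> matlas ?S" for c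
    using that mf_chart[OF M] is_chart_subtopology[OF S] unfolding open_submanifold_sel by (metis prod.collapse)
  show "charts_compatible (mdim ?S) c c'" if "c \<in> matlas ?S" "c' \<in> matlas ?S" for c c'
    using that M unfolding open_submanifold_sel complex_manifold_def by blast
  show "(\<Union>c\<in>matlas ?S. fst c) = mcarrier ?S"
  proof
    show "(\<Union>c\<in>matlas ?S. fst c) \<subseteq> mcarrier ?S"
      unfolding open_submanifold_carrier[OF S] by (auto simp: open_submanifold_sel)
    show "mcarrier ?S \<subseteq> (\<Union>c\<in>matlas ?S. fst c)"
    proof
      fix x assume "x \<in> mcarrier ?S"
      then have x: "x \<in> S" "x \<in> mcarrier M" using S openin_subset open_submanifold_carrier by blast+
      obtain U \<phi> where c: "(U, \<phi>) \<in> matlas M" "x \<in> U" using mf_cover[OF M x(2)] .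
      show "x \<in> (\<Union>c\<in>matlas ?S. fst c)"
        by (rule UN_I[OF open_submanifold_cover[OF M S c x(1)]]) (use c x in simp)
    qed
  qed
  fix c assume c: "is_chart (mdim ?S) (mtop ?S) c \<and> (\<forall>c'\<in>matlas ?S. charts_compatible (mdim ?S) c c')"
  obtain U \<phi> where c2: "c = (U, \<phi>)" by fastforce
  have chS: "is_chart ?n (subtopology (mtop M) S) (U, \<phi>)" using c c2 by (simp add: open_submanifold_sel)
  then have ic: "is_chart ?n (mtop M) (U, \<phi>)" and US: "U \<subseteq> S" using is_chart_subtopology[OF S] by auto
  have key: "\<exists>V \<psi>. (V, \<psi>) \<in> matlas M \<and> x \<in> V \<and> cdiff_at ?n ?n (\<lambda>w. \<psi> (inv_into U \<phi> w)) (\<phi> x) \<and> cdiff_at ?n ?n (\<lambda>w. \<phi> (inv_into V \<psi> w)) (\<psi> x)"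
    if x: "x \<in> U" for x
  proof -
    have xM: "x \<in> mcarrier M" using x is_chartD(1)[OF ic] openin_subset by blast
    obtain V \<psi> where d: "(V, \<psi>) \<in> matlas M" "x \<in> V" using mf_cover[OF M xM] .
    have xS: "x \<in> S" using x US by auto
    note dS = open_submanifold_cover[OF M S d xS]
    have "charts_compatible ?n (U, \<phi>) (V \<inter> S, restrict \<psi> (V \<inter> S))" using c dS c2 by (simp add: open_submanifold_sel)
    then show ?thesis
      using chart_compatible_iff[OF chS] ch[OF dS] dS d x xS by (intro exI[of _ "V \<inter> S"] exI[of _ "restrict \<psi> (V \<inter> S)"]) (simp add: open_submanifold_sel)
  qed
  have "(U, restrict \<phi> U) \<in> matlas M"
  proof (rule biholomorphic_chart[OF M is_chartD(1)[OF ic] is_chartD(3)[OF ic] is_chartD(4)[OF ic]])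
    fix x assume x: "x \<in> U"
    obtain V \<psi> where d: "(V, \<psi>) \<in> matlas M" "x \<in> V" "cdiff_at ?n ?n (\<lambda>w. \<psi> (inv_into U \<phi> w)) (\<phi> x)"
      "cdiff_at ?n ?n (\<lambda>w. \<phi> (inv_into V \<psi> w)) (\<psi> x)" using key[OF x] by blast
    show "hol_at M (csm ?n) \<phi> x" by (rule hol_at_csmI[OF M d(1,2,4)])
    have e: "inv_into U \<phi> (\<phi> x) = x" using is_chartD(3)[OF ic] x by simp
    have zc: "\<phi> x \<in> complex_space ?n" by (rule is_chartD(7)[OF ic x])
    show "hol_at (csm ?n) M (inv_into U \<phi>) (\<phi> x)"
    proof (rule hol_atI[where f = "inv_into U \<phi>" and x = "\<phi> x", OF _ csm_chart d(1) zc])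
      show "cont_at (mtop (csm ?n)) (mtop M) (inv_into U \<phi>) (\<phi> x)" using is_chartD(6)[OF ic x] by simp
      show "inv_into U \<phi> (\<phi> x) \<in> V" using e d by simp
      have "cdiff_at ?n ?n (\<lambda>w. \<psi> (inv_into U \<phi> (inv_into (complex_space ?n) (\<lambda>z\<in>complex_space ?n. z) w))) (\<phi> x)"
        by (rule cdiff_at_cong[OF d(3), where S = "complex_space ?n"]) (use zc in \<open>auto simp: inv_csm_chart\<close>)
      then show "cdiff_at (mdim (csm ?n)) ?n (\<lambda>w. \<psi> (inv_into U \<phi> (inv_into (complex_space ?n) (\<lambda>z\<in>complex_space ?n. z) w)))
         ((\<lambda>z\<in>complex_space ?n. z) (\<phi> x))" using zc by simp
    qed
  qed
  then show "c \<in> matlas ?S" using extensional_restrict[OF is_chartD(2)[OF ic]] US c2 by (simp add: open_submanifold_sel)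
qed

lemma hol_at_open_submanifold_dom:
  assumes M: "complex_manifold M" and N: "complex_manifold N" and S: "openin (mtop M) S" "x \<in> S"
  shows "hol_at (open_submanifold M S) N f x \<longleftrightarrow> hol_at M N f x"
proof
  assume "hol_at (open_submanifold M S) N f x"
  then show "hol_at M N f x" unfolding hol_at_def open_submanifold_sel using cont_at_subtopology_dom[OF S] by blast
next
  assume f: "hol_at M N f x"
  obtain U \<phi> where c: "(U, \<phi>) \<in> matlas M" "x \<in> U" using mf_cover[OF M hol_at_mem(1)[OF f]] .
  obtain V \<psi> where d: "(V, \<psi>) \<in> matlas N" "f x \<in> V" using mf_cover[OF N hol_at_mem(2)[OF f]] .
  note cS = open_submanifold_cover[OF M S(1) c S(2)]
  then have cM: "(U \<inter> S, restrict \<phi> (U \<inter> S)) \<in> matlas M" by (simp add: open_submanifold_sel)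
  have xx: "x \<in> U \<inter> S" using c S by simp
  show "hol_at (open_submanifold M S) N f x"
    by (rule hol_atI[where f = f and x = x, OF _ cS d(1) xx d(2)])
      (use cont_at_subtopology_dom[OF S, of "mtop N" f] hol_at_cont[OF f] hol_at_charts[OF M N f cM xx d] in
        \<open>simp_all only: open_submanifold_sel\<close>)
qed

lemma hol_at_open_submanifold_cod:
  assumes M: "complex_manifold M" and N: "complex_manifold N" and S: "openin (mtop N) S"
  shows "hol_at M (open_submanifold N S) f x \<longleftrightarrow> hol_at M N f x \<and> f x \<in> S"
proof
  assume f: "hol_at M (open_submanifold N S) f x"
  then have "f x \<in> S" using hol_at_mem(2)[OF f] open_submanifold_carrier[OF S] by simp
  moreover have "hol_at M N f x"
  proof -
    obtain U \<phi> V \<psi> where c: "(U, \<phi>) \<in> matlas M" "(V, \<psi>) \<in> matlas (open_submanifold N S)" "x \<in> U" "f x \<in> V"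
      "cdiff_at (mdim M) (mdim (open_submanifold N S)) (\<lambda>w. \<psi> (f (inv_into U \<phi> w))) (\<phi> x)"
      using f unfolding hol_at_def by blast
    have "cont_at (mtop M) (mtop N) f x"
      using hol_at_cont[OF f] unfolding open_submanifold_sel by (rule cont_at_subtopology_codD)
    then show ?thesis using c unfolding open_submanifold_sel by (intro hol_atI[where f = f and x = x]) auto
  qed
  ultimately show "hol_at M N f x \<and> f x \<in> S" by simp
next
  assume "hol_at M N f x \<and> f x \<in> S"
  then have f: "hol_at M N f x" and fx: "f x \<in> S" by auto
  obtain U \<phi> where c: "(U, \<phi>) \<in> matlas M" "x \<in> U" using mf_cover[OF M hol_at_mem(1)[OF f]] .
  obtain V \<psi> where d: "(V, \<psi>) \<in> matlas N" "f x \<in> V" using mf_cover[OF N hol_at_mem(2)[OF f]] .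
  note dS = open_submanifold_cover[OF N S(1) d fx]
  then have dN: "(V \<inter> S, restrict \<psi> (V \<inter> S)) \<in> matlas N" by (simp add: open_submanifold_sel)
  have fxx: "f x \<in> V \<inter> S" using d fx by simp
  obtain W where W: "openin (mtop M) W" "x \<in> W" "f ` W \<subseteq> S" using cont_at_nbhd[OF hol_at_cont[OF f] S fx] .
  show "hol_at M (open_submanifold N S) f x"
    by (rule hol_atI[where f = f and x = x, OF _ c(1) dS c(2) fxx])
      (use cont_at_subtopology_codI[OF hol_at_cont[OF f] W] hol_at_charts[OF M N f c dN fxx] in \<open>simp_all add: open_submanifold_sel\<close>)
qed

section \<open>The complex line as a manifold, and rules for composition\<close>

definition line_emb :: "complex \<Rightarrow> nat \<Rightarrow> complex" where "line_emb \<xi> = (\<lambda>i. if i = 0 then \<xi> else 0)"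

lemma line_manifold: "complex_manifold complex_line_manifold"
  and line_chart: "(UNIV, line_emb) \<in> matlas complex_line_manifold"
proof -
  let ?T = "euclidean :: complex topology"
  have inj: "inj line_emb" by (auto simp: inj_on_def line_emb_def fun_eq_iff split: if_splits)
  have im: "range line_emb = complex_space 1"
  proof
    show "range line_emb \<subseteq> complex_space 1" by (auto simp: line_emb_def complex_space_def)
    show "complex_space 1 \<subseteq> range line_emb"
    proof
      fix z assume "z \<in> complex_space 1"
      then have "z = line_emb (z 0)" by (auto simp: line_emb_def complex_space_def fun_eq_iff)
      then show "z \<in> range line_emb" by blast
    qed
  qed
  have inv: "inv line_emb z = z 0" if "z \<in> complex_space 1" for z
  proof -
    have "z = line_emb (z 0)" using that by (auto simp: line_emb_def complex_space_def fun_eq_iff)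
    then show ?thesis using inv_f_f[OF inj] by metis
  qed
  have oc: "open_cs 1 (complex_space 1)" by simp
  have ch: "is_chart 1 ?T (UNIV, line_emb)"
  proof (rule is_chartI)
    show "open_cs 1 (range line_emb)" unfolding im by simp
    have "continuous_on UNIV line_emb"
    proof (rule continuous_on_coordinatewise_then_product)
      show "continuous_on UNIV (\<lambda>x. line_emb x i)" for i unfolding line_emb_def by (cases "i = 0") auto
    qed
    then have "continuous_map ?T (top_of_set (complex_space 1)) line_emb"
      using im by (auto simp: continuous_map_in_subtopology)
    then show "cont_at ?T (top_of_set (complex_space 1)) line_emb x" for x
      by (simp add: continuous_map_iff_cont_at)
    have "continuous_map (top_of_set (complex_space 1)) ?T (\<lambda>z. z 0)"
      by (simp add: continuous_on_coord)
    then have "cont_at (top_of_set (complex_space 1)) ?T (\<lambda>z. z 0) (line_emb x)" for x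
      using im by (auto simp: continuous_map_iff_cont_at)
    then show "cont_at (top_of_set (complex_space 1)) ?T (inv line_emb) (line_emb x)" for x
      by (rule cont_at_cong[OF _ oc]) (use im inv in auto)
  qed (use inj in auto)
  have cd: "cdiff_at 1 1 (\<lambda>w. line_emb (inv line_emb w)) (line_emb x)" for x
    by (rule cdiff_at_cong[OF cdiff_at_id oc]) (use im in \<open>auto simp: f_inv_into_f\<close>)
  have comp: "charts_compatible 1 (UNIV, line_emb) (UNIV, line_emb)" unfolding chart_compatible_iff[OF ch ch] using cd by simp
  have "Hausdorff_space ?T" "second_countable ?T" by (auto intro: second_countable_euclidean)
  from generated_manifold[OF this, of "{(UNIV, line_emb)}" 1] ch comp
  show "complex_manifold complex_line_manifold" "(UNIV, line_emb) \<in> matlas complex_line_manifold"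
    by (auto simp: complex_line_manifold_def line_emb_def[abs_def])
qed

lemma line_sel [simp]: "mdim complex_line_manifold = 1" "mtop complex_line_manifold = euclidean"
  by (auto simp: complex_line_manifold_def)

lemma hol_at_comp:
  assumes "complex_manifold M" "complex_manifold N" "complex_manifold P"
    and "y = f x" "hol_at N P g y" "hol_at M N f x"
  shows "hol_at M P (\<lambda>x. g (f x)) x"
  using hol_at_compose[OF assms(1-3) assms(6)] assms(4,5) by simp

lemma hol_at_csm_compI:
  assumes M: "complex_manifold M" and f: "hol_at M (csm n) f x" and g: "cdiff_at n m g (f x)"
  shows "hol_at M (csm m) (\<lambda>x. g (f x)) x"
  by (rule hol_at_compose[OF M csm_manifold csm_manifold f]) (simp add: csm_csm g)

lemma hol_at_lineI:
  assumes "cdiff_at k 1 (\<lambda>z. line_emb (g z)) z"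
  shows "hol_at (csm k) complex_line_manifold g z"
proof -
  have inj: "inj line_emb" by (auto simp: inj_on_def line_emb_def fun_eq_iff split: if_splits)
  have "hol_at (csm k) complex_line_manifold (\<lambda>z. inv line_emb (line_emb (g z))) z"
    by (rule hol_at_compose[OF csm_manifold csm_manifold line_manifold, where f = "\<lambda>z. line_emb (g z)"])
      (use assms inv_chart_hol[OF line_manifold line_chart, of "g z"] in \<open>simp_all add: csm_csm\<close>)
  then show ?thesis using inv_f_f[OF inj] by simp
qed

section \<open>Homogeneous coordinates\<close>

lemma graded_homothety_comp: "graded_homothety w \<xi> (graded_homothety w \<eta> z) = graded_homothety w (\<xi> * \<eta>) z"
  by (auto simp: graded_homothety_def power_mult_distrib)

lemma graded_homothety_one: "z \<in> complex_space (length w) \<Longrightarrow> graded_homothety w 1 z = z"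
  by (auto simp: graded_homothety_def complex_space_def)

lemma graded_homothety_cancel:
  assumes "graded_homothety w \<xi> z = graded_homothety w \<xi> z'" "\<xi> \<noteq> 0"
    "z \<in> complex_space (length w)" "z' \<in> complex_space (length w)"
  shows "z = z'"
proof -
  have "graded_homothety w (1 / \<xi> * \<xi>) z = graded_homothety w (1 / \<xi> * \<xi>) z'"
    using assms(1) by (metis graded_homothety_comp)
  then show ?thesis using assms by (simp add: graded_homothety_one)
qed

lemma cdiff_at_homothety: "z \<in> complex_space (length w) \<Longrightarrow> cdiff_at (length w) (length w) (graded_homothety w c) z"
  by (rule cdiff_at_sep_hol[of _ "complex_space (length w)"])
    (auto simp: graded_homothety_def[abs_def] complex_space_def intro!: sep_hol_mult sep_hol_const sep_hol_coord)

text \<open>A homogeneity structure in pointwise form, without the extensionality condition (compare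
  \<open>homogeneity_structure_iff_haction\<close>).\<close>

locale haction =
  fixes M :: "'a cmanifold" and h :: "complex \<Rightarrow> 'a \<Rightarrow> 'a"
  assumes M: "complex_manifold M"
    and hol: "\<And>\<xi> x. x \<in> mcarrier M \<Longrightarrow>
      hol_at (product_manifold complex_line_manifold M) M (\<lambda>p. h (fst p) (snd p)) (\<xi>, x)"
    and act: "\<And>\<xi> \<eta> x. x \<in> mcarrier M \<Longrightarrow> h \<xi> (h \<eta> x) = h (\<xi> * \<eta>) x"
    and one: "\<And>x. x \<in> mcarrier M \<Longrightarrow> h 1 x = x"
begin

abbreviation "LM \<equiv> product_manifold complex_line_manifold M"

lemma LM: "complex_manifold LM" by (rule product_manifold_complex[OF line_manifold M])

lemma LM_top: "mtop LM = prod_topology euclidean (mtop M)"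
  by (simp add: product_sel[OF line_manifold M])

lemma h_mem [simp]: "x \<in> mcarrier M \<Longrightarrow> h \<xi> x \<in> mcarrier M"
  using hol_at_mem(2)[OF hol] by fastforce

lemma hol_h: "x \<in> mcarrier M \<Longrightarrow> hol_at M M (h \<xi>) x"
proof -
  assume x: "x \<in> mcarrier M"
  have "hol_at M LM (\<lambda>x. (\<xi>, x)) x"
    by (rule hol_at_pair[OF line_manifold M M])
      (use x hol_at_const[OF M line_manifold x, of \<xi>] hol_at_id[OF M x] in simp_all)
  from hol_at_compose[OF M LM M this, of "\<lambda>p. h (fst p) (snd p)"] hol[OF x] show ?thesis by simp
qed

lemma open_pair:
  assumes V: "openin (mtop M) V"
  shows "openin (prod_topology euclidean (mtop M)) {p \<in> UNIV \<times> mcarrier M. h (fst p) (snd p) \<in> V}"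
proof -
  have "\<forall>p\<in>topspace (prod_topology euclidean (mtop M)). cont_at (prod_topology euclidean (mtop M)) (mtop M) (\<lambda>p. h (fst p) (snd p)) p"
    using hol_at_cont[OF hol] unfolding LM_top by auto
  then have "continuous_map (prod_topology euclidean (mtop M)) (mtop M) (\<lambda>p. h (fst p) (snd p))"
    by (simp only: continuous_map_iff_cont_at)
  then show ?thesis using V unfolding continuous_map_def by auto
qed

lemma open_param:
  assumes V: "openin (mtop M) V" and x: "x \<in> mcarrier M" "h \<xi> x \<in> V"
  obtains e where "e > 0" "\<And>\<eta>. cmod (\<eta> - \<xi>) < e \<Longrightarrow> h \<eta> x \<in> V"
proof -
  have "(\<xi>, x) \<in> {p \<in> UNIV \<times> mcarrier M. h (fst p) (snd p) \<in> V}" using x by simp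
  from openin_prod_topology_alt[THEN iffD1, OF open_pair[OF V], rule_format, OF this]
  obtain A B where AB: "open A" "\<xi> \<in> A" "x \<in> B" "A \<times> B \<subseteq> {p \<in> UNIV \<times> mcarrier M. h (fst p) (snd p) \<in> V}"
    by auto
  obtain e where e: "e > 0" "ball \<xi> e \<subseteq> A" using AB open_contains_ball by blast
  show ?thesis
  proof (rule that[OF e(1)])
    fix \<eta> assume "cmod (\<eta> - \<xi>) < e"
    then have "\<eta> \<in> A" using e(2) by (auto simp: dist_norm norm_minus_commute)
    then have "(\<eta>, x) \<in> A \<times> B" using AB(3) by simp
    then show "h \<eta> x \<in> V" using AB(4) by auto
  qed
qed

lemma open_preimage_h:
  assumes V: "openin (mtop M) V" shows "openin (mtop M) {x \<in> mcarrier M. h \<xi> x \<in> V}"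
proof -
  have "cont_at (mtop M) (mtop M) (h \<xi>) x" if "x \<in> mcarrier M" for x
    by (rule hol_at_cont[OF hol_h[OF that]])
  then have "continuous_map (mtop M) (mtop M) (h \<xi>)" by (simp add: continuous_map_iff_cont_at)
  then show ?thesis using V unfolding continuous_map_def by auto
qed

text \<open>The largest part of \<open>V\<close> that the closed unit disc maps into itself; there
  all scalars of modulus at most 1 act without leaving \<open>V\<close>.\<close>

definition "star V = {x \<in> mcarrier M. \<forall>\<xi>. cmod \<xi> \<le> 1 \<longrightarrow> h \<xi> x \<in> V}"

lemma star_sub: "star V \<subseteq> V"
  unfolding star_def using one by (force dest: spec[of _ 1])

lemma star_inv: "x \<in> star V \<Longrightarrow> cmod \<xi> \<le> 1 \<Longrightarrow> h \<xi> x \<in> star V"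
  unfolding star_def by (auto simp: act norm_mult mult_le_one)

lemma star_mem: "x \<in> star V \<Longrightarrow> x \<in> mcarrier M" by (simp add: star_def)

text \<open>The tube lemma for the compact disc \<open>cball 0 1\<close> makes the neighbourhood of
  \<open>x\<close> uniform in \<xi>.\<close>

lemma star_open:
  assumes V: "openin (mtop M) V" shows "openin (mtop M) (star V)"
proof (subst openin_subopen, intro ballI)
  fix x assume x: "x \<in> star V"
  have k: "compactin euclidean (cball (0::complex) 1)" "compactin (mtop M) {x}" using x by (auto simp: star_def)
  have sub: "cball 0 1 \<times> {x} \<subseteq> {p \<in> UNIV \<times> mcarrier M. h (fst p) (snd p) \<in> V}" using x by (auto simp: star_def)
  obtain A B where "openin euclidean A" and AB: "openin (mtop M) B" "cball (0::complex) 1 \<subseteq> A" "{x} \<subseteq> B"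
    "A \<times> B \<subseteq> {p \<in> UNIV \<times> mcarrier M. h (fst p) (snd p) \<in> V}"
    by (rule Wallace_theorem_prod_topology[OF k open_pair[OF V] sub])
  have "B \<subseteq> star V"
  proof
    fix y assume y: "y \<in> B"
    have "h \<xi> y \<in> V" if "cmod \<xi> \<le> 1" for \<xi>
    proof -
      have "(\<xi>, y) \<in> A \<times> B" using that y AB(2) by auto
      then show ?thesis using AB(4) by auto
    qed
    moreover have "y \<in> mcarrier M" using openin_subset[OF AB(1)] y by auto
    ultimately show "y \<in> star V" by (simp add: star_def)
  qed
  then show "\<exists>T. openin (mtop M) T \<and> x \<in> T \<and> T \<subseteq> star V" using AB by blast
qed

lemma fixed: "p \<in> mcarrier M \<Longrightarrow> h 0 p = p \<Longrightarrow> h \<xi> p = p"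
  using act[of p \<xi> 0] by simp

lemma fixed_star: "p \<in> V \<Longrightarrow> p \<in> mcarrier M \<Longrightarrow> h 0 p = p \<Longrightarrow> p \<in> star V"
  by (simp add: star_def fixed)

text \<open>The Taylor coefficients in \<open>\<xi>\<close> of the coordinates of \<open>h \<xi> x\<close> are homogeneous functions of \<open>x\<close>.
  They sum up to the coordinates at \<open>\<xi> = 1\<close>, so their differentials span the cotangent space, and
  finitely many of them form a coordinate system.\<close>

lemma homogeneous_chart:
  assumes p: "p \<in> mcarrier M" "h 0 p = p"
  obtains V y ws where "(V, y) \<in> matlas M" "p \<in> V" "sorted ws" "length ws = mdim M"
    "\<And>q \<eta>. q \<in> V \<Longrightarrow> cmod \<eta> \<le> 1 \<Longrightarrow> h \<eta> q \<in> V \<Longrightarrow> y (h \<eta> q) = graded_homothety ws \<eta> (y q)"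
proof -
  define n where "n = mdim M"
  obtain U \<kappa> where c: "(U, \<kappa>) \<in> matlas M" "p \<in> U" using mf_cover[OF M p(1)] .
  note cU = mf_chart[OF M c(1), folded n_def]
  have Uo: "openin (mtop M) U" by (rule is_chartD(1)[OF cU])
  have inv: "inv_into U \<kappa> (\<kappa> q) = q" if "q \<in> U" for q using that is_chartD(3)[OF cU] by simp
  \<comment> \<open>On the star of \<open>U\<close> the whole closed unit disc acts inside the
    chart, as the lemmas on Taylor coefficients require.\<close>
  define V1 where "V1 = star U"
  have V1: "openin (mtop M) V1" "V1 \<subseteq> U" "p \<in> V1" "\<And>q. q \<in> V1 \<Longrightarrow> q \<in> mcarrier M"
    unfolding V1_def using star_open[OF Uo] star_sub fixed_star[OF c(2) p] star_mem by auto
  define O1 where "O1 = \<kappa> ` V1"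
  have O1: "open_cs n O1" unfolding O1_def by (rule chart_image_open[OF cU V1(1,2)])
  \<comment> \<open>Action and inverse chart as a function of one vector: the first \<open>n\<close>
    coordinates of \<open>z\<close> describe a point, and coordinate number \<open>n\<close> carries
    \<xi>. This is the form required by \<open>fcoef\<close>.\<close>
  define f where "f z = h (z n) (inv_into U \<kappa> (z(n := 0)))" for z
  define S where "S = {z \<in> complex_space (Suc n). z(n := 0) \<in> \<kappa> ` U \<and> f z \<in> U}"
  have upd: "z(n := 0) \<in> complex_space n" if "z \<in> complex_space (Suc n)" for z
    using that by (auto simp: complex_space_def)
  have cd0: "cdiff_at (Suc n) n (\<lambda>z. z(n := 0)) z" if z: "z \<in> complex_space (Suc n)" for z
    by (rule cdiff_at_sep_hol[of _ "complex_space (Suc n)"]) (use z upd in \<open>auto intro: sep_hol_coord\<close>)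
  have hf: "hol_at (csm (Suc n)) M f z" if z: "z \<in> complex_space (Suc n)" "z(n := 0) \<in> \<kappa> ` U" for z
  proof -
    have 1: "hol_at (csm (Suc n)) complex_line_manifold (\<lambda>z. z n) z"
      by (rule hol_at_lineI, rule cdiff_at_sep_hol[of _ "complex_space (Suc n)"])
        (use z in \<open>auto simp: line_emb_def complex_space_def intro: sep_hol_coord\<close>)
    have 2: "hol_at (csm (Suc n)) M (\<lambda>z. inv_into U \<kappa> (z(n := 0))) z"
      by (rule hol_at_compose[OF csm_manifold csm_manifold M, where n1 = n and f = "\<lambda>z. z(n := 0)"])
        (use z cd0 inv_chart_hol[OF M c(1)] in \<open>auto simp: csm_csm n_def\<close>)
    have 3: "hol_at (csm (Suc n)) LM (\<lambda>z. (z n, inv_into U \<kappa> (z(n := 0)))) z"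
      by (rule hol_at_pair[OF line_manifold M csm_manifold]) (use 1 2 in simp_all)
    have "inv_into U \<kappa> (z(n := 0)) \<in> mcarrier M" using hol_at_mem(2)[OF 2] .
    then have "hol_at LM M (\<lambda>p. h (fst p) (snd p)) ((\<lambda>z. (z n, inv_into U \<kappa> (z(n := 0)))) z)" by (simp add: hol)
    from hol_at_compose[where f = "\<lambda>z. (z n, inv_into U \<kappa> (z(n := 0)))" and g = "\<lambda>p. h (fst p) (snd p)",
        OF csm_manifold LM M 3 this] show ?thesis by (simp add: f_def[abs_def])
  qed
  have S: "open_cs (Suc n) S"
  proof (subst openin_subopen, intro ballI)
    fix z assume "z \<in> S"
    then have z: "z \<in> complex_space (Suc n)" "z(n := 0) \<in> \<kappa> ` U" "f z \<in> U" by (auto simp: S_def)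
    obtain A where A: "open_cs (Suc n) A" "z \<in> A" "(\<lambda>z. z(n := 0)) ` A \<subseteq> \<kappa> ` U"
      using cdiff_at_continuous[OF cd0[OF z(1)] is_chartD(4)[OF cU] z(2)] .
    obtain B where B: "openin (mtop (csm (Suc n))) B" "z \<in> B" "f ` B \<subseteq> U"
      using cont_at_nbhd[where f = f and x = z, OF hol_at_cont[OF hf[OF z(1,2)]] Uo z(3)] .
    have "A \<inter> B \<subseteq> S" using A B open_cs_subset[OF A(1)] by (auto simp: S_def)
    then show "\<exists>T. open_cs (Suc n) T \<and> z \<in> T \<and> T \<subseteq> S"
      using A B by (intro exI[of _ "A \<inter> B"]) auto
  qed
  define F where "F j z = \<kappa> (f z) j" for j z
  have F: "sep_hol (Suc n) S (F j)" if j: "j < n" for j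
    unfolding F_def
  proof (rule sep_hol_cdiff_at[OF S _ j])
    fix z assume "z \<in> S"
    then have z: "z \<in> complex_space (Suc n)" "z(n := 0) \<in> \<kappa> ` U" "f z \<in> U" by (auto simp: S_def)
    show "cdiff_at (Suc n) n (\<lambda>z. \<kappa> (f z)) z"
      using hol_at_comp[OF csm_manifold M csm_manifold refl chart_hol[OF M c(1) z(3)] hf[OF z(1,2)]]
      by (simp add: csm_csm n_def)
  qed
  have \<kappa>n: "\<kappa> q n = 0" "\<kappa> q \<in> complex_space n" if "q \<in> U" for q
    using is_chartD(7)[OF cU that] by (auto simp: complex_space_def)
  have fk: "f ((\<kappa> q)(n := \<zeta>)) = h \<zeta> q" if q: "q \<in> U" for q \<zeta>
  proof -
    have "((\<kappa> q)(n := \<zeta>))(n := 0) = \<kappa> q" using \<kappa>n[OF q] by (simp add: fun_upd_idem)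
    then show ?thesis using inv[OF q] by (simp add: f_def)
  qed
  have US: "x(n := \<zeta>) \<in> S" if x: "x \<in> O1" and \<zeta>: "cmod \<zeta> \<le> 1" for x \<zeta>
  proof -
    obtain q where q: "q \<in> V1" "x = \<kappa> q" using x by (auto simp: O1_def)
    have qU: "q \<in> U" using q V1 by auto
    have "x(n := \<zeta>) \<in> complex_space (Suc n)" using \<kappa>n(2)[OF qU] q by (auto simp: complex_space_def)
    moreover have "(x(n := \<zeta>))(n := 0) = \<kappa> q" using \<kappa>n[OF qU] q by (simp add: fun_upd_idem)
    moreover have "f (x(n := \<zeta>)) \<in> U" using fk[OF qU] q \<zeta> by (simp add: V1_def star_def)
    ultimately show ?thesis using qU by (simp add: S_def)
  qed
  \<comment> \<open>The Taylor coefficients of coordinate \<open>j\<close> of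
    \<open>h \<xi> x\<close>, as functions of the coordinates of \<open>x\<close>;
    \<open>a_hom\<close> shows that \<open>a j k\<close> is homogeneous of weight
    \<open>k\<close>.\<close>
  define a where "a j k = fcoef n (F j) k" for j k
  have a: "sep_hol n O1 (a j k)" if "j < n" for j k
    unfolding a_def by (rule sep_hol_fcoef[OF S F[OF that] O1]) (rule US)
  have a_hom: "a j k (\<kappa> (h \<eta> q)) = \<eta> ^ k * a j k (\<kappa> q)" if j: "j < n" and q: "q \<in> V1" and \<eta>: "cmod \<eta> \<le> 1" for j k \<eta> q
  proof -
    have q': "h \<eta> q \<in> V1" using star_inv q \<eta> by (simp add: V1_def)
    have x: "\<kappa> q \<in> O1" "\<kappa> (h \<eta> q) \<in> O1" using q q' by (auto simp: O1_def)
    have qU: "q \<in> U" "h \<eta> q \<in> U" using q q' V1 by auto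
    have e: "a j k x = (deriv ^^ k) (\<lambda>\<zeta>. F j (x(n := \<zeta>))) 0 / fact k" if "x \<in> O1" for x
      unfolding a_def by (rule fcoef_eq_deriv[OF S F[OF j] O1 _ that]) (rule US)
    obtain R where R: "R > 1" "(\<lambda>\<zeta>. F j ((\<kappa> q)(n := \<zeta>))) holomorphic_on ball 0 R"
      using fcoef_slice[OF S F[OF j] O1 _ x(1)] US by blast
    have "(\<lambda>\<zeta>. F j ((\<kappa> (h \<eta> q))(n := \<zeta>))) = (\<lambda>\<zeta>. F j ((\<kappa> q)(n := \<eta> * \<zeta>)))"
      using V1(4)[OF q] by (simp add: F_def fk qU act mult.commute)
    then have "(deriv ^^ k) (\<lambda>\<zeta>. F j ((\<kappa> (h \<eta> q))(n := \<zeta>))) 0 = (deriv ^^ k) (\<lambda>\<zeta>. (\<lambda>\<zeta>. F j ((\<kappa> q)(n := \<zeta>))) (\<eta> * \<zeta>)) 0"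
      by simp
    also have "\<dots> = \<eta> ^ k * (deriv ^^ k) (\<lambda>\<zeta>. F j ((\<kappa> q)(n := \<zeta>))) (\<eta> * 0)"
    proof (rule higher_deriv_compose_linear[OF R(2)])
      show "\<eta> * w \<in> ball 0 R" if "w \<in> ball 0 R" for w
        using that \<eta> mult_right_mono[OF \<eta>, of "cmod w"] by (auto simp: norm_mult)
    qed (use R in auto)
    finally show ?thesis unfolding e[OF x(1)] e[OF x(2)] by simp
  qed
  have px: "\<kappa> p \<in> O1" using V1 by (auto simp: O1_def)
  \<comment> \<open>The differentials at \<open>p\<close> of all these coefficients.\<close>
  define R where "R = {r. \<exists>j<n. \<exists>k. r = (\<lambda>i. pd i (a j k) (\<kappa> p))}"
  have span: "\<exists>r\<in>R. (\<Sum>i<n. r i * v i) \<noteq> 0" if v: "v \<in> complex_space n" "v \<noteq> (\<lambda>i. 0)" for v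
  proof (rule ccontr)
    assume neg: "\<not> ?thesis"
    have "v j = 0" if j: "j < n" for j
    proof -
      have z: "(\<Sum>i<n. pd i (a j k) (\<kappa> p) * v i) = 0" for k
      proof -
        have mem: "(\<lambda>i. pd i (a j k) (\<kappa> p)) \<in> R" using j by (auto simp: R_def)
        have "\<forall>r\<in>R. (\<Sum>i<n. r i * v i) = 0" using neg by blast
        from this[rule_format, OF mem] show ?thesis by simp
      qed
      \<comment> \<open>The expansion is differentiated term by term and evaluated at \<xi> = 1,
        where \<open>h 1\<close> is the identity: a vector killed by all differentials in
        \<open>R\<close> is killed by those of the coordinates.\<close>
      have s: "(\<lambda>k. pd i (a j k) (\<kappa> p)) sums pd i (F j) ((\<kappa> p)(n := 1))" if i: "i < n" for i
      proof -
        have "pd i (a j k) (\<kappa> p) = fcoef n (pd i (F j)) k (\<kappa> p) * 1 ^ k" for k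
          using pd_fcoef[OF S F[OF j] O1 _ px i] US unfolding a_def by simp
        moreover have "(\<lambda>k. fcoef n (pd i (F j)) k (\<kappa> p) * 1 ^ k) sums pd i (F j) ((\<kappa> p)(n := 1))"
          by (rule fcoef_sums[OF S sep_hol_pd_hol[OF S F[OF j]] O1 _ px]) (use US i in auto)
        ultimately show ?thesis by simp
      qed
      have "(\<lambda>k. \<Sum>i<n. pd i (a j k) (\<kappa> p) * v i) sums (\<Sum>i<n. pd i (F j) ((\<kappa> p)(n := 1)) * v i)"
        by (intro sums_sum sums_mult2 s) auto
      then have "(\<Sum>i<n. pd i (F j) ((\<kappa> p)(n := 1)) * v i) = 0"
        unfolding z by (simp add: sums_iff)
      moreover have "pd i (F j) ((\<kappa> p)(n := 1)) = (if i = j then 1 else 0)" if i: "i < n" for i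
      proof -
        \<comment> \<open>At \<xi> = 1 the function \<open>F j\<close> is the coordinate itself, but
          only for vectors in the image of the chart. The slice of that image is open, so the
          derivatives agree.\<close>
        have Xo: "open {\<zeta>. (\<kappa> p)(i := \<zeta>) \<in> \<kappa> ` U}" by (rule open_slice[OF is_chartD(4)[OF cU] i \<kappa>n(2)[OF c(2)]])
        have "((\<lambda>\<zeta>. ((\<kappa> p)(i := \<zeta>)) j) has_field_derivative (if i = j then 1 else 0)) (at (\<kappa> p i))"
          by (cases "i = j") auto
        then have "((\<lambda>\<zeta>. F j (((\<kappa> p)(n := 1))(i := \<zeta>))) has_field_derivative (if i = j then 1 else 0)) (at (\<kappa> p i))"
        proof (rule has_field_derivative_transform_within_open[OF _ Xo])
          fix \<zeta> assume "\<zeta> \<in> {\<zeta>. (\<kappa> p)(i := \<zeta>) \<in> \<kappa> ` U}"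
          then obtain q where q: "q \<in> U" "(\<kappa> p)(i := \<zeta>) = \<kappa> q" by auto
          have "((\<kappa> p)(n := 1))(i := \<zeta>) = (\<kappa> q)(n := 1)" unfolding q(2)[symmetric] using i by (simp add: fun_upd_twist)
          then show "((\<kappa> p)(i := \<zeta>)) j = F j (((\<kappa> p)(n := 1))(i := \<zeta>))"
            using q fk[OF q(1), of 1] one mf_chart_mem[OF M c(1) q(1)] by (simp add: F_def)
        qed (use c in simp)
        then show ?thesis unfolding pd_def using i by (intro DERIV_imp_deriv) simp
      qed
      then have "(\<Sum>i<n. pd i (F j) ((\<kappa> p)(n := 1)) * v i) = v j"
        using j by (simp add: if_distrib[of "\<lambda>x. x * _"] cong: if_cong)
      ultimately show "v j = 0" by simp
    qed
    then have "v = (\<lambda>i. 0)" using v(1) by (intro complex_space_eqI[of _ n]) auto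
    then show False using v(2) by simp
  qed
  obtain r V where rV: "\<And>i. i < n \<Longrightarrow> r i \<in> R"
    "\<And>i j. i < n \<Longrightarrow> j < n \<Longrightarrow> (\<Sum>k<n. r i k * V k j) = (if i = j then 1 else 0)"
    "\<And>i j. i < n \<Longrightarrow> j < n \<Longrightarrow> (\<Sum>k<n. V i k * r k j) = (if i = j then 1 else 0)"
    using dual_rows[of n R, OF span] by blast
  have "\<exists>j k. j < n \<and> r i = (\<lambda>l. pd l (a j k) (\<kappa> p))" if "i < n" for i
    using rV(1)[OF that] by (auto simp: R_def)
  then obtain J K where JK: "\<And>i. i < n \<Longrightarrow> J i < n" "\<And>i. i < n \<Longrightarrow> r i = (\<lambda>l. pd l (a (J i) (K i)) (\<kappa> p))"
    by metis
  \<comment> \<open>The chosen coefficients are listed by increasing weight, so that the weight list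
    is sorted and thus determined by its multiset.\<close>
  define il where "il = sort_key K [0..<n]"
  define ws where "ws = map K il"
  have il: "length il = n" "distinct il" "set il = {..<n}" by (auto simp: il_def)
  have ws: "sorted ws" "length ws = n" unfolding ws_def il_def by (simp_all del: sorted_sort_key add: sorted_sort_key)
  have ili: "il ! i < n" if "i < n" for i using nth_mem[of i il] il that by auto
  have ilb: "bij_betw ((!) il) {..<n} {..<n}" using bij_betw_nth[OF il(2)] il by auto
  define g where "g x = (\<lambda>i. if i < n then a (J (il ! i)) (K (il ! i)) x else 0)" for x
  have gpd: "pd l (\<lambda>x. g x i) (\<kappa> p) = r (il ! i) l" if "i < n" for i l
    using JK(2)[OF ili[OF that]] that by (simp add: g_def pd_def)
  have gh: "sep_hol n O1 (\<lambda>x. g x i)" for i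
    using a JK(1) ili by (cases "i < n") (auto simp: g_def sep_hol_const)
  have gc: "g x \<in> complex_space n" for x by (simp add: g_def complex_space_def)
  have L: "(\<Sum>k<n. V i (il ! k) * pd j (\<lambda>x. g x k) (\<kappa> p)) = (if i = j then 1 else 0)" if "i < n" "j < n" for i j
  proof -
    have "(\<Sum>k<n. V i (il ! k) * pd j (\<lambda>x. g x k) (\<kappa> p)) = (\<Sum>k<n. V i (il ! k) * r (il ! k) j)"
      by (intro sum.cong) (auto simp: gpd)
    also have "\<dots> = (\<Sum>k<n. V i k * r k j)" by (rule sum.reindex_bij_betw[OF ilb])
    finally show ?thesis using rV(3)[OF that] by simp
  qed
  have Rr: "(\<Sum>k<n. pd k (\<lambda>x. g x i) (\<kappa> p) * V k (il ! j)) = (if i = j then 1 else 0)" if "i < n" "j < n" for i j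
    using rV(2)[OF ili[OF that(1)] ili[OF that(2)]] that il nth_eq_iff_index_eq[of il i j] by (simp add: gpd)
  obtain U2 G where U2: "open_cs n U2" "\<kappa> p \<in> U2" "U2 \<subseteq> O1" "open_cs n (g ` U2)"
    "\<And>j. sep_hol n (g ` U2) (\<lambda>y. G y j)" "\<And>x. x \<in> U2 \<Longrightarrow> G (g x) = x"
    using inverse_function[where V = "\<lambda>i k. V i (il ! k)" and f = g, OF O1 px gh image_subsetI[OF gc] L Rr] by blast
  define V2 where "V2 = {q \<in> V1. \<kappa> q \<in> U2}"
  have V2c: "\<kappa> ` V2 = U2" using U2(3) by (auto simp: V2_def O1_def)
  have V2U: "V2 \<subseteq> U" "V2 \<subseteq> V1" using V1 by (auto simp: V2_def)
  have V2o: "openin (mtop M) V2"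
  proof (subst openin_subopen, intro ballI)
    fix q assume q: "q \<in> V2"
    then have qU: "q \<in> U" and qk: "\<kappa> q \<in> U2" using V2U by (auto simp: V2_def)
    obtain W where W: "openin (mtop M) W" "q \<in> W" "\<kappa> ` W \<subseteq> U2"
      using cont_at_nbhd[where f = \<kappa> and x = q, OF is_chartD(5)[OF cU qU] U2(1) qk] .
    then show "\<exists>T. openin (mtop M) T \<and> q \<in> T \<and> T \<subseteq> V2"
      using V1(1) q by (intro exI[of _ "W \<inter> V1"]) (auto simp: V2_def)
  qed
  define y where "y q = g (\<kappa> q)" for q
  have yV2: "y ` V2 = g ` U2" unfolding y_def V2c[symmetric] by auto
  have Gy: "G (y q) = \<kappa> q" if "q \<in> V2" for q using U2(6) that by (simp add: y_def V2_def)
  have yinj: "inj_on y V2"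
  proof (rule inj_onI)
    fix q q' assume q: "q \<in> V2" "q' \<in> V2" "y q = y q'"
    then have "\<kappa> q = \<kappa> q'" using Gy by metis
    then show "q = q'" using inv V2U q by (metis subsetD)
  qed
  have Gim: "G ` (g ` U2) \<subseteq> complex_space n" using U2(6) open_cs_subset[OF U2(1)] by auto
  have chart: "(V2, restrict y V2) \<in> matlas M"
  proof (rule biholomorphic_chart[OF M V2o yinj])
    show "open_cs (mdim M) (y ` V2)" unfolding yV2 using U2(4) n_def by simp
    fix q assume q: "q \<in> V2"
    have qU: "q \<in> U" and qO: "\<kappa> q \<in> O1" using q V2U by (auto simp: V2_def O1_def)
    show "hol_at M (csm (mdim M)) y q"
      unfolding y_def n_def[symmetric]
      by (rule hol_at_csm_compI[OF M chart_hol[OF M c(1) qU, folded n_def]], rule cdiff_at_sep_hol[OF O1 qO])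
        (use gh gc in auto)
    have yq: "y q \<in> g ` U2" using q yV2 by blast
    have cG: "cdiff_at n n G (y q)" by (rule cdiff_at_sep_hol[OF U2(4) yq Gim U2(5)])
    have "hol_at (csm n) M (inv_into U \<kappa>) (G (y q))" using inv_chart_hol[OF M c(1) qU] Gy[OF q] by (simp add: n_def)
    then have "hol_at (csm n) M (\<lambda>z. inv_into U \<kappa> (G z)) (y q)"
      using cG by (intro hol_at_compose[OF csm_manifold csm_manifold M, where f = G]) (auto simp: csm_csm)
    then have "hol_at (csm n) M (inv_into V2 y) (y q)"
    proof (rule hol_at_cong[OF csm_manifold])
      show "openin (mtop (csm n)) (g ` U2)" using U2(4) by simp
      fix z assume "z \<in> g ` U2"
      then obtain q' where q': "q' \<in> V2" "z = y q'" unfolding yV2[symmetric] by auto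
      then have "q' \<in> U" using V2U by blast
      then show "inv_into U \<kappa> (G z) = inv_into V2 y z"
        using Gy[OF q'(1)] inv q' inv_into_f_f[OF yinj q'(1)] by simp
    qed (rule yq)
    then show "hol_at (csm (mdim M)) M (inv_into V2 y) (y q)" by (simp add: n_def)
  qed
  show ?thesis
  proof (rule that[OF chart _ ws(1)])
    show "p \<in> V2" using V1 U2(2) by (simp add: V2_def)
    show "length ws = mdim M" using ws n_def by simp
    fix q \<eta> assume q: "q \<in> V2" "cmod \<eta> \<le> 1" "h \<eta> q \<in> V2"
    have "y (h \<eta> q) i = graded_homothety ws \<eta> (y q) i" for i
      using a_hom[OF JK(1)[OF ili] _ q(2), of i q] q V2U ws(2) il(1)
      by (cases "i < n") (auto simp: y_def g_def graded_homothety_def ws_def)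
    then show "restrict y V2 (h \<eta> q) = graded_homothety ws \<eta> (restrict y V2 q)" using q by auto
  qed
qed

end

context haction
begin

text \<open>A chart in which the action is linear and which is complete along the fibres of
  \<open>h 0\<close>: its domain contains every fibre that it meets, and its image contains every
  vector with the same coordinates of weight 0. Hence it splits into a base chart and a full
  fibre.\<close>

definition gchart :: "nat list \<Rightarrow> 'a set \<Rightarrow> ('a \<Rightarrow> nat \<Rightarrow> complex) \<Rightarrow> bool" where
  "gchart ws T Y \<longleftrightarrow> (T, Y) \<in> matlas M \<and> length ws = mdim M \<and>
     (\<forall>x\<in>T. \<forall>\<xi>. h \<xi> x \<in> T \<and> Y (h \<xi> x) = graded_homothety ws \<xi> (Y x)) \<and>
     (\<forall>x\<in>mcarrier M. h 0 x \<in> T \<longrightarrow> x \<in> T) \<and>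
     (\<forall>z\<in>Y ` T. \<forall>z'\<in>complex_space (mdim M). graded_homothety ws 0 z' = graded_homothety ws 0 z \<longrightarrow> z' \<in> Y ` T)"

text \<open>A homogeneous chart around a fixed point \<open>p\<close> extends along the fibres of \<open>h 0\<close>:
  scale a point into the domain of the chart and rescale its coordinates.\<close>

theorem gchart_exists:
  assumes p: "p \<in> mcarrier M" "h 0 p = p"
  obtains ws T Y where "sorted ws" "gchart ws T Y" "p \<in> T"
proof -
  define n where "n = mdim M"
  obtain V y ws where c: "(V, y) \<in> matlas M" "p \<in> V" and ws: "sorted ws" "length ws = n"
    and y_hom: "\<And>q \<eta>. q \<in> V \<Longrightarrow> cmod \<eta> \<le> 1 \<Longrightarrow> h \<eta> q \<in> V \<Longrightarrow> y (h \<eta> q) = graded_homothety ws \<eta> (y q)"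
    using homogeneous_chart[OF p] unfolding n_def by blast
  note cV = mf_chart[OF M c(1), folded n_def]
  have Vo: "openin (mtop M) V" by (rule is_chartD(1)[OF cV])
  have yc: "y q \<in> complex_space (length ws)" if "q \<in> V" for q using is_chartD(7)[OF cV that] ws by simp
  have inv: "inv_into V y (y q) = q" if "q \<in> V" for q using that is_chartD(3)[OF cV] by simp
  define W where "W = star V"
  have W: "openin (mtop M) W" "W \<subseteq> V" "p \<in> W" "\<And>q. q \<in> W \<Longrightarrow> q \<in> mcarrier M"
    unfolding W_def using star_open[OF Vo] star_sub fixed_star[OF c(2) p] star_mem by auto
  have Wi: "h \<xi> q \<in> W" if "q \<in> W" "cmod \<xi> \<le> 1" for \<xi> q using star_inv that by (simp add: W_def)
  have yW: "open_cs n (y ` W)" by (rule chart_image_open[OF cV W(1,2)])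
  \<comment> \<open>All points whose limit \<open>h 0 x\<close> lies in \<open>W\<close>: a union of
    fibres of \<open>h 0\<close>, open by continuity.\<close>
  define T where "T = {x \<in> mcarrier M. h 0 x \<in> W}"
  have To: "openin (mtop M) T" unfolding T_def by (rule open_preimage_h[OF W(1)])
  have small: "\<exists>e>0. e \<le> 1 \<and> (\<forall>\<eta>. cmod \<eta> < e \<longrightarrow> h \<eta> x \<in> W)" if x: "x \<in> T" for x
  proof -
    have "x \<in> mcarrier M" "h 0 x \<in> W" using x by (auto simp: T_def)
    from open_param[OF W(1) this] obtain e where "e > 0" "\<And>\<eta>. cmod (\<eta> - 0) < e \<Longrightarrow> h \<eta> x \<in> W" by blast
    then show ?thesis by (intro exI[of _ "min e 1"]) auto
  qed
  \<comment> \<open>Some nonzero scalar that brings \<open>x\<close> into \<open>W\<close>. By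
    \<open>L\<close> below, the coordinates \<open>Y\<close> do not depend on the choice.\<close>
  define \<sigma> where "\<sigma> x = (SOME \<xi>. \<xi> \<noteq> 0 \<and> cmod \<xi> \<le> 1 \<and> h \<xi> x \<in> W)" for x
  have \<sigma>: "\<sigma> x \<noteq> 0 \<and> cmod (\<sigma> x) \<le> 1 \<and> h (\<sigma> x) x \<in> W" if x: "x \<in> T" for x
    unfolding \<sigma>_def
  proof (rule someI_ex)
    obtain e where e: "e > 0" "e \<le> 1" "\<And>\<eta>. cmod \<eta> < e \<Longrightarrow> h \<eta> x \<in> W" using small[OF x] by blast
    then show "\<exists>\<xi>. \<xi> \<noteq> 0 \<and> cmod \<xi> \<le> 1 \<and> h \<xi> x \<in> W"
      by (intro exI[of _ "of_real (e / 2)"]) (auto simp: norm_divide)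
  qed
  define Y where "Y x = graded_homothety ws (1 / \<sigma> x) (y (h (\<sigma> x) x))" for x
  have Yc: "Y x \<in> complex_space (length ws)" for x by (simp add: Y_def)
  have Tc: "x \<in> mcarrier M" if "x \<in> T" for x using that by (simp add: T_def)
  have base: "y (h (\<zeta> * \<xi>) x) = graded_homothety ws \<zeta> (y (h \<xi> x))"
    if x: "x \<in> mcarrier M" and \<xi>: "h \<xi> x \<in> W" and \<zeta>: "cmod \<zeta> \<le> 1" for x \<xi> \<zeta>
    using y_hom[of "h \<xi> x" \<zeta>] Wi[OF \<xi> \<zeta>] \<xi> W(2) \<zeta> x by (auto simp: act)
  \<comment> \<open>The scalars \<sigma> and \<xi> commute, so both orders can be compared inside
    the chart, where \<open>y\<close> is homogeneous; then \<sigma> is cancelled.\<close>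
  have L: "y (h \<xi> x) = graded_homothety ws \<xi> (Y x)" if x: "x \<in> T" and \<xi>: "cmod \<xi> \<le> 1" "h \<xi> x \<in> W" for x \<xi>
  proof -
    have s: "\<sigma> x \<noteq> 0" "cmod (\<sigma> x) \<le> 1" "h (\<sigma> x) x \<in> W" using \<sigma>[OF x] by auto
    have "graded_homothety ws (\<sigma> x) (y (h \<xi> x)) = graded_homothety ws \<xi> (y (h (\<sigma> x) x))"
      using base[OF Tc[OF x] \<xi>(2) s(2)] base[OF Tc[OF x] s(3) \<xi>(1)] by (simp add: mult.commute)
    then have "graded_homothety ws (1 / \<sigma> x) (graded_homothety ws (\<sigma> x) (y (h \<xi> x))) =
        graded_homothety ws (1 / \<sigma> x) (graded_homothety ws \<xi> (y (h (\<sigma> x) x)))" by simp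
    then show ?thesis using s(1) yc \<xi>(2) W(2)
      by (simp add: graded_homothety_comp Y_def mult.commute graded_homothety_one subset_iff)
  qed
  have T0: "x \<in> T" if "x \<in> mcarrier M" "h \<xi> x \<in> W" for x \<xi>
    using Wi[OF that(2), of 0] that(1) by (simp add: T_def act)
  have TW: "W \<subseteq> T" using T0[of _ 1] one W(4) by auto
  have YW: "Y x = y x" if "x \<in> W" for x
    using L[of x 1] that TW one W(4)[OF that] graded_homothety_one[OF Yc] by auto
  have Th: "h \<eta> x \<in> T" if "x \<in> T" for \<eta> x using that by (simp add: T_def act)
  have eqv: "Y (h \<eta> x) = graded_homothety ws \<eta> (Y x)" if x: "x \<in> T" for \<eta> x
  proof -
    obtain e where e: "e > 0" "e \<le> 1" "\<And>\<xi>. cmod \<xi> < e \<Longrightarrow> h \<xi> x \<in> W" using small[OF x] by blast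
    obtain e' where e': "e' > 0" "e' \<le> 1" "\<And>\<xi>. cmod \<xi> < e' \<Longrightarrow> h \<xi> (h \<eta> x) \<in> W" using small[OF Th[OF x]] by blast
    \<comment> \<open>Small enough that \<open>s\<close> takes \<open>h \<eta> x\<close> into
      \<open>W\<close> and \<open>s * \<eta>\<close> takes \<open>x\<close> into
      \<open>W\<close>.\<close>
    define s where "s = min e e' / (2 * (1 + cmod \<eta>))"
    have s: "s > 0" unfolding s_def using e e' by (intro divide_pos_pos) (auto simp: add_pos_nonneg)
    have "0 < 1 + cmod \<eta>" by (simp add: add_pos_nonneg)
    then have "s * (1 + cmod \<eta>) = min e e' / 2" unfolding s_def by (simp add: field_simps)
    then have "s + s * cmod \<eta> = min e e' / 2" by (simp add: algebra_simps)
    moreover have "0 \<le> s * cmod \<eta>" "min e e' \<le> e" "min e e' \<le> e'" using s by simp_all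
    ultimately have s2: "s < e'" "s * cmod \<eta> < e" "s \<le> 1" "s * cmod \<eta> \<le> 1" using e e' s by linarith+
    let ?s = "of_real s :: complex"
    have c1: "cmod ?s = s" "cmod (?s * \<eta>) = s * cmod \<eta>" using s by (auto simp: norm_mult)
    have "graded_homothety ws ?s (Y (h \<eta> x)) = y (h ?s (h \<eta> x))"
      using L[OF Th[OF x], of ?s \<eta>] e'(3)[of ?s] c1 s2 by simp
    also have "\<dots> = graded_homothety ws (?s * \<eta>) (Y x)"
      using L[OF x, of "?s * \<eta>"] e(3)[of "?s * \<eta>"] c1 s2 Tc[OF x] by (simp add: act)
    also have "\<dots> = graded_homothety ws ?s (graded_homothety ws \<eta> (Y x))" by (simp add: graded_homothety_comp)
    finally show ?thesis by (rule graded_homothety_cancel) (use s Yc in auto)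
  qed
  have Yinj: "inj_on Y T"
  proof (rule inj_onI)
    fix x x' assume x: "x \<in> T" "x' \<in> T" "Y x = Y x'"
    obtain e where e: "e > 0" "e \<le> 1" "\<And>\<xi>. cmod \<xi> < e \<Longrightarrow> h \<xi> x \<in> W" using small[OF x(1)] by blast
    obtain e' where e': "e' > 0" "e' \<le> 1" "\<And>\<xi>. cmod \<xi> < e' \<Longrightarrow> h \<xi> x' \<in> W" using small[OF x(2)] by blast
    let ?s = "of_real (min e e' / 2) :: complex"
    have s: "?s \<noteq> 0" "cmod ?s < e" "cmod ?s < e'" "cmod ?s \<le> 1" using e e' by (auto simp: norm_divide)
    have "y (h ?s x) = y (h ?s x')" using L[OF x(1) s(4) e(3)[OF s(2)]] L[OF x(2) s(4) e'(3)[OF s(3)]] x(3) by simp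
    then have "h ?s x = h ?s x'" using inv e(3)[OF s(2)] e'(3)[OF s(3)] W(2) by (metis subsetD)
    then have "h (1 / ?s) (h ?s x) = h (1 / ?s) (h ?s x')" by simp
    then show "x = x'" using Tc x s(1) one by (simp add: act)
  qed
  \<comment> \<open>A single scalar \<xi> yields the inverse of \<open>Y\<close> on the open set of
    vectors that its homothety sends into the image of \<open>W\<close>. This gives both openness of
    the image of \<open>T\<close> and holomorphy of the inverse.\<close>
  have E: "z \<in> Y ` T \<and> inv_into T Y z = h (1 / \<xi>) (inv_into V y (graded_homothety ws \<xi> z))"
    if \<xi>: "\<xi> \<noteq> 0" "cmod \<xi> \<le> 1" and z: "z \<in> complex_space n" "graded_homothety ws \<xi> z \<in> y ` W" for z \<xi>
  proof -
    obtain q where q: "q \<in> W" "graded_homothety ws \<xi> z = y q" using z by auto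
    let ?x = "h (1 / \<xi>) q"
    have xm: "?x \<in> mcarrier M" and hx: "h \<xi> ?x = q" using W(4)[OF q(1)] \<xi> one by (auto simp: act)
    have xT: "?x \<in> T" using T0[OF xm, of \<xi>] hx q by simp
    have "graded_homothety ws \<xi> (Y ?x) = graded_homothety ws \<xi> z" using L[OF xT \<xi>(2)] hx q by simp
    then have Yx: "Y ?x = z" by (rule graded_homothety_cancel) (use \<xi> Yc z ws in auto)
    have "inv_into V y (graded_homothety ws \<xi> z) = q" using q inv W(2) by auto
    moreover have "z \<in> Y ` T" using Yx xT by blast
    moreover have "inv_into T Y z = ?x" using inv_into_f_f[OF Yinj xT] unfolding Yx .
    ultimately show ?thesis by simp
  qed
  have Ehom: "open_cs n {z \<in> complex_space n. graded_homothety ws \<xi> z \<in> y ` W}" for \<xi>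
  proof (subst openin_subopen, intro ballI)
    fix z assume z: "z \<in> {z \<in> complex_space n. graded_homothety ws \<xi> z \<in> y ` W}"
    then have "cdiff_at n n (graded_homothety ws \<xi>) z" using cdiff_at_homothety[of z ws] ws by simp
    from cdiff_at_continuous[OF this yW] z obtain S where S: "open_cs n S" "z \<in> S" "graded_homothety ws \<xi> ` S \<subseteq> y ` W" by blast
    then show "\<exists>T. open_cs n T \<and> z \<in> T \<and> T \<subseteq> {z \<in> complex_space n. graded_homothety ws \<xi> z \<in> y ` W}"
      using open_cs_subset[OF S(1)] by (intro exI[of _ S]) auto
  qed
  \<comment> \<open>Homothety by 0 sends \<open>z'\<close> into the image of \<open>W\<close>. That
    image is open, so a small nonzero homothety does so too, and \<open>E\<close> applies.\<close>
  have sat: "z' \<in> Y ` T" if z: "z \<in> Y ` T" and z': "z' \<in> complex_space n" "graded_homothety ws 0 z' = graded_homothety ws 0 z" for z z'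
  proof -
    obtain x where x: "x \<in> T" "z = Y x" using z by auto
    have "graded_homothety ws 0 z = y (h 0 x)" using L[OF x(1), of 0] x by (simp add: T_def)
    moreover have "y (h 0 x) \<in> y ` W" using x by (auto simp: T_def)
    ultimately have 0: "graded_homothety ws 0 z' \<in> y ` W" using z'(2) by simp
    obtain A where A: "open A" "y ` W = complex_space n \<inter> A" using yW by (auto simp: openin_open)
    have "continuous_on UNIV (\<lambda>\<xi>. graded_homothety ws \<xi> z')"
    proof (rule continuous_on_coordinatewise_then_product)
      fix i show "continuous_on UNIV (\<lambda>\<xi>. graded_homothety ws \<xi> z' i)"
        unfolding graded_homothety_def by (cases "i < length ws") (simp_all, intro continuous_intros)
    qed
    then have "open ((\<lambda>\<xi>. graded_homothety ws \<xi> z') -` A)" by (rule open_vimage[OF A(1)])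
    then obtain e where e: "e > 0" "ball 0 e \<subseteq> (\<lambda>\<xi>. graded_homothety ws \<xi> z') -` A"
      using 0 A(2) open_contains_ball by blast
    let ?s = "of_real (min e 1 / 2) :: complex"
    have s: "?s \<noteq> 0" "cmod ?s \<le> 1" "?s \<in> ball 0 e" using e by (auto simp: norm_divide)
    have "graded_homothety ws ?s z' \<in> complex_space n" using graded_homothety_space[of ws ?s z'] ws by simp
    then have "graded_homothety ws ?s z' \<in> y ` W" using s e A(2) by blast
    then show ?thesis using E[OF s(1,2) z'(1)] by blast
  qed
  have "(T, restrict Y T) \<in> matlas M"
  proof (rule biholomorphic_chart[OF M To Yinj])
    have loc: "\<exists>\<xi>. \<xi> \<noteq> 0 \<and> cmod \<xi> \<le> 1 \<and> h \<xi> x \<in> W" if "x \<in> T" for x using \<sigma>[OF that] by blast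
    show "open_cs (mdim M) (Y ` T)"
      unfolding n_def[symmetric]
    proof (subst openin_subopen, intro ballI)
      fix z assume "z \<in> Y ` T"
      then obtain x where x: "x \<in> T" "z = Y x" by auto
      obtain \<xi> where \<xi>: "\<xi> \<noteq> 0" "cmod \<xi> \<le> 1" "h \<xi> x \<in> W" using loc[OF x(1)] by blast
      have "graded_homothety ws \<xi> z \<in> y ` W" using L[OF x(1) \<xi>(2,3)] x \<xi> by (metis imageI)
      then show "\<exists>Q. open_cs n Q \<and> z \<in> Q \<and> Q \<subseteq> Y ` T"
        using Ehom[of \<xi>] E[OF \<xi>(1,2)] Yc[of x] x ws
        by (intro exI[of _ "{z \<in> complex_space n. graded_homothety ws \<xi> z \<in> y ` W}"]) auto
    qed
    fix x assume x: "x \<in> T"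
    obtain \<xi> where \<xi>: "\<xi> \<noteq> 0" "cmod \<xi> \<le> 1" "h \<xi> x \<in> W" using loc[OF x] by blast
    have hV: "h \<xi> x \<in> V" using \<xi> W by auto
    have yh: "hol_at M (csm n) (\<lambda>x. y (h \<xi> x)) x"
      by (rule hol_at_comp[OF M M csm_manifold refl _ hol_h[OF Tc[OF x]]]) (use chart_hol[OF M c(1) hV] n_def in simp)
    have "hol_at M (csm n) (\<lambda>x. graded_homothety ws (1 / \<xi>) (y (h \<xi> x))) x"
      by (rule hol_at_csm_compI[OF M yh]) (use cdiff_at_homothety[OF yc[OF hV], of "1 / \<xi>"] ws in simp)
    then show "hol_at M (csm (mdim M)) Y x"
      unfolding n_def[symmetric]
    proof (rule hol_at_cong[OF M])
      show "openin (mtop M) {x \<in> mcarrier M. h \<xi> x \<in> W}" by (rule open_preimage_h[OF W(1)])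
      show "x \<in> {x \<in> mcarrier M. h \<xi> x \<in> W}" using \<xi> Tc[OF x] by simp
      fix x' assume x': "x' \<in> {x \<in> mcarrier M. h \<xi> x \<in> W}"
      then have "y (h \<xi> x') = graded_homothety ws \<xi> (Y x')" using L[OF T0 \<xi>(2)] by auto
      then show "graded_homothety ws (1 / \<xi>) (y (h \<xi> x')) = Y x'"
        using \<xi>(1) graded_homothety_one[OF Yc] by (simp add: graded_homothety_comp)
    qed
    let ?z = "Y x"
    have zc: "?z \<in> complex_space n" using Yc[of x] ws by simp
    have zy: "graded_homothety ws \<xi> ?z = y (h \<xi> x)" using L[OF x \<xi>(2,3)] by simp
    have 1: "hol_at (csm n) M (\<lambda>z. inv_into V y (graded_homothety ws \<xi> z)) ?z"
    proof (rule hol_at_comp[OF csm_manifold csm_manifold M refl])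
      show "hol_at (csm n) M (inv_into V y) (graded_homothety ws \<xi> ?z)"
        unfolding zy using inv_chart_hol[OF M c(1) hV] n_def by simp
      show "hol_at (csm n) (csm n) (graded_homothety ws \<xi>) ?z"
        unfolding csm_csm using cdiff_at_homothety[of ?z ws \<xi>] zc ws by simp
    qed
    have "inv_into V y (graded_homothety ws \<xi> ?z) = h \<xi> x" unfolding zy by (rule inv[OF hV])
    then have 2: "hol_at (csm n) M (\<lambda>z. h (1 / \<xi>) (inv_into V y (graded_homothety ws \<xi> z))) ?z"
      by (intro hol_at_comp[OF csm_manifold M M refl _ 1]) (use hol_h[OF h_mem[OF Tc[OF x]]] in simp)
    show "hol_at (csm (mdim M)) M (inv_into T Y) (Y x)"
      unfolding n_def[symmetric]
      by (rule hol_at_cong[OF csm_manifold 2, where W = "{z \<in> complex_space n. graded_homothety ws \<xi> z \<in> y ` W}"])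
        (use Ehom[of \<xi>] zc zy \<xi> E[OF \<xi>(1,2)] in auto)
  qed
  moreover have "restrict Y T ` T = Y ` T" by auto
  ultimately have "gchart ws T (restrict Y T)"
    unfolding gchart_def using Th eqv sat ws n_def by (auto simp: T_def act)
  then show ?thesis using that[OF ws(1)] TW W(3) by blast
qed

end

section \<open>Jacobian matrices and the weights at a fixed point\<close>

lemma cdiff_at_pd:
  assumes "cdiff_at n m g z" "j < m" shows "has_cderiv n (\<lambda>w. g w j) (\<lambda>i. pd i (\<lambda>w. g w j) z) z"
proof -
  obtain c where c: "has_cderiv n (\<lambda>w. g w j) c z" using assms unfolding cdiff_at_def by blast
  have "pd i (\<lambda>w. g w j) z = c i" if "i < n" for i
    using has_cderiv_pd[OF c cdiff_at_space(1)[OF assms(1)] that] .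
  then show ?thesis using c by (simp add: has_cderiv_def)
qed

lemma pd_compose_cdiff:
  assumes g: "cdiff_at n m g z" and f: "cdiff_at m l f (g z)" and j: "j < l" and i: "i < n"
  shows "pd i (\<lambda>w. f (g w) j) z = (\<Sum>k<m. pd k (\<lambda>w. f w j) (g z) * pd i (\<lambda>w. g w k) z)"
proof -
  obtain S where S: "open_cs n S" "z \<in> S" "g ` S \<subseteq> complex_space m" using g by (auto simp: cdiff_at_def)
  from has_cderiv_compose[where f = "\<lambda>w. f w j" and g = g, OF cdiff_at_pd[OF f j] cdiff_at_pd[OF g] cdiff_at_space(1)[OF g] S]
  show ?thesis using has_cderiv_pd[OF _ cdiff_at_space(1)[OF g] i] by blast
qed

lemma pd_cong:
  assumes "cdiff_at n m f z" "open_cs n S" "z \<in> S" "\<And>w. w \<in> S \<Longrightarrow> f w = g w" "j < m" "i < n"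
  shows "pd i (\<lambda>w. f w j) z = pd i (\<lambda>w. g w j) z"
  using has_cderiv_pd[OF has_cderiv_cong[where g = "\<lambda>w. g w j", OF cdiff_at_pd[OF assms(1,5)] assms(2,3)]
    cdiff_at_space(1)[OF assms(1)] assms(6)] assms(4) by auto

lemma pd_coord: "pd i (\<lambda>w. w j) z = (if i = j then 1 else 0)"
proof -
  have "((\<lambda>\<zeta>. (z(i := \<zeta>)) j) has_field_derivative (if i = j then 1 else 0)) (at (z i))"
    by (cases "i = j") auto
  then show ?thesis unfolding pd_def by (rule DERIV_imp_deriv)
qed

lemma pd_homothety:
  "j < length w \<Longrightarrow> pd i (\<lambda>z. graded_homothety w c z j) z = (if i = j then c ^ (w ! j) else 0)"
proof -
  assume j: "j < length w"
  have "((\<lambda>\<zeta>. graded_homothety w c (z(i := \<zeta>)) j) has_field_derivative (if i = j then c ^ (w ! j) else 0)) (at (z i))"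
    using j by (cases "i = j") (auto simp: graded_homothety_def intro!: derivative_eq_intros)
  then show ?thesis unfolding pd_def by (rule DERIV_imp_deriv)
qed

text \<open>The weights at a fixed point are read off the differential of \<open>h (1/2)\<close>.\<close>

context haction
begin

text \<open>Linearizing coordinates \<open>f\<close> with inverse \<open>g\<close>, required only as
  germs at \<open>p\<close> and only for one map of the action. Both homogeneous charts
  (\<open>gchart_has_weights\<close>) and bundle trivializations combined with base charts
  (\<open>bundle_weights\<close>) supply them.\<close>

definition has_weights :: "'a \<Rightarrow> nat list \<Rightarrow> bool" where
  "has_weights p ws \<longleftrightarrow> p \<in> mcarrier M \<and> h 0 p = p \<and>
     (\<exists>f g W Q. hol_at M (csm (length ws)) f p \<and> hol_at (csm (length ws)) M g (f p) \<and>
       openin (mtop M) W \<and> p \<in> W \<and> (\<forall>x\<in>W. g (f x) = x) \<and>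
       open_cs (length ws) Q \<and> f p \<in> Q \<and>
       (\<forall>z\<in>Q. f (g z) = z \<and> f (h (1/2) (g z)) = graded_homothety ws (1/2) z))"

text \<open>The coordinate change \<tau> commutes with the diagonal homotheties by 1/2. Hence its
  Jacobian matrix joins coordinates \<open>j\<close> and \<open>i\<close> only if
  \<open>(1/2) ^ (ws ! j) = (1/2) ^ (ws' ! i)\<close>, that is, only if their weights agree, and
  \<open>weights_mset_eq\<close> applies.\<close>

theorem weights_unique:
  assumes p: "has_weights p ws" and p': "has_weights p ws'"
  shows "mset ws = mset ws'"
proof -
  let ?k = "length ws" and ?l = "length ws'"
  obtain f g W Q where 1: "hol_at M (csm ?k) f p" "hol_at (csm ?k) M g (f p)"
       "openin (mtop M) W" "p \<in> W" "\<And>x. x\<in>W \<Longrightarrow> g (f x) = x"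
       "open_cs ?k Q" "f p \<in> Q" "\<And>z. z\<in>Q \<Longrightarrow> f (g z) = z" "\<And>z. z\<in>Q \<Longrightarrow> f (h (1/2) (g z)) = graded_homothety ws (1/2) z"
    using p unfolding has_weights_def by auto
  obtain f' g' W' Q' where 2: "hol_at M (csm ?l) f' p" "hol_at (csm ?l) M g' (f' p)"
       "openin (mtop M) W'" "p \<in> W'" "\<And>x. x\<in>W' \<Longrightarrow> g' (f' x) = x"
       "open_cs ?l Q'" "f' p \<in> Q'" "\<And>z. z\<in>Q' \<Longrightarrow> f' (g' z) = z" "\<And>z. z\<in>Q' \<Longrightarrow> f' (h (1/2) (g' z)) = graded_homothety ws' (1/2) z"
    using p' unfolding has_weights_def by auto
  have pc: "p \<in> mcarrier M" "h \<xi> p = p" for \<xi> using p fixed by (auto simp: has_weights_def)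
  define \<tau> where "\<tau> z = f' (g z)" for z
  define \<sigma> where "\<sigma> z = f (g' z)" for z
  let ?z = "f p" and ?z' = "f' p"
  have gp: "g ?z = p" "g' ?z' = p" using 1(4,5) 2(4,5) by auto
  have \<tau>z: "\<tau> ?z = ?z'" and \<sigma>z: "\<sigma> ?z' = ?z" by (auto simp: \<tau>_def \<sigma>_def gp)
  have \<tau>d: "cdiff_at ?k ?l \<tau> ?z" unfolding \<tau>_def csm_csm[symmetric]
    by (rule hol_at_comp[OF csm_manifold M csm_manifold refl _ 1(2)]) (simp add: gp 2(1))
  have \<sigma>d: "cdiff_at ?l ?k \<sigma> ?z'" unfolding \<sigma>_def csm_csm[symmetric]
    by (rule hol_at_comp[OF csm_manifold M csm_manifold refl _ 2(2)]) (simp add: gp 1(1))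
  \<comment> \<open>The neighbourhoods \<open>A1\<close> to \<open>A4\<close> are chosen so that the
    cancellations of inverse germs below take place inside their domains of validity.\<close>
  have "cont_at (mtop (csm ?k)) (mtop M) g ?z" by (rule hol_at_cont[OF 1(2)])
  from cont_at_nbhd[where f = g and x = ?z, OF this 2(3)] obtain A1 where A1: "open_cs ?k A1" "?z \<in> A1" "g ` A1 \<subseteq> W'" using gp 2(4) by auto
  have "cont_at (mtop (csm ?l)) (mtop M) g' ?z'" by (rule hol_at_cont[OF 2(2)])
  from cont_at_nbhd[where f = g' and x = ?z', OF this 1(3)] obtain A2 where A2: "open_cs ?l A2" "?z' \<in> A2" "g' ` A2 \<subseteq> W" using gp 1(4) by auto
  have gm: "g w \<in> mcarrier M" if "w \<in> A1" for w using A1(3) that openin_subset[OF 2(3)] by blast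
  have "hol_at (csm ?k) M (\<lambda>w. h (1/2) (g w)) ?z"
    by (rule hol_at_comp[OF csm_manifold M M refl _ 1(2)]) (simp add: gp hol_h pc)
  then have "cont_at (mtop (csm ?k)) (mtop M) (\<lambda>w. h (1/2) (g w)) ?z" by (rule hol_at_cont)
  from cont_at_nbhd[where f = "\<lambda>w. h (1/2) (g w)" and x = ?z, OF this 1(3)] obtain A3
    where A3: "open_cs ?k A3" "?z \<in> A3" "(\<lambda>w. h (1/2) (g w)) ` A3 \<subseteq> W" using gp 1(4) pc by auto
  obtain A4 where A4: "open_cs ?k A4" "?z \<in> A4" "\<tau> ` A4 \<subseteq> Q'"
    using cdiff_at_continuous[OF \<tau>d 2(6)] 2(7) \<tau>z by auto
  define L where "L i j = pd j (\<lambda>w. \<tau> w i) ?z" for i j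
  define N where "N j i = pd i (\<lambda>w. \<sigma> w j) ?z'" for j i
  have \<sigma>\<tau>: "(\<Sum>i<?l. N j i * L i j') = (if j' = j then 1 else 0)" if j: "j < ?k" "j' < ?k" for j j'
  proof -
    have d: "cdiff_at ?k ?k (\<lambda>w. \<sigma> (\<tau> w)) ?z" by (rule cdiff_at_compose[OF \<tau>d]) (simp add: \<tau>z \<sigma>d)
    have o: "open_cs ?k (A1 \<inter> Q)" "?z \<in> A1 \<inter> Q" using A1 1 by auto
    have "pd j' (\<lambda>w. \<sigma> (\<tau> w) j) ?z = pd j' (\<lambda>w. w j) ?z"
    proof (rule pd_cong[OF d o _ j])
      fix w assume "w \<in> A1 \<inter> Q"
      then show "\<sigma> (\<tau> w) = w" using A1(3) 2(5) 1(8) by (auto simp: \<sigma>_def \<tau>_def)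
    qed
    moreover have "pd j' (\<lambda>w. \<sigma> (\<tau> w) j) ?z = (\<Sum>i<?l. pd i (\<lambda>w. \<sigma> w j) (\<tau> ?z) * pd j' (\<lambda>w. \<tau> w i) ?z)"
      by (rule pd_compose_cdiff[OF \<tau>d _ j]) (simp add: \<tau>z \<sigma>d)
    ultimately show ?thesis by (simp add: pd_coord \<tau>z L_def N_def)
  qed
  have \<tau>\<sigma>: "(\<Sum>j<?k. L i j * N j i') = (if i' = i then 1 else 0)" if i: "i < ?l" "i' < ?l" for i i'
  proof -
    have d: "cdiff_at ?l ?l (\<lambda>w. \<tau> (\<sigma> w)) ?z'" by (rule cdiff_at_compose[OF \<sigma>d]) (simp add: \<sigma>z \<tau>d)
    have o: "open_cs ?l (A2 \<inter> Q')" "?z' \<in> A2 \<inter> Q'" using A2 2 by auto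
    have "pd i' (\<lambda>w. \<tau> (\<sigma> w) i) ?z' = pd i' (\<lambda>w. w i) ?z'"
    proof (rule pd_cong[OF d o _ i])
      fix w assume "w \<in> A2 \<inter> Q'"
      then show "\<tau> (\<sigma> w) = w" using A2(3) 1(5) 2(8) by (auto simp: \<sigma>_def \<tau>_def)
    qed
    moreover have "pd i' (\<lambda>w. \<tau> (\<sigma> w) i) ?z' = (\<Sum>j<?k. pd j (\<lambda>w. \<tau> w i) (\<sigma> ?z') * pd i' (\<lambda>w. \<sigma> w j) ?z')"
      by (rule pd_compose_cdiff[OF \<sigma>d _ i]) (simp add: \<sigma>z \<tau>d)
    ultimately show ?thesis by (simp add: pd_coord \<sigma>z L_def N_def)
  qed
  have eqv: "ws' ! i = ws ! j" if ij: "i < ?l" "j < ?k" and nz: "L i j \<noteq> 0" for i j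
  proof -
    let ?H = "graded_homothety ws (1/2)" and ?H' = "graded_homothety ws' (1/2)"
    have Hz: "?H ?z = ?z" using 1(9)[OF 1(7)] gp pc by simp
    have Hd: "cdiff_at ?k ?k ?H ?z" by (rule cdiff_at_homothety) (rule cdiff_at_space(1)[OF \<tau>d])
    have H'd: "cdiff_at ?l ?l ?H' ?z'" by (rule cdiff_at_homothety) (rule cdiff_at_space(1)[OF \<sigma>d])
    have d: "cdiff_at ?k ?l (\<lambda>w. \<tau> (?H w)) ?z" by (rule cdiff_at_compose[OF Hd]) (simp only: Hz \<tau>d)
    have o: "open_cs ?k (A1 \<inter> A3 \<inter> A4 \<inter> Q)" "?z \<in> A1 \<inter> A3 \<inter> A4 \<inter> Q" using A1 A3 A4 1 by auto
    have "pd j (\<lambda>w. \<tau> (?H w) i) ?z = pd j (\<lambda>w. ?H' (\<tau> w) i) ?z"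
    proof (rule pd_cong[OF d o _ ij])
      fix w assume w: "w \<in> A1 \<inter> A3 \<inter> A4 \<inter> Q"
      have "\<tau> (?H w) = f' (g (f (h (1/2) (g w))))" using w 1(9) by (simp add: \<tau>_def)
      also have "\<dots> = f' (h (1/2) (g w))" using w A3(3) 1(5) by (simp add: image_subset_iff)
      also have "\<dots> = f' (h (1/2) (g' (\<tau> w)))" using w A1(3) 2(5) by (simp add: \<tau>_def image_subset_iff)
      also have "\<dots> = ?H' (\<tau> w)" using w A4(3) 2(9) by (simp add: image_subset_iff)
      finally show "\<tau> (?H w) = ?H' (\<tau> w)" .
    qed
    moreover have "pd j (\<lambda>w. \<tau> (?H w) i) ?z = (\<Sum>l<?k. pd l (\<lambda>w. \<tau> w i) (?H ?z) * pd j (\<lambda>w. ?H w l) ?z)"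
      by (rule pd_compose_cdiff[OF Hd _ ij]) (simp only: Hz \<tau>d)
    moreover have "\<dots> = (\<Sum>l<?k. L i l * (if j = l then (1/2) ^ (ws ! l) else 0))"
      by (intro sum.cong) (auto simp: L_def pd_homothety Hz)
    moreover have "\<dots> = L i j * (1/2) ^ (ws ! j)" using ij by (simp add: if_distrib[of "\<lambda>x. _ * x"] cong: if_cong)
    moreover have "pd j (\<lambda>w. ?H' (\<tau> w) i) ?z = (\<Sum>l<?l. pd l (\<lambda>w. ?H' w i) (\<tau> ?z) * pd j (\<lambda>w. \<tau> w l) ?z)"
      by (rule pd_compose_cdiff[OF \<tau>d _ ij]) (simp only: \<tau>z H'd)
    moreover have "\<dots> = (\<Sum>l<?l. (if l = i then (1/2) ^ (ws' ! i) else 0) * L l j)"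
      using ij by (intro sum.cong) (auto simp: L_def pd_homothety)
    moreover have "\<dots> = (1/2) ^ (ws' ! i) * L i j" using ij by (simp add: if_distrib[of "\<lambda>x. x * _"] cong: if_cong)
    ultimately have "L i j * (1/2) ^ (ws ! j) = (1/2) ^ (ws' ! i) * L i j" by metis
    then have "((1/2) ^ (ws ! j) :: complex) = (1/2) ^ (ws' ! i)" using nz by simp
    then have "cmod ((1/2) ^ (ws ! j)) = cmod ((1/2) ^ (ws' ! i))" by simp
    then have "((1/2::real)) ^ (ws ! j) = (1/2) ^ (ws' ! i)" by (simp only: norm_power norm_divide norm_one norm_numeral)
    then show ?thesis using power_inject_exp'[of "1/2::real"] by (metis power_one_over numeral_One one_less_numeral_iff
        power_inject_exp semiring_norm(76) inverse_eq_divide power_inverse inverse_inverse_eq)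
  qed
  show ?thesis by (rule weights_mset_eq[where w = ws and w' = ws' and L = L and M = N]) (use \<sigma>\<tau> \<tau>\<sigma> eqv in auto)
qed

lemma gchart_has_weights:
  assumes c: "gchart ws T Y" and q: "q \<in> T" "h 0 q = q"
  shows "has_weights q ws"
proof -
  have cT: "(T, Y) \<in> matlas M" and n: "length ws = mdim M"
    and eqv: "\<And>x \<xi>. x \<in> T \<Longrightarrow> h \<xi> x \<in> T \<and> Y (h \<xi> x) = graded_homothety ws \<xi> (Y x)"
    using c unfolding gchart_def by auto
  note ic = mf_chart[OF M cT]
  have inv: "inv_into T Y (Y x) = x" if "x \<in> T" for x using that is_chartD(3)[OF ic] by simp
  show ?thesis unfolding has_weights_def n
  proof (intro conjI exI[of _ Y] exI[of _ "inv_into T Y"] exI[of _ T] exI[of _ "Y ` T"])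
    show "q \<in> mcarrier M" by (rule mf_chart_mem[OF M cT q(1)])
    show "\<forall>z\<in>Y ` T. Y (inv_into T Y z) = z \<and> Y (h (1/2) (inv_into T Y z)) = graded_homothety ws (1/2) z"
      using inv eqv by auto
  qed (use q inv chart_hol[OF M cT q(1)] inv_chart_hol[OF M cT q(1)] is_chartD(1,4)[OF ic] in auto)
qed

text \<open>The domains of the homogeneous charts with weights \<open>ws\<close> unite to an open
  set \<open>B ws\<close>. These sets cover the total space, and those of different sorted lists are
  disjoint: with a point they contain its limit, whose weights are unique. Connectedness leaves one
  list.\<close>

theorem constant_weights:
  assumes con: "connected_space (mtop M)" and ne: "mcarrier M \<noteq> {}"
  obtains k d where "d \<noteq> [] \<longrightarrow> last d \<noteq> 0"
    "\<And>p. p \<in> mcarrier M \<Longrightarrow> h 0 p = p \<Longrightarrow> \<exists>T Y. gchart (replicate k 0 @ rank_weights d) T Y \<and> p \<in> T"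
proof -
  obtain x0 where x0: "x0 \<in> mcarrier M" using ne by blast
  have fx: "h 0 (h 0 x) = h 0 x" if "x \<in> mcarrier M" for x using that by (simp add: act)
  obtain ws T0 Y0 where ws: "sorted ws" "gchart ws T0 Y0" "h 0 x0 \<in> T0"
    using gchart_exists[OF h_mem[OF x0] fx[OF x0]] by blast
  define B where "B ws = \<Union>{T. \<exists>Y. gchart ws T Y}" for ws
  have Bo: "openin (mtop M) (B ws)" for ws
    unfolding B_def gchart_def using is_chartD(1)[OF mf_chart[OF M]] by blast
  have Bm: "x \<in> B ws \<longleftrightarrow> h 0 x \<in> B ws" if "x \<in> mcarrier M" for x ws
    using that unfolding B_def gchart_def by blast
  have disj: "B ws \<inter> B ws' = {}" if "sorted ws" "sorted ws'" "ws \<noteq> ws'" for ws ws'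
  proof (rule ccontr)
    assume "B ws \<inter> B ws' \<noteq> {}"
    then obtain x where x: "x \<in> B ws" "x \<in> B ws'" by blast
    have xm: "x \<in> mcarrier M" using x(1) Bo openin_subset by blast
    have "h 0 x \<in> B ws" "h 0 x \<in> B ws'" using x Bm[OF xm] by auto
    then have "has_weights (h 0 x) ws" "has_weights (h 0 x) ws'"
      unfolding B_def using gchart_has_weights fx[OF xm] by auto
    then have "mset ws = mset ws'" by (rule weights_unique)
    then show False using sorted_mset_unique that by blast
  qed
  have cover: "\<exists>ws'. sorted ws' \<and> x \<in> B ws'" if x: "x \<in> mcarrier M" for x
  proof -
    obtain ws' T Y where "sorted ws'" "gchart ws' T Y" "h 0 x \<in> T"
      using gchart_exists[OF h_mem[OF x] fx[OF x]] by blast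
    then show ?thesis using Bm[OF x, of ws'] unfolding B_def by blast
  qed
  have "mcarrier M - B ws = \<Union>{B ws' |ws'. sorted ws' \<and> ws' \<noteq> ws}"
  proof
    show "mcarrier M - B ws \<subseteq> \<Union>{B ws' |ws'. sorted ws' \<and> ws' \<noteq> ws}"
    proof
      fix x assume x: "x \<in> mcarrier M - B ws"
      then obtain ws' where "sorted ws'" "x \<in> B ws'" using cover by blast
      then show "x \<in> \<Union>{B ws' |ws'. sorted ws' \<and> ws' \<noteq> ws}" using x by blast
    qed
    show "\<Union>{B ws' |ws'. sorted ws' \<and> ws' \<noteq> ws} \<subseteq> mcarrier M - B ws"
    proof clarify
      fix x ws' assume x: "x \<in> B ws'" "sorted ws'" "ws' \<noteq> ws"
      then have "x \<notin> B ws" using disj[OF ws(1) x(2)] by blast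
      then show "x \<in> mcarrier M - B ws" using x openin_subset[OF Bo] by blast
    qed
  qed
  then have "openin (mtop M) (mcarrier M - B ws)" using Bo by auto
  then have "closedin (mtop M) (B ws)" using openin_subset[OF Bo] by (simp add: closedin_def)
  moreover have "B ws \<noteq> {}" using ws unfolding B_def by blast
  ultimately have all: "B ws = mcarrier M" using con Bo connected_space_clopen_in by blast
  obtain k d where kd: "d \<noteq> [] \<longrightarrow> last d \<noteq> 0" "ws = replicate k 0 @ rank_weights d"
    using sorted_weights_split[OF ws(1)] by blast
  show ?thesis
  proof (rule that[OF kd(1)])
    fix p assume "p \<in> mcarrier M" "h 0 p = p"
    then have "p \<in> B ws" using all by simp
    then show "\<exists>T Y. gchart (replicate k 0 @ rank_weights d) T Y \<and> p \<in> T" unfolding B_def kd(2) by blast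
  qed
qed

end

section \<open>Maps into and out of products\<close>

lemma hol_at_prod_iff:
  assumes "complex_manifold M" "complex_manifold N" "complex_manifold P"
  shows "hol_at P (product_manifold M N) f x \<longleftrightarrow> hol_at P M (\<lambda>x. fst (f x)) x \<and> hol_at P N (\<lambda>x. snd (f x)) x"
proof
  note prod = product_manifold_complex[OF assms(1,2)]
  assume f: "hol_at P (product_manifold M N) f x"
  note pr = hol_at_pr[OF assms(1,2) hol_at_mem(2)[OF f]]
  show "hol_at P M (\<lambda>x. fst (f x)) x \<and> hol_at P N (\<lambda>x. snd (f x)) x"
    using hol_at_comp[OF assms(3) prod assms(1) refl pr(1) f] hol_at_comp[OF assms(3) prod assms(2) refl pr(2) f] by simp
qed (use hol_at_pair[OF assms] in blast)

lemma hol_at_prod_open_submanifold: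
  assumes M: "complex_manifold M" and N: "complex_manifold N" and P: "complex_manifold P" and U: "openin (mtop M) U"
  shows "hol_at P (product_manifold (open_submanifold M U) N) f x \<longleftrightarrow> hol_at P (product_manifold M N) f x \<and> fst (f x) \<in> U"
  unfolding hol_at_prod_iff[OF M N P] hol_at_prod_iff[OF open_submanifold_manifold[OF M U] N P] hol_at_open_submanifold_cod[OF P M U] by blast

lemma product_carrier: "mcarrier (product_manifold M N) = mcarrier M \<times> mcarrier N"
  by (simp add: product_manifold_def)

lemma hol_at_prod_open_submanifold_dom:
  assumes M: "complex_manifold M" and N: "complex_manifold N" and P: "complex_manifold P" and U: "openin (mtop M) U"
    and p: "fst p \<in> U" "snd p \<in> mcarrier N"
  shows "hol_at (product_manifold (open_submanifold M U) N) P g p \<longleftrightarrow> hol_at (product_manifold M N) P g p"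
proof -
  note MU = open_submanifold_manifold[OF M U]
  note A = product_manifold_complex[OF M N] and B = product_manifold_complex[OF MU N]
  have "p \<in> mcarrier (product_manifold M N)" "p \<in> mcarrier (product_manifold (open_submanifold M U) N)"
    using p open_submanifold_carrier[OF U] openin_subset[OF U] by (auto simp: product_carrier mem_Times_iff)
  from hol_at_id[OF A this(1)] hol_at_id[OF B this(2)]
  have 1: "hol_at (product_manifold M N) (product_manifold (open_submanifold M U) N) (\<lambda>p. p) p"
    and 2: "hol_at (product_manifold (open_submanifold M U) N) (product_manifold M N) (\<lambda>p. p) p"
    using p hol_at_prod_open_submanifold[OF M N A U, of "\<lambda>p. p" p] hol_at_prod_open_submanifold[OF M N B U, of "\<lambda>p. p" p] by auto
  show ?thesis using hol_at_comp[OF A B P refl _ 1, of g] hol_at_comp[OF B A P refl _ 2, of g] by blast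
qed

lemma hol_at_join:
  assumes P: "complex_manifold P" and a: "hol_at P (csm m) a x" and b: "hol_at P (csm n) b x"
  shows "hol_at P (csm (m + n)) (\<lambda>x. join m (a x) (b x)) x"
proof -
  obtain U \<phi> where c: "(U, \<phi>) \<in> matlas P" "x \<in> U" using mf_cover[OF P hol_at_mem(1)[OF a]] .
  show ?thesis by (rule hol_at_csmI[OF P c]) (rule cdiff_at_join[OF hol_at_csmD[OF P c a] hol_at_csmD[OF P c b]])
qed

section \<open>Homotheties of graded bundles\<close>

text \<open>The part of a bundle that is independent of its family of trivializations. It allows
  single trivializations to be studied in a given bundle as well as in a structure not yet known to
  be a bundle.\<close>

definition pre_bundle :: "'a graded_bundle \<Rightarrow> bool" where
  "pre_bundle B \<longleftrightarrow> complex_manifold (gtotal B) \<and> complex_manifold (gbase B) \<and>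
     (\<forall>e\<in>mcarrier (gtotal B). hol_at (gtotal B) (gbase B) (gproj B) e)"

lemma pre_bundle_proj: "pre_bundle B \<Longrightarrow> e \<in> mcarrier (gtotal B) \<Longrightarrow> hol_at (gtotal B) (gbase B) (gproj B) e"
  by (simp add: pre_bundle_def)

lemma gover_open:
  assumes B: "pre_bundle B" and U: "openin (mtop (gbase B)) U"
  shows "openin (mtop (gtotal B)) (gover B U)"
proof -
  have "\<forall>x\<in>mcarrier (gtotal B). cont_at (mtop (gtotal B)) (mtop (gbase B)) (gproj B) x"
    using hol_at_cont[OF pre_bundle_proj[OF B]] by simp
  then have "continuous_map (mtop (gtotal B)) (mtop (gbase B)) (gproj B)" by (simp add: continuous_map_iff_cont_at)
  then show ?thesis using U unfolding gover_def continuous_map_def by auto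
qed

lemma gweights_pos: "\<forall>a\<in>set (gweights B). 0 < a"
  using rank_weights_pos by blast

abbreviation gfib :: "'a graded_bundle \<Rightarrow> nat" where "gfib B \<equiv> length (gweights B)"

abbreviation gprod :: "'a graded_bundle \<Rightarrow> ('a \<times> (nat \<Rightarrow> complex)) cmanifold" where
  "gprod B \<equiv> product_manifold (gbase B) (csm (gfib B))"

text \<open>Holomorphy between open submanifolds is replaced by pointwise holomorphy in the ambient
  manifolds.\<close>

lemma is_trivialization_iff:
  assumes B: "pre_bundle B"
  shows "is_trivialization B (U, \<phi>) \<longleftrightarrow> openin (mtop (gbase B)) U \<and> \<phi> \<in> extensional (gover B U) \<and>
    bij_betw \<phi> (gover B U) (U \<times> complex_space (gfib B)) \<and>
    (\<forall>e\<in>gover B U. hol_at (gtotal B) (gprod B) \<phi> e) \<and>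
    (\<forall>p\<in>U \<times> complex_space (gfib B). hol_at (gprod B) (gtotal B) (inv_into (gover B U) \<phi>) p) \<and>
    (\<forall>e\<in>gover B U. fst (\<phi> e) = gproj B e)"
proof (cases "openin (mtop (gbase B)) U")
  case U: True
  let ?m = "gfib B" and ?G = "gover B U"
  let ?TG = "open_submanifold (gtotal B) ?G" and ?BU = "open_submanifold (gbase B) U"
  have Tm: "complex_manifold (gtotal B)" and Bm: "complex_manifold (gbase B)" using B by (auto simp: pre_bundle_def)
  note G = gover_open[OF B U]
  note TG = open_submanifold_manifold[OF Tm G] and BU = open_submanifold_manifold[OF Bm U]
  note PU = product_manifold_complex[OF BU csm_manifold, of ?m] and PB = product_manifold_complex[OF Bm csm_manifold, of ?m]
  have c1: "mcarrier ?TG = ?G" by (rule open_submanifold_carrier[OF G])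
  have c2: "mcarrier (product_manifold ?BU (csm ?m)) = U \<times> complex_space ?m"
    unfolding product_carrier open_submanifold_carrier[OF U] by simp
  have "biholomorphic_map ?TG (product_manifold ?BU (csm ?m)) \<phi> \<longleftrightarrow>
     bij_betw \<phi> ?G (U \<times> complex_space ?m) \<and> (\<forall>e\<in>?G. hol_at ?TG (product_manifold ?BU (csm ?m)) \<phi> e) \<and>
     (\<forall>p\<in>U \<times> complex_space ?m. hol_at (product_manifold ?BU (csm ?m)) ?TG (inv_into ?G \<phi>) p)"
    unfolding biholomorphic_map_def holomorphic_map_iff[OF TG PU] holomorphic_map_iff[OF PU TG] c1 c2 ..
  moreover have "hol_at ?TG (product_manifold ?BU (csm ?m)) \<phi> e \<longleftrightarrow> hol_at (gtotal B) (gprod B) \<phi> e \<and> fst (\<phi> e) \<in> U"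
    if "e \<in> ?G" for e
    unfolding hol_at_prod_open_submanifold[OF Bm csm_manifold TG U] hol_at_open_submanifold_dom[OF Tm PB G that] ..
  moreover have "hol_at (product_manifold ?BU (csm ?m)) ?TG (inv_into ?G \<phi>) p \<longleftrightarrow>
      hol_at (gprod B) (gtotal B) (inv_into ?G \<phi>) p \<and> inv_into ?G \<phi> p \<in> ?G"
    if "p \<in> U \<times> complex_space ?m" for p
    unfolding hol_at_open_submanifold_cod[OF PU Tm G] using hol_at_prod_open_submanifold_dom[OF Bm csm_manifold Tm U, of p ?m] that by auto
  moreover have "inv_into ?G \<phi> p \<in> ?G" if "bij_betw \<phi> ?G (U \<times> complex_space ?m)" "p \<in> U \<times> complex_space ?m" for p
    using that by (metis bij_betw_def inv_into_into)
  moreover have "fst (\<phi> e) \<in> U" if "bij_betw \<phi> ?G (U \<times> complex_space ?m)" "e \<in> ?G" for e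
    using that by (metis bij_betwE mem_Times_iff)
  ultimately have "biholomorphic_map ?TG (product_manifold ?BU (csm ?m)) \<phi> \<longleftrightarrow>
     bij_betw \<phi> ?G (U \<times> complex_space ?m) \<and> (\<forall>e\<in>?G. hol_at (gtotal B) (gprod B) \<phi> e) \<and>
     (\<forall>p\<in>U \<times> complex_space ?m. hol_at (gprod B) (gtotal B) (inv_into ?G \<phi>) p)" by auto
  then show ?thesis using U unfolding is_trivialization_def by simp
qed (simp add: is_trivialization_def)

lemma trivD:
  assumes B: "pre_bundle B" and t: "is_trivialization B (U, \<phi>)"
  shows "openin (mtop (gbase B)) U" "\<phi> \<in> extensional (gover B U)" "inj_on \<phi> (gover B U)"
    "e \<in> gover B U \<Longrightarrow> \<phi> e = (gproj B e, snd (\<phi> e))"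
    "e \<in> gover B U \<Longrightarrow> snd (\<phi> e) \<in> complex_space (gfib B)"
    "e \<in> gover B U \<Longrightarrow> inv_into (gover B U) \<phi> (gproj B e, snd (\<phi> e)) = e"
    "q \<in> U \<Longrightarrow> z \<in> complex_space (gfib B) \<Longrightarrow> inv_into (gover B U) \<phi> (q, z) \<in> gover B U"
    "q \<in> U \<Longrightarrow> z \<in> complex_space (gfib B) \<Longrightarrow> \<phi> (inv_into (gover B U) \<phi> (q, z)) = (q, z)"
    "q \<in> U \<Longrightarrow> z \<in> complex_space (gfib B) \<Longrightarrow> gproj B (inv_into (gover B U) \<phi> (q, z)) = q"
    "e \<in> gover B U \<Longrightarrow> hol_at (gtotal B) (gprod B) \<phi> e"
    "q \<in> U \<Longrightarrow> z \<in> complex_space (gfib B) \<Longrightarrow> hol_at (gprod B) (gtotal B) (inv_into (gover B U) \<phi>) (q, z)"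
    "e \<in> gover B U \<Longrightarrow> gproj B e \<in> U"
    "e \<in> gover B U \<Longrightarrow> e \<in> mcarrier (gtotal B)"
proof -
  let ?m = "gfib B" and ?G = "gover B U"
  have *: "openin (mtop (gbase B)) U" "\<phi> \<in> extensional ?G" "bij_betw \<phi> ?G (U \<times> complex_space ?m)"
    "\<And>e. e \<in> ?G \<Longrightarrow> hol_at (gtotal B) (gprod B) \<phi> e"
    "\<And>p. p \<in> U \<times> complex_space ?m \<Longrightarrow> hol_at (gprod B) (gtotal B) (inv_into ?G \<phi>) p"
    "\<And>e. e \<in> ?G \<Longrightarrow> fst (\<phi> e) = gproj B e"
    using t unfolding is_trivialization_iff[OF B] by auto
  then show "openin (mtop (gbase B)) U" "\<phi> \<in> extensional ?G" "inj_on \<phi> ?G" by (auto simp: bij_betw_def)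
  show p: "\<phi> e = (gproj B e, snd (\<phi> e))" if "e \<in> ?G" for e using *(6)[OF that] by (metis prod.collapse)
  show "snd (\<phi> e) \<in> complex_space ?m" if "e \<in> ?G" for e using *(3) that by (metis bij_betwE mem_Times_iff)
  show "inv_into ?G \<phi> (gproj B e, snd (\<phi> e)) = e" if "e \<in> ?G" for e
    using *(3) that p[OF that] by (metis bij_betw_def inv_into_f_f)
  show i: "inv_into ?G \<phi> (q, z) \<in> ?G" "\<phi> (inv_into ?G \<phi> (q, z)) = (q, z)" if "q \<in> U" "z \<in> complex_space ?m" for q z
    using *(3) that by (auto simp: bij_betw_def inv_into_into f_inv_into_f)
  show "gproj B (inv_into ?G \<phi> (q, z)) = q" if "q \<in> U" "z \<in> complex_space ?m" for q z
    using *(6)[OF i(1)[OF that]] i(2)[OF that] by simp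
qed (use assms in \<open>auto simp: is_trivialization_iff[OF B] gover_def\<close>)

lemma graded_space_morphism_cong:
  assumes "graded_space_morphism w w' g" "\<And>z. z \<in> complex_space (length w) \<Longrightarrow> g z = g' z"
  shows "graded_space_morphism w w' g'"
  using assms unfolding graded_space_morphism_def weighted_homogeneous_poly_def by (simp add: image_subset_iff)

text \<open>Equivariance is stated through the trivializations, so that the lemma covers transition
  functions, with \<Phi> the identity, as well as bundle morphisms. On one fibre the map is
  holomorphic and equivariant, and \<open>graded_morphismI\<close> makes it polynomial.\<close>

lemma fibre_morphism:
  assumes B: "pre_bundle B" and B': "pre_bundle B'" and t: "is_trivialization B (U, \<phi>)" and t': "is_trivialization B' (V, \<psi>)"
    and \<Phi>: "\<And>e. e \<in> mcarrier (gtotal B) \<Longrightarrow> hol_at (gtotal B) (gtotal B') \<Phi> e"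
    and q: "q \<in> U" and V: "\<And>e. e \<in> gover B U \<Longrightarrow> gproj B e = q \<Longrightarrow> gproj B' (\<Phi> e) \<in> V"
    and eqv: "\<And>e e1 \<xi>. e \<in> gover B U \<Longrightarrow> gproj B e = q \<Longrightarrow> e1 \<in> gover B U \<Longrightarrow>
       \<phi> e1 = (q, graded_homothety (gweights B) \<xi> (snd (\<phi> e))) \<Longrightarrow>
       snd (\<psi> (\<Phi> e1)) = graded_homothety (gweights B') \<xi> (snd (\<psi> (\<Phi> e)))"
  shows "graded_space_morphism (gweights B) (gweights B') (\<lambda>z. snd (\<psi> (\<Phi> (inv_into (gover B U) \<phi> (q, z)))))"
proof -
  let ?m = "gfib B" and ?m' = "gfib B'" and ?G = "gover B U" and ?G' = "gover B' V"
  note T = trivD[OF B t] and T' = trivD[OF B' t']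
  have mf: "complex_manifold (gtotal B)" "complex_manifold (gbase B)" "complex_manifold (gtotal B')" "complex_manifold (gbase B')"
    using B B' by (auto simp: pre_bundle_def)
  note P = product_manifold_complex[OF mf(2) csm_manifold, of ?m] and P' = product_manifold_complex[OF mf(4) csm_manifold, of ?m']
  have qb: "q \<in> mcarrier (gbase B)" using q T(1) openin_subset by blast
  let ?g = "\<lambda>z. snd (\<psi> (\<Phi> (inv_into ?G \<phi> (q, z))))"
  have G': "\<Phi> (inv_into ?G \<phi> (q, z)) \<in> ?G'" if z: "z \<in> complex_space ?m" for z
    using hol_at_mem(2)[OF \<Phi>[OF T(13)[OF T(7)[OF q z]]]] V[OF T(7)[OF q z] T(9)[OF q z]] by (simp add: gover_def)
  have g: "cdiff_at ?m ?m' ?g z" if z: "z \<in> complex_space ?m" for z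
  proof -
    have 1: "hol_at (csm ?m) (gprod B) (\<lambda>z. (q, z)) z"
      using hol_at_const[OF csm_manifold mf(2) _ qb, of z ?m] hol_at_id[OF csm_manifold, of z ?m] z
      by (simp add: hol_at_prod_iff[OF mf(2) csm_manifold csm_manifold])
    have 2: "hol_at (csm ?m) (gtotal B) (\<lambda>z. inv_into ?G \<phi> (q, z)) z"
      by (rule hol_at_comp[OF csm_manifold P mf(1) refl _ 1]) (rule T(11)[OF q z])
    have 3: "hol_at (csm ?m) (gtotal B') (\<lambda>z. \<Phi> (inv_into ?G \<phi> (q, z))) z"
      by (rule hol_at_comp[OF csm_manifold mf(1,3) refl _ 2]) (rule \<Phi>[OF T(13)[OF T(7)[OF q z]]])
    have "hol_at (csm ?m) (gprod B') (\<lambda>z. \<psi> (\<Phi> (inv_into ?G \<phi> (q, z)))) z"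
      by (rule hol_at_comp[OF csm_manifold mf(3) P' refl _ 3]) (rule T'(10)[OF G'[OF z]])
    then show ?thesis unfolding hol_at_prod_iff[OF mf(4) csm_manifold csm_manifold] csm_csm by simp
  qed
  show ?thesis
  proof (rule graded_morphismI[OF gweights_pos gweights_pos])
    show "?g ` complex_space ?m \<subseteq> complex_space ?m'" using cdiff_at_space(2)[OF g] by blast
    show "sep_hol ?m (complex_space ?m) (\<lambda>z. ?g z i)" if "i < ?m'" for i
      by (rule sep_hol_cdiff_at[OF _ g that]) auto
    fix \<xi> z assume z: "z \<in> complex_space ?m"
    let ?e = "inv_into ?G \<phi> (q, z)" and ?e1 = "inv_into ?G \<phi> (q, graded_homothety (gweights B) \<xi> z)"
    show "?g (graded_homothety (gweights B) \<xi> z) = graded_homothety (gweights B') \<xi> (?g z)"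
      by (rule eqv) (use T(7,8,9)[OF q z] T(7,8)[OF q graded_homothety_space] in auto)
  qed
qed

text \<open>Among all trivializations of a bundle, this condition for its homothety action selects
  exactly the family \<open>gtrivs\<close> (see \<open>gtrivs_eq\<close>).\<close>

definition eqv_triv :: "'a graded_bundle \<Rightarrow> (complex \<Rightarrow> 'a \<Rightarrow> 'a) \<Rightarrow> 'a trivialization \<Rightarrow> bool" where
  "eqv_triv B h = (\<lambda>(U, \<phi>). \<forall>e\<in>gover B U. \<forall>\<xi>. h \<xi> e \<in> gover B U \<and>
     \<phi> (h \<xi> e) = (gproj B e, graded_homothety (gweights B) \<xi> (snd (\<phi> e))))"

lemma eqv_trivD:
  assumes "eqv_triv B h (U, \<phi>)" "e \<in> gover B U"
  shows "h \<xi> e \<in> gover B U" "\<phi> (h \<xi> e) = (gproj B e, graded_homothety (gweights B) \<xi> (snd (\<phi> e)))"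
  using assms by (auto simp: eqv_triv_def)

lemma eqv_triv_unique:
  assumes B: "pre_bundle B" and t: "is_trivialization B (U, \<phi>)" "eqv_triv B h (U, \<phi>)"
    and e: "e \<in> gover B U" "e1 \<in> gover B U" "\<phi> e1 = (gproj B e, graded_homothety (gweights B) \<xi> (snd (\<phi> e)))"
  shows "e1 = h \<xi> e"
  using inj_onD[OF trivD(3)[OF B t(1)]] eqv_trivD[OF t(2) e(1)] e by metis

text \<open>Both trivializations intertwine \<open>h\<close> with the homotheties of the model, so
  the transition function and its inverse commute with these homotheties, and
  \<open>fibre_morphism\<close> makes them graded.\<close>

lemma eqv_triv_compatible:
  assumes B: "pre_bundle B" and t: "is_trivialization B (U, \<phi>)" "eqv_triv B h (U, \<phi>)"
    and t': "is_trivialization B (V, \<psi>)" "eqv_triv B h (V, \<psi>)"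
  shows "trivializations_compatible B (U, \<phi>) (V, \<psi>)"
proof -
  let ?m = "gfib B" and ?w = "gweights B"
  have mf: "complex_manifold (gtotal B)" using B by (auto simp: pre_bundle_def)
  have mor: "graded_space_morphism ?w ?w (\<lambda>z. snd (\<psi> (inv_into (gover B U) \<phi> (q, z))))"
    if t: "is_trivialization B (U, \<phi>)" "eqv_triv B h (U, \<phi>)"
      and t': "is_trivialization B (V, \<psi>)" "eqv_triv B h (V, \<psi>)" and q: "q \<in> U" "q \<in> V" for U \<phi> V \<psi> q
  proof (rule fibre_morphism[where \<Phi> = "\<lambda>e. e", OF B B t(1) t'(1) hol_at_id[OF mf] q(1)])
    fix e e1 \<xi> assume e: "e \<in> gover B U" "gproj B e = q" "e1 \<in> gover B U" "\<phi> e1 = (q, graded_homothety ?w \<xi> (snd (\<phi> e)))"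
    then have "e1 = h \<xi> e" using eqv_triv_unique[OF B t e(1,3)] by simp
    moreover have "e \<in> gover B V" using e q(2) by (simp add: gover_def)
    ultimately show "snd (\<psi> e1) = graded_homothety ?w \<xi> (snd (\<psi> e))" using eqv_trivD[OF t'(2)] by simp
  qed (use q in auto)
  have bk: "snd (\<phi> (inv_into (gover B V) \<psi> (q, snd (\<psi> (inv_into (gover B U) \<phi> (q, z)))))) = z"
    if t: "is_trivialization B (U, \<phi>)" and t': "is_trivialization B (V, \<psi>)"
      and q: "q \<in> U" "q \<in> V" and z: "z \<in> complex_space ?m" for U \<phi> V \<psi> q z
  proof -
    let ?e = "inv_into (gover B U) \<phi> (q, z)"
    have e: "?e \<in> gover B U" "\<phi> ?e = (q, z)" "gproj B ?e = q" using trivD(7,8,9)[OF B t q(1) z] by auto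
    then have "?e \<in> gover B V" using q(2) by (simp add: gover_def)
    from trivD(6)[OF B t' this] e show ?thesis by simp
  qed
  show ?thesis unfolding trivializations_compatible_def prod.case
  proof
    fix q assume q: "q \<in> U \<inter> V"
    then have q2: "q \<in> U" "q \<in> V" by auto
    let ?g = "\<lambda>z. snd (\<psi> (inv_into (gover B U) \<phi> (q, z)))" and ?g' = "\<lambda>z. snd (\<phi> (inv_into (gover B V) \<psi> (q, z)))"
    have m1: "graded_space_morphism ?w ?w ?g" by (rule mor[OF t t' q2])
    have m2: "graded_space_morphism ?w ?w ?g'" by (rule mor[OF t' t q2(2,1)])
    have bij: "bij_betw ?g (complex_space ?m) (complex_space ?m)"
      by (rule bij_betwI[where g = ?g'])
        (use m1 m2 bk[OF t(1) t'(1) q2] bk[OF t'(1) t(1) q2(2,1)] in \<open>auto simp: graded_space_morphism_def\<close>)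
    have "graded_space_morphism ?w ?w (inv_into (complex_space ?m) ?g)"
    proof (rule graded_space_morphism_cong[OF m2])
      fix z assume z: "z \<in> complex_space ?m"
      then have z': "?g' z \<in> complex_space ?m" using m2 by (auto simp: graded_space_morphism_def)
      have "inv_into (complex_space ?m) ?g (?g (?g' z)) = ?g' z"
        by (rule inv_into_f_f[OF _ z']) (use bij in \<open>simp add: bij_betw_def\<close>)
      then show "?g' z = inv_into (complex_space ?m) ?g z" using bk[OF t'(1) t(1) q2(2,1) z] by simp
    qed
    then show "graded_space_isomorphism ?w ?w ?g" unfolding graded_space_isomorphism_def using bij m1 by blast
  qed
qed

text \<open>Conversely, a graded transition function carries the homothety computed in one
  trivialization to that in the other. This makes \<open>gbundle_homothety\<close> well defined and
  forces a trivialization compatible with equivariant ones to be equivariant.\<close>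

lemma compatible_eqv_triv:
  assumes B: "pre_bundle B" and t: "is_trivialization B (U, \<phi>)" and t': "is_trivialization B (V, \<psi>)"
    and comp: "trivializations_compatible B (U, \<phi>) (V, \<psi>)" and e: "e \<in> gover B U" "e \<in> gover B V"
    and e1: "e1 \<in> gover B U" "\<phi> e1 = (gproj B e, graded_homothety (gweights B) \<xi> (snd (\<phi> e)))"
  shows "e1 \<in> gover B V" "\<psi> e1 = (gproj B e, graded_homothety (gweights B) \<xi> (snd (\<psi> e)))"
proof -
  let ?q = "gproj B e" and ?w = "gweights B"
  let ?g = "\<lambda>z. snd (\<psi> (inv_into (gover B U) \<phi> (?q, z)))"
  have q: "?q \<in> U \<inter> V" using e by (simp add: gover_def)
  have g: "graded_space_morphism ?w ?w ?g"
    using comp q unfolding trivializations_compatible_def graded_space_isomorphism_def by auto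
  have p1: "gproj B e1 = ?q" using trivD(4)[OF B t e1(1)] e1(2) by simp
  then show V: "e1 \<in> gover B V" using e1(1) q by (simp add: gover_def)
  have "snd (\<psi> e1) = ?g (snd (\<phi> e1))" using trivD(6)[OF B t e1(1)] p1 by simp
  also have "\<dots> = ?g (graded_homothety ?w \<xi> (snd (\<phi> e)))" by (simp add: e1(2))
  also have "\<dots> = graded_homothety ?w \<xi> (?g (snd (\<phi> e)))"
    by (rule graded_morphism_homothety[OF g trivD(5)[OF B t e(1)]])
  also have "?g (snd (\<phi> e)) = snd (\<psi> e)" using trivD(6)[OF B t e(1)] by simp
  finally show "\<psi> e1 = (?q, graded_homothety ?w \<xi> (snd (\<psi> e)))"
    using trivD(4)[OF B t' V] p1 by simp
qed

lemma homogeneity_structure_iff_haction: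
  "holomorphic_homogeneity_structure S \<longleftrightarrow>
     haction (hspace S) (hact S) \<and> (\<forall>\<xi>. hact S \<xi> \<in> extensional (mcarrier (hspace S)))"
proof (cases "complex_manifold (hspace S)")
  case M: True
  have "holomorphic_map (product_manifold complex_line_manifold (hspace S)) (hspace S) (\<lambda>(\<xi>, x). hact S \<xi> x) \<longleftrightarrow>
    (\<forall>\<xi>. \<forall>x\<in>mcarrier (hspace S). hol_at (product_manifold complex_line_manifold (hspace S)) (hspace S) (\<lambda>p. hact S (fst p) (snd p)) (\<xi>, x))"
    unfolding holomorphic_map_iff[OF product_manifold_complex[OF line_manifold M] M] product_carrier case_prod_unfold by auto
  then show ?thesis using M unfolding holomorphic_homogeneity_structure_def haction_def by blast
qed (simp add: holomorphic_homogeneity_structure_def haction_def)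

section \<open>The homothety action of a bundle and its zero section\<close>

locale hbundle =
  fixes B :: "'a graded_bundle"
  assumes hgb: "holomorphic_graded_bundle B"
begin

lemma pre: "pre_bundle B"
  using hgb holomorphic_map_iff[of "gtotal B" "gbase B"] unfolding holomorphic_graded_bundle_def pre_bundle_def by blast

lemma mf: "complex_manifold (gtotal B)" "complex_manifold (gbase B)"
  using pre by (auto simp: pre_bundle_def)

lemma triv: "t \<in> gtrivs B \<Longrightarrow> is_trivialization B t"
  and compat: "t \<in> gtrivs B \<Longrightarrow> t' \<in> gtrivs B \<Longrightarrow> trivializations_compatible B t t'"
  and maximal: "is_trivialization B t \<Longrightarrow> (\<And>t'. t' \<in> gtrivs B \<Longrightarrow> trivializations_compatible B t t') \<Longrightarrow> t \<in> gtrivs B"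
  and cover: "(\<Union>t\<in>gtrivs B. fst t) = mcarrier (gbase B)"
  using hgb unfolding holomorphic_graded_bundle_def by blast+

lemma proj_mem: "e \<in> mcarrier (gtotal B) \<Longrightarrow> gproj B e \<in> mcarrier (gbase B)"
  using hol_at_mem(2)[OF pre_bundle_proj[OF pre]] .

lemma base_triv:
  assumes "q \<in> mcarrier (gbase B)" obtains U \<phi> where "(U, \<phi>) \<in> gtrivs B" "q \<in> U"
  using assms cover that by (metis UN_E prod.collapse)

lemma total_triv:
  assumes "e \<in> mcarrier (gtotal B)" obtains U \<phi> where "(U, \<phi>) \<in> gtrivs B" "e \<in> gover B U"
  using base_triv[OF proj_mem[OF assms]] assms by (metis (mono_tags, lifting) gover_def mem_Collect_eq)

abbreviation "hB \<equiv> gbundle_homothety B"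

text \<open>Resolves the description in \<open>gbundle_homothety\<close>: by
  \<open>compatible_eqv_triv\<close> every trivialization around \<open>e\<close> yields the same
  point.\<close>

lemma homothety:
  assumes t: "(U, \<phi>) \<in> gtrivs B" and e: "e \<in> gover B U"
  shows "hB \<xi> e \<in> gover B U" "\<phi> (hB \<xi> e) = (gproj B e, graded_homothety (gweights B) \<xi> (snd (\<phi> e)))"
proof -
  let ?P = "\<lambda>e'. \<exists>(U, \<phi>)\<in>gtrivs B. e \<in> gover B U \<and> e' \<in> gover B U \<and>
       \<phi> e' = (gproj B e, graded_homothety (gweights B) \<xi> (snd (\<phi> e)))"
  note T = trivD[OF pre triv[OF t]]
  define e1 where "e1 = inv_into (gover B U) \<phi> (gproj B e, graded_homothety (gweights B) \<xi> (snd (\<phi> e)))"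
  have e1: "e1 \<in> gover B U" "\<phi> e1 = (gproj B e, graded_homothety (gweights B) \<xi> (snd (\<phi> e)))"
    unfolding e1_def by (rule T(7,8)[OF T(12)[OF e] graded_homothety_space])+
  have "(THE e'. ?P e') = e1"
  proof (rule the_equality)
    show "?P e1" using t e e1 by blast
    fix e' assume "?P e'"
    then obtain V \<psi> where V: "(V, \<psi>) \<in> gtrivs B" "e \<in> gover B V" "e' \<in> gover B V"
      "\<psi> e' = (gproj B e, graded_homothety (gweights B) \<xi> (snd (\<psi> e)))" by blast
    note C = compatible_eqv_triv[OF pre triv[OF V(1)] triv[OF t] compat[OF V(1) t] V(2) e V(3,4)]
    show "e' = e1" using inj_onD[OF T(3) _ C(1) e1(1)] C(2) e1(2) by simp
  qed
  then have "hB \<xi> e = e1" using T(13)[OF e] by (simp add: gbundle_homothety_def)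
  then show "hB \<xi> e \<in> gover B U" "\<phi> (hB \<xi> e) = (gproj B e, graded_homothety (gweights B) \<xi> (snd (\<phi> e)))"
    using e1 by auto
qed

lemma eqv: "t \<in> gtrivs B \<Longrightarrow> eqv_triv B hB t"
  using homothety by (cases t) (auto simp: eqv_triv_def)

text \<open>By maximality the family of trivializations can be recovered from the homothety action,
  which is the key to uniqueness of the bundle of an action.\<close>

lemma gtrivs_eq: "gtrivs B = {t. is_trivialization B t \<and> eqv_triv B hB t}"
proof
  show "gtrivs B \<subseteq> {t. is_trivialization B t \<and> eqv_triv B hB t}" using triv eqv by blast
  show "{t. is_trivialization B t \<and> eqv_triv B hB t} \<subseteq> gtrivs B"
  proof
    fix t assume t: "t \<in> {t. is_trivialization B t \<and> eqv_triv B hB t}"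
    obtain U \<phi> where tU: "t = (U, \<phi>)" by fastforce
    show "t \<in> gtrivs B"
    proof (rule maximal)
      fix t' assume t': "t' \<in> gtrivs B"
      obtain V \<psi> where tV: "t' = (V, \<psi>)" by fastforce
      show "trivializations_compatible B t t'"
        unfolding tU tV using t t' triv[OF t'] eqv[OF t'] tU tV by (intro eqv_triv_compatible[OF pre]) auto
    qed (use t in simp)
  qed
qed

lemma homothety_proj: "e \<in> mcarrier (gtotal B) \<Longrightarrow> gproj B (hB \<xi> e) = gproj B e"
proof -
  assume "e \<in> mcarrier (gtotal B)"
  then obtain U \<phi> where t: "(U, \<phi>) \<in> gtrivs B" "e \<in> gover B U" by (rule total_triv)
  show ?thesis using trivD(4)[OF pre triv[OF t(1)] homothety(1)[OF t]] homothety(2)[OF t] by simp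
qed

lemma haction_homothety: "haction (gtotal B) hB"
proof (unfold_locales)
  let ?m = "gfib B" and ?w = "gweights B" and ?L = "complex_line_manifold"
  let ?LT = "product_manifold ?L (gtotal B)"
  show "complex_manifold (gtotal B)" by (rule mf)
  note LT = product_manifold_complex[OF line_manifold mf(1)]
  note PB = product_manifold_complex[OF mf(2) csm_manifold, of ?m]
  fix e assume e: "e \<in> mcarrier (gtotal B)"
  obtain U \<phi> where t: "(U, \<phi>) \<in> gtrivs B" "e \<in> gover B U" using total_triv[OF e] .
  note T = trivD[OF pre triv[OF t(1)]]
  show "hB 1 e = e"
    by (rule inj_onD[OF T(3) _ homothety(1)[OF t] t(2)])
      (use homothety(2)[OF t, of 1] T(4,5)[OF t(2)] graded_homothety_one in simp)
  show "hB \<xi> (hB \<eta> e) = hB (\<xi> * \<eta>) e" for \<xi> \<eta>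
  proof (rule inj_onD[OF T(3) _ homothety(1)[OF t(1) homothety(1)[OF t]] homothety(1)[OF t]])
    show "\<phi> (hB \<xi> (hB \<eta> e)) = \<phi> (hB (\<xi> * \<eta>) e)"
      using homothety(2)[OF t(1) homothety(1)[OF t]] homothety(2)[OF t] homothety_proj[OF e]
      by (simp add: graded_homothety_comp)
  qed
  fix \<xi> :: complex
  let ?p = "(\<xi>, e)"
  have pc: "?p \<in> mcarrier ?LT" using e by (simp add: product_carrier)
  have p1: "hol_at ?LT ?L fst ?p" and p2: "hol_at ?LT (gtotal B) snd ?p"
    using hol_at_pr[OF line_manifold mf(1) pc] by auto
  have pr: "hol_at ?LT (gbase B) (\<lambda>p. gproj B (snd p)) ?p"
    by (rule hol_at_comp[OF LT mf refl _ p2]) (use pre e in \<open>simp add: pre_bundle_def\<close>)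
  have \<phi>h: "hol_at ?LT (gprod B) (\<lambda>p. \<phi> (snd p)) ?p"
    by (rule hol_at_comp[OF LT mf(1) PB refl _ p2]) (use T(10)[OF t(2)] in simp)
  have a: "hol_at ?LT (csm 1) (\<lambda>p. line_emb (fst p)) ?p"
    by (rule hol_at_comp[OF LT line_manifold csm_manifold refl _ p1]) (use chart_hol[OF line_manifold line_chart, of \<xi>] in simp)
  have b: "hol_at ?LT (csm ?m) (\<lambda>p. snd (\<phi> (snd p))) ?p"
    using \<phi>h unfolding hol_at_prod_iff[OF mf(2) csm_manifold LT] by blast
  \<comment> \<open>The scalar and the fibre coordinates are joined into one vector \<open>c\<close>
    with \<xi> in coordinate 0, so that the homothety becomes a single polynomial map of coordinate
    spaces.\<close>
  let ?R = "\<lambda>c. graded_homothety ?w (c 0) (pj2 1 ?m c)"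
  have R: "cdiff_at (1 + ?m) ?m ?R c" if c: "c \<in> complex_space (1 + ?m)" for c
    by (rule cdiff_at_sep_hol[of _ "complex_space (1 + ?m)"])
      (use c in \<open>auto simp: graded_homothety_def pj2_def complex_space_def intro!: sep_hol_mult sep_hol_power sep_hol_coord\<close>)
  have "hol_at ?LT (csm ?m) (\<lambda>p. ?R (join 1 (line_emb (fst p)) (snd (\<phi> (snd p))))) ?p"
    by (rule hol_at_csm_compI[OF LT hol_at_join[OF LT a b]], rule R)
      (use join_space[of "snd (\<phi> e)" ?m 1 "line_emb \<xi>", OF T(5)[OF t(2)]] in simp)
  then have c: "hol_at ?LT (csm ?m) (\<lambda>p. graded_homothety ?w (fst p) (snd (\<phi> (snd p)))) ?p"
  proof (rule hol_at_cong[OF LT])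
    show "openin (mtop ?LT) (UNIV \<times> gover B U)"
      using gover_open[OF pre T(1)] by (simp add: product_sel[OF line_manifold mf(1)] openin_prod_Times_iff)
    fix p :: "complex \<times> 'a" assume "p \<in> UNIV \<times> gover B U"
    then have "snd (\<phi> (snd p)) \<in> complex_space ?m" using T(5) by auto
    then show "?R (join 1 (line_emb (fst p)) (snd (\<phi> (snd p)))) = graded_homothety ?w (fst p) (snd (\<phi> (snd p)))"
      using pj_join(2)[of "snd (\<phi> (snd p))" ?m 1 "line_emb (fst p)"] by (simp add: join_def line_emb_def)
  qed (use t in simp)
  have d: "hol_at ?LT (gprod B) (\<lambda>p. (gproj B (snd p), graded_homothety ?w (fst p) (snd (\<phi> (snd p))))) ?p"
    using pr c by (simp add: hol_at_prod_iff[OF mf(2) csm_manifold LT])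
  have "hol_at ?LT (gtotal B) (\<lambda>p. inv_into (gover B U) \<phi> (gproj B (snd p), graded_homothety ?w (fst p) (snd (\<phi> (snd p))))) ?p"
    by (rule hol_at_comp[OF LT PB mf(1) refl _ d]) (use T(11)[OF T(12)[OF t(2)] graded_homothety_space] in simp)
  then show "hol_at ?LT (gtotal B) (\<lambda>p. hB (fst p) (snd p)) ?p"
  proof (rule hol_at_cong[OF LT])
    show "openin (mtop ?LT) (UNIV \<times> gover B U)"
      using gover_open[OF pre T(1)] by (simp add: product_sel[OF line_manifold mf(1)] openin_prod_Times_iff)
    fix p :: "complex \<times> 'a" assume "p \<in> UNIV \<times> gover B U"
    then have p: "snd p \<in> gover B U" by auto
    show "inv_into (gover B U) \<phi> (gproj B (snd p), graded_homothety ?w (fst p) (snd (\<phi> (snd p)))) = hB (fst p) (snd p)"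
      using inv_into_f_f[OF T(3) homothety(1)[OF t(1) p]] homothety(2)[OF t(1) p] by metis
  qed (use t in simp)
qed

lemma homothety_is_homogeneity_structure: "holomorphic_homogeneity_structure (homothety_structure B)"
  unfolding homogeneity_structure_iff_haction homothety_structure_def
  using haction_homothety by (simp add: gbundle_homothety_def)

text \<open>The zero section, described through the action: the fibre weights are positive, so the
  fixed point of \<open>hB 0\<close> in a fibre is its origin.\<close>

definition zsec :: "'a \<Rightarrow> 'a" where
  "zsec q = (SOME e. e \<in> mcarrier (gtotal B) \<and> gproj B e = q \<and> hB 0 e = e)"

lemma homothety_zero:
  assumes t: "(U, \<phi>) \<in> gtrivs B" and e: "e \<in> gover B U"
  shows "hB 0 e = inv_into (gover B U) \<phi> (gproj B e, \<lambda>i. 0)"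
proof -
  note T = trivD[OF pre triv[OF t]]
  have "graded_homothety (gweights B) 0 (snd (\<phi> e)) = (\<lambda>i. 0)"
    using gweights_pos[of B] nth_mem by (fastforce simp: graded_homothety_def)
  then show ?thesis using T(6)[OF homothety(1)[OF t e]] homothety(2)[OF t e] by (metis T(4) homothety(1) e fst_conv snd_conv t)
qed

lemma zsec:
  assumes t: "(U, \<phi>) \<in> gtrivs B" and q: "q \<in> U"
  shows "zsec q = inv_into (gover B U) \<phi> (q, \<lambda>i. 0)"
proof -
  note T = trivD[OF pre triv[OF t]]
  let ?e = "inv_into (gover B U) \<phi> (q, \<lambda>i. 0)"
  have e: "?e \<in> gover B U" "gproj B ?e = q" using T(7,9)[OF q zero_in_complex_space] by auto
  show ?thesis unfolding zsec_def
  proof (rule some_equality)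
    show "?e \<in> mcarrier (gtotal B) \<and> gproj B ?e = q \<and> hB 0 ?e = ?e"
      using T(13)[OF e(1)] e homothety_zero[OF t e(1)] by simp
    fix e' assume e': "e' \<in> mcarrier (gtotal B) \<and> gproj B e' = q \<and> hB 0 e' = e'"
    then have "e' \<in> gover B U" using q by (simp add: gover_def)
    from homothety_zero[OF t this] e' show "e' = ?e" by simp
  qed
qed

lemma zsec_proj: "e \<in> mcarrier (gtotal B) \<Longrightarrow> zsec (gproj B e) = hB 0 e"
proof -
  assume "e \<in> mcarrier (gtotal B)"
  then obtain U \<phi> where t: "(U, \<phi>) \<in> gtrivs B" "e \<in> gover B U" by (rule total_triv)
  show ?thesis using homothety_zero[OF t] zsec[OF t(1)] trivD(12)[OF pre triv[OF t(1)] t(2)] by simp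
qed

lemma zsec_hol: "q \<in> mcarrier (gbase B) \<Longrightarrow> hol_at (gbase B) (gtotal B) zsec q"
proof -
  assume qb: "q \<in> mcarrier (gbase B)"
  then obtain U \<phi> where t: "(U, \<phi>) \<in> gtrivs B" "q \<in> U" by (rule base_triv)
  note T = trivD[OF pre triv[OF t(1)]]
  have "hol_at (gbase B) (gprod B) (\<lambda>q. (q, \<lambda>i. 0)) q"
    using hol_at_id[OF mf(2) qb] hol_at_const[OF mf(2) csm_manifold qb, of "\<lambda>i. 0" "gfib B"]
    by (simp add: hol_at_prod_iff[OF mf(2) csm_manifold mf(2)])
  then have "hol_at (gbase B) (gtotal B) (\<lambda>q. inv_into (gover B U) \<phi> (q, \<lambda>i. 0)) q"
    by (rule hol_at_comp[where f = "\<lambda>q. (q, \<lambda>i. 0)" and x = q, OF mf(2) product_manifold_complex[OF mf(2) csm_manifold] mf(1) refl T(11)[OF t(2) zero_in_complex_space]])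
  then show "hol_at (gbase B) (gtotal B) zsec q"
    by (rule hol_at_cong[OF mf(2) _ T(1) t(2)]) (simp add: zsec[OF t(1)])
qed

end

text \<open>Forward, the fibre maps are graded polynomials and so commute with homotheties.
  Backward, the base map is found by following the zero section; commutation with
  \<open>hB 0\<close> shows that \<Phi> covers it, and \<open>fibre_morphism\<close> makes the fibre
  maps graded.\<close>

theorem graded_bundle_morphism_iff:
  assumes "holomorphic_graded_bundle B" "holomorphic_graded_bundle B'"
  shows "graded_bundle_morphism B B' \<Phi> \<longleftrightarrow> homogeneity_morphism (homothety_structure B) (homothety_structure B') \<Phi>"
proof -
  interpret B: hbundle B by unfold_locales fact
  interpret B': hbundle B' by unfold_locales fact
  show ?thesis
  proof
    assume g: "graded_bundle_morphism B B' \<Phi>"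
    then obtain f where ext: "\<Phi> \<in> extensional (mcarrier (gtotal B))" and hol: "holomorphic_map (gtotal B) (gtotal B') \<Phi>"
      and fb: "holomorphic_map (gbase B) (gbase B') f"
      and f: "\<And>e. e \<in> mcarrier (gtotal B) \<Longrightarrow> gproj B' (\<Phi> e) = f (gproj B e)"
      and mor: "\<And>U \<phi> V \<psi> q. (U, \<phi>) \<in> gtrivs B \<Longrightarrow> (V, \<psi>) \<in> gtrivs B' \<Longrightarrow> q \<in> U \<Longrightarrow> f q \<in> V \<Longrightarrow>
         graded_space_morphism (gweights B) (gweights B') (\<lambda>z. snd (\<psi> (\<Phi> (inv_into (gover B U) \<phi> (q, z)))))"
      unfolding graded_bundle_morphism_def by fast
    have \<Phi>m: "\<Phi> e \<in> mcarrier (gtotal B')" if "e \<in> mcarrier (gtotal B)" for e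
      using hol_at_mem(2)[OF hol[unfolded holomorphic_map_iff[OF B.mf(1) B'.mf(1)], rule_format, OF that]] .
    have "\<Phi> (B.hB \<xi> e) = B'.hB \<xi> (\<Phi> e)" if e: "e \<in> mcarrier (gtotal B)" for \<xi> e
    proof -
      obtain U \<phi> where t: "(U, \<phi>) \<in> gtrivs B" "e \<in> gover B U" using B.total_triv[OF e] .
      obtain V \<psi> where t': "(V, \<psi>) \<in> gtrivs B'" "\<Phi> e \<in> gover B' V" using B'.total_triv[OF \<Phi>m[OF e]] .
      note T = trivD[OF B.pre B.triv[OF t(1)]] and T' = trivD[OF B'.pre B'.triv[OF t'(1)]]
      let ?q = "gproj B e"
      have q: "?q \<in> U" "f ?q \<in> V" using T(12)[OF t(2)] T'(12)[OF t'(2)] f[OF e] by auto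
      let ?g = "\<lambda>z. snd (\<psi> (\<Phi> (inv_into (gover B U) \<phi> (?q, z))))"
      note he = B.homothety[OF t, of \<xi>]
      have hm: "B.hB \<xi> e \<in> mcarrier (gtotal B)" by (rule T(13)[OF he(1)])
      have p: "gproj B' (\<Phi> (B.hB \<xi> e)) = f ?q" using f[OF hm] B.homothety_proj[OF e] by simp
      have \<Phi>h: "\<Phi> (B.hB \<xi> e) \<in> gover B' V" using \<Phi>m[OF hm] p q by (simp add: gover_def)
      have "snd (\<psi> (\<Phi> (B.hB \<xi> e))) = ?g (snd (\<phi> (B.hB \<xi> e)))"
        using T(6)[OF he(1)] B.homothety_proj[OF e] by simp
      also have "\<dots> = ?g (graded_homothety (gweights B) \<xi> (snd (\<phi> e)))" by (simp add: he(2))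
      also have "\<dots> = graded_homothety (gweights B') \<xi> (?g (snd (\<phi> e)))"
        by (rule graded_morphism_homothety[OF mor[OF t(1) t'(1) q] T(5)[OF t(2)]])
      also have "?g (snd (\<phi> e)) = snd (\<psi> (\<Phi> e))" using T(6)[OF t(2)] by simp
      finally have "\<psi> (\<Phi> (B.hB \<xi> e)) = \<psi> (B'.hB \<xi> (\<Phi> e))"
        using T'(4)[OF \<Phi>h] p B'.homothety(2)[OF t'] f[OF e] by simp
      then show ?thesis by (rule inj_onD[OF T'(3) _ \<Phi>h B'.homothety(1)[OF t']])
    qed
    then show "homogeneity_morphism (homothety_structure B) (homothety_structure B') \<Phi>"
      using ext hol by (simp add: homogeneity_morphism_def homothety_structure_def)
  next
    assume g: "homogeneity_morphism (homothety_structure B) (homothety_structure B') \<Phi>"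
    have ext: "\<Phi> \<in> extensional (mcarrier (gtotal B))" and hol: "holomorphic_map (gtotal B) (gtotal B') \<Phi>"
      and eq: "\<And>\<xi> e. e \<in> mcarrier (gtotal B) \<Longrightarrow> \<Phi> (B.hB \<xi> e) = B'.hB \<xi> (\<Phi> e)"
      using g by (auto simp: homogeneity_morphism_def homothety_structure_def)
    have \<Phi>h: "hol_at (gtotal B) (gtotal B') \<Phi> e" if "e \<in> mcarrier (gtotal B)" for e
      using hol that unfolding holomorphic_map_iff[OF B.mf(1) B'.mf(1)] by blast
    define f where "f q = gproj B' (\<Phi> (B.zsec q))" for q
    have fb: "holomorphic_map (gbase B) (gbase B') f"
      unfolding holomorphic_map_iff[OF B.mf(2) B'.mf(2)]
    proof
      fix q assume q: "q \<in> mcarrier (gbase B)"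
      have z: "B.zsec q \<in> mcarrier (gtotal B)" by (rule hol_at_mem(2)[OF B.zsec_hol[OF q]])
      have 1: "hol_at (gbase B) (gtotal B') (\<lambda>q. \<Phi> (B.zsec q)) q"
        by (rule hol_at_comp[OF B.mf(2,1) B'.mf(1) refl \<Phi>h[OF z] B.zsec_hol[OF q]])
      show "hol_at (gbase B) (gbase B') f q" unfolding f_def
        by (rule hol_at_comp[OF B.mf(2) B'.mf refl _ 1]) (use B'.pre hol_at_mem(2)[OF 1] in \<open>simp add: pre_bundle_def\<close>)
    qed
    have f: "gproj B' (\<Phi> e) = f (gproj B e)" if e: "e \<in> mcarrier (gtotal B)" for e
      using B'.homothety_proj[OF hol_at_mem(2)[OF \<Phi>h[OF e]], of 0] by (simp add: f_def B.zsec_proj[OF e] eq[OF e])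
    have "graded_space_morphism (gweights B) (gweights B') (\<lambda>z. snd (\<psi> (\<Phi> (inv_into (gover B U) \<phi> (q, z)))))"
      if t: "(U, \<phi>) \<in> gtrivs B" and t': "(V, \<psi>) \<in> gtrivs B'" and q: "q \<in> U" "f q \<in> V" for U \<phi> V \<psi> q
    proof (rule fibre_morphism[OF B.pre B'.pre B.triv[OF t] B'.triv[OF t'] \<Phi>h q(1)])
      show V: "gproj B' (\<Phi> e) \<in> V" if "e \<in> gover B U" "gproj B e = q" for e
        using that q f by (simp add: gover_def)
      fix e e1 \<xi> assume e: "e \<in> gover B U" "gproj B e = q" "e1 \<in> gover B U" "\<phi> e1 = (q, graded_homothety (gweights B) \<xi> (snd (\<phi> e)))"
      have em: "e \<in> mcarrier (gtotal B)" using e by (simp add: gover_def)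
      have "e1 = B.hB \<xi> e" using eqv_triv_unique[OF B.pre B.triv[OF t] B.eqv[OF t] e(1,3)] e by simp
      then have 1: "\<Phi> e1 = B'.hB \<xi> (\<Phi> e)" using eq[OF em] by simp
      have "\<Phi> e \<in> gover B' V" using V[OF e(1,2)] hol_at_mem(2)[OF \<Phi>h[OF em]] by (simp add: gover_def)
      from B'.homothety(2)[OF t' this] show "snd (\<psi> (\<Phi> e1)) = graded_homothety (gweights B') \<xi> (snd (\<psi> (\<Phi> e)))"
        unfolding 1 by simp
    qed
    then show "graded_bundle_morphism B B' \<Phi>"
      unfolding graded_bundle_morphism_def using ext hol fb f by (intro conjI exI[of _ f]) auto
  qed
qed

section \<open>The graded bundle of an action\<close>

lemma homothety_join:
  assumes "z \<in> complex_space (k + length w)"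
  shows "graded_homothety (replicate k 0 @ w) \<xi> z = join k (pj1 k z) (graded_homothety w \<xi> (pj2 k (length w) z))"
  using assms by (auto simp: graded_homothety_def join_def pj1_def pj2_def nth_append fun_eq_iff complex_space_def)

text \<open>Since \<open>0 ^ 0 = 1\<close>, homothety by 0 keeps exactly the coordinates of weight
  0: in homogeneous coordinates \<open>h 0\<close> is the projection to the base.\<close>

lemma homothety_zero_pj1:
  assumes "z \<in> complex_space (k + length w)" "\<forall>a\<in>set w. 0 < a"
  shows "graded_homothety (replicate k 0 @ w) 0 z = pj1 k z"
proof
  fix i
  have "w ! (i - k) \<noteq> 0" if "k \<le> i" "i < k + length w"
    using assms(2) nth_mem[of "i - k" w] that by fastforce
  then show "graded_homothety (replicate k 0 @ w) 0 z i = pj1 k z i"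
    by (auto simp: graded_homothety_def pj1_def nth_append)
qed

text \<open>\<open>complex_space n0\<close> is literally a subset of \<open>complex_space n\<close>,
  so the same function is differentiated on the coordinate subspace, and the increments in the
  remaining directions vanish.\<close>

lemma has_cderiv_restrict:
  assumes f: "has_cderiv n f c z" and z: "z \<in> complex_space n0" and n: "n0 \<le> n"
  shows "has_cderiv n0 f c z"
  unfolding has_cderiv_def
proof (intro allI impI)
  fix e :: real assume "e > 0"
  then obtain r where r: "r > 0" "\<And>w. w\<in>pdisc n z r \<Longrightarrow>
     cmod (f w - f z - (\<Sum>i<n. c i * (w i - z i))) \<le> e * (\<Sum>i<n. cmod (w i - z i))"
    using f unfolding has_cderiv_def by meson
  show "\<exists>r>0. \<forall>w\<in>pdisc n0 z r. cmod (f w - f z - (\<Sum>i<n0. c i * (w i - z i))) \<le> e * (\<Sum>i<n0. cmod (w i - z i))"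
  proof (intro exI conjI ballI)
    fix w assume w: "w \<in> pdisc n0 z r"
    have 0: "w i - z i = 0" if "n0 \<le> i" for i using w z that by (auto simp: pdisc_def complex_space_def)
    have wn: "w \<in> pdisc n z r"
      unfolding pdisc_def
    proof (intro CollectI conjI allI impI)
      show "w \<in> complex_space n" using w complex_space_mono[OF n] by (auto simp: pdisc_def)
      show "cmod (w i - z i) < r" for i using w r(1) 0[of i] by (cases "i < n0") (auto simp: pdisc_def)
    qed
    have "(\<Sum>i<n. c i * (w i - z i)) = (\<Sum>i<n0. c i * (w i - z i))"
      by (rule sum.mono_neutral_right) (use n 0 in auto)
    moreover have "(\<Sum>i<n. cmod (w i - z i)) = (\<Sum>i<n0. cmod (w i - z i))"
      by (rule sum.mono_neutral_right) (use n 0 in auto)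
    ultimately show "cmod (f w - f z - (\<Sum>i<n0. c i * (w i - z i))) \<le> e * (\<Sum>i<n0. cmod (w i - z i))"
      using r(2)[OF wn] by simp
  qed (rule r)
qed

lemma cdiff_at_restrict:
  assumes g: "cdiff_at n m g z" and z: "z \<in> complex_space n0" and n: "n0 \<le> n" "m0 \<le> m"
    and S: "open_cs n0 S" "z \<in> S" "g ` S \<subseteq> complex_space m0"
  shows "cdiff_at n0 m0 g z"
proof -
  have "\<exists>c. has_cderiv n0 (\<lambda>w. g w j) c z" if "j < m0" for j
    using has_cderiv_restrict[OF cdiff_at_pd[OF g] z n(1)] that n(2) less_le_trans by blast
  then show ?thesis unfolding cdiff_at_def using S by blast
qed

text \<open>Base coordinates, which all homotheties fix, followed by the fibre coordinates of a
  trivialization linearize the action near a point of the zero section.\<close>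

lemma (in hbundle) bundle_weights:
  assumes q: "q \<in> mcarrier (gtotal B)" "hB 0 q = q"
  shows "haction.has_weights (gtotal B) hB q (replicate (mdim (gbase B)) 0 @ gweights B)"
proof -
  interpret H: haction "gtotal B" hB by (rule haction_homothety)
  let ?k = "mdim (gbase B)" and ?m = "gfib B" and ?w = "gweights B"
  obtain U \<phi> where t: "(U, \<phi>) \<in> gtrivs B" "q \<in> gover B U" using total_triv[OF q(1)] .
  note T = trivD[OF pre triv[OF t(1)]]
  let ?b = "gproj B q"
  obtain V \<kappa> where c: "(V, \<kappa>) \<in> matlas (gbase B)" "?b \<in> V" using mf_cover[OF mf(2) proj_mem[OF q(1)]] .
  note ic = mf_chart[OF mf(2) c(1)]
  have inv: "inv_into V \<kappa> (\<kappa> b) = b" if "b \<in> V" for b using that is_chartD(3)[OF ic] by simp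
  have \<kappa>c: "\<kappa> b \<in> complex_space ?k" if "b \<in> V" for b by (rule is_chartD(7)[OF ic that])
  define f where "f e = join ?k (\<kappa> (gproj B e)) (snd (\<phi> e))" for e
  define g where "g z = inv_into (gover B U) \<phi> (inv_into V \<kappa> (pj1 ?k z), pj2 ?k ?m z)" for z
  define Q where "Q = {z \<in> complex_space (?k + ?m). pj1 ?k z \<in> \<kappa> ` (U \<inter> V)}"
  have UV: "openin (mtop (gbase B)) (U \<inter> V)" using T(1) is_chartD(1)[OF ic] by blast
  have Qo: "open_cs (?k + ?m) Q"
  proof (subst openin_subopen, intro ballI)
    fix z assume z: "z \<in> Q"
    have zc: "z \<in> complex_space (?k + ?m)" and zp: "pj1 ?k z \<in> \<kappa> ` (U \<inter> V)" using z by (auto simp: Q_def)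
    obtain S where S: "open_cs (?k + ?m) S" "z \<in> S" "pj1 ?k ` S \<subseteq> \<kappa> ` (U \<inter> V)"
      by (rule cdiff_at_continuous[OF cdiff_at_pj1[OF zc] chart_image_open[OF ic UV Int_lower2] zp])
    then show "\<exists>T. open_cs (?k + ?m) T \<and> z \<in> T \<and> T \<subseteq> Q"
      using open_cs_subset[OF S(1)] by (intro exI[of _ S]) (auto simp: Q_def)
  qed
  have gf: "g (f e) = e" if e: "e \<in> gover B (U \<inter> V)" for e
  proof -
    have eU: "e \<in> gover B U" and eV: "gproj B e \<in> V" using e by (auto simp: gover_def)
    show ?thesis unfolding f_def g_def using \<kappa>c[OF eV] T(5)[OF eU] inv[OF eV] T(6)[OF eU] by simp
  qed
  have gz: "f (g z) = z \<and> f (hB \<xi> (g z)) = graded_homothety (replicate ?k 0 @ ?w) \<xi> z" if z: "z \<in> Q" for z \<xi>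
  proof -
    obtain b where b: "b \<in> U" "b \<in> V" "pj1 ?k z = \<kappa> b" using z by (auto simp: Q_def)
    have zc: "z \<in> complex_space (?k + ?m)" using z by (simp add: Q_def)
    have e: "g z = inv_into (gover B U) \<phi> (b, pj2 ?k ?m z)" using b inv by (simp add: g_def)
    note E = T(7,8,9)[OF b(1) pj_space(2)[of ?k ?m z], folded e]
    have "f (g z) = z" using E(2,3) b join_pj[OF zc] by (simp add: f_def)
    moreover have "f (hB \<xi> (g z)) = graded_homothety (replicate ?k 0 @ ?w) \<xi> z"
      using E homothety(2)[OF t(1) E(1)] homothety_proj[OF T(13)[OF E(1)]] b homothety_join[OF zc] by (simp add: f_def)
    ultimately show ?thesis by simp
  qed
  have qc: "q \<in> gover B (U \<inter> V)" using t c by (auto simp: gover_def)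
  have fq: "f q \<in> Q"
    using \<kappa>c[OF c(2)] T(5)[OF t(2)] T(12)[OF t(2)] c(2) by (auto simp: Q_def f_def)
  note PB = product_manifold_complex[OF mf(2) csm_manifold, of ?m]
  have fh: "hol_at (gtotal B) (csm (?k + ?m)) f q"
    unfolding f_def
  proof (rule hol_at_join[OF mf(1)])
    show "hol_at (gtotal B) (csm ?k) (\<lambda>e. \<kappa> (gproj B e)) q"
      by (rule hol_at_comp[OF mf csm_manifold refl chart_hol[OF mf(2) c] pre_bundle_proj[OF pre q(1)]])
    show "hol_at (gtotal B) (csm ?m) (\<lambda>e. snd (\<phi> e)) q"
      using T(10)[OF t(2)] unfolding hol_at_prod_iff[OF mf(2) csm_manifold mf(1)] by blast
  qed
  have fqc: "f q \<in> complex_space (?k + ?m)" using fq by (simp add: Q_def)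
  have pf: "pj1 ?k (f q) = \<kappa> ?b" "pj2 ?k ?m (f q) = snd (\<phi> q)"
    using \<kappa>c[OF c(2)] T(5)[OF t(2)] by (simp_all add: f_def)
  have "hol_at (csm (?k + ?m)) (gbase B) (\<lambda>z. inv_into V \<kappa> (pj1 ?k z)) (f q)"
    by (rule hol_at_comp[where f = "pj1 ?k" and x = "f q" and g = "inv_into V \<kappa>" and N = "csm ?k",
        OF csm_manifold csm_manifold mf(2) refl])
      (use inv_chart_hol[OF mf(2) c] pf cdiff_at_pj1[OF fqc] in \<open>simp_all add: csm_csm\<close>)
  then have "hol_at (csm (?k + ?m)) (gprod B) (\<lambda>z. (inv_into V \<kappa> (pj1 ?k z), pj2 ?k ?m z)) (f q)"
    using cdiff_at_pj2[OF fqc] by (simp add: hol_at_prod_iff[OF mf(2) csm_manifold csm_manifold] csm_csm)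
  then have gh: "hol_at (csm (?k + ?m)) (gtotal B) g (f q)"
    unfolding g_def
    by (rule hol_at_comp[where f = "\<lambda>z. (inv_into V \<kappa> (pj1 ?k z), pj2 ?k ?m z)" and x = "f q" and g = "inv_into (gover B U) \<phi>",
        OF csm_manifold PB mf(1) refl, rotated])
      (use T(11)[OF T(12)[OF t(2)] T(5)[OF t(2)]] pf inv[OF c(2)] in simp)
  show ?thesis
    unfolding H.has_weights_def
  proof (intro conjI exI[of _ f] exI[of _ g] exI[of _ "gover B (U \<inter> V)"] exI[of _ Q])
    show "openin (mtop (gtotal B)) (gover B (U \<inter> V))" by (rule gover_open[OF pre UV])
  qed (use q fh gh qc gf fq gz Qo in auto)
qed

text \<open>The zero section is a holomorphic inclusion of the base, which determines the complex structure
  of the base; the rank is determined by the weights at a fixed point.\<close>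

lemma graded_bundle_of_unique:
  assumes S: "holomorphic_homogeneity_structure S" and ne: "mcarrier (hspace S) \<noteq> {}"
    and 1: "is_graded_bundle_of S B" and 2: "is_graded_bundle_of S B'"
  shows "B = B'"
proof -
  interpret S: haction "hspace S" "hact S" using S homogeneity_structure_iff_haction by blast
  \<comment> \<open>On the common carrier the identity is the zero section of one bundle followed by
    the projection of the other.\<close>
  have base: "hol_at (gbase B) (gbase B') (\<lambda>x. x) q"
    and carr: "mcarrier (gbase B) = hact S 0 ` mcarrier (hspace S)"
    if 1: "is_graded_bundle_of S B" and 2: "is_graded_bundle_of S B'" and q: "q \<in> mcarrier (gbase B)" for B B' q
  proof -
    interpret B: hbundle B using 1 by unfold_locales (simp add: is_graded_bundle_of_def)
    interpret B': hbundle B' using 2 by unfold_locales (simp add: is_graded_bundle_of_def)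
    note E = 1[unfolded is_graded_bundle_of_def] 2[unfolded is_graded_bundle_of_def]
    show car: "mcarrier (gbase B) = hact S 0 ` mcarrier (hspace S)" using E by blast
    have fixq: "q \<in> mcarrier (hspace S) \<and> hact S 0 q = q" if "q \<in> mcarrier (gbase B)" for q
      using that unfolding car by (auto simp: S.act)
    have z: "B.zsec q = q" if "q \<in> mcarrier (gbase B)" for q
      using B.zsec_proj[of q] fixq[OF that] E by simp
    have o: "openin (mtop (gbase B)) (mcarrier (gbase B))" by simp
    have 3: "hol_at (gbase B) (gtotal B) (\<lambda>x. x) q"
      by (rule hol_at_cong[OF B.mf(2) B.zsec_hol[OF q] o q z])
    have 4: "hol_at (gtotal B) (gbase B') (gproj B') q"
      using pre_bundle_proj[OF B'.pre, of q] fixq[OF q] E by simp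
    have "hol_at (gbase B) (gbase B') (\<lambda>x. gproj B' x) q"
      by (rule hol_at_comp[where f = "\<lambda>x. x" and x = q, OF B.mf(2,1) B'.mf(2) refl _ 3]) (rule 4)
    then show "hol_at (gbase B) (gbase B') (\<lambda>x. x) q"
    proof (rule hol_at_cong[OF B.mf(2) _ o q])
      have "gproj B' = hact S 0" using E by blast
      then show "gproj B' x = x" if "x \<in> mcarrier (gbase B)" for x using fixq[OF that] by simp
    qed
  qed
  interpret B: hbundle B using 1 by unfold_locales (simp add: is_graded_bundle_of_def)
  interpret B': hbundle B' using 2 by unfold_locales (simp add: is_graded_bundle_of_def)
  note E = 1[unfolded is_graded_bundle_of_def] 2[unfolded is_graded_bundle_of_def]
  have tot: "gtotal B = gtotal B'" "gproj B = gproj B'" "mcarrier (gbase B) = mcarrier (gbase B')"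
    "gbundle_homothety B = gbundle_homothety B'" using E by auto
  obtain x where x: "x \<in> mcarrier (hspace S)" using ne by blast
  let ?p = "hact S 0 x"
  have p: "?p \<in> mcarrier (hspace S)" "hact S 0 ?p = ?p" using x by (auto simp: S.act)
  have "S.has_weights ?p (replicate (mdim (gbase B)) 0 @ gweights B)"
    "S.has_weights ?p (replicate (mdim (gbase B')) 0 @ gweights B')"
    using B.bundle_weights[of ?p] B'.bundle_weights[of ?p] p E by auto
  then have ms: "mset (replicate (mdim (gbase B)) 0 @ gweights B) = mset (replicate (mdim (gbase B')) 0 @ gweights B')"
    by (rule S.weights_unique)
  \<comment> \<open>Fibre weights are positive, so the multiplicity of weight 0 is the dimension of
    the base.\<close>
  have c0: "count (mset (replicate k 0 @ gweights C)) 0 = k" for k and C :: "'a graded_bundle"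
    using count_rank_weights[of "grank C" 0] by simp
  have k: "mdim (gbase B) = mdim (gbase B')" using c0 ms by metis
  then have "mset (gweights B) = mset (gweights B')" using ms by simp
  then have "gweights B = gweights B'" using sorted_mset_unique sorted_rank_weights by blast
  moreover have "grank B \<noteq> [] \<longrightarrow> last (grank B) \<noteq> 0"
    using B.hgb unfolding holomorphic_graded_bundle_def by (elim conjE)
  moreover have "grank B' \<noteq> [] \<longrightarrow> last (grank B') \<noteq> 0"
    using B'.hgb unfolding holomorphic_graded_bundle_def by (elim conjE)
  ultimately have rk: "grank B = grank B'" by (rule rank_weights_inj)
  have bs: "gbase B = gbase B'"
    by (rule manifold_eqI[OF B.mf(2) B'.mf(2) k tot(3)]) (use base[OF 1 2] base[OF 2 1] tot(3) in auto)
  have gv: "gover B U = gover B' U" for U by (simp add: gover_def tot)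
  have "is_trivialization B t = is_trivialization B' t" for t
    by (cases t) (simp add: is_trivialization_def gv tot bs rk)
  moreover have "eqv_triv B (gbundle_homothety B) t = eqv_triv B' (gbundle_homothety B') t" for t
    by (cases t) (simp add: eqv_triv_def gv tot(2,4) rk)
  ultimately have "gtrivs B = gtrivs B'" unfolding B.gtrivs_eq B'.gtrivs_eq by simp
  then show ?thesis using tot bs rk by (intro graded_bundle.equality) auto
qed

text \<open>An action whose weights are the same at all fixed points, as
  \<open>constant_weights\<close> provides: \<open>k\<close> will be the dimension of the base and
  \<open>d\<close> the rank.\<close>

locale gaction = haction +
  fixes k :: nat and d :: "nat list"
  assumes h_ext: "\<And>\<xi>. h \<xi> \<in> extensional (mcarrier M)"
    and trimmed: "d \<noteq> [] \<longrightarrow> last d \<noteq> 0"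
    and charts: "\<And>p. p \<in> mcarrier M \<Longrightarrow> h 0 p = p \<Longrightarrow> \<exists>T Y. gchart (replicate k 0 @ rank_weights d) T Y \<and> p \<in> T"
begin

abbreviation "w \<equiv> rank_weights d"
abbreviation "m \<equiv> length (rank_weights d)"
abbreviation "ws \<equiv> replicate k 0 @ rank_weights d"
definition "N0 = h 0 ` mcarrier M"

lemma N0_iff: "x \<in> N0 \<longleftrightarrow> x \<in> mcarrier M \<and> h 0 x = x"
  unfolding N0_def by (auto simp: act image_iff) metis

lemma wpos: "\<forall>a\<in>set w. 0 < a" using rank_weights_pos by blast

context
  fixes T Y assumes c: "gchart ws T Y"
begin

lemma gc_dim: "mdim M = k + m"
  using c unfolding gchart_def by (elim conjE) simp

lemma gc_chart: "(T, Y) \<in> matlas M"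
  and gc_mem: "x \<in> T \<Longrightarrow> h \<xi> x \<in> T" and gc_eqv: "x \<in> T \<Longrightarrow> Y (h \<xi> x) = graded_homothety ws \<xi> (Y x)"
  and gc_sat: "x \<in> mcarrier M \<Longrightarrow> h 0 x \<in> T \<Longrightarrow> x \<in> T"
  using c unfolding gchart_def by blast+

lemma gc_ic: "is_chart (k + m) (mtop M) (T, Y)"
  using mf_chart[OF M gc_chart] gc_dim by simp

lemma gc_car: "x \<in> T \<Longrightarrow> x \<in> mcarrier M" by (rule mf_chart_mem[OF M gc_chart])

lemma gc_Y: "x \<in> T \<Longrightarrow> Y x \<in> complex_space (k + m)" by (rule is_chartD(7)[OF gc_ic])

lemma gc_inv: "x \<in> T \<Longrightarrow> inv_into T Y (Y x) = x" using is_chartD(3)[OF gc_ic] by simp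

lemma gc_Y0: "x \<in> T \<Longrightarrow> Y (h 0 x) = pj1 k (Y x)"
  using gc_eqv[of x 0] homothety_zero_pj1[OF gc_Y wpos] by simp

text \<open>Saturation of the image in terms of base coordinates: over each of its points the fibre
  coordinates range over all of \<open>complex_space m\<close>.\<close>

lemma gc_img: "z \<in> Y ` T \<Longrightarrow> z' \<in> complex_space (k + m) \<Longrightarrow> pj1 k z' = pj1 k z \<Longrightarrow> z' \<in> Y ` T"
proof -
  assume z: "z \<in> Y ` T" "z' \<in> complex_space (k + m)" "pj1 k z' = pj1 k z"
  have zc: "z \<in> complex_space (k + m)" using z(1) gc_Y by auto
  have "graded_homothety ws 0 z' = graded_homothety ws 0 z"
    using z(3) homothety_zero_pj1[OF z(2) wpos] homothety_zero_pj1[OF zc wpos] by simp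
  then show ?thesis using c z(1,2) gc_dim unfolding gchart_def by metis
qed

lemma gc_YN: "x \<in> T \<inter> N0 \<Longrightarrow> pj1 k (Y x) = Y x" "x \<in> T \<inter> N0 \<Longrightarrow> Y x \<in> complex_space k"
proof -
  assume "x \<in> T \<inter> N0"
  then show 1: "pj1 k (Y x) = Y x" using gc_Y0[of x] by (simp add: N0_iff)
  show "Y x \<in> complex_space k" using pj_space(1)[of k "Y x"] unfolding 1 .
qed

abbreviation "TN \<equiv> T \<inter> N0"
abbreviation "YN \<equiv> restrict Y (T \<inter> N0)"

lemma gc_image: "YN ` TN = Y ` T \<inter> complex_space k"
proof
  show "YN ` TN \<subseteq> Y ` T \<inter> complex_space k" using gc_YN(2) by auto
  show "Y ` T \<inter> complex_space k \<subseteq> YN ` TN"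
  proof clarify
    fix x assume x: "x \<in> T" "Y x \<in> complex_space k"
    have "Y (h 0 x) = Y x" using gc_Y0[OF x(1)] x(2) by (auto simp: pj1_def complex_space_def fun_eq_iff)
    moreover have "h 0 x \<in> TN" using gc_mem[OF x(1)] gc_car[OF x(1)] by (simp add: N0_iff act)
    ultimately show "Y x \<in> YN ` TN" by (metis image_eqI restrict_apply')
  qed
qed

lemma gc_image_open: "open_cs k (YN ` TN)"
proof -
  obtain A where A: "open A" "Y ` T = complex_space (k + m) \<inter> A"
    using is_chartD(4)[OF gc_ic] by (auto simp: openin_open)
  have "YN ` TN = complex_space k \<inter> A" unfolding gc_image A(2) using complex_space_mono[of k "k + m"] by auto
  then show ?thesis using A(1) by (simp add: openin_open_Int)
qed

lemma gc_invN: "z \<in> YN ` TN \<Longrightarrow> inv_into TN YN z = inv_into T Y z"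
proof -
  assume "z \<in> YN ` TN"
  then obtain x where x: "x \<in> TN" "z = Y x" by auto
  have "inj_on YN TN" using is_chartD(3)[OF gc_ic] by (auto simp: inj_on_def)
  from inv_into_f_f[OF this x(1)] show ?thesis using x gc_inv by simp
qed

text \<open>In a homogeneous chart the fixed points are those whose coordinates of positive weight
  vanish, so the restriction of \<open>Y\<close> takes values in
  \<open>complex_space k\<close>.\<close>

lemma gc_base_chart: "is_chart k (subtopology (mtop M) N0) (TN, YN)"
proof (rule is_chartI)
  show To: "openin (subtopology (mtop M) N0) TN"
    using is_chartD(1)[OF gc_ic] by (auto simp: openin_subtopology)
  show "inj_on YN TN" using is_chartD(3)[OF gc_ic] by (auto simp: inj_on_def)
  show o: "open_cs k (YN ` TN)" by (rule gc_image_open)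
  have sub: "top_of_set (complex_space k) = subtopology (top_of_set (complex_space (k + m))) (complex_space k)"
    using complex_space_mono[of k "k + m"] by (simp add: subtopology_subtopology Int_absorb1)
  fix x assume x: "x \<in> TN"
  then have xT: "x \<in> T" and xN: "x \<in> N0" by auto
  have "cont_at (subtopology (mtop M) N0) (top_of_set (complex_space (k + m))) Y x"
    by (rule cont_at_from_subtopology[OF is_chartD(5)[OF gc_ic xT] xN])
  then have "cont_at (subtopology (mtop M) N0) (top_of_set (complex_space k)) Y x"
    unfolding sub by (rule cont_at_subtopology_codI[OF _ To x]) (use gc_YN(2) in auto)
  then show "cont_at (subtopology (mtop M) N0) (top_of_set (complex_space k)) YN x"
    by (rule cont_at_cong[OF _ To x]) simp
  have Yx: "YN x = Y x" using x by simp
  have "cont_at (top_of_set (complex_space k)) (mtop M) (inv_into T Y) (Y x)"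
    unfolding sub by (rule cont_at_from_subtopology[OF is_chartD(6)[OF gc_ic xT] gc_YN(2)[OF x]])
  then have "cont_at (top_of_set (complex_space k)) (subtopology (mtop M) N0) (inv_into T Y) (Y x)"
    by (rule cont_at_subtopology_codI[OF _ o]) (use x gc_inv in auto)
  then show "cont_at (top_of_set (complex_space k)) (subtopology (mtop M) N0) (inv_into TN YN) (YN x)"
    unfolding Yx by (rule cont_at_cong[OF _ o]) (use x gc_invN in auto)
qed simp

end

definition "base_charts = {(T \<inter> N0, restrict Y (T \<inter> N0)) | T Y. gchart ws T Y}"
definition "base = \<lparr>mdim = k, mtop = subtopology (mtop M) N0, matlas = generated_atlas k (subtopology (mtop M) N0) base_charts\<rparr>"

lemma base_sel: "mdim base = k" "mtop base = subtopology (mtop M) N0" "mcarrier base = N0"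
  by (auto simp: base_def N0_iff)

text \<open>The transition functions are restrictions of those of \<open>M\<close> to
  \<open>complex_space k\<close>, hence holomorphic by \<open>cdiff_at_restrict\<close>.\<close>

lemma base_manifold: "complex_manifold base"
  and base_chart: "gchart ws T Y \<Longrightarrow> (T \<inter> N0, restrict Y (T \<inter> N0)) \<in> matlas base"
proof -
  let ?T = "subtopology (mtop M) N0"
  have hs: "Hausdorff_space ?T" "second_countable ?T"
    using M by (auto simp: complex_manifold_def Hausdorff_space_subtopology second_countable_subtopology)
  have ch: "is_chart k ?T a" if "a \<in> base_charts" for a
    using that gc_base_chart unfolding base_charts_def by auto
  have cov: "(\<Union>a\<in>base_charts. fst a) = topspace ?T"
  proof
    show "(\<Union>a\<in>base_charts. fst a) \<subseteq> topspace ?T" unfolding base_charts_def by (auto simp: N0_iff)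
    show "topspace ?T \<subseteq> (\<Union>a\<in>base_charts. fst a)"
    proof
      fix p assume "p \<in> topspace ?T"
      then have p: "p \<in> N0" "p \<in> mcarrier M" "h 0 p = p" using N0_iff by auto
      obtain T Y where "gchart ws T Y" "p \<in> T" using charts[OF p(2,3)] by blast
      then have "(T \<inter> N0, restrict Y (T \<inter> N0)) \<in> base_charts" "p \<in> fst (T \<inter> N0, restrict Y (T \<inter> N0))"
        unfolding base_charts_def using p(1) by auto
      then show "p \<in> (\<Union>a\<in>base_charts. fst a)" by (rule UN_I)
    qed
  qed
  have half: "cdiff_at k k (\<lambda>z. restrict Y' (T' \<inter> N0) (inv_into (T \<inter> N0) (restrict Y (T \<inter> N0)) z)) (restrict Y (T \<inter> N0) x)"
    if c: "gchart ws T Y" and c': "gchart ws T' Y'" and x: "x \<in> (T \<inter> N0) \<inter> (T' \<inter> N0)" for T Y T' Y' x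
  proof -
    have xx: "x \<in> T \<inter> N0" "x \<in> T'" "x \<in> T" using x by auto
    note b = gc_base_chart[OF c] gc_base_chart[OF c']
    have "openin ?T ((T \<inter> N0) \<inter> (T' \<inter> N0))" using is_chartD(1)[OF b(1)] is_chartD(1)[OF b(2)] by blast
    then have o: "open_cs k (restrict Y (T \<inter> N0) ` ((T \<inter> N0) \<inter> (T' \<inter> N0)))" by (intro chart_image_open[OF b(1)]) auto
    have e: "restrict Y' (T' \<inter> N0) (inv_into (T \<inter> N0) (restrict Y (T \<inter> N0)) z) = Y' (inv_into T Y z)"
      if zz: "z \<in> restrict Y (T \<inter> N0) ` ((T \<inter> N0) \<inter> (T' \<inter> N0))" for z
    proof -
      obtain y where y: "y \<in> T" "y \<in> N0" "y \<in> T'" "z = Y y" using zz by auto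
      have "z \<in> restrict Y (T \<inter> N0) ` (T \<inter> N0)" using zz by blast
      from gc_invN[OF c this] show ?thesis using gc_inv[OF c y(1)] y by simp
    qed
    have im: "(\<lambda>z. Y' (inv_into T Y z)) ` (restrict Y (T \<inter> N0) ` ((T \<inter> N0) \<inter> (T' \<inter> N0))) \<subseteq> complex_space k"
      using gc_YN(2)[OF c'] gc_inv[OF c] by auto
    have "cdiff_at (k + m) (k + m) (\<lambda>z. Y' (inv_into T Y z)) (Y x)"
      using mf_transition[OF M gc_chart[OF c] gc_chart[OF c'] xx(3,2)] gc_dim[OF c] by simp
    then have "cdiff_at k k (\<lambda>z. Y' (inv_into T Y z)) (Y x)"
      by (rule cdiff_at_restrict[OF _ gc_YN(2)[OF c xx(1)] _ _ o _ im]) (use x in auto)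
    then have "cdiff_at k k (\<lambda>z. restrict Y' (T' \<inter> N0) (inv_into (T \<inter> N0) (restrict Y (T \<inter> N0)) z)) (Y x)"
      by (rule cdiff_at_cong[OF _ o]) (use x e in auto)
    then show ?thesis using xx by simp
  qed
  have comp: "charts_compatible k a b" if ab: "a \<in> base_charts" "b \<in> base_charts" for a b
  proof -
    obtain T Y where a: "a = (T \<inter> N0, restrict Y (T \<inter> N0))" "gchart ws T Y" using ab(1) unfolding base_charts_def by blast
    obtain T' Y' where b: "b = (T' \<inter> N0, restrict Y' (T' \<inter> N0))" "gchart ws T' Y'" using ab(2) unfolding base_charts_def by blast
    show ?thesis
      unfolding a(1) b(1) chart_compatible_iff[OF gc_base_chart[OF a(2)] gc_base_chart[OF b(2)]]
      using half[OF a(2) b(2)] half[OF b(2) a(2)] by blast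
  qed
  note G = generated_manifold[OF hs ch cov comp]
  show "complex_manifold base" unfolding base_def by (rule G(1))
  show "(T \<inter> N0, restrict Y (T \<inter> N0)) \<in> matlas base" if "gchart ws T Y"
  proof -
    have "(T \<inter> N0, restrict Y (T \<inter> N0)) \<in> base_charts" unfolding base_charts_def using that by blast
    then show ?thesis unfolding base_def using G(2) by auto
  qed
qed

lemma gchart_at:
  assumes "x \<in> mcarrier M" obtains T Y where "gchart ws T Y" "x \<in> T" "h 0 x \<in> T \<inter> N0"
proof -
  have "h 0 x \<in> mcarrier M" "h 0 (h 0 x) = h 0 x" using assms by (auto simp: act)
  from charts[OF this] obtain T Y where T: "gchart ws T Y" "h 0 x \<in> T" by blast
  then show ?thesis using that gc_sat[OF T(1) assms T(2)] assms by (auto simp: N0_def)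
qed

text \<open>In a homogeneous chart and its base chart, \<open>h 0\<close> is the projection
  \<open>pj1 k\<close>.\<close>

lemma proj_hol: "x \<in> mcarrier M \<Longrightarrow> hol_at M base (h 0) x"
proof -
  assume x: "x \<in> mcarrier M"
  obtain T Y where c: "gchart ws T Y" "x \<in> T" "h 0 x \<in> T \<inter> N0" using gchart_at[OF x] .
  note ic = gc_ic[OF c(1)]
  show ?thesis
  proof (rule hol_atI[where f = "h 0" and x = x, OF _ gc_chart[OF c(1)] base_chart[OF c(1)] c(2,3)])
    show "cont_at (mtop M) (mtop base) (h 0) x"
      unfolding base_sel by (rule cont_at_subtopology_codI[OF hol_at_cont[OF hol_h[OF x]] openin_topspace x])
        (auto simp: N0_def)
    have z: "Y x \<in> Y ` T" using c by blast
    have "cdiff_at (k + m) k (\<lambda>w. restrict Y (T \<inter> N0) (h 0 (inv_into T Y w))) (Y x)"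
    proof (rule cdiff_at_cong[OF cdiff_at_pj1[OF gc_Y[OF c(1,2)]] is_chartD(4)[OF ic] z])
      fix z assume "z \<in> Y ` T"
      then obtain y where y: "y \<in> T" "z = Y y" by blast
      have "h 0 y \<in> T \<inter> N0" using gc_mem[OF c(1) y(1)] gc_car[OF c(1) y(1)] by (auto simp: N0_def)
      then show "pj1 k z = restrict Y (T \<inter> N0) (h 0 (inv_into T Y z))"
        using gc_inv[OF c(1) y(1)] gc_Y0[OF c(1) y(1)] y by simp
    qed
    then show "cdiff_at (mdim M) (mdim base) (\<lambda>w. restrict Y (T \<inter> N0) (h 0 (inv_into T Y w))) (Y x)"
      unfolding base_sel gc_dim[OF c(1)] .
  qed
qed

text \<open>Trivializations do not depend on \<^const>\<open>gtrivs\<close>, so \<open>precanon\<close> can serve to define the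
  field \<^const>\<open>gtrivs\<close> of \<open>canon\<close>.\<close>

definition "precanon = \<lparr>gtotal = M, gbase = base, gproj = h 0, grank = d, gtrivs = {}\<rparr>"
definition "canon = \<lparr>gtotal = M, gbase = base, gproj = h 0, grank = d, gtrivs = {t. is_trivialization precanon t \<and> eqv_triv precanon h t}\<rparr>"

lemma canon_sel: "gtotal canon = M" "gbase canon = base" "gproj canon = h 0" "grank canon = d"
  by (auto simp: canon_def)

lemma canon_triv: "is_trivialization precanon t = is_trivialization canon t" "eqv_triv precanon h t = eqv_triv canon h t"
  by (cases t; simp add: is_trivialization_def eqv_triv_def gover_def canon_def precanon_def)+

lemma canon_trivs: "t \<in> gtrivs canon \<longleftrightarrow> is_trivialization canon t \<and> eqv_triv canon h t"
  unfolding canon_triv[symmetric] by (simp add: canon_def)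

lemma canon_pre: "pre_bundle canon"
  using M base_manifold proj_hol by (simp add: pre_bundle_def canon_sel)

text \<open>The first component is the limit point, the second the coordinates of positive weight.
  The inverse joins base and fibre coordinates (\<open>j\<close> below) and applies the inverse
  chart; saturation of the image makes it defined on whole fibres.\<close>

lemma gchart_triv:
  assumes c: "gchart ws T Y"
  shows "(T \<inter> N0, \<lambda>e\<in>T. (h 0 e, pj2 k m (Y e))) \<in> gtrivs canon"
proof -
  let ?U = "T \<inter> N0" and ?\<phi> = "\<lambda>e\<in>T. (h 0 e, pj2 k m (Y e))"
  have G: "gover canon ?U = T"
    unfolding gover_def canon_sel N0_def using gc_mem[OF c] gc_car[OF c] gc_sat[OF c] by blast
  note ic = gc_ic[OF c] and bc = base_chart[OF c] and bic = gc_base_chart[OF c]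
  note PB = product_manifold_complex[OF base_manifold csm_manifold, of m]
  have To: "openin (mtop M) T" by (rule is_chartD(1)[OF ic])
  have h0: "h 0 e \<in> ?U" if "e \<in> T" for e using gc_mem[OF c that] gc_car[OF c that] by (auto simp: N0_def)
  define j where "j p = join k (Y (fst p)) (snd p)" for p :: "'a \<times> (nat \<Rightarrow> complex)"
  have jp: "j p \<in> Y ` T \<and> pj1 k (j p) = Y (fst p) \<and> pj2 k m (j p) = snd p" if p: "p \<in> ?U \<times> complex_space m" for p
  proof -
    have f: "fst p \<in> T \<inter> N0" "snd p \<in> complex_space m" using p by auto
    have "j p \<in> complex_space (k + m)" "pj1 k (j p) = Y (fst p)" "pj2 k m (j p) = snd p"
      unfolding j_def using gc_YN(2)[OF c f(1)] f(2) by auto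
    moreover have "j p \<in> Y ` T"
      by (rule gc_img[OF c imageI]) (use f calculation gc_YN(1)[OF c f(1)] in auto)
    ultimately show ?thesis by simp
  qed
  have jY: "j (?\<phi> e) = Y e" if e: "e \<in> T" for e
    using e gc_Y0[OF c e] join_pj[OF gc_Y[OF c e]] by (simp add: j_def)
  have inj: "inj_on ?\<phi> T"
  proof (rule inj_on_inverseI)
    show "inv_into T Y (j (?\<phi> e)) = e" if "e \<in> T" for e unfolding jY[OF that] by (rule gc_inv[OF c that])
  qed
  have \<phi>i: "?\<phi> (inv_into T Y (j p)) = p" "inv_into T Y (j p) \<in> T" if p: "p \<in> ?U \<times> complex_space m" for p
  proof -
    obtain e where e: "e \<in> T" "j p = Y e" using jp[OF p] by blast
    have i: "inv_into T Y (j p) = e" using gc_inv[OF c e(1)] e by simp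
    then show "inv_into T Y (j p) \<in> T" using e by simp
    have "Y (h 0 e) = Y (fst p)" using gc_Y0[OF c e(1)] jp[OF p] e by simp
    then have "h 0 e = fst p" using inj_onD[OF is_chartD(3)[OF ic], of "h 0 e" "fst p"] h0[OF e(1)] p by auto
    then show "?\<phi> (inv_into T Y (j p)) = p" using i e jp[OF p] by (simp add: prod_eq_iff)
  qed
  have bij: "bij_betw ?\<phi> T (?U \<times> complex_space m)"
    by (rule bij_betw_byWitness[where f' = "\<lambda>p. inv_into T Y (j p)"])
      (use jY gc_inv[OF c] \<phi>i h0 in auto)
  have inv\<phi>: "inv_into T ?\<phi> p = inv_into T Y (j p)" if p: "p \<in> ?U \<times> complex_space m" for p
    using inv_into_f_f[OF inj \<phi>i(2)[OF p]] \<phi>i(1)[OF p] by simp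
  have 1: "hol_at M (product_manifold base (csm m)) ?\<phi> e" if e: "e \<in> T" for e
  proof -
    have "hol_at M (csm m) (\<lambda>e. pj2 k m (Y e)) e"
      using hol_at_csm_compI[OF M chart_hol[OF M gc_chart[OF c] e]] cdiff_at_pj2[OF gc_Y[OF c e]] gc_dim[OF c] by metis
    then have "hol_at M (product_manifold base (csm m)) (\<lambda>e. (h 0 e, pj2 k m (Y e))) e"
      using proj_hol[OF gc_car[OF c e]] by (simp add: hol_at_prod_iff[OF base_manifold csm_manifold M])
    then show ?thesis by (rule hol_at_cong[OF M _ To e]) simp
  qed
  have Uo: "openin (mtop base) ?U" using is_chartD(1)[OF bic] by (simp add: base_sel)
  have 2: "hol_at (product_manifold base (csm m)) M (inv_into T ?\<phi>) p" if p: "p \<in> ?U \<times> complex_space m" for p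
  proof -
    let ?P = "product_manifold base (csm m)"
    have f: "fst p \<in> T \<inter> N0" "snd p \<in> complex_space m" using p by auto
    have pc: "p \<in> mcarrier ?P" using p by (auto simp: product_carrier base_sel(3))
    note pr = hol_at_pr[OF base_manifold csm_manifold pc]
    have "hol_at base (csm k) (restrict Y ?U) (fst p)" using chart_hol[OF base_manifold bc f(1)] by (simp add: base_sel)
    from hol_at_comp[OF PB base_manifold csm_manifold refl this pr(1)]
    have "hol_at ?P (csm (k + m)) (\<lambda>p. join k (restrict Y ?U (fst p)) (snd p)) p" by (rule hol_at_join[OF PB _ pr(2)])
    moreover have o: "openin (mtop ?P) (?U \<times> complex_space m)"
      using Uo by (simp add: product_sel[OF base_manifold csm_manifold] openin_prod_Times_iff)
    ultimately have 3: "hol_at ?P (csm (k + m)) j p"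
      by (rule hol_at_cong[OF PB _ _ p]) (auto simp: j_def)
    obtain e where e: "e \<in> T" "j p = Y e" using jp[OF p] by blast
    have "hol_at (csm (k + m)) M (inv_into T Y) (j p)"
      using inv_chart_hol[OF M gc_chart[OF c] e(1)] e(2) gc_dim[OF c] by simp
    from hol_at_comp[OF PB csm_manifold M refl this 3]
    show ?thesis by (rule hol_at_cong[OF PB _ o p]) (simp only: inv\<phi>)
  qed
  have "is_trivialization canon (?U, ?\<phi>)"
    unfolding is_trivialization_iff[OF canon_pre] G canon_sel using Uo bij 1 2 by simp
  moreover have "eqv_triv canon h (?U, ?\<phi>)"
    unfolding eqv_triv_def prod.case G canon_sel
  proof (intro ballI allI conjI)
    fix e \<xi> assume e: "e \<in> T"
    show he: "h \<xi> e \<in> T" by (rule gc_mem[OF c e])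
    have "pj2 k m (graded_homothety ws \<xi> (Y e)) = graded_homothety w \<xi> (pj2 k m (Y e))"
      unfolding homothety_join[OF gc_Y[OF c e]] by simp
    then show "?\<phi> (h \<xi> e) = (h 0 e, graded_homothety w \<xi> (snd (?\<phi> e)))"
      using e he gc_eqv[OF c e] gc_car[OF c e] by (simp add: act)
  qed
  ultimately show ?thesis by (simp add: canon_trivs)
qed

lemma canon_cover: "q \<in> N0 \<Longrightarrow> \<exists>t\<in>gtrivs canon. q \<in> fst t"
proof -
  assume q: "q \<in> N0"
  then obtain T Y where "gchart ws T Y" "q \<in> T" using charts[of q] N0_iff[of q] by blast
  then show ?thesis using q by (intro bexI[OF _ gchart_triv[of T Y]]) auto
qed

lemma canon_bundle: "holomorphic_graded_bundle canon"
  unfolding holomorphic_graded_bundle_def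
proof (intro conjI ballI allI impI)
  show "complex_manifold (gtotal canon)" "complex_manifold (gbase canon)" using M base_manifold by (simp_all add: canon_sel)
  show "gproj canon \<in> extensional (mcarrier (gtotal canon))" using h_ext by (simp add: canon_sel)
  show "holomorphic_map (gtotal canon) (gbase canon) (gproj canon)"
    unfolding canon_sel holomorphic_map_iff[OF M base_manifold] using proj_hol by blast
  show "last (grank canon) \<noteq> 0" if "grank canon \<noteq> []" using that trimmed by (simp add: canon_sel)
  show tr: "is_trivialization canon t" if "t \<in> gtrivs canon" for t using that canon_trivs by blast
  show "(\<Union>t\<in>gtrivs canon. fst t) = mcarrier (gbase canon)"
  proof
    show "(\<Union>t\<in>gtrivs canon. fst t) \<subseteq> mcarrier (gbase canon)"
    proof
      fix q assume "q \<in> (\<Union>t\<in>gtrivs canon. fst t)"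
      then obtain U \<phi> where "(U, \<phi>) \<in> gtrivs canon" "q \<in> U" by auto
      then show "q \<in> mcarrier (gbase canon)" using trivD(1)[OF canon_pre tr] openin_subset by blast
    qed
    show "mcarrier (gbase canon) \<subseteq> (\<Union>t\<in>gtrivs canon. fst t)"
      using canon_cover by (auto simp: canon_sel base_sel)
  qed
  show "trivializations_compatible canon t t'" if "t \<in> gtrivs canon" "t' \<in> gtrivs canon" for t t'
    using that canon_trivs by (cases t; cases t') (auto intro: eqv_triv_compatible[OF canon_pre])
  fix t assume t: "is_trivialization canon t \<and> (\<forall>t'\<in>gtrivs canon. trivializations_compatible canon t t')"
  obtain U \<phi> where tU: "t = (U, \<phi>)" by fastforce
  have tr1: "is_trivialization canon (U, \<phi>)" using t tU by simp
  note T = trivD[OF canon_pre tr1]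
  \<comment> \<open>Maximality: around each point a compatible trivialization is compared with an
    equivariant one, and \<open>compatible_eqv_triv\<close> makes it equivariant too.\<close>
  have "eqv_triv canon h (U, \<phi>)"
    unfolding eqv_triv_def prod.case
  proof (intro ballI allI)
    fix e \<xi> assume e: "e \<in> gover canon U"
    let ?q = "gproj canon e"
    have "?q \<in> N0" using T(13)[OF e] by (auto simp: canon_sel N0_def)
    then obtain V \<psi> where V: "(V, \<psi>) \<in> gtrivs canon" "?q \<in> V" using canon_cover by fastforce
    have V': "is_trivialization canon (V, \<psi>)" "eqv_triv canon h (V, \<psi>)" using V(1) canon_trivs by blast+
    have eV: "e \<in> gover canon V" using V(2) T(13)[OF e] by (simp add: gover_def)
    define e1 where "e1 = inv_into (gover canon U) \<phi> (?q, graded_homothety (gweights canon) \<xi> (snd (\<phi> e)))"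
    have e1: "e1 \<in> gover canon U" "\<phi> e1 = (?q, graded_homothety (gweights canon) \<xi> (snd (\<phi> e)))"
      unfolding e1_def by (rule T(7,8)[OF T(12)[OF e] graded_homothety_space])+
    have "trivializations_compatible canon (U, \<phi>) (V, \<psi>)" using t tU V(1) by blast
    note C = compatible_eqv_triv[OF canon_pre tr1 V'(1) this e eV e1]
    have "e1 = h \<xi> e" by (rule eqv_triv_unique[OF canon_pre V' eV C])
    then show "h \<xi> e \<in> gover canon U \<and> \<phi> (h \<xi> e) = (?q, graded_homothety (gweights canon) \<xi> (snd (\<phi> e)))"
      using e1 by simp
  qed
  then show "t \<in> gtrivs canon" using canon_trivs tr1 tU by blast
qed

lemma canon_homothety: "gbundle_homothety canon = h"
proof (intro ext)
  interpret C: hbundle canon by unfold_locales (rule canon_bundle)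
  fix \<xi> e
  show "gbundle_homothety canon \<xi> e = h \<xi> e"
  proof (cases "e \<in> mcarrier M")
    case True
    then have "e \<in> mcarrier (gtotal canon)" by (simp add: canon_sel)
    then obtain U \<phi> where t: "(U, \<phi>) \<in> gtrivs canon" "e \<in> gover canon U" by (rule C.total_triv)
    have "eqv_triv canon h (U, \<phi>)" using t canon_trivs by blast
    from eqv_triv_unique[OF canon_pre C.triv[OF t(1)] this t(2) C.homothety[OF t]] show ?thesis .
  next
    case False
    then show ?thesis using h_ext[of \<xi>] by (simp add: gbundle_homothety_def canon_sel extensional_def)
  qed
qed

lemma canon_is: "is_graded_bundle_of \<lparr>hspace = M, hact = h\<rparr> canon"
  unfolding is_graded_bundle_of_def using canon_bundle canon_homothety
  by (simp add: canon_sel base_sel(3) N0_def)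

end

text \<open>Connectedness gives one weight list for all homogeneous charts and hence the bundle
  \<open>canon\<close>. Uniqueness as an equality is what the definite description in
  \<open>canonical_graded_bundle\<close> calls for.\<close>

theorem graded_bundle_of_ex1:
  assumes S: "holomorphic_homogeneity_structure S" and con: "connected_manifold (hspace S)"
  shows "\<exists>!B. is_graded_bundle_of S B"
proof -
  have S': "haction (hspace S) (hact S)" "\<And>\<xi>. hact S \<xi> \<in> extensional (mcarrier (hspace S))" using S homogeneity_structure_iff_haction by blast+
  have ne: "mcarrier (hspace S) \<noteq> {}" and con': "connected_space (mtop (hspace S))"
    using con by (auto simp: connected_manifold_def)
  interpret H: haction "hspace S" "hact S" by (rule S'(1))
  obtain k d where kd: "d \<noteq> [] \<longrightarrow> last d \<noteq> 0"
    "\<And>p. p \<in> mcarrier (hspace S) \<Longrightarrow> hact S 0 p = p \<Longrightarrow> \<exists>T Y. H.gchart (replicate k 0 @ rank_weights d) T Y \<and> p \<in> T"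
    by (rule H.constant_weights[OF con' ne]) (rule that, assumption, blast)
  interpret G: gaction "hspace S" "hact S" k d
    by unfold_locales (use S'(2) kd in auto)
  have "\<lparr>hspace = hspace S, hact = hact S\<rparr> = S" by (rule homogeneity_structure.equality) simp_all
  then have "is_graded_bundle_of S G.canon" using G.canon_is by (rule subst)
  then show ?thesis using graded_bundle_of_unique[OF S ne] by blast
qed

section \<open>The equivalence\<close>

lemma homogeneity_morphism_iff:
  assumes S: "holomorphic_homogeneity_structure S" and S': "holomorphic_homogeneity_structure S'"
  shows "homogeneity_morphism S S' \<Phi> \<longleftrightarrow> \<Phi> \<in> extensional (mcarrier (hspace S)) \<and>
    (\<forall>x\<in>mcarrier (hspace S). hol_at (hspace S) (hspace S') \<Phi> x) \<and>
    (\<forall>\<xi>. \<forall>x\<in>mcarrier (hspace S). \<Phi> (hact S \<xi> x) = hact S' \<xi> (\<Phi> x))"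
proof -
  have M: "complex_manifold (hspace S)" "complex_manifold (hspace S')"
    using S S' unfolding holomorphic_homogeneity_structure_def by blast+
  show ?thesis unfolding homogeneity_morphism_def holomorphic_map_iff[OF M] by simp
qed

lemma homogeneity_morphism_mem:
  assumes "holomorphic_homogeneity_structure S" "holomorphic_homogeneity_structure S'" "homogeneity_morphism S S' \<Phi>"
  shows "\<Phi> \<in> mcarrier (hspace S) \<rightarrow> mcarrier (hspace S')"
proof
  fix x assume "x \<in> mcarrier (hspace S)"
  then have "hol_at (hspace S) (hspace S') \<Phi> x"
    using assms(3) unfolding homogeneity_morphism_iff[OF assms(1,2)] by blast
  then show "\<Phi> x \<in> mcarrier (hspace S')" by (rule hol_at_mem(2))
qed

lemma homogeneity_morphism_id:
  assumes S: "holomorphic_homogeneity_structure S"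
  shows "homogeneity_morphism S S (\<lambda>x\<in>mcarrier (hspace S). x)"
  unfolding homogeneity_morphism_iff[OF S S]
proof (intro conjI ballI allI)
  interpret haction "hspace S" "hact S" using S homogeneity_structure_iff_haction by blast
  fix x assume x: "x \<in> mcarrier (hspace S)"
  show "hol_at (hspace S) (hspace S) (\<lambda>x\<in>mcarrier (hspace S). x) x"
    by (rule hol_at_cong[OF M hol_at_id[OF M x] openin_topspace x]) simp
  show "(\<lambda>x\<in>mcarrier (hspace S). x) (hact S \<xi> x) = hact S \<xi> ((\<lambda>x\<in>mcarrier (hspace S). x) x)" for \<xi>
    using x h_mem[OF x] by simp
qed simp

lemma homogeneity_morphism_compose:
  assumes S: "holomorphic_homogeneity_structure S" and S': "holomorphic_homogeneity_structure S'"
    and S'': "holomorphic_homogeneity_structure S''"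
    and f: "homogeneity_morphism S S' \<Phi>" and g: "homogeneity_morphism S' S'' \<Psi>"
  shows "homogeneity_morphism S S'' (compose (mcarrier (hspace S)) \<Psi> \<Phi>)"
  unfolding homogeneity_morphism_iff[OF S S'']
proof (intro conjI ballI allI)
  interpret haction "hspace S" "hact S" using S homogeneity_structure_iff_haction by blast
  have M': "complex_manifold (hspace S')" and M'': "complex_manifold (hspace S'')"
    using S' S'' unfolding holomorphic_homogeneity_structure_def by blast+
  note F = f[unfolded homogeneity_morphism_iff[OF S S']] and G = g[unfolded homogeneity_morphism_iff[OF S' S'']]
  fix x assume x: "x \<in> mcarrier (hspace S)"
  have \<Phi>x: "\<Phi> x \<in> mcarrier (hspace S')" using homogeneity_morphism_mem[OF S S' f] x by blast
  have a: "hol_at (hspace S) (hspace S') \<Phi> x" and b: "hol_at (hspace S') (hspace S'') \<Psi> (\<Phi> x)"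
    using F G x \<Phi>x by blast+
  show "hol_at (hspace S) (hspace S'') (compose (mcarrier (hspace S)) \<Psi> \<Phi>) x"
    by (rule hol_at_cong[OF M hol_at_comp[OF M M' M'' refl b a] openin_topspace x]) (simp add: compose_def)
  show "compose (mcarrier (hspace S)) \<Psi> \<Phi> (hact S \<xi> x) = hact S'' \<xi> (compose (mcarrier (hspace S)) \<Psi> \<Phi> x)" for \<xi>
    using F G x \<Phi>x h_mem[OF x] by (simp add: compose_def)
qed simp

lemma homogeneity_category: "is_category homogeneity_cat"
  unfolding is_category_def
proof (intro conjI ballI)
  fix x y z u :: "'a homogeneity_structure" and f g h
  assume x: "x \<in> Ob homogeneity_cat"
  then have X: "holomorphic_homogeneity_structure x" by (simp add: homogeneity_cat_def)
  show "Idt homogeneity_cat x \<in> Hom homogeneity_cat x x"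
    using homogeneity_morphism_id[OF X] by (simp add: homogeneity_cat_def)
  assume y: "y \<in> Ob homogeneity_cat" and f: "f \<in> Hom homogeneity_cat x y"
  then have Y: "holomorphic_homogeneity_structure y" and F: "homogeneity_morphism x y f"
    by (simp_all add: homogeneity_cat_def)
  have fm: "f \<in> mcarrier (hspace x) \<rightarrow> mcarrier (hspace y)" by (rule homogeneity_morphism_mem[OF X Y F])
  have fe: "f \<in> extensional (mcarrier (hspace x))" using F by (simp add: homogeneity_morphism_def)
  show "Cmp homogeneity_cat x x y f (Idt homogeneity_cat x) = f"
    using compose_Id[OF fm fe] by (simp add: homogeneity_cat_def)
  show "Cmp homogeneity_cat x y y (Idt homogeneity_cat y) f = f"
    using Id_compose[OF fm fe] by (simp add: homogeneity_cat_def)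
  assume z: "z \<in> Ob homogeneity_cat" and g: "g \<in> Hom homogeneity_cat y z"
  then show "Cmp homogeneity_cat x y z g f \<in> Hom homogeneity_cat x z"
    using homogeneity_morphism_compose[OF X Y _ F] by (simp add: homogeneity_cat_def)
  show "Cmp homogeneity_cat x z u h (Cmp homogeneity_cat x y z g f) =
      Cmp homogeneity_cat x y u (Cmp homogeneity_cat y z u h g) f"
    using compose_assoc[OF fm] by (simp add: homogeneity_cat_def)
qed

text \<open>On morphisms both functors are the identity, and \<open>G\<close> is a strict right
  inverse of \<open>F\<close> on objects. The laws of \<open>C\<close> are inherited from
  \<open>D\<close>. Since \<open>F (G (F x)) = F x\<close>, the objects \<open>G (F x)\<close> and
  \<open>x\<close> have the same morphisms, so the identity of \<open>x\<close> is an isomorphism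
  between them.\<close>

lemma equivalence_of_full_embedding:
  assumes D: "is_category D" and F: "\<And>x. x \<in> Ob C \<Longrightarrow> F x \<in> Ob D" and G: "\<And>y. y \<in> Ob D \<Longrightarrow> G y \<in> Ob C"
    and FG: "\<And>y. y \<in> Ob D \<Longrightarrow> F (G y) = y"
    and hom: "\<And>x y. x \<in> Ob C \<Longrightarrow> y \<in> Ob C \<Longrightarrow> Hom C x y = Hom D (F x) (F y)"
    and idt: "\<And>x. Idt C x = Idt D (F x)" and cmp: "\<And>x y z. Cmp C x y z = Cmp D (F x) (F y) (F z)"
  shows "equivalence_of_categories C D F (\<lambda>_ _ f. f) G (\<lambda>_ _ f. f)"
proof -
  note D1 = D[unfolded is_category_def]
  have id: "Idt D x \<in> Hom D x x" if "x \<in> Ob D" for x using D1 that by blast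
  have idl: "Cmp D x x y f (Idt D x) = f" "Cmp D x y y (Idt D y) f = f"
    if "x \<in> Ob D" "y \<in> Ob D" "f \<in> Hom D x y" for x y f using D1 that by blast+
  have comp: "Cmp D x y z g f \<in> Hom D x z"
    if "x \<in> Ob D" "y \<in> Ob D" "z \<in> Ob D" "f \<in> Hom D x y" "g \<in> Hom D y z" for x y z f g using D1 that by blast
  have assoc: "Cmp D x z u h (Cmp D x y z g f) = Cmp D x y u (Cmp D y z u h g) f"
    if "x \<in> Ob D" "y \<in> Ob D" "z \<in> Ob D" "u \<in> Ob D" "f \<in> Hom D x y" "g \<in> Hom D y z" "h \<in> Hom D z u" for x y z u f g h
    using D1 that by blast
  have "is_category C"
    unfolding is_category_def by (auto simp: hom idt cmp F id idl comp assoc)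
  moreover have "is_functor C D F (\<lambda>_ _ f. f)" "is_functor D C G (\<lambda>_ _ f. f)"
    unfolding is_functor_def by (auto simp: hom idt cmp F G FG)
  moreover have "naturally_isomorphic C C (\<lambda>x. G (F x)) (\<lambda>x y f. f) (\<lambda>x. x) (\<lambda>x y f. f)"
    unfolding naturally_isomorphic_def is_iso_def
    by (rule exI[of _ "Idt C"]) (auto simp: hom idt cmp F G FG id idl)
  moreover have "naturally_isomorphic D D (\<lambda>x. F (G x)) (\<lambda>x y f. f) (\<lambda>x. x) (\<lambda>x y f. f)"
    unfolding naturally_isomorphic_def is_iso_def
    by (rule exI[of _ "Idt D"]) (auto simp: FG id idl)
  ultimately show ?thesis using D unfolding equivalence_of_categories_def by simp
qed

lemma canonical_graded_bundle:
  assumes "holomorphic_homogeneity_structure S" "connected_manifold (hspace S)"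
  shows "is_graded_bundle_of S (canonical_graded_bundle S)"
  unfolding canonical_graded_bundle_def by (rule theI'[OF graded_bundle_of_ex1[OF assms]])

lemma canonical_graded_bundle_bundle:
  assumes "holomorphic_homogeneity_structure S" "connected_manifold (hspace S)"
  shows "holomorphic_graded_bundle (canonical_graded_bundle S)" "gtotal (canonical_graded_bundle S) = hspace S"
    "homothety_structure (canonical_graded_bundle S) = S"
proof -
  note C = canonical_graded_bundle[OF assms, unfolded is_graded_bundle_of_def]
  show "holomorphic_graded_bundle (canonical_graded_bundle S)" "gtotal (canonical_graded_bundle S) = hspace S"
    using C by blast+
  show "homothety_structure (canonical_graded_bundle S) = S"
    by (rule homogeneity_structure.equality) (use C in \<open>auto simp: homothety_structure_def\<close>)
qed

lemma homothety_structure_holomorphic: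
  assumes "holomorphic_graded_bundle B"
  shows "holomorphic_homogeneity_structure (homothety_structure B)"
proof -
  interpret hbundle B by unfold_locales fact
  show ?thesis by (rule homothety_is_homogeneity_structure)
qed

lemma homothety_equivalence:
  "equivalence_of_categories
     (graded_bundle_cat :: ('a graded_bundle, 'a \<Rightarrow> 'a) cat) homogeneity_cat
     homothety_structure (\<lambda>_ _ \<Phi>. \<Phi>)
     canonical_graded_bundle (\<lambda>_ _ \<Phi>. \<Phi>)"
proof (rule equivalence_of_full_embedding[OF homogeneity_category])
  have s: "hspace (homothety_structure B) = gtotal B" for B :: "'a graded_bundle"
    by (simp add: homothety_structure_def)
  show "homothety_structure B \<in> Ob homogeneity_cat" if "B \<in> Ob graded_bundle_cat" for B :: "'a graded_bundle"
    using that homothety_structure_holomorphic by (auto simp: s graded_bundle_cat_def homogeneity_cat_def)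
  show "canonical_graded_bundle S \<in> Ob graded_bundle_cat" if "S \<in> Ob homogeneity_cat" for S :: "'a homogeneity_structure"
    using that canonical_graded_bundle_bundle[of S] by (auto simp: graded_bundle_cat_def homogeneity_cat_def)
  show "homothety_structure (canonical_graded_bundle S) = S" if "S \<in> Ob homogeneity_cat" for S :: "'a homogeneity_structure"
    using that canonical_graded_bundle_bundle(3)[of S] by (auto simp: homogeneity_cat_def)
  show "Hom graded_bundle_cat B B' = Hom homogeneity_cat (homothety_structure B) (homothety_structure B')"
    if "B \<in> Ob graded_bundle_cat" "B' \<in> Ob graded_bundle_cat" for B B' :: "'a graded_bundle"
    using that graded_bundle_morphism_iff[of B B'] by (auto simp: graded_bundle_cat_def homogeneity_cat_def)
  show "Idt graded_bundle_cat B = Idt homogeneity_cat (homothety_structure B)" for B :: "'a graded_bundle"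
    by (simp add: s graded_bundle_cat_def homogeneity_cat_def)
  show "Cmp graded_bundle_cat B B' B'' =
      Cmp homogeneity_cat (homothety_structure B) (homothety_structure B') (homothety_structure B'')"
    for B B' B'' :: "'a graded_bundle"
    by (simp add: s graded_bundle_cat_def homogeneity_cat_def)
qed

theorem theorem3p9:
  shows "equivalence_of_categories
           (graded_bundle_cat :: ('a graded_bundle, 'a \<Rightarrow> 'a) cat) homogeneity_cat
           homothety_structure (\<lambda>_ _ \<Phi>. \<Phi>)
           canonical_graded_bundle (\<lambda>_ _ \<Phi>. \<Phi>) \<and>
         (\<forall>B :: 'a graded_bundle. holomorphic_graded_bundle B \<longrightarrow>
           holomorphic_homogeneity_structure (homothety_structure B)) \<and>
         (\<forall>S :: 'a homogeneity_structure.
           holomorphic_homogeneity_structure S \<and> connected_manifold (hspace S) \<longrightarrow>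
           (\<exists>!B. is_graded_bundle_of S B) \<and> is_graded_bundle_of S (canonical_graded_bundle S)) \<and>
         (\<forall>(B :: 'a graded_bundle) B' \<Phi>.
           holomorphic_graded_bundle B \<and> holomorphic_graded_bundle B' \<and>
           graded_bundle_morphism B B' \<Phi> \<longrightarrow>
           homogeneity_morphism (homothety_structure B) (homothety_structure B') \<Phi>) \<and>
         (\<forall>(S :: 'a homogeneity_structure) S' \<Phi>.
           holomorphic_homogeneity_structure S \<and> connected_manifold (hspace S) \<and>
           holomorphic_homogeneity_structure S' \<and> connected_manifold (hspace S') \<and>
           homogeneity_morphism S S' \<Phi> \<longrightarrow>
           graded_bundle_morphism (canonical_graded_bundle S) (canonical_graded_bundle S') \<Phi>)"
proof (intro conjI allI impI)
  fix S S' :: "'a homogeneity_structure" and \<Phi> :: "'a \<Rightarrow> 'a"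
  assume S: "holomorphic_homogeneity_structure S \<and> connected_manifold (hspace S) \<and>
    holomorphic_homogeneity_structure S' \<and> connected_manifold (hspace S') \<and> homogeneity_morphism S S' \<Phi>"
  note C = canonical_graded_bundle_bundle[of S] canonical_graded_bundle_bundle[of S']
  show "graded_bundle_morphism (canonical_graded_bundle S) (canonical_graded_bundle S') \<Phi>"
    using S C graded_bundle_morphism_iff[of "canonical_graded_bundle S" "canonical_graded_bundle S'" \<Phi>] by simp
next
  fix S :: "'a homogeneity_structure"
  assume S: "holomorphic_homogeneity_structure S \<and> connected_manifold (hspace S)"
  show "\<exists>!B. is_graded_bundle_of S B" using S by (intro graded_bundle_of_ex1) simp_all
  show "is_graded_bundle_of S (canonical_graded_bundle S)" using S by (intro canonical_graded_bundle) simp_all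
next
  fix B B' :: "'a graded_bundle" and \<Phi> :: "'a \<Rightarrow> 'a"
  assume "holomorphic_graded_bundle B \<and> holomorphic_graded_bundle B' \<and> graded_bundle_morphism B B' \<Phi>"
  then show "homogeneity_morphism (homothety_structure B) (homothety_structure B') \<Phi>"
    using graded_bundle_morphism_iff[of B B' \<Phi>] by blast
qed (rule homothety_equivalence, rule homothety_structure_holomorphic)

end
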